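(* Given two finite groups $G$ and $Q$ and a $G$-injective PEPS with $Q$ as a global on-site symmetry, one can define (an equivalence class of) a homomorphism $\phi:Q\to\mathrm{Aut}(G)$ and a 2-cocycle $\omega:Q\times Q\to G$ so that the pair $(\phi,\omega)$ is constant in a neighbourhood of any $G$-isometric PEPS, when perturbed with a natural perturbation (those that correspond to a continuous deformation of the parent Hamiltonian).
   Context: A square-lattice PEPS tensor is a linear map $A: V\otimes V\otimes V^*\otimes V^*\to\mathbb{C}^d$ (up, right, down, left virtual legs, $V=\mathbb{C}^D$). Write $A(Y\otimes X\otimes Y^{-1}\otimes X^{-1}):=A\circ(Y\otimes X\otimes (Y^{-1})^{T}\otimes (X^{-1})^{T})$. The state $|\Psi_A\rangle$ on a torus is obtained by contracting neighbouring legs (right with left, up with down). $A$ is $G$-injective if, for a representation $u_g$ of $G$ on $V$ containing every irreducible representation of $G$, $A=A(u_g\otimes u_g\otimes u_g^{-1}\otimes u_g^{-1})$ for all $g\in G$ and there is $A^{-1}$ with $A^{-1}A=\frac{1}{|G|}\sum_g u_g\otimes u_g\otimes (u_g^{-1})^T\otimes (u_g^{-1})^T$. It is $G$-isometric if moreover $V=\mathbb{C}[G]$, $u_g=L_g$ is the left regular representation and, up to a unitary on the physical space, $A=\frac{1}{|G|}\sum_g L_g\otimes L_g\otimes L_g^\dagger\otimes L_g^\dagger$. The parent Hamiltonian of $A$ is the sum over all $2\times2$ patches of the orthogonal projector whose kernel is the space of physical states generated by the patch of four tensors with arbitrary boundary condition on its outer virtual legs. Global on-site symmetry: a unitary linear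 representation $U_q$ of $Q$ on $\mathbb{C}^d$ with $\bigotimes_v U_q|\Psi_A\rangle=|\Psi_A\rangle$ for all $q\in Q$ and all system sizes. Then there are invertible matrices $v_q,w_q$ with $U_qA=A(w_q\otimes v_q\otimes w_q^{-1}\otimes v_q^{-1})$, and the pair is defined, dropping nonzero scalars, by $v_q u_g v_q^{-1}= u_{\phi_q(g)}$ and $v_kv_qv_{kq}^{-1}= u_{\omega(k,q)}$ (the same maps are obtained from $w_q$). These maps satisfy $\phi_k\circ\phi_q=\tau_{\omega(k,q)}\circ\phi_{kq}$, where $\tau_g$ is conjugation by $g$. "2-cocycle" means $\omega(k,q)\omega(kq,p)=\phi_k(\omega(q,p))\,\omega(k,qp)$. Two pairs are equivalent, $(\phi,\omega)\sim(\phi',\omega')$, if there are elements $g_q\in G$ ($q\in Q$) with $\phi'_k=\tau_{g_k}\circ\phi_k$ and $\omega'(k,q)=g_k\,\phi_k(g_q)\,\omega(k,q)\,g_{kq}^{-1}$; "constant" refers to the equivalence class of the pair. Natural perturbation: a family of local operators $R(\epsilon)$ (after blocking sites, operators on the physical space of a single tensor), continuous in $\epsilon$ near $0$ with $\lim_{\epsilon\to0}R(\epsilon)=\mathbb{1}$, applied to every site, giving the PEPS with tensor $A(\epsilon)=R(\epsilon)A$; the perturbed PEPS is required to keep the symmetry, $\bigotimes_vU_q|\Psi_{A(\epsilon)}\rangle=|\Psi_{A(\epsilon)}\rangle$ for all $q\in Q$. "Neighbourhood" means all sufficiently small $\epsilon$. *)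

theory Defs
  imports "HOL-Analysis.Analysis" "HOL-Algebra.Group"
begin

section \<open>Representations on \<open>V = \<complex>\<^sup>n\<close>\<close>

definition representation ::
  "('g, 'b) monoid_scheme \<Rightarrow> ('g \<Rightarrow> complex^'n^'n) \<Rightarrow> bool" where
  "representation G u \<longleftrightarrow>
     u \<one>\<^bsub>G\<^esub> = mat 1 \<and>
     (\<forall>g\<in>carrier G. \<forall>h\<in>carrier G. u (g \<otimes>\<^bsub>G\<^esub> h) = u g ** u h)"

text \<open>Irreducible representations of all degrees \<open>k\<close> have to be quantified over inside a formula, so
  a matrix representation of degree \<open>k\<close> is an array \<open>\<rho> g i j\<close> with \<open>i, j < k\<close>, acting on the space
  of sequences vanishing from index \<open>k\<close> on.\<close>

definition coord_space :: "nat \<Rightarrow> (nat \<Rightarrow> complex) set" where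
  "coord_space k = {x. \<forall>i\<ge>k. x i = 0}"

definition array_apply :: "nat \<Rightarrow> (nat \<Rightarrow> nat \<Rightarrow> complex) \<Rightarrow> (nat \<Rightarrow> complex) \<Rightarrow> nat \<Rightarrow> complex" where
  "array_apply k X x = (\<lambda>i. if i < k then (\<Sum>j<k. X i j * x j) else 0)"

definition matrix_rep ::
  "('g, 'b) monoid_scheme \<Rightarrow> nat \<Rightarrow> ('g \<Rightarrow> nat \<Rightarrow> nat \<Rightarrow> complex) \<Rightarrow> bool" where
  "matrix_rep G k \<rho> \<longleftrightarrow>
     (\<forall>i<k. \<forall>j<k. \<rho> \<one>\<^bsub>G\<^esub> i j = (if i = j then 1 else 0)) \<and>
     (\<forall>g\<in>carrier G. \<forall>h\<in>carrier G. \<forall>i<k. \<forall>j<k.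
        \<rho> (g \<otimes>\<^bsub>G\<^esub> h) i j = (\<Sum>l<k. \<rho> g i l * \<rho> h l j))"

definition irreducible_matrix_rep ::
  "('g, 'b) monoid_scheme \<Rightarrow> nat \<Rightarrow> ('g \<Rightarrow> nat \<Rightarrow> nat \<Rightarrow> complex) \<Rightarrow> bool" where
  "irreducible_matrix_rep G k \<rho> \<longleftrightarrow>
     0 < k \<and> matrix_rep G k \<rho> \<and>
     (\<forall>W. W \<subseteq> coord_space k \<and> (\<lambda>_. 0) \<in> W \<and>
          (\<forall>x\<in>W. \<forall>y\<in>W. (\<lambda>i. x i + y i) \<in> W) \<and>
          (\<forall>c. \<forall>x\<in>W. (\<lambda>i. c * x i) \<in> W) \<and>
          (\<forall>g\<in>carrier G. \<forall>x\<in>W. array_apply k (\<rho> g) x \<in> W)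
        \<longrightarrow> W = {\<lambda>_. 0} \<or> W = coord_space k)"

text \<open>\<open>\<rho>\<close> is a subrepresentation of \<open>u\<close>: \<open>T j\<close> is the image of the \<open>j\<close>-th basis vector under an
  injective intertwiner \<open>\<complex>\<^sup>k \<rightarrow> V\<close>.\<close>

definition contains_rep ::
  "('g, 'b) monoid_scheme \<Rightarrow> ('g \<Rightarrow> complex^'n^'n) \<Rightarrow> nat \<Rightarrow> ('g \<Rightarrow> nat \<Rightarrow> nat \<Rightarrow> complex) \<Rightarrow> bool" where
  "contains_rep G u k \<rho> \<longleftrightarrow>
     (\<exists>T :: nat \<Rightarrow> complex^'n.
        (\<forall>c. (\<Sum>j<k. c j *s T j) = 0 \<longrightarrow> (\<forall>j<k. c j = 0)) \<and>
        (\<forall>g\<in>carrier G. \<forall>j<k. u g *v T j = (\<Sum>i<k. \<rho> g i j *s T i)))"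

definition contains_all_irreps ::
  "('g, 'b) monoid_scheme \<Rightarrow> ('g \<Rightarrow> complex^'n^'n) \<Rightarrow> bool" where
  "contains_all_irreps G u \<longleftrightarrow>
     (\<forall>k \<rho>. irreducible_matrix_rep G k \<rho> \<longrightarrow> contains_rep G u k \<rho>)"

text \<open>Left regular representation on \<open>\<complex>[G]\<close>; the basis of group elements is labelled by the index
  type through an enumeration \<open>b\<close> of \<open>G\<close>.\<close>

definition left_regular ::
  "('g, 'b) monoid_scheme \<Rightarrow> ('n \<Rightarrow> 'g) \<Rightarrow> 'g \<Rightarrow> complex^'n^'n" where
  "left_regular G b g = (\<chi> i j. if b i = g \<otimes>\<^bsub>G\<^esub> b j then 1 else 0)"

definition cadjoint :: "complex^'n^'m \<Rightarrow> complex^'m^'n" where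
  "cadjoint X = (\<chi> i j. cnj (X $ j $ i))"

definition unitary_matrix :: "complex^'n^'n \<Rightarrow> bool" where
  "unitary_matrix X \<longleftrightarrow> cadjoint X ** X = mat 1 \<and> X ** cadjoint X = mat 1"


section \<open>PEPS tensors\<close>

text \<open>Virtual legs are ordered up, right, down, left. The last two carry the dual basis of \<open>V\<^sup>*\<close>.\<close>

type_synonym 'n legs = "'n \<times> 'n \<times> 'n \<times> 'n"
type_synonym ('n, 'p) tensor = "complex^('n legs)^'p"

definition kron4 ::
  "complex^'n^'n \<Rightarrow> complex^'n^'n \<Rightarrow> complex^'n^'n \<Rightarrow> complex^'n^'n \<Rightarrow> complex^('n legs)^('n legs)" where
  "kron4 X1 X2 X3 X4 =
     (\<chi> i j. case i of (a, b, c, d) \<Rightarrow> case j of (a', b', c', d') \<Rightarrow>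
        X1 $ a $ a' * X2 $ b $ b' * X3 $ c $ c' * X4 $ d $ d')"

text \<open>The operator written \<open>Y \<otimes> X \<otimes> Y\<^sup>-\<^sup>1 \<otimes> X\<^sup>-\<^sup>1\<close>; on the dual legs the inverse acts by its transpose.\<close>

definition gauge :: "complex^'n^'n \<Rightarrow> complex^'n^'n \<Rightarrow> complex^('n legs)^('n legs)" where
  "gauge Y X = kron4 Y X (transpose (matrix_inv Y)) (transpose (matrix_inv X))"

definition group_average ::
  "('g, 'b) monoid_scheme \<Rightarrow> ('g \<Rightarrow> complex^'n^'n) \<Rightarrow> complex^('n legs)^('n legs)" where
  "group_average G u =
     (\<chi> i j. (1 / of_nat (card (carrier G))) * (\<Sum>g\<in>carrier G. gauge (u g) (u g) $ i $ j))"

definition G_injective ::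
  "('g, 'b) monoid_scheme \<Rightarrow> ('g \<Rightarrow> complex^'n^'n) \<Rightarrow> ('n::finite, 'p::finite) tensor \<Rightarrow> bool" where
  "G_injective G u A \<longleftrightarrow>
     representation G u \<and> contains_all_irreps G u \<and>
     (\<forall>g\<in>carrier G. A ** gauge (u g) (u g) = A) \<and>
     (\<exists>B. B ** A = group_average G u)"

text \<open>The physical dimension is not forced to be \<open>|G|\<^sup>4\<close>: a unitary identification of the physical
  space is a map \<open>W\<close> that is isometric on the range of the projector.\<close>

definition G_isometric ::
  "('g, 'b) monoid_scheme \<Rightarrow> ('g \<Rightarrow> complex^'n^'n) \<Rightarrow> ('n::finite, 'p::finite) tensor \<Rightarrow> bool" where
  "G_isometric G u A \<longleftrightarrow>
     G_injective G u A \<and>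
     (\<exists>b. bij_betw b UNIV (carrier G) \<and> (\<forall>g\<in>carrier G. u g = left_regular G b g)) \<and>
     (\<exists>W. (\<forall>x. norm (W *v (group_average G u *v x)) = norm (group_average G u *v x)) \<and>
          A = W ** group_average G u)"


section \<open>States and on-site symmetries on the torus\<close>

definition sites :: "nat \<Rightarrow> nat \<Rightarrow> (nat \<times> nat) set" where
  "sites N M = {..<N} \<times> {..<M}"

definition configs :: "nat \<Rightarrow> nat \<Rightarrow> (nat \<times> nat \<Rightarrow> 'x) set" where
  "configs N M = sites N M \<rightarrow>\<^sub>E UNIV"

text \<open>\<open>h (i, j)\<close> is the value on the bond joining the right leg of \<open>(i, j)\<close> to the left leg of
  \<open>(i + 1, j)\<close>, and \<open>v (i, j)\<close> on the bond joining the up leg of \<open>(i, j)\<close> to the down leg of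
  \<open>(i, j + 1)\<close>, indices being taken modulo \<open>N\<close> and \<open>M\<close>.\<close>

definition peps_state ::
  "nat \<Rightarrow> nat \<Rightarrow> ('n::finite, 'p::finite) tensor \<Rightarrow> (nat \<times> nat \<Rightarrow> 'p) \<Rightarrow> complex" where
  "peps_state N M A s =
     (\<Sum>h\<in>configs N M. \<Sum>v\<in>configs N M. \<Prod>(i, j)\<in>sites N M.
        A $ s (i, j) $ (v (i, j), h (i, j),
                        v (i, (j + M - 1) mod M), h ((i + N - 1) mod N, j)))"

definition onsite_apply ::
  "nat \<Rightarrow> nat \<Rightarrow> complex^'p^'p \<Rightarrow> ((nat \<times> nat \<Rightarrow> 'p) \<Rightarrow> complex) \<Rightarrow> (nat \<times> nat \<Rightarrow> 'p) \<Rightarrow> complex" where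
  "onsite_apply N M X \<psi> s = (\<Sum>t\<in>configs N M. (\<Prod>x\<in>sites N M. X $ s x $ t x) * \<psi> t)"

definition onsite_symmetry ::
  "('q, 'c) monoid_scheme \<Rightarrow> ('q \<Rightarrow> complex^'p^'p) \<Rightarrow> ('n::finite, 'p::finite) tensor \<Rightarrow> bool" where
  "onsite_symmetry Q U A \<longleftrightarrow>
     representation Q U \<and> (\<forall>q\<in>carrier Q. unitary_matrix (U q)) \<and>
     (\<forall>q\<in>carrier Q. \<forall>N\<ge>1. \<forall>M\<ge>1. \<forall>s\<in>configs N M.
        onsite_apply N M (U q) (peps_state N M A) s = peps_state N M A s)"


section \<open>The pair \<open>(\<phi>, \<omega>)\<close>\<close>

definition virtual_symmetry ::
  "('q, 'c) monoid_scheme \<Rightarrow> ('q \<Rightarrow> complex^'p^'p) \<Rightarrow> ('n::finite, 'p::finite) tensor \<Rightarrow>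
   ('q \<Rightarrow> complex^'n^'n) \<Rightarrow> ('q \<Rightarrow> complex^'n^'n) \<Rightarrow> bool" where
  "virtual_symmetry Q U A v w \<longleftrightarrow>
     (\<forall>q\<in>carrier Q. invertible (v q) \<and> invertible (w q) \<and> U q ** A = A ** gauge (w q) (v q))"

definition proportional :: "complex^'n^'m \<Rightarrow> complex^'n^'m \<Rightarrow> bool" where
  "proportional X Y \<longleftrightarrow> (\<exists>c. c \<noteq> 0 \<and> (\<forall>i j. X $ i $ j = c * Y $ i $ j))"

type_synonym ('g, 'q) pair_data = "('q \<Rightarrow> 'g \<Rightarrow> 'g) \<times> ('q \<Rightarrow> 'q \<Rightarrow> 'g)"

definition induces_pair ::
  "('g, 'b) monoid_scheme \<Rightarrow> ('q, 'c) monoid_scheme \<Rightarrow> ('g \<Rightarrow> complex^'n^'n) \<Rightarrow>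
   ('q \<Rightarrow> complex^'n^'n) \<Rightarrow> ('g, 'q) pair_data \<Rightarrow> bool" where
  "induces_pair G Q u v = (\<lambda>(\<phi>, \<omega>).
     \<phi> \<in> carrier Q \<rightarrow> carrier G \<rightarrow> carrier G \<and>
     \<omega> \<in> carrier Q \<rightarrow> carrier Q \<rightarrow> carrier G \<and>
     (\<forall>q\<in>carrier Q. \<forall>g\<in>carrier G.
        proportional (v q ** u g ** matrix_inv (v q)) (u (\<phi> q g))) \<and>
     (\<forall>k\<in>carrier Q. \<forall>q\<in>carrier Q.
        proportional (v k ** v q ** matrix_inv (v (k \<otimes>\<^bsub>Q\<^esub> q))) (u (\<omega> k q))))"

text \<open>All pairs obtained from any choice of the virtual matrices.\<close>

definition symmetry_class ::
  "('g, 'b) monoid_scheme \<Rightarrow> ('q, 'c) monoid_scheme \<Rightarrow> ('g \<Rightarrow> complex^'n^'n) \<Rightarrow>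
   ('q \<Rightarrow> complex^'p^'p) \<Rightarrow> ('n::finite, 'p::finite) tensor \<Rightarrow> ('g, 'q) pair_data set" where
  "symmetry_class G Q u U A =
     {p. \<exists>v w. virtual_symmetry Q U A v w \<and> induces_pair G Q u v p \<and> induces_pair G Q u w p}"

text \<open>\<open>\<phi>\<close> takes values in \<open>Aut(G)\<close> and is a homomorphism up to the inner automorphisms given by the
  2-cocycle \<open>\<omega>\<close>.\<close>

definition cocycle_pairs ::
  "('g, 'b) monoid_scheme \<Rightarrow> ('q, 'c) monoid_scheme \<Rightarrow> ('g, 'q) pair_data set" where
  "cocycle_pairs G Q = {(\<phi>, \<omega>).
     \<phi> \<in> carrier Q \<rightarrow> iso G G \<and>
     \<omega> \<in> carrier Q \<rightarrow> carrier Q \<rightarrow> carrier G \<and>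
     (\<forall>k\<in>carrier Q. \<forall>q\<in>carrier Q. \<forall>g\<in>carrier G.
        \<phi> k (\<phi> q g) = \<omega> k q \<otimes>\<^bsub>G\<^esub> \<phi> (k \<otimes>\<^bsub>Q\<^esub> q) g \<otimes>\<^bsub>G\<^esub> inv\<^bsub>G\<^esub> (\<omega> k q)) \<and>
     (\<forall>k\<in>carrier Q. \<forall>q\<in>carrier Q. \<forall>p\<in>carrier Q.
        \<omega> k q \<otimes>\<^bsub>G\<^esub> \<omega> (k \<otimes>\<^bsub>Q\<^esub> q) p = \<phi> k (\<omega> q p) \<otimes>\<^bsub>G\<^esub> \<omega> k (q \<otimes>\<^bsub>Q\<^esub> p))}"

definition pair_equiv ::
  "('g, 'b) monoid_scheme \<Rightarrow> ('q, 'c) monoid_scheme \<Rightarrow> (('g, 'q) pair_data \<times> ('g, 'q) pair_data) set" where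
  "pair_equiv G Q = {((\<phi>, \<omega>), (\<phi>', \<omega>')).
     (\<phi>, \<omega>) \<in> cocycle_pairs G Q \<and> (\<phi>', \<omega>') \<in> cocycle_pairs G Q \<and>
     (\<exists>\<gamma> \<in> carrier Q \<rightarrow> carrier G.
        (\<forall>k\<in>carrier Q. \<forall>g\<in>carrier G. \<phi>' k g = \<gamma> k \<otimes>\<^bsub>G\<^esub> \<phi> k g \<otimes>\<^bsub>G\<^esub> inv\<^bsub>G\<^esub> (\<gamma> k)) \<and>
        (\<forall>k\<in>carrier Q. \<forall>q\<in>carrier Q.
           \<omega>' k q = \<gamma> k \<otimes>\<^bsub>G\<^esub> \<phi> k (\<gamma> q) \<otimes>\<^bsub>G\<^esub> \<omega> k q \<otimes>\<^bsub>G\<^esub> inv\<^bsub>G\<^esub> (\<gamma> (k \<otimes>\<^bsub>Q\<^esub> q))))}"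

lemma (in group) cancel_mid:
  assumes "a \<in> carrier G" "b \<in> carrier G"
  shows "a \<otimes> (inv a \<otimes> b) = b" "inv a \<otimes> (a \<otimes> b) = b"
  using assms by (simp_all flip: m_assoc)

lemma pair_equivI:
  assumes "(\<phi>, \<omega>) \<in> cocycle_pairs G Q" "(\<phi>', \<omega>') \<in> cocycle_pairs G Q"
    and "\<gamma> \<in> carrier Q \<rightarrow> carrier G"
    and "\<And>k g. k \<in> carrier Q \<Longrightarrow> g \<in> carrier G \<Longrightarrow>
        \<phi>' k g = \<gamma> k \<otimes>\<^bsub>G\<^esub> \<phi> k g \<otimes>\<^bsub>G\<^esub> inv\<^bsub>G\<^esub> (\<gamma> k)"
    and "\<And>k q. k \<in> carrier Q \<Longrightarrow> q \<in> carrier Q \<Longrightarrow>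
        \<omega>' k q = \<gamma> k \<otimes>\<^bsub>G\<^esub> \<phi> k (\<gamma> q) \<otimes>\<^bsub>G\<^esub> \<omega> k q \<otimes>\<^bsub>G\<^esub> inv\<^bsub>G\<^esub> (\<gamma> (k \<otimes>\<^bsub>Q\<^esub> q))"
  shows "((\<phi>, \<omega>), (\<phi>', \<omega>')) \<in> pair_equiv G Q"
  unfolding pair_equiv_def mem_Collect_eq case_prod_conv
  by (intro conjI bexI[of _ \<gamma>] ballI assms)

lemma equiv_pair_equiv:
  assumes "group G" "group Q"
  shows "equiv (cocycle_pairs G Q) (pair_equiv G Q)"
proof -
  interpret G: group G by fact
  interpret Q: group Q by fact
  have cl: "\<phi> k g \<in> carrier G" and mult: "h \<in> carrier G \<Longrightarrow> \<phi> k (g \<otimes>\<^bsub>G\<^esub> h) = \<phi> k g \<otimes>\<^bsub>G\<^esub> \<phi> k h"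
    and inv: "\<phi> k (inv\<^bsub>G\<^esub> g) = inv\<^bsub>G\<^esub> (\<phi> k g)" and one: "\<phi> k \<one>\<^bsub>G\<^esub> = \<one>\<^bsub>G\<^esub>"
    if "(\<phi>, \<omega>) \<in> cocycle_pairs G Q" "k \<in> carrier Q" "g \<in> carrier G" for \<phi> \<omega> k g h
  proof -
    have hom: "\<phi> k \<in> hom G G" using that by (auto simp: cocycle_pairs_def iso_def)
    then interpret group_hom G G "\<phi> k" by unfold_locales
    show "\<phi> k g \<in> carrier G" "h \<in> carrier G \<Longrightarrow> \<phi> k (g \<otimes>\<^bsub>G\<^esub> h) = \<phi> k g \<otimes>\<^bsub>G\<^esub> \<phi> k h"
      "\<phi> k (inv\<^bsub>G\<^esub> g) = inv\<^bsub>G\<^esub> (\<phi> k g)" "\<phi> k \<one>\<^bsub>G\<^esub> = \<one>\<^bsub>G\<^esub>"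
      using that by simp_all
  qed
  have wcl: "\<omega> k q \<in> carrier G"
    if "(\<phi>, \<omega>) \<in> cocycle_pairs G Q" "k \<in> carrier Q" "q \<in> carrier Q" for \<phi> \<omega> k q
    using that by (auto simp: cocycle_pairs_def)
  have R: "(p, p) \<in> pair_equiv G Q" if p: "p \<in> cocycle_pairs G Q" for p
  proof -
    obtain \<phi> \<omega> where [simp]: "p = (\<phi>, \<omega>)" by (cases p)
    have P: "(\<phi>, \<omega>) \<in> cocycle_pairs G Q" using p by simp
    show ?thesis using P
      by (auto simp: pair_equiv_def cl[OF P] wcl[OF P] one[OF P _ G.one_closed] intro!: bexI[of _ "\<lambda>_. \<one>\<^bsub>G\<^esub>"])
  qed
  have S: "(p', p) \<in> pair_equiv G Q" if p: "(p, p') \<in> pair_equiv G Q" for p p'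
  proof -
    obtain \<phi> \<omega> \<phi>' \<omega>' where [simp]: "p = (\<phi>, \<omega>)" "p' = (\<phi>', \<omega>')" by (cases p, cases p')
    from p obtain \<gamma> where P: "(\<phi>, \<omega>) \<in> cocycle_pairs G Q" "(\<phi>', \<omega>') \<in> cocycle_pairs G Q"
      and \<gamma>: "\<gamma> \<in> carrier Q \<rightarrow> carrier G"
      and 1: "\<And>k g. k \<in> carrier Q \<Longrightarrow> g \<in> carrier G \<Longrightarrow>
          \<phi>' k g = \<gamma> k \<otimes>\<^bsub>G\<^esub> \<phi> k g \<otimes>\<^bsub>G\<^esub> inv\<^bsub>G\<^esub> (\<gamma> k)"
      and 2: "\<And>k q. k \<in> carrier Q \<Longrightarrow> q \<in> carrier Q \<Longrightarrow>
          \<omega>' k q = \<gamma> k \<otimes>\<^bsub>G\<^esub> \<phi> k (\<gamma> q) \<otimes>\<^bsub>G\<^esub> \<omega> k q \<otimes>\<^bsub>G\<^esub> inv\<^bsub>G\<^esub> (\<gamma> (k \<otimes>\<^bsub>Q\<^esub> q))"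
      by (auto simp: pair_equiv_def)
    have \<gamma>': "k \<in> carrier Q \<Longrightarrow> \<gamma> k \<in> carrier G" for k using \<gamma> by auto
    have c: "k \<in> carrier Q \<Longrightarrow> g \<in> carrier G \<Longrightarrow> \<phi> k g \<in> carrier G"
      "k \<in> carrier Q \<Longrightarrow> q \<in> carrier Q \<Longrightarrow> \<omega> k q \<in> carrier G" for k g q
      using cl[OF P(1)] wcl[OF P(1)] by auto
    have A: "\<phi> k g = inv\<^bsub>G\<^esub> (\<gamma> k) \<otimes>\<^bsub>G\<^esub> \<phi>' k g \<otimes>\<^bsub>G\<^esub> inv\<^bsub>G\<^esub> (inv\<^bsub>G\<^esub> (\<gamma> k))"
      if "k \<in> carrier Q" "g \<in> carrier G" for k g
      using that by (simp add: 1 \<gamma>' c G.m_assoc G.cancel_mid)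
    have B: "\<omega> k q = inv\<^bsub>G\<^esub> (\<gamma> k) \<otimes>\<^bsub>G\<^esub> \<phi>' k (inv\<^bsub>G\<^esub> (\<gamma> q)) \<otimes>\<^bsub>G\<^esub> \<omega>' k q
        \<otimes>\<^bsub>G\<^esub> inv\<^bsub>G\<^esub> (inv\<^bsub>G\<^esub> (\<gamma> (k \<otimes>\<^bsub>Q\<^esub> q)))"
      if "k \<in> carrier Q" "q \<in> carrier Q" for k q
      using that by (simp add: 1 2 \<gamma>' c inv[OF P(1)] G.m_assoc G.cancel_mid)
    have C: "(\<lambda>k. inv\<^bsub>G\<^esub> (\<gamma> k)) \<in> carrier Q \<rightarrow> carrier G" using \<gamma>' by auto
    show ?thesis using pair_equivI[OF P(2,1) C A B] by simp
  qed
  have T: "(p, p'') \<in> pair_equiv G Q"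
    if p: "(p, p') \<in> pair_equiv G Q" and p': "(p', p'') \<in> pair_equiv G Q" for p p' p''
  proof -
    obtain \<phi> \<omega> \<phi>' \<omega>' \<phi>'' \<omega>'' where [simp]: "p = (\<phi>, \<omega>)" "p' = (\<phi>', \<omega>')" "p'' = (\<phi>'', \<omega>'')"
      by (cases p, cases p', cases p'')
    from p obtain \<gamma> where P: "(\<phi>, \<omega>) \<in> cocycle_pairs G Q" "(\<phi>', \<omega>') \<in> cocycle_pairs G Q"
      and \<gamma>: "\<gamma> \<in> carrier Q \<rightarrow> carrier G"
      and 1: "\<And>k g. k \<in> carrier Q \<Longrightarrow> g \<in> carrier G \<Longrightarrow>
          \<phi>' k g = \<gamma> k \<otimes>\<^bsub>G\<^esub> \<phi> k g \<otimes>\<^bsub>G\<^esub> inv\<^bsub>G\<^esub> (\<gamma> k)"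
      and 2: "\<And>k q. k \<in> carrier Q \<Longrightarrow> q \<in> carrier Q \<Longrightarrow>
          \<omega>' k q = \<gamma> k \<otimes>\<^bsub>G\<^esub> \<phi> k (\<gamma> q) \<otimes>\<^bsub>G\<^esub> \<omega> k q \<otimes>\<^bsub>G\<^esub> inv\<^bsub>G\<^esub> (\<gamma> (k \<otimes>\<^bsub>Q\<^esub> q))"
      by (auto simp: pair_equiv_def)
    from p' obtain \<delta> where P': "(\<phi>'', \<omega>'') \<in> cocycle_pairs G Q"
      and \<delta>: "\<delta> \<in> carrier Q \<rightarrow> carrier G"
      and 3: "\<And>k g. k \<in> carrier Q \<Longrightarrow> g \<in> carrier G \<Longrightarrow>
          \<phi>'' k g = \<delta> k \<otimes>\<^bsub>G\<^esub> \<phi>' k g \<otimes>\<^bsub>G\<^esub> inv\<^bsub>G\<^esub> (\<delta> k)"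
      and 4: "\<And>k q. k \<in> carrier Q \<Longrightarrow> q \<in> carrier Q \<Longrightarrow>
          \<omega>'' k q = \<delta> k \<otimes>\<^bsub>G\<^esub> \<phi>' k (\<delta> q) \<otimes>\<^bsub>G\<^esub> \<omega>' k q \<otimes>\<^bsub>G\<^esub> inv\<^bsub>G\<^esub> (\<delta> (k \<otimes>\<^bsub>Q\<^esub> q))"
      by (auto simp: pair_equiv_def)
    have \<gamma>': "k \<in> carrier Q \<Longrightarrow> \<gamma> k \<in> carrier G" "k \<in> carrier Q \<Longrightarrow> \<delta> k \<in> carrier G" for k
      using \<gamma> \<delta> by auto
    have c: "k \<in> carrier Q \<Longrightarrow> g \<in> carrier G \<Longrightarrow> \<phi> k g \<in> carrier G"
      "k \<in> carrier Q \<Longrightarrow> q \<in> carrier Q \<Longrightarrow> \<omega> k q \<in> carrier G" for k g q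
      using cl[OF P(1)] wcl[OF P(1)] by auto
    let ?\<epsilon> = "\<lambda>k. \<delta> k \<otimes>\<^bsub>G\<^esub> \<gamma> k"
    have A: "\<phi>'' k g = ?\<epsilon> k \<otimes>\<^bsub>G\<^esub> \<phi> k g \<otimes>\<^bsub>G\<^esub> inv\<^bsub>G\<^esub> (?\<epsilon> k)"
      if "k \<in> carrier Q" "g \<in> carrier G" for k g
      using that by (simp add: 1 3 \<gamma>' c G.m_assoc G.inv_mult_group)
    have B: "\<omega>'' k q = ?\<epsilon> k \<otimes>\<^bsub>G\<^esub> \<phi> k (?\<epsilon> q) \<otimes>\<^bsub>G\<^esub> \<omega> k q \<otimes>\<^bsub>G\<^esub> inv\<^bsub>G\<^esub> (?\<epsilon> (k \<otimes>\<^bsub>Q\<^esub> q))"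
      if "k \<in> carrier Q" "q \<in> carrier Q" for k q
      using that by (simp add: 1 2 4 \<gamma>' c mult[OF P(1)] G.m_assoc G.inv_mult_group G.cancel_mid)
    have C: "?\<epsilon> \<in> carrier Q \<rightarrow> carrier G" using \<gamma>' by auto
    show ?thesis using pair_equivI[OF P(1) P' C A B] by simp
  qed
  have "pair_equiv G Q \<subseteq> cocycle_pairs G Q \<times> cocycle_pairs G Q"
    by (auto simp: pair_equiv_def)
  then show ?thesis
    using R S T by (intro equivI refl_onI symI transI) assumption+
qed


section \<open>Parent Hamiltonian and natural perturbations\<close>

text \<open>The four tensors of a patch sit at \<open>(0,0)\<close>, \<open>(1,0)\<close>, \<open>(0,1)\<close>, \<open>(1,1)\<close>, in this order; \<open>x\<^sub>1, x\<^sub>2\<close>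
  run over the lower and upper horizontal inner bond, \<open>y\<^sub>1, y\<^sub>2\<close> over the left and right vertical one.
  The columns are indexed by the eight outer legs.\<close>

definition patch_map ::
  "('n::finite, 'p::finite) tensor \<Rightarrow>
   complex^(('n \<times> 'n) \<times> ('n \<times> 'n) \<times> ('n \<times> 'n) \<times> ('n \<times> 'n))^('p \<times> 'p \<times> 'p \<times> 'p)" where
  "patch_map A =
     (\<chi> s l. case s of (s00, s10, s01, s11) \<Rightarrow>
       case l of ((d00, l00), (d10, r10), (u01, l01), (u11, r11)) \<Rightarrow>
         (\<Sum>x1\<in>UNIV. \<Sum>x2\<in>UNIV. \<Sum>y1\<in>UNIV. \<Sum>y2\<in>UNIV.
            A $ s00 $ (y1, x1, d00, l00) * A $ s10 $ (y2, r10, d10, x1) *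
            A $ s01 $ (u01, x2, y1, l01) * A $ s11 $ (u11, r11, y2, x2)))"

definition patch_space :: "('n::finite, 'p::finite) tensor \<Rightarrow> (complex^('p \<times> 'p \<times> 'p \<times> 'p)) set" where
  "patch_space A = range (\<lambda>X. patch_map A *v X)"

definition parent_term ::
  "('n::finite, 'p::finite) tensor \<Rightarrow> complex^('p \<times> 'p \<times> 'p \<times> 'p)^('p \<times> 'p \<times> 'p \<times> 'p)" where
  "parent_term A =
     (THE P. P ** P = P \<and> cadjoint P = P \<and> {x. P *v x = 0} = patch_space A)"

text \<open>Matrix elements on the \<open>N \<times> M\<close> torus; meaningful for \<open>N, M \<ge> 2\<close>, where the four sites of a patch
  are distinct.\<close>

definition parent_hamiltonian ::
  "nat \<Rightarrow> nat \<Rightarrow> ('n::finite, 'p::finite) tensor \<Rightarrow> (nat \<times> nat \<Rightarrow> 'p) \<Rightarrow> (nat \<times> nat \<Rightarrow> 'p) \<Rightarrow> complex" where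
  "parent_hamiltonian N M A s t =
     (\<Sum>(i, j)\<in>sites N M.
        let i' = (i + 1) mod N; j' = (j + 1) mod M;
            patch = (\<lambda>r. (r (i, j), r (i', j), r (i, j'), r (i', j')))
        in if \<forall>x \<in> sites N M - {(i, j), (i', j), (i, j'), (i', j')}. s x = t x
           then parent_term A $ patch s $ patch t else 0)"

definition natural_perturbation ::
  "('q, 'c) monoid_scheme \<Rightarrow> ('q \<Rightarrow> complex^'p^'p) \<Rightarrow> ('n::finite, 'p::finite) tensor \<Rightarrow>
   (real \<Rightarrow> complex^'p^'p) \<Rightarrow> bool" where
  "natural_perturbation Q U A R \<longleftrightarrow>
     (\<exists>r>0. continuous_on (ball 0 r) R \<and> (R \<longlongrightarrow> mat 1) (at 0) \<and>
            (\<forall>\<epsilon>\<in>ball 0 r. onsite_symmetry Q U (R \<epsilon> ** A)))"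

end

theory Submission
  imports Defs "HOL-Computational_Algebra.Fundamental_Theorem_Algebra"
begin

text \<open>Compressing the symmetry \<open>U\<close> with a left inverse of \<open>A\<close> gives an operator \<open>L\<close> on the invariant
  tensors on the four virtual legs. On the \<open>3 \<times> 3\<close> torus an invariant operator on two adjacent legs of a
  site acts on the state like an operator on a connected set of other sites, and for complementary
  pairs of legs these sets can be chosen disjoint. Hence the conjugate by \<open>L\<close> of an operator on one pair
  commutes with the operators on the complementary pair, which makes \<open>L\<close> multiplicative for both
  products obtained by splitting the four legs into adjacent pairs; the \<open>1 \<times> 1\<close> torus shows that \<open>L\<close>
  preserves the unit. Such a map is a conjugation by \<open>w\<close> on the vertical and \<open>v\<close> on the horizontal legs.

  Since \<open>u\<close> contains all irreducible representations, the matrices \<open>u g\<close> are linearly independent, and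
  functionals dual to them show that \<open>w\<close>, \<open>v\<close> are unique up to scalars and a common \<open>u h\<close>. This yields
  \<open>\<phi>\<close>, \<open>\<omega>\<close>, the cocycle relations and the equivalence of all choices.

  For a perturbed tensor the condition numbers of \<open>w\<close> and \<open>v\<close> stay bounded, so by compactness they can be
  chosen close to the unperturbed ones; the dual functionals then force the discrete data \<open>\<phi>\<close>, \<open>\<omega>\<close> to
  agree. The parent projector is an explicit continuous function of the perturbation.\<close>

section \<open>Complex matrices\<close>

text \<open>The tensor is inverted only up to the group average, so a general matrix on one leg
  cannot be pulled back to the physical space and pushed through a bond. What can be moved are
  operators on two legs that commute with \<open>u g \<otimes> u g\<close>, and they pass only
  through a region whose sites all carry the same group element. This fixes the size of the torus:
  for side 3 the four neighbours of a site are distinct and every adjacent pair of them is joined by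
  a corner site of its own, so complementary pairs of legs get disjoint connected regions.

  Two products are needed because an automorphism for a single splitting of the legs may be
  conjugation by an element that mixes the two pairs; only compatibility with both splittings forces
  a product form.

  For perturbations the discreteness of \<open>\<phi>\<close> and \<open>\<omega>\<close> helps only
  once the matrices are controlled. What is bounded is a sum of gauges over the group, whose terms
  could cancel while \<open>w\<close> and \<open>v\<close> degenerate; excluding this is the purpose
  of linking two copies of the sum.\<close>

definition cscale :: "complex \<Rightarrow> complex^'n^'m \<Rightarrow> complex^'n^'m" (infixr "*m" 75) where
  "c *m X = (\<chi> i j. c * X $ i $ j)"

definition munit :: "'m \<Rightarrow> 'n \<Rightarrow> complex^'n^'m" where
  "munit i j = (\<chi> a b. if a = i \<and> b = j then 1 else 0)"

lemma cscale_nth [simp]: "(c *m X) $ i $ j = c * X $ i $ j"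
  by (simp add: cscale_def)

lemma munit_nth: "munit i j $ a $ b = (if a = i \<and> b = j then 1 else 0)"
  by (simp add: munit_def)

lemma matrix_eqI: "(\<And>i j. X $ i $ j = Y $ i $ j) \<Longrightarrow> X = Y"
  by (simp add: vec_eq_iff)

lemma mmult_nth: "(X ** Y) $ i $ j = (\<Sum>k\<in>UNIV. X $ i $ k * Y $ k $ j)"
  by (simp add: matrix_matrix_mult_def)

lemma cscale_simps [simp]:
  "1 *m X = X" "0 *m X = 0" "c *m 0 = 0"
  "c *m (d *m X) = (c * d) *m X"
  by (auto intro!: matrix_eqI)

lemma cscale_add: "c *m (X + Y) = c *m X + c *m Y" "(c + d) *m X = c *m X + d *m X"
  "c *m (X - Y) = c *m X - c *m Y" "(c - d) *m X = c *m X - d *m X" "(- c) *m X = - (c *m X)"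
  "c *m (- X) = - (c *m X)"
  by (auto intro!: matrix_eqI simp: algebra_simps)

lemma cscale_sum: "c *m (\<Sum>i\<in>S. f i) = (\<Sum>i\<in>S. c *m f i)"
  by (auto intro!: matrix_eqI simp: sum_distrib_left)

lemma cscale_sum_left: "(\<Sum>i\<in>S. f i) *m X = (\<Sum>i\<in>S. f i *m X)"
  by (auto intro!: matrix_eqI simp: sum_distrib_right)

lemma cscale_mult [simp]:
  fixes X :: "complex^'n^'m" and Y :: "complex^'k^'n"
  shows "(c *m X) ** Y = c *m (X ** Y)" "X ** (c *m Y) = c *m (X ** Y)"
  by (auto intro!: matrix_eqI simp: mmult_nth sum_distrib_left mult_ac)

lemma cscale_eq_0: "c *m X = 0 \<longleftrightarrow> c = 0 \<or> X = 0"
  by (auto simp: vec_eq_iff)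

lemma mmult_sum:
  fixes X :: "complex^'n^'m" and Y :: "complex^'k^'n"
  shows "(\<Sum>i\<in>S. f i) ** Y = (\<Sum>i\<in>S. f i ** Y)" "X ** (\<Sum>i\<in>S. g i) = (\<Sum>i\<in>S. X ** g i)"
  by (rule matrix_eqI, simp add: mmult_nth sum_distrib_left sum_distrib_right, rule sum.swap)+

lemma mmult_diff:
  fixes X :: "complex^'n^'m" and Y :: "complex^'k^'n"
  shows "(X - X') ** Y = X ** Y - X' ** Y" "X ** (Y - Y') = X ** Y - X ** Y'"
  by (auto intro!: matrix_eqI simp: mmult_nth sum_subtractf algebra_simps)

lemma mmult_0 [simp]:
  fixes X :: "complex^'n^'m" and Y :: "complex^'k^'n"
  shows "(0 :: complex^'n^'m) ** Y = 0" "X ** (0 :: complex^'k^'n) = 0"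
  by (auto intro!: matrix_eqI simp: mmult_nth)

lemma mvec_sum:
  fixes X :: "complex^'n^'m"
  shows "(\<Sum>i\<in>S. f i) *v y = (\<Sum>i\<in>S. f i *v y)" "X *v (\<Sum>i\<in>S. g i) = (\<Sum>i\<in>S. X *v g i)"
  by (simp add: vec_eq_iff matrix_vector_mult_def sum_distrib_left sum_distrib_right, rule allI, rule sum.swap)+

lemma mvec_scale [simp]:
  fixes X :: "complex^'n^'m"
  shows "(c *m X) *v y = c *s (X *v y)" "X *v (c *s y) = c *s (X *v y)"
  by (auto simp: vec_eq_iff matrix_vector_mult_def sum_distrib_left mult_ac)

lemma matrix_eq_sum_munit: "X = (\<Sum>i\<in>UNIV. \<Sum>j\<in>UNIV. X $ i $ j *m munit i j)"
proof (rule matrix_eqI)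
  fix a b
  have "(\<Sum>i\<in>UNIV. \<Sum>j\<in>UNIV. X $ i $ j *m munit i j) $ a $ b
      = (\<Sum>i\<in>UNIV. \<Sum>j\<in>UNIV. if i = a then if j = b then X $ i $ j else 0 else 0)"
    by (auto simp: munit_nth intro!: sum.cong)
  also have "\<dots> = (\<Sum>i\<in>UNIV. if i = a then \<Sum>j\<in>UNIV. if j = b then X $ i $ j else 0 else 0)"
    by (intro sum.cong) auto
  finally show "X $ a $ b = (\<Sum>i\<in>UNIV. \<Sum>j\<in>UNIV. X $ i $ j *m munit i j) $ a $ b" by simp
qed

lemma munit_mult_nth:
  fixes X :: "complex^'k^'n"
  shows "(munit i j ** X) $ a $ b = (if a = i then X $ j $ b else 0)"
proof -
  have "(munit i j ** X) $ a $ b = (\<Sum>k\<in>UNIV. if k = j then (if a = i then X $ k $ b else 0) else 0)"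
    unfolding mmult_nth by (rule sum.cong) (auto simp: munit_nth)
  then show ?thesis by simp
qed

lemma mult_munit_nth:
  fixes X :: "complex^'n^'k"
  shows "(X ** munit i j) $ a $ b = (if b = j then X $ a $ i else 0)"
proof -
  have "(X ** munit i j) $ a $ b = (\<Sum>k\<in>UNIV. if k = i then (if b = j then X $ a $ k else 0) else 0)"
    unfolding mmult_nth by (rule sum.cong) (auto simp: munit_nth)
  then show ?thesis by simp
qed

lemma munit_conj_nth: "(X ** munit i j ** Y) $ a $ b = X $ a $ i * Y $ j $ b"
proof -
  have "(X ** munit i j ** Y) $ a $ b = (\<Sum>k\<in>UNIV. if k = j then X $ a $ i * Y $ k $ b else 0)"
    by (subst mmult_nth, rule sum.cong) (auto simp: mult_munit_nth)
  then show ?thesis by simp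
qed

lemma munit_sandwich: "munit i j ** X ** munit k l = X $ j $ k *m munit i l"
proof (rule matrix_eqI)
  fix a b
  show "(munit i j ** X ** munit k l) $ a $ b = (X $ j $ k *m munit i l) $ a $ b"
    unfolding mult_munit_nth by (simp add: munit_mult_nth munit_nth)
qed

lemma sum_munit_diag: "(\<Sum>i\<in>UNIV. munit i i) = mat 1"
  by (rule matrix_eqI) (auto simp: munit_nth mat_def intro!: sum.neutral)

lemma trace_mult_munit: "trace (X ** munit i j) = X $ j $ i"
proof -
  have "trace (X ** munit i j) = (\<Sum>k\<in>UNIV. if k = j then X $ k $ i else 0)"
    unfolding trace_def by (rule sum.cong) (auto simp: mult_munit_nth)
  then show ?thesis by simp
qed

lemma trace_munit_mult: "trace (munit i j ** X) = X $ j $ i"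
  using trace_mult_munit trace_mul_sym by metis

lemma trace_cscale: "trace (c *m X) = c * trace X"
  by (simp add: trace_def sum_distrib_left)

lemma trace_sum: "trace (\<Sum>i\<in>S. f i :: complex^'n^'n) = (\<Sum>i\<in>S. trace (f i))"
  unfolding trace_def by (simp) (rule sum.swap)

lemma trace_mult_eq: "trace (X ** Y) = (\<Sum>i\<in>UNIV. \<Sum>j\<in>UNIV. X $ i $ j * Y $ j $ i)"
  by (simp add: trace_def mmult_nth)

lemma trace_mult_cong:
  fixes X Y :: "complex^'n^'n"
  assumes "\<And>Z. trace (Z ** X) = trace (Z ** Y)"
  shows "X = Y"
proof (rule matrix_eqI)
  fix i j
  show "X $ i $ j = Y $ i $ j" using assms[of "munit j i"] by (simp add: trace_munit_mult)
qed

lemma matrix_inv_mult: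
  fixes X :: "complex^'n^'n"
  assumes "invertible X"
  shows "X ** matrix_inv X = mat 1" "matrix_inv X ** X = mat 1"
proof -
  have "X ** matrix_inv X = mat 1 \<and> matrix_inv X ** X = mat 1"
    using assms unfolding invertible_def matrix_inv_def by (rule someI_ex)
  then show "X ** matrix_inv X = mat 1" "matrix_inv X ** X = mat 1" by auto
qed

lemma matrix_inv_unique:
  fixes X :: "complex^'n^'n"
  assumes "X ** Y = mat 1"
  shows "matrix_inv X = Y" "invertible X"
proof -
  have "Y ** X = mat 1" using assms matrix_left_right_inverse by blast
  then show inv: "invertible X" using assms unfolding invertible_def by blast
  have "matrix_inv X = matrix_inv X ** (X ** Y)" using assms by simp
  also have "\<dots> = Y" by (simp add: matrix_mul_assoc matrix_inv_mult[OF inv])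
  finally show "matrix_inv X = Y" .
qed

lemma matrix_inv_cancel:
  fixes X :: "complex^'n^'n" and Y :: "complex^'k^'n" and Z :: "complex^'n^'m"
  assumes "invertible X"
  shows "X ** (matrix_inv X ** Y) = Y" "matrix_inv X ** (X ** Y) = Y"
    "Z ** X ** matrix_inv X = Z" "Z ** matrix_inv X ** X = Z"
proof -
  show "X ** (matrix_inv X ** Y) = Y" "matrix_inv X ** (X ** Y) = Y"
    by (simp_all add: matrix_mul_assoc matrix_inv_mult[OF assms])
  show "Z ** X ** matrix_inv X = Z" "Z ** matrix_inv X ** X = Z"
    by (simp_all add: matrix_inv_mult[OF assms] flip: matrix_mul_assoc)
qed

lemma invertible_matrix_inv:
  fixes X :: "complex^'n^'n"
  assumes "invertible X"
  shows "invertible (matrix_inv X)" "matrix_inv (matrix_inv X) = X"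
  using matrix_inv_unique[OF matrix_inv_mult(2)[OF assms]] by auto

lemma matrix_inv_mult_distrib:
  fixes X Y :: "complex^'n^'n"
  assumes "invertible X" "invertible Y"
  shows "matrix_inv (X ** Y) = matrix_inv Y ** matrix_inv X"
proof (rule matrix_inv_unique)
  have "X ** Y ** (matrix_inv Y ** matrix_inv X) = X ** (Y ** (matrix_inv Y ** matrix_inv X))"
    by (simp add: matrix_mul_assoc)
  also have "\<dots> = mat 1" using assms by (simp add: matrix_inv_cancel matrix_inv_mult)
  finally show "X ** Y ** (matrix_inv Y ** matrix_inv X) = mat 1" .
qed

lemma matrix_inv_cscale:
  fixes X :: "complex^'n^'n"
  assumes "invertible X" "c \<noteq> 0"
  shows "matrix_inv (c *m X) = inverse c *m matrix_inv X" "invertible (c *m X)"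
proof -
  have "c *m X ** (inverse c *m matrix_inv X) = mat 1"
    using assms by (simp add: matrix_inv_mult)
  then show "matrix_inv (c *m X) = inverse c *m matrix_inv X" "invertible (c *m X)"
    using matrix_inv_unique by blast+
qed

lemma matrix_inv_mat1 [simp]: "matrix_inv (mat 1 :: complex^'n^'n) = mat 1" "invertible (mat 1 :: complex^'n^'n)"
  using matrix_inv_unique[of "mat 1" "mat 1 :: complex^'n^'n"] by simp_all

lemma invertible_nonzero:
  fixes X :: "complex^'n^'n"
  assumes "invertible X" shows "X \<noteq> 0"
proof
  assume "X = 0"
  then have "(mat 1 :: complex^'n^'n) = 0" using matrix_inv_mult[OF assms] by simp
  then have "(mat 1 :: complex^'n^'n) $ undefined $ undefined = 0" by simp
  then show False by (simp add: mat_def)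
qed

lemma matrix_eq_by_vec:
  fixes X Y :: "complex^'n^'m"
  assumes "\<And>x. X *v x = Y *v x" shows "X = Y"
  using assms matrix_eq by blast

lemma matrix_nonzero_obtains:
  fixes X :: "complex^'n^'m"
  assumes "X \<noteq> 0" obtains x where "X *v x \<noteq> 0"
  using assms matrix_eq_by_vec[of X 0] by auto

lemma invertible_injI:
  fixes X :: "complex^'n^'n"
  assumes "\<And>x. X *v x = 0 \<Longrightarrow> x = 0"
  shows "invertible X"
  using assms matrix_left_invertible_ker invertible_left_inverse by blast

section \<open>Common eigenvectors of commuting operators on complex subspaces\<close>

definition csubspace :: "(complex^'n^'m) set \<Rightarrow> bool" where
  "csubspace S \<longleftrightarrow> 0 \<in> S \<and> (\<forall>x\<in>S. \<forall>y\<in>S. x + y \<in> S) \<and> (\<forall>c. \<forall>x\<in>S. c *m x \<in> S)"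

definition clinear_op :: "(complex^'n^'m \<Rightarrow> complex^'n^'m) \<Rightarrow> bool" where
  "clinear_op f \<longleftrightarrow> (\<forall>x y. f (x + y) = f x + f y) \<and> (\<forall>c x. f (c *m x) = c *m f x)"

lemma clinear_op_sum:
  assumes "clinear_op f"
  shows "f (\<Sum>i\<in>S. g i) = (\<Sum>i\<in>S. f (g i))"
proof -
  have "f 0 = 0" using assms unfolding clinear_op_def by (metis cscale_simps(2))
  then show ?thesis
    using assms by (induction S rule: infinite_finite_induct) (auto simp: clinear_op_def)
qed

lemma csubspace_sum:
  assumes "csubspace S" "\<And>i. i \<in> I \<Longrightarrow> g i \<in> S"
  shows "(\<Sum>i\<in>I. g i) \<in> S"
  using assms by (induction I rule: infinite_finite_induct) (auto simp: csubspace_def)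

text \<open>The operator polynomial \<open>p(f)\<close>, evaluated at the vector
  \<open>x\<close>.\<close>

definition papply ::
  "(complex^'n^'m \<Rightarrow> complex^'n^'m) \<Rightarrow> complex poly \<Rightarrow> complex^'n^'m \<Rightarrow> complex^'n^'m" where
  "papply f p x = (\<Sum>i\<le>degree p. coeff p i *m (f ^^ i) x)"

lemma papply_eq: "degree p \<le> N \<Longrightarrow> papply f p x = (\<Sum>i\<le>N. coeff p i *m (f ^^ i) x)"
  unfolding papply_def
  by (rule sum.mono_neutral_left) (auto simp: coeff_eq_0)

lemma papply_factor:
  assumes "clinear_op f"
  shows "papply f ([:- z, 1:] * q) x = f (papply f q x) - z *m papply f q x"
proof -
  let ?N = "Suc (degree q)"
  have "[:- z, 1:] * q = smult (- z) q + pCons 0 q" by simp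
  have c: "coeff ([:- z, 1:] * q) i = - z * coeff q i + coeff (pCons 0 q) i" for i by simp
  have "degree ([:- z, 1:] * q) \<le> ?N"
    using degree_mult_le[of "[:- z, 1:]" q] by simp
  then have "papply f ([:- z, 1:] * q) x = (\<Sum>i\<le>?N. (- z * coeff q i + coeff (pCons 0 q) i) *m (f ^^ i) x)"
    by (simp only: papply_eq c)
  also have "\<dots> = (\<Sum>i\<le>?N. (- z * coeff q i) *m (f ^^ i) x) + (\<Sum>i\<le>?N. coeff (pCons 0 q) i *m (f ^^ i) x)"
    by (simp only: cscale_add sum.distrib)
  also have "(\<Sum>i\<le>?N. coeff (pCons 0 q) i *m (f ^^ i) x) = (\<Sum>i\<le>degree q. coeff q i *m f ((f ^^ i) x))"
    by (subst sum.atMost_Suc_shift) simp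
  also have "\<dots> = f (papply f q x)"
    using assms unfolding papply_def clinear_op_sum[OF assms] by (auto simp: clinear_op_def)
  also have "(\<Sum>i\<le>?N. (- z * coeff q i) *m (f ^^ i) x) = - z *m (\<Sum>i\<le>?N. coeff q i *m (f ^^ i) x)"
    by (simp only: cscale_sum cscale_simps)
  also have "(\<Sum>i\<le>?N. coeff q i *m (f ^^ i) x) = papply f q x" by (rule papply_eq[symmetric]) simp
  finally show ?thesis by (simp add: cscale_add)
qed

lemma scaleR_cscale: "a *\<^sub>R X = complex_of_real a *m (X :: complex^'n^'m)"
  by (rule matrix_eqI) (simp only: cscale_nth vector_scaleR_component, simp only: scaleR_conv_of_real)

text \<open>The matrices form a real vector space of finite dimension \<open>?d\<close>, so the
  first \<open>?d + 1\<close> iterates of \<open>x\<close> satisfy a real linear relation. The case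
  of two equal iterates is separate because dependence is a property of a set, in which repeated
  vectors are lost.\<close>

lemma papply_annihilator:
  fixes x :: "complex^'n^'m"
  shows "\<exists>p. p \<noteq> 0 \<and> papply f p x = 0"
proof -
  let ?d = "DIM(complex^'n^'m)"
  let ?g = "\<lambda>i. (f ^^ i) x"
  show ?thesis
  proof (cases "inj_on ?g {..?d}")
    case False
    then obtain i j where ij: "i \<noteq> j" "?g i = ?g j" unfolding inj_on_def by auto
    let ?p = "monom 1 i - monom (1::complex) j"
    have "coeff ?p i = 1" using ij by simp
    then have "?p \<noteq> 0" using coeff_0[of i, where ?'a = complex] by force
    moreover have "papply f ?p x = 0"
    proof -
      have "papply f ?p x = (\<Sum>k\<le>i + j. coeff ?p k *m ?g k)"
        by (rule papply_eq, rule degree_diff_le)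
          (rule order_trans[OF degree_monom_le], simp)+
      also have "\<dots> = (\<Sum>k\<le>i + j. (if k = i then ?g k else 0) - (if k = j then ?g k else 0))"
        by (rule sum.cong) (auto simp: cscale_add)
      also have "\<dots> = ?g i - ?g j" by (simp add: sum_subtractf)
      finally show ?thesis using ij by simp
    qed
    ultimately show ?thesis by blast
  next
    case True
    let ?S = "?g ` {..?d}"
    have "card ?S = Suc ?d" using True by (simp add: card_image)
    then have "dependent ?S" using independent_bound[of ?S] by linarith
    moreover have "finite ?S" by simp
    ultimately obtain c where c: "\<exists>v\<in>?S. c v \<noteq> 0" "(\<Sum>v\<in>?S. c v *\<^sub>R v) = 0"
      using real_vector.dependent_finite by blast
    have s: "(\<Sum>i\<le>?d. complex_of_real (c (?g i)) *m ?g i) = 0"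
      using c(2) unfolding sum.reindex[OF True] o_def scaleR_cscale .
    define p where "p = (\<Sum>i\<le>?d. monom (complex_of_real (c (?g i))) i)"
    have cf: "coeff p k = (if k \<le> ?d then complex_of_real (c (?g k)) else 0)" for k
      unfolding p_def by (simp add: coeff_sum)
    obtain i where "i \<le> ?d" "c (?g i) \<noteq> 0" using c(1) by blast
    then have "coeff p i \<noteq> 0" using cf by simp
    then have "p \<noteq> 0" by auto
    moreover have "papply f p x = 0"
    proof -
      have "degree p \<le> ?d" by (rule degree_le) (simp add: cf)
      then show ?thesis using s by (simp add: papply_eq cf)
    qed
    ultimately show ?thesis by blast
  qed
qed

text \<open>A polynomial of least degree that kills \<open>x\<close> is not constant and so has a
  root \<open>z\<close>. Its cofactor \<open>q\<close> does not kill \<open>x\<close> by minimality,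
  hence \<open>papply f q x\<close> is the eigenvector; it lies in \<open>S\<close> as a combination
  of iterates of \<open>x\<close>.\<close>

lemma eigenvector_in_subspace:
  fixes S :: "(complex^'n^'m) set"
  assumes S: "csubspace S" and f: "clinear_op f" and fS: "\<And>x. x \<in> S \<Longrightarrow> f x \<in> S"
    and x: "x \<in> S" "x \<noteq> 0"
  obtains v z where "v \<in> S" "v \<noteq> 0" "f v = z *m v"
proof -
  have iter: "(f ^^ i) x \<in> S" for i by (induction i) (auto simp: x fS)
  define Z where "Z d \<longleftrightarrow> (\<exists>p. p \<noteq> 0 \<and> papply f p x = 0 \<and> degree p = d)" for d
  define d where "d = Least Z"
  obtain p0 where "p0 \<noteq> 0" "papply f p0 x = 0" using papply_annihilator[of f x] by (elim exE conjE)
  then have "Z (degree p0)" unfolding Z_def by (intro exI[of _ p0] conjI refl)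
  then have "Z d" unfolding d_def by (rule LeastI)
  then obtain p where p: "p \<noteq> 0" "papply f p x = 0" "degree p = d" unfolding Z_def by (elim exE conjE)
  have min: "papply f q x \<noteq> 0" if "q \<noteq> 0" "degree q < d" for q
  proof
    assume "papply f q x = 0"
    then have "Z (degree q)" unfolding Z_def using that(1) by (intro exI[of _ q] conjI refl)
    then show False using not_less_Least that(2) unfolding d_def by blast
  qed
  have "d \<noteq> 0"
  proof
    assume "d = 0"
    then have "papply f p x = coeff p 0 *m x" using p by (simp add: papply_def)
    moreover have "coeff p 0 \<noteq> 0" using p \<open>d = 0\<close> leading_coeff_0_iff[of p] by simp
    ultimately have "coeff p 0 \<noteq> 0" "coeff p 0 *m x = 0" using p by simp_all
    then show False using x by (simp add: cscale_eq_0)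
  qed
  then have "\<not> constant (poly p)" using p(3) by (simp add: constant_degree)
  then obtain z where "poly p z = 0" using fundamental_theorem_of_algebra by blast
  then have "[:- z, 1:] dvd p" by (simp only: poly_eq_0_iff_dvd)
  then obtain q where q: "p = [:- z, 1:] * q" by (rule dvdE)
  have "q \<noteq> 0" using p(1) q by auto
  then have "degree p = degree [:- z, 1:] + degree q" unfolding q by (intro degree_mult_eq) auto
  then have "degree q < d" using p(3) by simp
  let ?v = "papply f q x"
  have "?v \<in> S" unfolding papply_def
    by (rule csubspace_sum[OF S]) (use S iter in \<open>auto simp: csubspace_def\<close>)
  moreover have "?v \<noteq> 0" using \<open>q \<noteq> 0\<close> \<open>degree q < d\<close> by (rule min)
  moreover have "f ?v = z *m ?v"
    using papply_factor[OF f, of z q x] p(2) unfolding q[symmetric] by simp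
  ultimately show thesis by (rule that)
qed

text \<open>The eigenspace of one operator inside \<open>S\<close> is invariant under the others
  because they commute, so induction continues within it. Commutation is asked for on
  \<open>S\<close> only, since in the application it is available only on \<open>AA\<close>.\<close>

lemma common_eigenvector:
  fixes S :: "(complex^'n^'m) set"
  assumes "finite X" and "csubspace S" and "\<exists>x\<in>S. x \<noteq> 0"
    and "\<And>i. i \<in> X \<Longrightarrow> clinear_op (T i)"
    and "\<And>i x. i \<in> X \<Longrightarrow> x \<in> S \<Longrightarrow> T i x \<in> S"
    and "\<And>i j x. i \<in> X \<Longrightarrow> j \<in> X \<Longrightarrow> x \<in> S \<Longrightarrow> T i (T j x) = T j (T i x)"
  shows "\<exists>v\<in>S. v \<noteq> 0 \<and> (\<forall>i\<in>X. \<exists>z. T i v = z *m v)"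
  using assms
proof (induction X arbitrary: S rule: finite_induct)
  case empty
  then show ?case by auto
next
  case (insert a X)
  obtain x where x: "x \<in> S" "x \<noteq> 0" using insert.prems by blast
  have lin: "clinear_op (T a)" and inS: "\<And>x. x \<in> S \<Longrightarrow> T a x \<in> S" using insert.prems by auto
  obtain v z where v: "v \<in> S" "v \<noteq> 0" "T a v = z *m v"
    using eigenvector_in_subspace[OF insert.prems(1) lin inS x] by blast
  define S' where "S' = {x \<in> S. T a x = z *m x}"
  have T0: "T a 0 = 0" using clinear_op_sum[OF lin, of "\<lambda>_. 0" "{}"] by simp
  have "csubspace S'"
    unfolding csubspace_def
  proof (intro conjI ballI allI)
    show "0 \<in> S'" using insert.prems(1) T0 by (simp add: S'_def csubspace_def)
    show "x + y \<in> S'" if "x \<in> S'" "y \<in> S'" for x y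
      using that insert.prems(1) lin by (simp add: S'_def csubspace_def clinear_op_def cscale_add)
    show "c *m x \<in> S'" if "x \<in> S'" for c x
      using that insert.prems(1) lin by (simp add: S'_def csubspace_def clinear_op_def mult.commute)
  qed
  moreover have "T i x \<in> S'" if "i \<in> X" "x \<in> S'" for i x
  proof -
    have "T a (T i x) = T i (T a x)" using insert.prems(5)[of a i x] that by (auto simp: S'_def)
    also have "\<dots> = z *m T i x" using insert.prems(3)[of i] that by (auto simp: S'_def clinear_op_def)
    finally show ?thesis using insert.prems(4)[of i x] that by (auto simp: S'_def)
  qed
  moreover have "\<exists>x\<in>S'. x \<noteq> 0" using v by (auto simp: S'_def)
  ultimately have "\<exists>v\<in>S'. v \<noteq> 0 \<and> (\<forall>i\<in>X. \<exists>z. T i v = z *m v)"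
    using insert.prems by (intro insert.IH) (auto simp: S'_def)
  then show ?case by (auto simp: S'_def)
qed

section \<open>Invariant blocks and their two products\<close>

text \<open>Blocks \<open>t i j\<close> are tensors on the four legs of a site, \<open>i\<close> and \<open>j\<close> belonging to the up and down
  leg and the matrix indices to the right and left leg. The two products correspond to the two ways
  of splitting the legs into adjacent pairs: up, right against down, left for \<open>bmul\<close>, and up, left
  against right, down for \<open>omul\<close>.\<close>

definition bmul :: "('n::finite \<Rightarrow> 'n \<Rightarrow> complex^'m^'m) \<Rightarrow> ('n \<Rightarrow> 'n \<Rightarrow> complex^'m^'m) \<Rightarrow> 'n \<Rightarrow> 'n \<Rightarrow> complex^'m^'m" where
  "bmul t s i j = (\<Sum>m\<in>UNIV. t i m ** s m j)"

definition omul :: "('n::finite \<Rightarrow> 'n \<Rightarrow> complex^'m^'m) \<Rightarrow> ('n \<Rightarrow> 'n \<Rightarrow> complex^'m^'m) \<Rightarrow> 'n \<Rightarrow> 'n \<Rightarrow> complex^'m^'m" where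
  "omul t s i j = (\<Sum>m\<in>UNIV. s m j ** t i m)"

text \<open>The element \<open>1 \<otimes> c\<close>; for \<open>c = mat 1\<close> it is the unit of
  both products.\<close>

definition dblock :: "complex^'m^'m \<Rightarrow> 'n \<Rightarrow> 'n \<Rightarrow> complex^'m^'m" where
  "dblock c i j = (if i = j then c else 0)"

lemma mmult_double_sum:
  fixes f :: "_ \<Rightarrow> _ \<Rightarrow> complex^'n^'m" and g :: "_ \<Rightarrow> _ \<Rightarrow> complex^'k^'n"
  shows "(\<Sum>i\<in>A. \<Sum>j\<in>B. f i j) ** (\<Sum>k\<in>C. \<Sum>l\<in>D. g k l)
    = (\<Sum>i\<in>A. \<Sum>j\<in>B. \<Sum>k\<in>C. \<Sum>l\<in>D. f i j ** g k l)"
  by (simp only: mmult_sum(1)) (simp only: mmult_sum(2))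

lemma sum_swap_7:
  "(\<Sum>a\<in>UNIV. \<Sum>b\<in>UNIV. \<Sum>c\<in>UNIV. \<Sum>d\<in>UNIV. \<Sum>e\<in>UNIV. \<Sum>x\<in>UNIV. \<Sum>y\<in>UNIV. f a b c d e x y)
   = (\<Sum>x\<in>UNIV. \<Sum>y\<in>UNIV. \<Sum>a\<in>UNIV. \<Sum>b\<in>UNIV. \<Sum>c\<in>UNIV. \<Sum>d\<in>UNIV. \<Sum>e\<in>UNIV. f a b c d e x y)"
proof -
  have "(\<Sum>a\<in>UNIV. \<Sum>b\<in>UNIV. \<Sum>c\<in>UNIV. \<Sum>d\<in>UNIV. \<Sum>e\<in>UNIV. \<Sum>x\<in>UNIV. \<Sum>y\<in>UNIV. f a b c d e x y)
    = (\<Sum>(a, b, c, d, e, x, y)\<in>UNIV. f a b c d e x y)"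
    by (simp add: sum.cartesian_product flip: UNIV_Times_UNIV)
  also have "\<dots> = (\<Sum>(x, y, a, b, c, d, e)\<in>UNIV. f a b c d e x y)"
    by (rule sum.reindex_bij_witness[of _ "\<lambda>(x, y, a, b, c, d, e). (a, b, c, d, e, x, y)"
          "\<lambda>(a, b, c, d, e, x, y). (x, y, a, b, c, d, e)"]) auto
  also have "\<dots> = (\<Sum>x\<in>UNIV. \<Sum>y\<in>UNIV. \<Sum>a\<in>UNIV. \<Sum>b\<in>UNIV. \<Sum>c\<in>UNIV. \<Sum>d\<in>UNIV. \<Sum>e\<in>UNIV. f a b c d e x y)"
    by (simp add: sum.cartesian_product flip: UNIV_Times_UNIV)
  finally show ?thesis .
qed

lemma sum_dblock:
  "(\<Sum>m\<in>UNIV. dblock c i m ** t m j) = c ** (t i j :: complex^'m^'m)" (is ?A)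
  "(\<Sum>m\<in>UNIV. t i m ** dblock c m j) = (t i j :: complex^'m^'m) ** c" (is ?B)
  "(\<Sum>m\<in>UNIV. t m j ** dblock c i m) = (t i j :: complex^'m^'m) ** c" (is ?C)
  "(\<Sum>m\<in>UNIV. dblock c m j ** t i m) = c ** (t i j :: complex^'m^'m)" (is ?D)
  for i j :: "'n::finite"
proof -
  have "(\<Sum>m\<in>UNIV. dblock c i m ** t m j) = (\<Sum>m\<in>UNIV. if m = i then c ** t m j else 0)"
    by (rule sum.cong) (auto simp: dblock_def)
  then show ?A by simp
  have "(\<Sum>m\<in>UNIV. t i m ** dblock c m j) = (\<Sum>m\<in>UNIV. if m = j then t i m ** c else 0)"
    by (rule sum.cong) (auto simp: dblock_def)
  then show ?B by simp
  have "(\<Sum>m\<in>UNIV. t m j ** dblock c i m) = (\<Sum>m\<in>UNIV. if m = i then t m j ** c else 0)"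
    by (rule sum.cong) (auto simp: dblock_def)
  then show ?C by simp
  have "(\<Sum>m\<in>UNIV. dblock c m j ** t i m) = (\<Sum>m\<in>UNIV. if m = j then c ** t i m else 0)"
    by (rule sum.cong) (auto simp: dblock_def)
  then show ?D by simp
qed

lemma bmul_dblock: "bmul (dblock c) t i j = c ** t i j" "bmul t (dblock c) i j = t i j ** c"
  by (simp_all add: bmul_def sum_dblock)

lemma omul_dblock: "omul (dblock c) t i j = t i j ** c" "omul t (dblock c) i j = c ** t i j"
  by (simp_all add: omul_def sum_dblock)

text \<open>Pairing with \<open>K\<close> under the trace reads off the coefficient of
  \<open>u \<one>\<close> in a combination of the matrices \<open>u g\<close>. Existence of such a
  \<open>K\<close> amounts to their linear independence, which \<open>delta_rep_exists\<close>
  derives from the presence of all irreducible representations.\<close>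

locale delta_rep = group G for G :: "('g, 'b) monoid_scheme" (structure) +
  fixes u :: "'g \<Rightarrow> complex^'n^'n" and K :: "complex^'n^'n"
  assumes fin: "finite (carrier G)"
    and rep: "representation G u"
    and K: "\<And>g. g \<in> carrier G \<Longrightarrow> trace (K ** u g) = (if g = \<one> then 1 else 0)"
begin

lemma u_one: "u \<one> = mat 1"
  using rep by (simp add: representation_def)

lemma u_mult: "g \<in> carrier G \<Longrightarrow> h \<in> carrier G \<Longrightarrow> u (g \<otimes> h) = u g ** u h"
  using rep by (simp add: representation_def)

lemma u_inv: "g \<in> carrier G \<Longrightarrow> u g ** u (inv g) = mat 1" "g \<in> carrier G \<Longrightarrow> u (inv g) ** u g = mat 1"
  by (simp_all add: u_one flip: u_mult)

lemma u_matrix_inv: "g \<in> carrier G \<Longrightarrow> matrix_inv (u g) = u (inv g)" "g \<in> carrier G \<Longrightarrow> invertible (u g)"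
  using matrix_inv_unique[OF u_inv(1)] by auto

lemma u_cancel:
  assumes "g \<in> carrier G"
  shows "u g ** (u (inv g) ** X) = X" "u (inv g) ** (u g ** X) = X"
    "Y ** u g ** u (inv g) = Y" "Y ** u (inv g) ** u g = Y"
  using assms
  by (simp_all add: matrix_mul_assoc u_inv) (simp_all add: u_inv flip: matrix_mul_assoc)

lemma K_delta:
  assumes "g \<in> carrier G" "h \<in> carrier G"
  shows "trace (K ** (u (inv g) ** u h)) = (if g = h then 1 else 0)"
proof -
  have "inv g \<otimes> h = \<one> \<longleftrightarrow> g = h"
    using assms by (metis inv_closed inv_equality inv_inv l_inv)
  then show ?thesis using K[of "inv g \<otimes> h"] assms by (simp add: u_mult)
qed

definition N :: complex where "N = of_nat (card (carrier G))"

lemma N_nonzero: "N \<noteq> 0"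
  using fin one_closed by (auto simp: N_def)

lemma sum_const_N: "(\<Sum>g\<in>carrier G. X) = N *m X"
  by (rule matrix_eqI) (simp only: sum_component, simp add: N_def)

lemma sum_reindex_left:
  assumes "h \<in> carrier G"
  shows "(\<Sum>g\<in>carrier G. f (h \<otimes> g)) = (\<Sum>g\<in>carrier G. f g)"
  by (rule sum.reindex_bij_witness[of _ "\<lambda>g. inv h \<otimes> g" "\<lambda>g. h \<otimes> g"])
    (use assms in \<open>auto simp flip: m_assoc\<close>)

definition uconj :: "'g \<Rightarrow> complex^'n^'n \<Rightarrow> complex^'n^'n" where
  "uconj g X = u (inv g) ** X ** u g"

lemma uconj_mult: "g \<in> carrier G \<Longrightarrow> uconj g (X ** Y) = uconj g X ** uconj g Y"
  by (simp add: uconj_def u_cancel matrix_mul_assoc)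

lemma uconj_sum: "uconj g (\<Sum>i\<in>S. f i) = (\<Sum>i\<in>S. uconj g (f i))"
  by (simp add: uconj_def mmult_sum)

lemma uconj_cscale: "uconj g (c *m X) = c *m uconj g X"
  by (simp add: uconj_def)

text \<open>Conjugation of the index part by \<open>u g\<close>. As \<open>uconj\<close> conjugates
  the matrix part by the inverse, equality of the two expresses invariance under the joint
  conjugation.\<close>

definition twist :: "'g \<Rightarrow> ('n \<Rightarrow> 'n \<Rightarrow> complex^'n^'n) \<Rightarrow> 'n \<Rightarrow> 'n \<Rightarrow> complex^'n^'n" where
  "twist g t a b = (\<Sum>i\<in>UNIV. \<Sum>j\<in>UNIV. (u g $ a $ i * u (inv g) $ j $ b) *m t i j)"

text \<open>A family of blocks \<open>t i j\<close> stands for \<open>\<Sum> E\<^sub>i\<^sub>j \<otimes> t i j\<close>; \<open>invt\<close> says that this element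
  commutes with all \<open>u g \<otimes> u g\<close>.\<close>

definition invt :: "('n \<Rightarrow> 'n \<Rightarrow> complex^'n^'n) \<Rightarrow> bool" where
  "invt t \<longleftrightarrow> (\<forall>g\<in>carrier G. \<forall>a b. twist g t a b = uconj g (t a b))"

lemma invtD: "invt t \<Longrightarrow> g \<in> carrier G \<Longrightarrow> uconj g (t a b) = twist g t a b"
  by (simp add: invt_def)

lemma u_sum_delta:
  assumes "g \<in> carrier G"
  shows "(\<Sum>j\<in>UNIV. u g $ i $ j * u (inv g) $ j $ k) = (if i = k then 1 else 0)"
    "(\<Sum>j\<in>UNIV. u (inv g) $ i $ j * u g $ j $ k) = (if i = k then 1 else 0)"
  using u_inv[OF assms] by (auto simp: vec_eq_iff mmult_nth mat_def)

text \<open>Invariance trades the conjugation of the matrix part for one of the index part. The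
  contraction is a trace over the index part, where \<open>u g\<close> and its inverse cancel; the
  factor \<open>X\<close> in the middle stays untouched.\<close>

lemma invt_contract:
  assumes q: "invt q" and s: "invt s" and g: "g \<in> carrier G"
  shows "(\<Sum>i\<in>UNIV. \<Sum>j\<in>UNIV. uconj g (q j i) ** X ** uconj g (s i j))
    = (\<Sum>i\<in>UNIV. \<Sum>j\<in>UNIV. q j i ** X ** s i j)"
proof -
  let ?m = "\<lambda>j a b k c d. (u g $ k $ c * u (inv g) $ d $ j) *m ((u g $ j $ a * u (inv g) $ b $ k) *m (q a b ** X ** s c d))"
  have "(\<Sum>i\<in>UNIV. \<Sum>j\<in>UNIV. uconj g (q j i) ** X ** uconj g (s i j))
     = (\<Sum>i\<in>UNIV. \<Sum>j\<in>UNIV. \<Sum>c\<in>UNIV. \<Sum>d\<in>UNIV. \<Sum>a\<in>UNIV. \<Sum>b\<in>UNIV. ?m j a b i c d)"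
    by (simp add: invtD[OF q g] invtD[OF s g] twist_def mmult_sum cscale_sum mult_ac)
  also have "\<dots> = (\<Sum>c\<in>UNIV. \<Sum>d\<in>UNIV. \<Sum>a\<in>UNIV. \<Sum>b\<in>UNIV. \<Sum>i\<in>UNIV. \<Sum>j\<in>UNIV. ?m j a b i c d)"
  proof -
    have "(\<Sum>i\<in>UNIV. \<Sum>j\<in>UNIV. \<Sum>c\<in>UNIV. \<Sum>d\<in>UNIV. \<Sum>a\<in>UNIV. \<Sum>b\<in>UNIV. ?m j a b i c d)
      = (\<Sum>(i, j, c, d, a, b)\<in>UNIV. ?m j a b i c d)"
      by (simp add: sum.cartesian_product flip: UNIV_Times_UNIV)
    also have "\<dots> = (\<Sum>(c, d, a, b, i, j)\<in>UNIV. ?m j a b i c d)"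
      by (rule sum.reindex_bij_witness[of _ "\<lambda>(c, d, a, b, i, j). (i, j, c, d, a, b)" "\<lambda>(i, j, c, d, a, b). (c, d, a, b, i, j)"]) auto
    also have "\<dots> = (\<Sum>c\<in>UNIV. \<Sum>d\<in>UNIV. \<Sum>a\<in>UNIV. \<Sum>b\<in>UNIV. \<Sum>i\<in>UNIV. \<Sum>j\<in>UNIV. ?m j a b i c d)"
      by (simp add: sum.cartesian_product flip: UNIV_Times_UNIV)
    finally show ?thesis .
  qed
  also have "\<dots> = (\<Sum>c\<in>UNIV. \<Sum>d\<in>UNIV. \<Sum>a\<in>UNIV. \<Sum>b\<in>UNIV. if a = d then if b = c then q a b ** X ** s c d else 0 else 0)"
  proof (intro sum.cong refl)
    fix a b c d
    have "(\<Sum>i\<in>UNIV. \<Sum>j\<in>UNIV. ?m j a b i c d)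
       = ((\<Sum>i\<in>UNIV. u (inv g) $ b $ i * u g $ i $ c) * (\<Sum>j\<in>UNIV. u (inv g) $ d $ j * u g $ j $ a)) *m (q a b ** X ** s c d)"
      unfolding sum_product cscale_sum_left by (intro sum.cong refl) (simp add: mult_ac)
    then show "(\<Sum>i\<in>UNIV. \<Sum>j\<in>UNIV. ?m j a b i c d) = (if a = d then if b = c then q a b ** X ** s c d else 0 else 0)"
      by (auto simp: u_sum_delta[OF g])
  qed
  also have "\<dots> = (\<Sum>c\<in>UNIV. \<Sum>d\<in>UNIV. \<Sum>a\<in>UNIV. if a = d then q a c ** X ** s c d else 0)"
    by (intro sum.cong refl) auto
  also have "\<dots> = (\<Sum>i\<in>UNIV. \<Sum>j\<in>UNIV. q j i ** X ** s i j)" by simp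
  finally show ?thesis .
qed

definition comm :: "complex^'n^'n \<Rightarrow> bool" where
  "comm c \<longleftrightarrow> (\<forall>g\<in>carrier G. uconj g c = c)"

lemma twist_dblock: "g \<in> carrier G \<Longrightarrow> twist g (dblock c) a b = dblock c a b"
proof -
  assume g: "g \<in> carrier G"
  have "twist g (dblock c) a b = (\<Sum>i\<in>UNIV. \<Sum>j\<in>UNIV. if j = i then (u g $ a $ i * u (inv g) $ j $ b) *m c else 0)"
    unfolding twist_def by (intro sum.cong refl) (auto simp: dblock_def)
  also have "\<dots> = (\<Sum>i\<in>UNIV. u g $ a $ i * u (inv g) $ i $ b) *m c"
    by (simp add: cscale_sum_left)
  finally show ?thesis by (simp add: u_sum_delta[OF g] dblock_def)
qed

lemma uconj_0 [simp]: "uconj g 0 = 0" by (simp add: uconj_def)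

lemma invt_dblock: "invt (dblock c) \<longleftrightarrow> comm c"
proof
  assume t: "invt (dblock c)"
  show "comm c" unfolding comm_def
  proof
    fix g assume "g \<in> carrier G"
    from invtD[OF t this, of undefined undefined] twist_dblock[OF this, of c undefined undefined]
    show "uconj g c = c" by (simp add: dblock_def)
  qed
next
  assume "comm c"
  then show "invt (dblock c)" by (auto simp: invt_def twist_dblock comm_def) (auto simp: dblock_def)
qed

lemma comm_one: "comm (mat 1)"
  by (simp add: comm_def uconj_def u_inv)

lemma comm_contract:
  assumes "invt q" "invt s" shows "comm (\<Sum>i\<in>UNIV. \<Sum>j\<in>UNIV. q j i ** s i j)"
  unfolding comm_def
proof
  fix g assume g: "g \<in> carrier G"
  show "uconj g (\<Sum>i\<in>UNIV. \<Sum>j\<in>UNIV. q j i ** s i j) = (\<Sum>i\<in>UNIV. \<Sum>j\<in>UNIV. q j i ** s i j)"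
    using invt_contract[OF assms g, of "mat 1"] by (simp add: uconj_sum uconj_mult[OF g])
qed

lemma invt_cscale_sum: "invt t \<Longrightarrow> invt (\<lambda>i j. c *m t i j)"
proof -
  have "twist g (\<lambda>i j. c *m t i j) a b = c *m twist g t a b" for g a b
    by (simp add: twist_def cscale_sum mult.left_commute mult.commute)
  then show "invt t \<Longrightarrow> invt (\<lambda>i j. c *m t i j)" by (simp add: invt_def uconj_cscale)
qed

lemma twist_sum: "twist g (\<lambda>i j. \<Sum>x\<in>S. t x i j) a b = (\<Sum>x\<in>S. twist g (t x) a b)"
proof -
  have "twist g (\<lambda>i j. \<Sum>x\<in>S. t x i j) a b
      = (\<Sum>i\<in>UNIV. \<Sum>x\<in>S. \<Sum>j\<in>UNIV. (u g $ a $ i * u (inv g) $ j $ b) *m t x i j)"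
    unfolding twist_def cscale_sum by (intro sum.cong refl sum.swap)
  also have "\<dots> = (\<Sum>x\<in>S. twist g (t x) a b)" unfolding twist_def by (rule sum.swap)
  finally show ?thesis .
qed

lemma twist_cjmult:
  assumes g: "g \<in> carrier G"
  shows "(\<Sum>m\<in>UNIV. twist g t a m ** twist g s m b) = twist g (bmul t s) a b"
    "(\<Sum>m\<in>UNIV. twist g s m b ** twist g t a m) = twist g (omul t s) a b"
proof -
  have a: "(\<Sum>m\<in>UNIV. \<Sum>x\<in>UNIV. \<Sum>y\<in>UNIV. \<Sum>j\<in>UNIV. \<Sum>k\<in>UNIV. (u g $ a $ x * u (inv g) $ k $ b * (u (inv g) $ y $ m * u g $ m $ j)) *m F x y j k)
     = (\<Sum>x\<in>UNIV. \<Sum>k\<in>UNIV. \<Sum>y\<in>UNIV. (u g $ a $ x * u (inv g) $ k $ b) *m F x y y k)"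
    for F :: "'n \<Rightarrow> 'n \<Rightarrow> 'n \<Rightarrow> 'n \<Rightarrow> complex^'n^'n"
  proof -
    have "(\<Sum>m\<in>UNIV. \<Sum>x\<in>UNIV. \<Sum>y\<in>UNIV. \<Sum>j\<in>UNIV. \<Sum>k\<in>UNIV. (u g $ a $ x * u (inv g) $ k $ b * (u (inv g) $ y $ m * u g $ m $ j)) *m F x y j k)
       = (\<Sum>(m, x, y, j, k)\<in>UNIV. (u g $ a $ x * u (inv g) $ k $ b * (u (inv g) $ y $ m * u g $ m $ j)) *m F x y j k)"
      by (simp add: sum.cartesian_product flip: UNIV_Times_UNIV)
    also have "\<dots> = (\<Sum>(x, k, y, j, m)\<in>UNIV. (u g $ a $ x * u (inv g) $ k $ b * (u (inv g) $ y $ m * u g $ m $ j)) *m F x y j k)"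
      by (rule sum.reindex_bij_witness[of _ "\<lambda>(x, k, y, j, m). (m, x, y, j, k)" "\<lambda>(m, x, y, j, k). (x, k, y, j, m)"]) auto
    also have "\<dots> = (\<Sum>x\<in>UNIV. \<Sum>k\<in>UNIV. \<Sum>y\<in>UNIV. \<Sum>j\<in>UNIV. \<Sum>m\<in>UNIV. (u g $ a $ x * u (inv g) $ k $ b * (u (inv g) $ y $ m * u g $ m $ j)) *m F x y j k)"
      by (simp add: sum.cartesian_product flip: UNIV_Times_UNIV)
    also have "\<dots> = (\<Sum>x\<in>UNIV. \<Sum>k\<in>UNIV. \<Sum>y\<in>UNIV. \<Sum>j\<in>UNIV. if j = y then (u g $ a $ x * u (inv g) $ k $ b) *m F x y j k else 0)"
      by (intro sum.cong refl) (simp add: u_sum_delta[OF g] flip: cscale_sum_left sum_distrib_left)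
    also have "\<dots> = (\<Sum>x\<in>UNIV. \<Sum>k\<in>UNIV. \<Sum>y\<in>UNIV. (u g $ a $ x * u (inv g) $ k $ b) *m F x y y k)"
      by simp
    finally show ?thesis .
  qed
  have "(\<Sum>m\<in>UNIV. twist g t a m ** twist g s m b) = (\<Sum>m\<in>UNIV. \<Sum>x\<in>UNIV. \<Sum>y\<in>UNIV. \<Sum>j\<in>UNIV. \<Sum>k\<in>UNIV. (u g $ a $ x * u (inv g) $ k $ b * (u (inv g) $ y $ m * u g $ m $ j)) *m (t x y ** s j k))"
    unfolding twist_def mmult_double_sum by (intro sum.cong refl) (simp add: mult_ac)
  also note a[of "\<lambda>x y j k. t x y ** s j k"]
  finally show "(\<Sum>m\<in>UNIV. twist g t a m ** twist g s m b) = twist g (bmul t s) a b"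
    unfolding twist_def[of g "bmul t s"] bmul_def cscale_sum .
  have "(\<Sum>m\<in>UNIV. twist g s m b ** twist g t a m) = (\<Sum>m\<in>UNIV. \<Sum>j\<in>UNIV. \<Sum>k\<in>UNIV. \<Sum>x\<in>UNIV. \<Sum>y\<in>UNIV. (u g $ a $ x * u (inv g) $ k $ b * (u (inv g) $ y $ m * u g $ m $ j)) *m (s j k ** t x y))"
    unfolding twist_def mmult_double_sum by (intro sum.cong refl) (simp add: mult_ac)
  also have "\<dots> = (\<Sum>m\<in>UNIV. \<Sum>x\<in>UNIV. \<Sum>y\<in>UNIV. \<Sum>j\<in>UNIV. \<Sum>k\<in>UNIV. (u g $ a $ x * u (inv g) $ k $ b * (u (inv g) $ y $ m * u g $ m $ j)) *m (s j k ** t x y))"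
  proof (rule sum.cong[OF refl])
    fix m
    let ?h = "\<lambda>x y j k. (u g $ a $ x * u (inv g) $ k $ b * (u (inv g) $ y $ m * u g $ m $ j)) *m (s j k ** t x y)"
    have "(\<Sum>j\<in>UNIV. \<Sum>k\<in>UNIV. \<Sum>x\<in>UNIV. \<Sum>y\<in>UNIV. ?h x y j k) = (\<Sum>(j, k, x, y)\<in>UNIV. ?h x y j k)"
      by (simp add: sum.cartesian_product flip: UNIV_Times_UNIV)
    also have "\<dots> = (\<Sum>(x, y, j, k)\<in>UNIV. ?h x y j k)"
      by (rule sum.reindex_bij_witness[of _ "\<lambda>(x, y, j, k). (j, k, x, y)" "\<lambda>(j, k, x, y). (x, y, j, k)"]) auto
    also have "\<dots> = (\<Sum>x\<in>UNIV. \<Sum>y\<in>UNIV. \<Sum>j\<in>UNIV. \<Sum>k\<in>UNIV. ?h x y j k)"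
      by (simp add: sum.cartesian_product flip: UNIV_Times_UNIV)
    finally show "(\<Sum>j\<in>UNIV. \<Sum>k\<in>UNIV. \<Sum>x\<in>UNIV. \<Sum>y\<in>UNIV. ?h x y j k) = (\<Sum>x\<in>UNIV. \<Sum>y\<in>UNIV. \<Sum>j\<in>UNIV. \<Sum>k\<in>UNIV. ?h x y j k)" .
  qed
  also note a[of "\<lambda>x y j k. s j k ** t x y"]
  finally show "(\<Sum>m\<in>UNIV. twist g s m b ** twist g t a m) = twist g (omul t s) a b"
    unfolding twist_def[of g "omul t s"] omul_def cscale_sum .
qed

lemma invt_bmul: "invt t \<Longrightarrow> invt s \<Longrightarrow> invt (bmul t s)"
  by (subst invt_def) (simp add: bmul_def uconj_sum uconj_mult invtD twist_cjmult(1))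

lemma invt_omul: "invt t \<Longrightarrow> invt s \<Longrightarrow> invt (omul t s)"
  by (subst invt_def) (simp add: omul_def uconj_sum uconj_mult invtD twist_cjmult(2))

text \<open>The sum of \<open>x \<otimes> M\<close> over all joint conjugations, without the factor
  \<open>1 / N\<close>. It supplies the invariant families used as test elements below.\<close>

definition avg :: "complex^'n^'n \<Rightarrow> complex^'n^'n \<Rightarrow> 'n \<Rightarrow> 'n \<Rightarrow> complex^'n^'n" where
  "avg x M a b = (\<Sum>g\<in>carrier G. (u g ** x ** u (inv g)) $ a $ b *m (u g ** M ** u (inv g)))"

lemma invt_avg: "invt (avg x M)"
  unfolding invt_def
proof (intro ballI allI)
  fix h a b assume h: "h \<in> carrier G"
  have e: "(\<Sum>i\<in>UNIV. \<Sum>j\<in>UNIV. u h $ a $ i * u (inv h) $ j $ b * X $ i $ j) = (u h ** X ** u (inv h)) $ a $ b" for X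
    by (simp add: mmult_nth sum_distrib_left sum_distrib_right mult_ac) (rule sum.swap)
  have "twist h (avg x M) a b = (\<Sum>i\<in>UNIV. \<Sum>j\<in>UNIV. \<Sum>g\<in>carrier G. (u h $ a $ i * u (inv h) $ j $ b * (u g ** x ** u (inv g)) $ i $ j) *m (u g ** M ** u (inv g)))"
    by (simp add: twist_def avg_def cscale_sum)
  also have "\<dots> = (\<Sum>g\<in>carrier G. \<Sum>i\<in>UNIV. \<Sum>j\<in>UNIV. (u h $ a $ i * u (inv h) $ j $ b * (u g ** x ** u (inv g)) $ i $ j) *m (u g ** M ** u (inv g)))"
    by (simp add: sum.swap[of _ "carrier G"])
  also have "\<dots> = (\<Sum>g\<in>carrier G. (u h ** (u g ** x ** u (inv g)) ** u (inv h)) $ a $ b *m (u g ** M ** u (inv g)))"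
    by (simp only: e flip: cscale_sum_left)
  also have "\<dots> = (\<Sum>g\<in>carrier G. (u (h \<otimes> g) ** x ** u (inv (h \<otimes> g))) $ a $ b *m uconj h (u (h \<otimes> g) ** M ** u (inv (h \<otimes> g))))"
    using h by (intro sum.cong refl) (simp add: u_mult inv_mult_group uconj_def matrix_mul_assoc u_cancel u_inv)
  also have "\<dots> = (\<Sum>g\<in>carrier G. (u g ** x ** u (inv g)) $ a $ b *m uconj h (u g ** M ** u (inv g)))"
    by (rule sum_reindex_left[OF h])
  also have "\<dots> = uconj h (avg x M a b)" by (simp add: avg_def uconj_sum uconj_cscale)
  finally show "twist h (avg x M) a b = uconj h (avg x M a b)" .
qed

text \<open>Averages of matrix units resolve the identity: the functional of \<open>K\<close> collapses the double
  group sum to its diagonal.\<close>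

lemma avg_resolution:
  "(\<Sum>a\<in>UNIV. \<Sum>b\<in>UNIV. \<Sum>i\<in>UNIV. \<Sum>j\<in>UNIV. \<Sum>l\<in>UNIV.
      K $ l $ j *m (avg (munit a b) (munit i j) p q ** avg (munit b a) (munit l i) r s))
    = (if p = s \<and> q = r then N *m mat 1 else 0)"
proof -
  let ?c = "\<lambda>g h a b. (u g ** munit a b ** u (inv g)) $ p $ q * (u h ** munit b a ** u (inv h)) $ r $ s"
  let ?m = "\<lambda>g h i j l. K $ l $ j *m (u g ** munit i j ** (u (inv g) ** u h) ** munit l i ** u (inv h))"
  have in1: "(\<Sum>i\<in>UNIV. \<Sum>j\<in>UNIV. \<Sum>l\<in>UNIV. ?m g h i j l) = (if g = h then mat 1 else 0)"
    if "g \<in> carrier G" "h \<in> carrier G" for g h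
  proof -
    have "(\<Sum>j\<in>UNIV. \<Sum>l\<in>UNIV. ?m g h i j l) = trace (K ** (u (inv g) ** u h)) *m (u g ** munit i i ** u (inv h))" for i
    proof -
      have "?m g h i j l = (K $ l $ j * (u (inv g) ** u h) $ j $ l) *m (u g ** munit i i ** u (inv h))" for j l
      proof -
        have "u g ** munit i j ** (u (inv g) ** u h) ** munit l i ** u (inv h)
            = u g ** (munit i j ** (u (inv g) ** u h) ** munit l i) ** u (inv h)"
          by (simp add: matrix_mul_assoc)
        then show ?thesis unfolding munit_sandwich by simp
      qed
      then show ?thesis
        unfolding trace_mult_eq cscale_sum_left by simp (rule sum.swap)
    qed
    then have "(\<Sum>i\<in>UNIV. \<Sum>j\<in>UNIV. \<Sum>l\<in>UNIV. ?m g h i j l)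
        = trace (K ** (u (inv g) ** u h)) *m (u g ** (\<Sum>i\<in>UNIV. munit i i) ** u (inv h))"
      by (simp add: mmult_sum cscale_sum)
    then show ?thesis using that by (simp add: K_delta sum_munit_diag u_inv)
  qed
  have in2: "(\<Sum>a\<in>UNIV. \<Sum>b\<in>UNIV. ?c g g a b) = (if p = s \<and> q = r then 1 else 0)"
    if g: "g \<in> carrier G" for g
  proof -
    have "(\<Sum>a\<in>UNIV. \<Sum>b\<in>UNIV. ?c g g a b) = (\<Sum>a\<in>UNIV. u g $ p $ a * u (inv g) $ a $ s) * (\<Sum>b\<in>UNIV. u g $ r $ b * u (inv g) $ b $ q)"
      unfolding sum_product by (intro sum.cong refl) (simp add: munit_conj_nth mult_ac)
    then show ?thesis by (auto simp: u_sum_delta[OF g])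
  qed
  have "(\<Sum>a\<in>UNIV. \<Sum>b\<in>UNIV. \<Sum>i\<in>UNIV. \<Sum>j\<in>UNIV. \<Sum>l\<in>UNIV.
      K $ l $ j *m (avg (munit a b) (munit i j) p q ** avg (munit b a) (munit l i) r s))
    = (\<Sum>a\<in>UNIV. \<Sum>b\<in>UNIV. \<Sum>i\<in>UNIV. \<Sum>j\<in>UNIV. \<Sum>l\<in>UNIV. \<Sum>(g, h)\<in>carrier G \<times> carrier G. ?c g h a b *m ?m g h i j l)"
  proof (intro sum.cong refl)
    fix a b i j l
    have "K $ l $ j *m (avg (munit a b) (munit i j) p q ** avg (munit b a) (munit l i) r s)
       = (\<Sum>g\<in>carrier G. \<Sum>h\<in>carrier G. ?c g h a b *m ?m g h i j l)"
      unfolding avg_def by (simp only: mmult_sum(1)) (simp add: mmult_sum(2) cscale_sum matrix_mul_assoc mult_ac)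
    then show "K $ l $ j *m (avg (munit a b) (munit i j) p q ** avg (munit b a) (munit l i) r s)
       = (\<Sum>(g, h)\<in>carrier G \<times> carrier G. ?c g h a b *m ?m g h i j l)"
      by (simp add: sum.cartesian_product)
  qed
  also have "\<dots> = (\<Sum>(g, h)\<in>carrier G \<times> carrier G. \<Sum>a\<in>UNIV. \<Sum>b\<in>UNIV. \<Sum>i\<in>UNIV. \<Sum>j\<in>UNIV. \<Sum>l\<in>UNIV. ?c g h a b *m ?m g h i j l)"
    unfolding split_def by (simp only: sum.swap[of _ "carrier G \<times> carrier G"])
  also have "\<dots> = (\<Sum>g\<in>carrier G. \<Sum>h\<in>carrier G. \<Sum>a\<in>UNIV. \<Sum>b\<in>UNIV. \<Sum>i\<in>UNIV. \<Sum>j\<in>UNIV. \<Sum>l\<in>UNIV. ?c g h a b *m ?m g h i j l)"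
    by (rule sum.cartesian_product[symmetric])
  also have "\<dots> = (\<Sum>g\<in>carrier G. \<Sum>h\<in>carrier G. \<Sum>a\<in>UNIV. \<Sum>b\<in>UNIV. ?c g h a b *m (if g = h then mat 1 else 0))"
    by (intro sum.cong refl) (simp only: in1 flip: cscale_sum)
  also have "\<dots> = (\<Sum>g\<in>carrier G. \<Sum>h\<in>carrier G. if g = h then (\<Sum>a\<in>UNIV. \<Sum>b\<in>UNIV. ?c g g a b) *m mat 1 else 0)"
    by (intro sum.cong refl) (auto simp: cscale_sum_left)
  also have "\<dots> = (\<Sum>h\<in>carrier G. (if p = s \<and> q = r then 1 else 0) *m mat 1)"
    using fin by (intro sum.cong refl) (simp add: in2)
  also have "\<dots> = (if p = s \<and> q = r then N *m mat 1 else 0)"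
    unfolding sum_const_N by auto
  finally show ?thesis .
qed

text \<open>Contracting \<open>X\<close> with one average, multiplying by a second one and summing
  as in \<open>avg_resolution\<close> returns \<open>N\<close> times the entry \<open>X p q\<close>.
  Hence coefficients can be compared although only invariant families are available as
  arguments.\<close>

lemma full_right:
  assumes "\<And>t. invt t \<Longrightarrow> (\<Sum>i\<in>UNIV. \<Sum>j\<in>UNIV. X i j ** t i j) = (0 :: complex^'n^'n)"
  shows "X p q = 0"
proof -
  have "0 = (\<Sum>a\<in>UNIV. \<Sum>b\<in>UNIV. \<Sum>i\<in>UNIV. \<Sum>j\<in>UNIV. \<Sum>l\<in>UNIV.
      K $ l $ j *m ((\<Sum>x\<in>UNIV. \<Sum>y\<in>UNIV. X x y ** avg (munit a b) (munit i j) x y) ** avg (munit b a) (munit l i) q p))"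
    by (simp add: assms[OF invt_avg])
  also have "\<dots> = (\<Sum>a\<in>UNIV. \<Sum>b\<in>UNIV. \<Sum>i\<in>UNIV. \<Sum>j\<in>UNIV. \<Sum>l\<in>UNIV. \<Sum>x\<in>UNIV. \<Sum>y\<in>UNIV.
      X x y ** (K $ l $ j *m (avg (munit a b) (munit i j) x y ** avg (munit b a) (munit l i) q p)))"
    by (simp add: mmult_sum cscale_sum matrix_mul_assoc)
  also have "\<dots> = (\<Sum>x\<in>UNIV. \<Sum>y\<in>UNIV. \<Sum>a\<in>UNIV. \<Sum>b\<in>UNIV. \<Sum>i\<in>UNIV. \<Sum>j\<in>UNIV. \<Sum>l\<in>UNIV.
      X x y ** (K $ l $ j *m (avg (munit a b) (munit i j) x y ** avg (munit b a) (munit l i) q p)))"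
    by (rule sum_swap_7)
  also have "\<dots> = (\<Sum>x\<in>UNIV. \<Sum>y\<in>UNIV. X x y ** (if x = p \<and> y = q then N *m mat 1 else 0))"
    by (simp only: avg_resolution flip: mmult_sum)
  also have "\<dots> = (\<Sum>x\<in>UNIV. \<Sum>y\<in>UNIV. if x = p then if y = q then N *m X x y else 0 else 0)"
    by (intro sum.cong refl) auto
  also have "\<dots> = (\<Sum>x\<in>UNIV. if x = p then N *m X x q else 0)"
    by (intro sum.cong refl) auto
  finally show ?thesis using N_nonzero by (simp add: cscale_eq_0)
qed

lemma full_left:
  assumes "\<And>t. invt t \<Longrightarrow> (\<Sum>i\<in>UNIV. \<Sum>j\<in>UNIV. t i j ** X i j) = (0 :: complex^'n^'n)"
  shows "X p q = 0"
proof -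
  have "0 = (\<Sum>a\<in>UNIV. \<Sum>b\<in>UNIV. \<Sum>i\<in>UNIV. \<Sum>j\<in>UNIV. \<Sum>l\<in>UNIV.
      K $ l $ j *m (avg (munit a b) (munit i j) q p ** (\<Sum>x\<in>UNIV. \<Sum>y\<in>UNIV. avg (munit b a) (munit l i) x y ** X x y)))"
    by (simp add: assms[OF invt_avg])
  also have "\<dots> = (\<Sum>a\<in>UNIV. \<Sum>b\<in>UNIV. \<Sum>i\<in>UNIV. \<Sum>j\<in>UNIV. \<Sum>l\<in>UNIV. \<Sum>x\<in>UNIV. \<Sum>y\<in>UNIV.
      K $ l $ j *m (avg (munit a b) (munit i j) q p ** avg (munit b a) (munit l i) x y) ** X x y)"
    by (simp add: mmult_sum cscale_sum matrix_mul_assoc)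
  also have "\<dots> = (\<Sum>x\<in>UNIV. \<Sum>y\<in>UNIV. \<Sum>a\<in>UNIV. \<Sum>b\<in>UNIV. \<Sum>i\<in>UNIV. \<Sum>j\<in>UNIV. \<Sum>l\<in>UNIV.
      K $ l $ j *m (avg (munit a b) (munit i j) q p ** avg (munit b a) (munit l i) x y) ** X x y)"
    by (rule sum_swap_7)
  also have "\<dots> = (\<Sum>x\<in>UNIV. \<Sum>y\<in>UNIV. (if q = y \<and> p = x then N *m mat 1 else 0) ** X x y)"
    by (simp only: avg_resolution flip: mmult_sum)
  also have "\<dots> = (\<Sum>x\<in>UNIV. \<Sum>y\<in>UNIV. if x = p then if y = q then N *m X x y else 0 else 0)"
    by (intro sum.cong refl) auto
  also have "\<dots> = (\<Sum>x\<in>UNIV. if x = p then N *m X x q else 0)"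
    by (intro sum.cong refl) auto
  finally show ?thesis using N_nonzero by (simp add: cscale_eq_0)
qed

text \<open>This is \<open>avg_resolution\<close> read as a frame, the weights
  \<open>K $ l $ j / N\<close> being put into \<open>Q\<close>. If \<open>Y\<close> is invariant,
  the inner contractions lie in the commutant, so finitely many \<open>P k\<close> generate the
  invariant families over it. The expansion also covers families \<open>Y\<close> that are not
  invariant, as needed for products of single blocks.\<close>

lemma block_expansion:
  "\<exists>P Q. (\<forall>k. invt (P k)) \<and> (\<forall>k. invt (Q k)) \<and>
     (\<forall>Y p q. Y p q = (\<Sum>k\<in>UNIV. P (k :: 'n \<times> 'n \<times> 'n \<times> 'n \<times> 'n) p q **
        (\<Sum>i\<in>UNIV. \<Sum>j\<in>UNIV. Q k j i ** Y i j :: complex^'n^'n)))"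
proof (intro exI conjI allI)
  let ?P = "\<lambda>(a, b, i, j, l). avg (munit a b) (munit i j)"
  let ?Q = "\<lambda>(a, b, i, j, l) x y. (K $ l $ j / N) *m avg (munit b a) (munit l i) x y"
  show "invt (?P k)" for k by (cases k) (simp add: invt_avg)
  show "invt (?Q k)" for k by (cases k) (simp add: invt_avg invt_cscale_sum)
  fix Y :: "'n \<Rightarrow> 'n \<Rightarrow> complex^'n^'n" and p q
  let ?f = "\<lambda>(a, b, i, j, l) x y. (K $ l $ j / N) *m (avg (munit a b) (munit i j) p q ** avg (munit b a) (munit l i) y x)"
  have r: "(\<Sum>k\<in>UNIV. ?f k x y) = (if p = x \<and> q = y then mat 1 else 0)" for x y
  proof -
    have "(\<Sum>k\<in>UNIV. ?f k x y) = (1 / N) *m (\<Sum>a\<in>UNIV. \<Sum>b\<in>UNIV. \<Sum>i\<in>UNIV. \<Sum>j\<in>UNIV. \<Sum>l\<in>UNIV.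
      K $ l $ j *m (avg (munit a b) (munit i j) p q ** avg (munit b a) (munit l i) y x))"
      by (simp add: sum.cartesian_product split_def cscale_sum flip: UNIV_Times_UNIV)
    then show ?thesis unfolding avg_resolution using N_nonzero by auto
  qed
  have "(\<Sum>k\<in>UNIV. ?P k p q ** (\<Sum>i\<in>UNIV. \<Sum>j\<in>UNIV. ?Q k j i ** Y i j))
      = (\<Sum>k\<in>UNIV. \<Sum>i\<in>UNIV. \<Sum>j\<in>UNIV. ?f k i j ** Y i j)"
    by (intro sum.cong refl) (simp add: mmult_sum matrix_mul_assoc split_def)
  also have "\<dots> = (\<Sum>i\<in>UNIV. \<Sum>j\<in>UNIV. (\<Sum>k\<in>UNIV. ?f k i j) ** Y i j)"
    unfolding mmult_sum by (subst sum.swap) (intro sum.cong refl sum.swap)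
  also have "\<dots> = (\<Sum>i\<in>UNIV. \<Sum>j\<in>UNIV. if i = p then if j = q then Y i j else 0 else 0)"
    unfolding r by (intro sum.cong refl) auto
  also have "\<dots> = (\<Sum>i\<in>UNIV. if i = p then Y i q else 0)"
    by (intro sum.cong refl) auto
  finally show "Y p q = (\<Sum>k\<in>UNIV. ?P k p q ** (\<Sum>i\<in>UNIV. \<Sum>j\<in>UNIV. ?Q k j i ** Y i j))" by simp
qed

text \<open>Pairing an average with \<open>K\<close> on its index part retains only the term of
  \<open>\<one>\<close>. So every matrix \<open>M\<close> is a linear combination of single blocks
  of invariant families.\<close>

lemma slices_full:
  assumes "\<And>t a b. invt t \<Longrightarrow> v ** t a b *v x = (0 :: complex^'n)"
  shows "v ** M *v x = 0"
proof -
  \<comment> \<open>Any index does: the second index is only evaluated on the diagonal of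
    \<open>u \<one>\<close>, where it gives 1.\<close>
  let ?j = "undefined :: 'n"
  have j1: "(mat 1 :: complex^'n^'n) $ ?j $ ?j = 1" by (simp add: mat_def)
  have "(\<Sum>i\<in>UNIV. \<Sum>f\<in>UNIV. K $ i $ f *m avg (munit i ?j) M f ?j)
     = (\<Sum>i\<in>UNIV. \<Sum>f\<in>UNIV. \<Sum>g\<in>carrier G. (K $ i $ f * (u g $ f $ i * u (inv g) $ ?j $ ?j)) *m (u g ** M ** u (inv g)))"
    by (simp add: avg_def cscale_sum munit_conj_nth)
  also have "\<dots> = (\<Sum>g\<in>carrier G. \<Sum>i\<in>UNIV. \<Sum>f\<in>UNIV. (K $ i $ f * (u g $ f $ i * u (inv g) $ ?j $ ?j)) *m (u g ** M ** u (inv g)))"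
    by (simp only: sum.swap[of _ "carrier G"])
  also have "\<dots> = (\<Sum>g\<in>carrier G. (trace (K ** u g) * u (inv g) $ ?j $ ?j) *m (u g ** M ** u (inv g)))"
    by (intro sum.cong refl) (simp only: trace_mult_eq sum_distrib_right cscale_sum_left mult.assoc)
  also have "\<dots> = (\<Sum>g\<in>carrier G. if g = \<one> then M else 0)"
    by (intro sum.cong refl) (auto simp: K u_one j1)
  also have "\<dots> = M" using fin by simp
  finally have M: "M = (\<Sum>i\<in>UNIV. \<Sum>f\<in>UNIV. K $ i $ f *m avg (munit i ?j) M f ?j)" by simp
  have "v ** M *v x = (\<Sum>i\<in>UNIV. \<Sum>f\<in>UNIV. K $ i $ f *s (v ** avg (munit i ?j) M f ?j *v x))"
    by (subst M) (simp add: mmult_sum mvec_sum)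
  then show ?thesis by (simp add: assms[OF invt_avg])
qed

end

section \<open>Automorphisms of both products are inner\<close>

lemma sum_swap_1_2:
  "(\<Sum>a\<in>A. \<Sum>c\<in>C. \<Sum>d\<in>D. f a c d) = (\<Sum>c\<in>C. \<Sum>d\<in>D. \<Sum>a\<in>A. f a c d)"
proof -
  have "(\<Sum>a\<in>A. \<Sum>c\<in>C. \<Sum>d\<in>D. f a c d) = (\<Sum>c\<in>C. \<Sum>a\<in>A. \<Sum>d\<in>D. f a c d)" by (rule sum.swap)
  also have "\<dots> = (\<Sum>c\<in>C. \<Sum>d\<in>D. \<Sum>a\<in>A. f a c d)" by (intro sum.cong refl sum.swap)
  finally show ?thesis .
qed

lemma sum_swap_2_2:
  "(\<Sum>a\<in>A. \<Sum>b\<in>B. \<Sum>c\<in>C. \<Sum>d\<in>D. f a b c d) = (\<Sum>c\<in>C. \<Sum>d\<in>D. \<Sum>a\<in>A. \<Sum>b\<in>B. f a b c d)"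
proof -
  have "(\<Sum>a\<in>A. \<Sum>b\<in>B. \<Sum>c\<in>C. \<Sum>d\<in>D. f a b c d) = (\<Sum>a\<in>A. \<Sum>c\<in>C. \<Sum>d\<in>D. \<Sum>b\<in>B. f a b c d)"
    by (intro sum.cong refl sum_swap_1_2)
  also have "\<dots> = (\<Sum>c\<in>C. \<Sum>d\<in>D. \<Sum>a\<in>A. \<Sum>b\<in>B. f a b c d)" by (rule sum_swap_1_2)
  finally show ?thesis .
qed

lemma mmult_add:
  fixes X :: "complex^'b^'a" and Y :: "complex^'c^'b"
  shows "(X + X') ** Y = X ** Y + X' ** Y" "X ** (Y + Y') = X ** Y + X ** Y'"
  by (auto intro!: matrix_eqI simp: mmult_nth sum.distrib algebra_simps)

text \<open>Matrix units move a vector \<open>y\<close> in the range of a diagonal one to a basis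
  \<open>D r o' *v y\<close>, on which they act like the standard units; \<open>w\<close> has this
  basis as its columns.\<close>

lemma matrix_units_conjugate:
  fixes D :: "'n::finite \<Rightarrow> 'n \<Rightarrow> complex^'n^'n"
  assumes mult: "\<And>p q r y. D p q ** D r y = (if q = r then D p y else 0)"
    and one: "(\<Sum>p\<in>UNIV. D p p) = mat 1"
  obtains w where "invertible w" "\<And>p q. D p q = w ** munit p q ** matrix_inv w"
proof -
  define o' where "o' = (undefined :: 'n)"
  have "D o' o' \<noteq> 0"
  proof
    assume z: "D o' o' = 0"
    have "D p p = 0" for p
    proof -
      have "D p p = D p o' ** D o' o' ** D o' p" by (simp add: mult)
      then show ?thesis using z by simp
    qed
    then have "(mat 1 :: complex^'n^'n) = 0" using one by simp
    then show False using invertible_nonzero matrix_inv_mat1(2) by blast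
  qed
  then obtain x where x: "D o' o' *v x \<noteq> 0" by (rule matrix_nonzero_obtains)
  define y where "y = D o' o' *v x"
  have Dy: "D r o' *v y = D r o' *v x" for r
    by (simp add: y_def matrix_vector_mul_assoc mult)
  define w where "w = (\<chi> i r. (D r o' *v y) $ i)"
  have wv: "w *v z = (\<Sum>r\<in>UNIV. z $ r *s (D r o' *v y))" for z
    by (simp add: vec_eq_iff w_def matrix_vector_mult_def mult.commute sum_component)
  have Dw: "D p q ** w = w ** munit p q" for p q
  proof (rule matrix_eqI)
    fix i j
    have "(D p q ** w) $ i $ j = (D p q *v (D j o' *v y)) $ i"
      by (simp add: mmult_nth matrix_vector_mult_def w_def)
    also have "\<dots> = (if j = q then (D p o' *v y) $ i else 0)"
      by (simp add: matrix_vector_mul_assoc mult)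
    also have "\<dots> = (w ** munit p q) $ i $ j" unfolding mult_munit_nth by (simp add: w_def)
    finally show "(D p q ** w) $ i $ j = (w ** munit p q) $ i $ j" .
  qed
  have inv: "invertible w"
  proof (rule invertible_injI)
    fix z assume z: "w *v z = 0"
    have "z $ r = 0" for r
    proof -
      have "0 = D o' r *v (w *v z)" using z by simp
      also have "\<dots> = (\<Sum>s\<in>UNIV. if s = r then z $ s *s y else 0)"
        unfolding wv mvec_sum by (intro sum.cong refl) (simp add: matrix_vector_mul_assoc mult Dy y_def)
      finally have "z $ r *s y = 0" by simp
      then show ?thesis using x by (auto simp: y_def vec_eq_iff)
    qed
    then show "z = 0" by (simp add: vec_eq_iff)
  qed
  have "D p q = w ** munit p q ** matrix_inv w" for p q
    using Dw[of p q] inv by (metis matrix_inv_cancel(3))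
  with inv show thesis by (rule that)
qed

text \<open>With block families read as elements of \<open>M \<otimes> M\<close>,
  \<open>bmul\<close> is the ordinary product and \<open>omul\<close> is the one with the order
  reversed in the second factor; \<open>L\<close> is an automorphism for both. Linearity is assumed
  on all families, whereas bijectivity and multiplicativity concern the invariant ones.\<close>

locale block_automorphism = delta_rep G u K
  for G :: "('g, 'b) monoid_scheme" (structure) and u :: "'g \<Rightarrow> complex^'n^'n" and K +
  fixes L :: "('n \<Rightarrow> 'n \<Rightarrow> complex^'n^'n) \<Rightarrow> 'n \<Rightarrow> 'n \<Rightarrow> complex^'n^'n"
  assumes add: "\<And>t s. L (\<lambda>i j. t i j + s i j) = (\<lambda>i j. L t i j + L s i j)"
    and scale: "\<And>c t. L (\<lambda>i j. c *m t i j) = (\<lambda>i j. c *m L t i j)"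
    and invL: "\<And>t. invt t \<Longrightarrow> invt (L t)"
    and surjL: "\<And>s. invt s \<Longrightarrow> \<exists>t. invt t \<and> L t = s"
    and injL: "\<And>t. invt t \<Longrightarrow> L t = (\<lambda>i j. 0) \<Longrightarrow> t = (\<lambda>i j. 0)"
    and bm: "\<And>t s. invt t \<Longrightarrow> invt s \<Longrightarrow> L (bmul t s) = bmul (L t) (L s)"
    and om: "\<And>t s. invt t \<Longrightarrow> invt s \<Longrightarrow> L (omul t s) = omul (L t) (L s)"
begin

lemma L_zero: "L (\<lambda>i j. 0) = (\<lambda>i j. 0)"
  using scale[of 0 "\<lambda>i j. 0"] by simp

lemma L_sum: "L (\<lambda>i j. \<Sum>x\<in>S. t x i j) = (\<lambda>i j. \<Sum>x\<in>S. L (t x) i j)"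
  by (induction S rule: infinite_finite_induct) (simp_all add: L_zero add)

lemma full_right_eq:
  fixes X Y :: "'n \<Rightarrow> 'n \<Rightarrow> complex^'n^'n"
  assumes "\<And>t. invt t \<Longrightarrow> (\<Sum>i\<in>UNIV. \<Sum>j\<in>UNIV. X i j ** t i j) = (\<Sum>i\<in>UNIV. \<Sum>j\<in>UNIV. Y i j ** t i j)"
  shows "X p q = Y p q"
proof -
  have "X p q - Y p q = 0"
    by (rule full_right[of "\<lambda>i j. X i j - Y i j"]) (simp add: mmult_diff sum_subtractf assms)
  then show ?thesis by simp
qed

lemma full_left_eq:
  fixes X Y :: "'n \<Rightarrow> 'n \<Rightarrow> complex^'n^'n"
  assumes "\<And>t. invt t \<Longrightarrow> (\<Sum>i\<in>UNIV. \<Sum>j\<in>UNIV. t i j ** X i j) = (\<Sum>i\<in>UNIV. \<Sum>j\<in>UNIV. t i j ** Y i j)"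
  shows "X p q = Y p q"
proof -
  have "X p q - Y p q = 0"
    by (rule full_left[of "\<lambda>i j. X i j - Y i j"]) (simp add: mmult_diff sum_subtractf assms)
  then show ?thesis by simp
qed

lemma L_one: "L (dblock (mat 1)) = dblock (mat 1)"
proof -
  obtain t where t: "invt t" "L t = dblock (mat 1)" using surjL[of "dblock (mat 1)"] comm_one invt_dblock by blast
  have "bmul (dblock (mat 1)) t = t" by (intro ext) (simp add: bmul_dblock)
  then have "bmul (L (dblock (mat 1))) (L t) = L t"
    using bm[of "dblock (mat 1)" t] t comm_one invt_dblock by simp
  moreover have "bmul (L (dblock (mat 1))) (L t) = L (dblock (mat 1))"
    unfolding t by (intro ext) (simp add: bmul_dblock)
  ultimately show ?thesis using t by simp
qed

definition alpha :: "complex^'n^'n \<Rightarrow> complex^'n^'n" where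
  "alpha c = L (dblock c) undefined undefined"

text \<open>Elements \<open>1 \<otimes> c\<close> are recognised by \<open>bmul s t = omul t s\<close> for all \<open>s\<close>.\<close>

lemma L_dblock:
  assumes c: "comm c"
  shows "L (dblock c) = dblock (alpha c)"
proof -
  let ?e = "L (dblock c)"
  have ic: "invt (dblock c)" using c invt_dblock by simp
  have sym: "bmul s ?e = omul ?e s" if s: "invt s" for s
  proof -
    obtain s' where s': "invt s'" "L s' = s" using surjL[OF s] by blast
    have "bmul s' (dblock c) = omul (dblock c) s'" by (intro ext) (simp add: bmul_dblock omul_dblock)
    then show ?thesis using bm[OF s'(1) ic] om[OF ic s'(1)] s' by simp
  qed
  \<comment> \<open>The blocks of an arbitrary invariant \<open>s\<close> are stripped from the
    equality of \<open>bmul s ?e\<close> and \<open>omul ?e s\<close>. Suitable indices then show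
    that \<open>?e\<close> vanishes off the diagonal and is constant on it.\<close>
  have key: "(if x = i then ?e y j else 0) = (if y = j then ?e i x else 0)" for i j x y
  proof (rule full_left_eq[of "\<lambda>x y. if x = i then ?e y j else 0" "\<lambda>x y. if y = j then ?e i x else 0"])
    fix s assume "invt s"
    have "(\<Sum>x\<in>UNIV. \<Sum>y\<in>UNIV. s x y ** (if x = i then ?e y j else 0))
        = (\<Sum>x\<in>UNIV. if x = i then \<Sum>y\<in>UNIV. s x y ** ?e y j else 0)"
      by (intro sum.cong refl) auto
    also have "\<dots> = bmul s ?e i j" by (simp add: bmul_def)
    also have "\<dots> = omul ?e s i j" using sym \<open>invt s\<close> by simp
    also have "\<dots> = (\<Sum>x\<in>UNIV. \<Sum>y\<in>UNIV. if y = j then s x y ** ?e i x else 0)"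
      by (simp add: omul_def)
    also have "\<dots> = (\<Sum>x\<in>UNIV. \<Sum>y\<in>UNIV. s x y ** (if y = j then ?e i x else 0))"
      by (intro sum.cong refl) auto
    finally show "(\<Sum>x\<in>UNIV. \<Sum>y\<in>UNIV. s x y ** (if x = i then ?e y j else 0))
      = (\<Sum>x\<in>UNIV. \<Sum>y\<in>UNIV. s x y ** (if y = j then ?e i x else 0))" .
  qed
  show ?thesis
  proof (intro ext)
    fix i j
    show "?e i j = dblock (alpha c) i j"
    proof (cases "i = j")
      case True
      then show ?thesis using key[of undefined undefined j j] by (simp add: dblock_def alpha_def)
    next
      case False
      then show ?thesis using key[of i i i j] by (simp add: dblock_def)
    qed
  qed
qed

lemma alpha_add: "alpha (c + d) = alpha c + alpha d"
proof -
  have "dblock (c + d) = (\<lambda>i j :: 'n. dblock c i j + dblock d i j)" by (intro ext) (simp add: dblock_def)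
  then show ?thesis by (simp add: alpha_def add)
qed

lemma alpha_cscale: "alpha (z *m c) = z *m alpha c"
proof -
  have "dblock (z *m c) = (\<lambda>i j :: 'n. z *m dblock c i j)" by (intro ext) (simp add: dblock_def)
  then show ?thesis by (simp add: alpha_def scale)
qed

lemma alpha_sum: "alpha (\<Sum>x\<in>S. f x) = (\<Sum>x\<in>S. alpha (f x))"
  using alpha_cscale[of 0 0]
  by (induction S rule: infinite_finite_induct) (simp_all add: alpha_add)

lemma alpha_mult:
  assumes "comm c" "comm d" shows "alpha (c ** d) = alpha c ** alpha d"
proof -
  have cd: "dblock (c ** d) = (bmul (dblock c) (dblock d) :: 'n \<Rightarrow> 'n \<Rightarrow> _)"
    by (intro ext) (simp add: bmul_dblock, simp add: dblock_def)
  have "L (dblock (c ** d)) = bmul (dblock (alpha c)) (dblock (alpha d))"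
    unfolding cd using assms by (simp add: bm invt_dblock L_dblock)
  then show ?thesis by (simp add: alpha_def[of "c ** d"] bmul_dblock) (simp add: dblock_def)
qed

lemma alpha_inj: "comm c \<Longrightarrow> alpha c = 0 \<Longrightarrow> c = 0"
proof -
  assume c: "comm c" "alpha c = 0"
  then have "L (dblock c) = dblock 0" by (simp add: L_dblock)
  also have "dblock 0 = (\<lambda>i j :: 'n. 0)" by (intro ext) (simp add: dblock_def)
  finally have "L (dblock c) = (\<lambda>i j. 0)" .
  then have "dblock c = (\<lambda>i j :: 'n. 0)" using c invt_dblock injL by blast
  then have "dblock c (undefined :: 'n) undefined = 0" by (rule arg_cong[where f = "\<lambda>t. t undefined undefined", THEN trans]) simp
  then show "c = 0" by (simp add: dblock_def)
qed

text \<open>Intertwiners from \<open>V\<close>, as a module over the commutant, to the same space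
  with the action twisted by \<open>alpha\<close>.\<close>

definition AA :: "(complex^'n^'n) set" where
  "AA = {v. \<forall>c. comm c \<longrightarrow> v ** c = alpha c ** v}"

lemma AA_D: "v \<in> AA \<Longrightarrow> comm c \<Longrightarrow> v ** c = alpha c ** v"
  by (simp add: AA_def)

lemma csubspace_AA: "csubspace AA"
  by (auto simp: csubspace_def AA_def mmult_add)

text \<open>The trivial representation occurs in \<open>V\<close>, which yields an intertwiner between \<open>V\<close> and its
  twist by \<open>alpha\<close>: an element \<open>c \<xi>\<close> of the orbit of an invariant vector is sent to \<open>alpha c \<zeta>\<close>.\<close>

lemma AA_nonzero: "\<exists>v\<in>AA. v \<noteq> 0"
proof -
  \<comment> \<open>\<open>N\<close> times the projector onto the vectors fixed by all
    \<open>u g\<close>; it is nonzero because \<open>K\<close> takes the value 1 on it.\<close>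
  define P0 where "P0 = (\<Sum>g\<in>carrier G. u g)"
  have left: "u h ** P0 = P0" if "h \<in> carrier G" for h
  proof -
    have "u h ** P0 = (\<Sum>g\<in>carrier G. u (h \<otimes> g))" using that by (simp add: P0_def mmult_sum u_mult)
    then show ?thesis using sum_reindex_left[OF that, of u] by (simp add: P0_def)
  qed
  have right: "P0 ** u h = P0" if "h \<in> carrier G" for h
  proof -
    have "P0 ** u h = (\<Sum>g\<in>carrier G. u (g \<otimes> h))" using that by (simp add: P0_def mmult_sum u_mult)
    also have "\<dots> = (\<Sum>g\<in>carrier G. u g)"
      by (rule sum.reindex_bij_witness[of _ "\<lambda>g. g \<otimes> inv h" "\<lambda>g. g \<otimes> h"])
        (use that in \<open>auto simp: m_assoc\<close>)
    finally show ?thesis by (simp add: P0_def)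
  qed
  have "trace (K ** P0) = 1"
    using fin by (simp add: P0_def mmult_sum trace_sum K)
  then have "P0 \<noteq> 0" by (auto simp: trace_def)
  then obtain e where e: "P0 *v e \<noteq> 0" by (rule matrix_nonzero_obtains)
  then obtain m where m: "(P0 *v e) $ m \<noteq> 0" by (auto simp: vec_eq_iff)
  \<comment> \<open>A rank-one matrix with column \<open>x\<close> and a row of \<open>P0\<close>.
    It absorbs \<open>u g\<close> on the right, and on the left as well if \<open>x\<close> is fixed
    by the group, so \<open>cc (P0 *v x)\<close> lies in the commutant.\<close>
  define cc where "cc x = (\<chi> r l. x $ r * P0 $ m $ l)" for x :: "complex^'n"
  have cc_left: "c ** cc x = cc (c *v x)" for c :: "complex^'n^'n" and x
    by (rule matrix_eqI) (simp add: cc_def mmult_nth matrix_vector_mult_def sum_distrib_right mult.assoc)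
  have cc_right: "cc x ** u g = cc x" if "g \<in> carrier G" for g x
  proof (rule matrix_eqI)
    fix i j
    have "(cc x ** u g) $ i $ j = x $ i * (P0 ** u g) $ m $ j"
      by (simp add: cc_def mmult_nth sum_distrib_left mult.assoc)
    then show "(cc x ** u g) $ i $ j = cc x $ i $ j" using right[OF that] by (simp add: cc_def)
  qed
  have cc_comm: "comm (cc (P0 *v x))" for x
    unfolding comm_def uconj_def
    by (auto simp: cc_left cc_right matrix_vector_mul_assoc left)
  have cc_sum: "cc (P0 *v x) = (\<Sum>k\<in>UNIV. x $ k *m cc (P0 *v axis k 1))" for x
  proof (rule matrix_eqI)
    fix i j
    have "(P0 *v axis k 1) $ i = P0 $ i $ k" for k
      by (simp add: matrix_vector_mult_def axis_def if_distrib cong: if_cong)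
    then have "(\<Sum>k\<in>UNIV. x $ k *m cc (P0 *v axis k 1)) $ i $ j = (\<Sum>k\<in>UNIV. P0 $ i $ k * x $ k * P0 $ m $ j)"
      by (simp add: cc_def mult_ac)
    also have "\<dots> = cc (P0 *v x) $ i $ j"
      by (simp add: cc_def matrix_vector_mult_def sum_distrib_right)
    finally show "cc (P0 *v x) $ i $ j = (\<Sum>k\<in>UNIV. x $ k *m cc (P0 *v axis k 1)) $ i $ j" by simp
  qed
  have P0_comm: "c ** P0 = P0 ** c" if c: "comm c" for c
  proof -
    have "c ** u g = u g ** c" if "g \<in> carrier G" for g
    proof -
      have "u g ** c = u g ** (u (inv g) ** c ** u g)" using c that by (simp add: comm_def uconj_def)
      then show ?thesis using that by (simp add: matrix_mul_assoc u_inv)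
    qed
    then show ?thesis by (simp add: P0_def mmult_sum)
  qed
  have "cc (P0 *v e) \<noteq> 0"
  proof
    assume z: "cc (P0 *v e) = 0"
    have "(P0 *v e) $ m * P0 $ m $ l = 0" for l
      using arg_cong[OF z, of "\<lambda>X. X $ m $ l"] by (simp add: cc_def)
    then have "P0 $ m $ l = 0" for l using m by simp
    then show False using m by (simp add: matrix_vector_mult_def)
  qed
  then have "alpha (cc (P0 *v e)) \<noteq> 0" using alpha_inj cc_comm by blast
  then obtain z where z: "alpha (cc (P0 *v e)) *v z \<noteq> 0" by (rule matrix_nonzero_obtains)
  define v where "v = (\<chi> r k. (alpha (cc (P0 *v axis k 1)) *v z) $ r)"
  have v: "v *v x = alpha (cc (P0 *v x)) *v z" for x
  proof -
    have "alpha (cc (P0 *v x)) *v z = (\<Sum>k\<in>UNIV. x $ k *s (alpha (cc (P0 *v axis k 1)) *v z))"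
      by (subst cc_sum) (simp add: alpha_sum alpha_cscale mvec_sum)
    then show ?thesis
      by (simp add: vec_eq_iff v_def matrix_vector_mult_def[of "\<chi> r k. f r k" for f] mult.commute)
  qed
  have "v \<in> AA"
    unfolding AA_def
  proof (intro CollectI allI impI matrix_eq_by_vec)
    fix c x assume c: "comm c"
    have "v ** c *v x = alpha (cc (P0 *v (c *v x))) *v z" by (simp add: v flip: matrix_vector_mul_assoc)
    also have "P0 *v (c *v x) = c *v (P0 *v x)" using P0_comm[OF c] by (simp add: matrix_vector_mul_assoc)
    also have "alpha (cc (c *v (P0 *v x))) *v z = alpha c ** v *v x"
      using alpha_mult[OF c cc_comm[of x]] unfolding cc_left by (simp add: v flip: matrix_vector_mul_assoc)
    finally show "v ** c *v x = alpha c ** v *v x" .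
  qed
  moreover have "v \<noteq> 0" using z v[of e] by auto
  ultimately show ?thesis by blast
qed

text \<open>The hypothesis relates products of single blocks, to which \<open>L\<close> does not
  apply. Contracted with a free invariant \<open>r\<close>, both sides become iterated
  \<open>bmul\<close> and \<open>omul\<close> products, through which \<open>L\<close> passes, and
  \<open>full_left_eq\<close> removes \<open>r\<close> afterwards. Both products are needed to let
  \<open>r\<close> stand between the two factors.\<close>

lemma L_swap:
  fixes P R :: "'k::finite \<Rightarrow> 'n \<Rightarrow> 'n \<Rightarrow> complex^'n^'n"
  assumes t: "invt t" and s: "invt s" and P: "\<And>k. invt (P k)" and R: "\<And>k. invt (R k)"
    and eq: "\<And>p q a b. t p q ** s a b = (\<Sum>k\<in>UNIV. P k a b ** R k p q)"
  shows "L t i j ** L s a b = (\<Sum>k\<in>UNIV. L (P k) a b ** L (R k) i j)"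
proof (rule full_left_eq[of "\<lambda>j a. L t i j ** L s a b" "\<lambda>j a. \<Sum>k\<in>UNIV. L (P k) a b ** L (R k) i j"])
  have e1: "bmul (omul t r) s i b = (\<Sum>x\<in>UNIV. \<Sum>m\<in>UNIV. r x m ** (t i x ** s m b))" for t r s :: "'n \<Rightarrow> 'n \<Rightarrow> complex^'n^'n" and i b
    by (simp add: bmul_def omul_def mmult_sum matrix_mul_assoc) (rule sum.swap)
  have e2: "omul t (bmul r s) i b = (\<Sum>x\<in>UNIV. \<Sum>m\<in>UNIV. r x m ** (s m b ** t i x))" for t r s :: "'n \<Rightarrow> 'n \<Rightarrow> complex^'n^'n" and i b
    by (simp add: bmul_def omul_def mmult_sum matrix_mul_assoc)
  fix r' assume "invt r'"
  then obtain r where r: "invt r" "L r = r'" using surjL by blast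
  have "bmul (omul t r) s = (\<lambda>i b. \<Sum>k\<in>UNIV. omul (R k) (bmul r (P k)) i b)"
    unfolding e1 e2 eq mmult_sum by (intro ext, subst sum_swap_1_2) (rule refl)
  then have "L (bmul (omul t r) s) = (\<lambda>i b. \<Sum>k\<in>UNIV. L (omul (R k) (bmul r (P k))) i b)"
    by (simp add: L_sum)
  then have "bmul (omul (L t) r') (L s) = (\<lambda>i b. \<Sum>k\<in>UNIV. omul (L (R k)) (bmul r' (L (P k))) i b)"
    using t s P R r by (simp add: bm om invt_bmul invt_omul)
  from fun_cong[OF fun_cong[OF this, of i], of b]
  show "(\<Sum>x\<in>UNIV. \<Sum>m\<in>UNIV. r' x m ** (L t i x ** L s m b))
     = (\<Sum>x\<in>UNIV. \<Sum>m\<in>UNIV. r' x m ** (\<Sum>k\<in>UNIV. L (P k) m b ** L (R k) i x))"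
    unfolding e1 e2 mmult_sum by (subst sum_swap_1_2[symmetric])
qed

text \<open>The pair \<open>q\<close>, \<open>s\<close> is insensitive to conjugation by
  \<open>invt_contract\<close>, so only the twist of the middle factor \<open>t\<close>
  remains.\<close>

lemma invt_slide:
  assumes q: "invt q" and t: "invt t" and s: "invt s"
  shows "invt (\<lambda>x y. \<Sum>i\<in>UNIV. \<Sum>j\<in>UNIV. q j i ** t x y ** s i j)"
  unfolding invt_def
proof (intro ballI allI)
  fix g a b assume g: "g \<in> carrier G"
  have "twist g (\<lambda>x y. \<Sum>i\<in>UNIV. \<Sum>j\<in>UNIV. q j i ** t x y ** s i j) a b
      = (\<Sum>i\<in>UNIV. \<Sum>j\<in>UNIV. q j i ** twist g t a b ** s i j)"
    by (simp add: twist_sum) (simp add: twist_def mmult_sum)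
  also have "\<dots> = (\<Sum>i\<in>UNIV. \<Sum>j\<in>UNIV. uconj g (q j i) ** uconj g (t a b) ** uconj g (s i j))"
    by (simp add: invt_contract[OF q s g] invtD[OF t g])
  also have "\<dots> = uconj g (\<Sum>i\<in>UNIV. \<Sum>j\<in>UNIV. q j i ** t a b ** s i j)"
    by (simp add: uconj_sum uconj_mult[OF g])
  finally show "twist g (\<lambda>x y. \<Sum>i\<in>UNIV. \<Sum>j\<in>UNIV. q j i ** t x y ** s i j) a b
    = uconj g (\<Sum>i\<in>UNIV. \<Sum>j\<in>UNIV. q j i ** t a b ** s i j)" .
qed

text \<open>Expanding \<open>t\<close> over the commutant by \<open>block_expansion\<close> and
  letting \<open>alpha c\<close> pass through \<open>v \<in> AA\<close> as \<open>c\<close> turns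
  left multiplication by \<open>L t i j\<close> into right multiplication by the blocks of
  \<open>t\<close>, with linear operators \<open>T\<close> as coefficients. By fullness these
  preserve \<open>AA\<close>, and by \<open>L_swap\<close> they commute there. On a common
  eigenvector they become the scalars \<open>D\<close>.\<close>

lemma common_eigen:
  "\<exists>v D. v \<noteq> 0 \<and> (\<forall>t i j. invt t \<longrightarrow> L t i j ** v = (\<Sum>p\<in>UNIV. \<Sum>q\<in>UNIV. D i j p q *m (v ** t p q)))"
proof -
  obtain P Q where PQ: "\<And>k. invt (P k)" "\<And>k. invt (Q k)"
    and expand: "\<And>Y p q. Y p q = (\<Sum>k\<in>UNIV. P (k :: 'n \<times> 'n \<times> 'n \<times> 'n \<times> 'n) p q **
        (\<Sum>i\<in>UNIV. \<Sum>j\<in>UNIV. Q k j i ** Y i j :: complex^'n^'n))"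
    using block_expansion by blast
  define T where "T = (\<lambda>(i, j, p, q) v. \<Sum>k\<in>UNIV. L (P k) i j ** v ** Q k q p)"
  have Tlin: "clinear_op (T x)" for x
    by (cases x) (simp add: clinear_op_def T_def mmult_add sum.distrib cscale_sum)
  have act: "L t i j ** v = (\<Sum>p\<in>UNIV. \<Sum>q\<in>UNIV. T (i, j, p, q) v ** t p q)"
    if t: "invt t" and v: "v \<in> AA" for t i j v
  proof -
    define c where "c k = (\<Sum>i\<in>UNIV. \<Sum>j\<in>UNIV. Q k j i ** t i j)" for k
    have c: "comm (c k)" for k unfolding c_def by (rule comm_contract[OF PQ(2) t])
    have "t = (\<lambda>i j. \<Sum>k\<in>UNIV. bmul (P k) (dblock (c k)) i j)"
      by (intro ext) (simp only: bmul_dblock c_def, rule expand)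
    then have "L t = (\<lambda>i j. \<Sum>k\<in>UNIV. L (bmul (P k) (dblock (c k))) i j)"
      using L_sum[of "\<lambda>k. bmul (P k) (dblock (c k))" UNIV] by simp
    then have "L t i j = (\<Sum>k\<in>UNIV. L (P k) i j ** alpha (c k))"
      using c by (simp add: bm PQ invt_dblock L_dblock bmul_dblock)
    then have "L t i j ** v = (\<Sum>k\<in>UNIV. L (P k) i j ** (v ** c k))"
      using AA_D[OF v c] by (simp add: mmult_sum matrix_mul_assoc)
    also have "\<dots> = (\<Sum>k\<in>UNIV. \<Sum>p\<in>UNIV. \<Sum>q\<in>UNIV. L (P k) i j ** v ** Q k q p ** t p q)"
      by (simp add: c_def mmult_sum matrix_mul_assoc)
    also have "\<dots> = (\<Sum>p\<in>UNIV. \<Sum>q\<in>UNIV. T (i, j, p, q) v ** t p q)"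
      by (subst sum_swap_1_2) (simp add: T_def mmult_sum)
    finally show ?thesis .
  qed
  have TAA: "T x v \<in> AA" if v: "v \<in> AA" for x v
    unfolding AA_def
  proof (intro CollectI allI impI)
    fix c assume c: "comm c"
    obtain i j p q where x: "x = (i, j, p, q)" by (cases x)
    have "T (i, j, p, q) v ** c = alpha c ** T (i, j, p, q) v"
    proof (rule full_right_eq[of "\<lambda>p q. T (i, j, p, q) v ** c" "\<lambda>p q. alpha c ** T (i, j, p, q) v"])
      fix t assume t: "invt t"
      have "L (bmul (dblock c) t) i j ** v = (\<Sum>p\<in>UNIV. \<Sum>q\<in>UNIV. T (i, j, p, q) v ** c ** t p q)"
        using act[OF invt_bmul[OF _ t] v, of "dblock c" i j] c by (simp add: invt_dblock bmul_dblock matrix_mul_assoc)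
      moreover have "L (bmul (dblock c) t) i j ** v = alpha c ** (L t i j ** v)"
        using c t by (simp add: bm invt_dblock L_dblock bmul_dblock matrix_mul_assoc)
      ultimately show "(\<Sum>p\<in>UNIV. \<Sum>q\<in>UNIV. T (i, j, p, q) v ** c ** t p q)
        = (\<Sum>p\<in>UNIV. \<Sum>q\<in>UNIV. alpha c ** T (i, j, p, q) v ** t p q)"
        by (simp add: act[OF t v] mmult_sum matrix_mul_assoc)
    qed
    then show "T x v ** c = alpha c ** T x v" by (simp add: x)
  qed
  have Tcomm: "T x (T y v) = T y (T x v)" if v: "v \<in> AA" for x y v
  proof -
    obtain i j p0 q0 where x: "x = (i, j, p0, q0)" by (cases x)
    obtain k l r0 y0 where y: "y = (k, l, r0, y0)" by (cases y)
    have e: "(\<Sum>r\<in>UNIV. \<Sum>y\<in>UNIV. (\<Sum>p\<in>UNIV. \<Sum>q\<in>UNIV. T (i, j, p, q) (T (k, l, r, y) v) ** t p q) ** s r y)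
       = (\<Sum>r\<in>UNIV. \<Sum>y\<in>UNIV. (\<Sum>p\<in>UNIV. \<Sum>q\<in>UNIV. T (k, l, r, y) (T (i, j, p, q) v) ** t p q) ** s r y)"
      if t: "invt t" and s: "invt s" for t s
    proof -
      \<comment> \<open>This rewrites \<open>t p q ** s a b\<close> with the factor depending on
        \<open>a\<close>, \<open>b\<close> in front. The other factor is again invariant in
        \<open>p\<close>, \<open>q\<close>, as \<open>L_swap\<close> requires.\<close>
      define R where "R m p q = (\<Sum>a\<in>UNIV. \<Sum>b\<in>UNIV. Q m b a ** t p q ** s a b)" for m p q
      have R: "invt (R m)" for m
        unfolding R_def[abs_def] by (rule invt_slide[OF PQ(2) t s])
      have ts: "t p q ** s a b = (\<Sum>m\<in>UNIV. P m a b ** R m p q)" for p q a b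
        using expand[of "\<lambda>a b. t p q ** s a b" a b] by (simp add: R_def matrix_mul_assoc)
      have "L t i j ** (L s k l ** v) = (\<Sum>r\<in>UNIV. \<Sum>y\<in>UNIV. L t i j ** T (k, l, r, y) v ** s r y)"
        by (simp add: act[OF s v] mmult_sum matrix_mul_assoc)
      also have "\<dots> = (\<Sum>r\<in>UNIV. \<Sum>y\<in>UNIV. (\<Sum>p\<in>UNIV. \<Sum>q\<in>UNIV. T (i, j, p, q) (T (k, l, r, y) v) ** t p q) ** s r y)"
        by (simp add: act[OF t TAA[OF v]])
      finally have A: "L t i j ** (L s k l ** v) = \<dots>" .
      have "L t i j ** (L s k l ** v) = (\<Sum>m\<in>UNIV. L (P m) k l ** L (R m) i j) ** v"
        using L_swap[OF t s PQ(1) R ts] by (simp add: matrix_mul_assoc)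
      also have "\<dots> = (\<Sum>m\<in>UNIV. L (P m) k l ** (L (R m) i j ** v))"
        by (simp add: mmult_sum matrix_mul_assoc)
      also have "\<dots> = (\<Sum>m\<in>UNIV. \<Sum>p\<in>UNIV. \<Sum>q\<in>UNIV. L (P m) k l ** T (i, j, p, q) v ** R m p q)"
        by (simp add: act[OF R v] mmult_sum matrix_mul_assoc)
      also have "\<dots> = (\<Sum>m\<in>UNIV. \<Sum>p\<in>UNIV. \<Sum>q\<in>UNIV. \<Sum>r\<in>UNIV. \<Sum>y\<in>UNIV. T (k, l, r, y) (T (i, j, p, q) v) ** P m r y ** R m p q)"
        by (simp add: act[OF PQ(1) TAA[OF v]] mmult_sum)
      also have "\<dots> = (\<Sum>p\<in>UNIV. \<Sum>q\<in>UNIV. \<Sum>m\<in>UNIV. \<Sum>r\<in>UNIV. \<Sum>y\<in>UNIV. T (k, l, r, y) (T (i, j, p, q) v) ** P m r y ** R m p q)"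
        by (rule sum_swap_1_2)
      also have "\<dots> = (\<Sum>p\<in>UNIV. \<Sum>q\<in>UNIV. \<Sum>r\<in>UNIV. \<Sum>y\<in>UNIV. \<Sum>m\<in>UNIV. T (k, l, r, y) (T (i, j, p, q) v) ** P m r y ** R m p q)"
        by (intro sum.cong refl sum_swap_1_2)
      also have "\<dots> = (\<Sum>p\<in>UNIV. \<Sum>q\<in>UNIV. \<Sum>r\<in>UNIV. \<Sum>y\<in>UNIV. T (k, l, r, y) (T (i, j, p, q) v) ** t p q ** s r y)"
        by (intro sum.cong refl) (simp add: ts mmult_sum flip: matrix_mul_assoc)
      also have "\<dots> = (\<Sum>r\<in>UNIV. \<Sum>y\<in>UNIV. (\<Sum>p\<in>UNIV. \<Sum>q\<in>UNIV. T (k, l, r, y) (T (i, j, p, q) v) ** t p q) ** s r y)"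
        by (subst sum_swap_2_2) (simp add: mmult_sum)
      finally show ?thesis using A by simp
    qed
    have "(\<Sum>p\<in>UNIV. \<Sum>q\<in>UNIV. T (i, j, p, q) (T (k, l, r0, y0) v) ** t p q)
       = (\<Sum>p\<in>UNIV. \<Sum>q\<in>UNIV. T (k, l, r0, y0) (T (i, j, p, q) v) ** t p q)" if t: "invt t" for t
      by (rule full_right_eq[of "\<lambda>r y. \<Sum>p\<in>UNIV. \<Sum>q\<in>UNIV. T (i, j, p, q) (T (k, l, r, y) v) ** t p q"
            "\<lambda>r y. \<Sum>p\<in>UNIV. \<Sum>q\<in>UNIV. T (k, l, r, y) (T (i, j, p, q) v) ** t p q"]) (rule e[OF t])
    then have "T (i, j, p0, q0) (T (k, l, r0, y0) v) = T (k, l, r0, y0) (T (i, j, p0, q0) v)"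
      by (rule full_right_eq[of "\<lambda>p q. T (i, j, p, q) (T (k, l, r0, y0) v)"
            "\<lambda>p q. T (k, l, r0, y0) (T (i, j, p, q) v)"])
    then show ?thesis by (simp add: x y)
  qed
  have "\<exists>v\<in>AA. v \<noteq> 0 \<and> (\<forall>x\<in>UNIV. \<exists>z. T x v = z *m v)"
    by (rule common_eigenvector[OF _ csubspace_AA AA_nonzero Tlin TAA Tcomm]) simp_all
  then obtain v where v: "v \<in> AA" "v \<noteq> 0" and "\<forall>x. \<exists>z. T x v = z *m v" by auto
  from choice[OF this(3)] obtain z where z: "\<And>x. T x v = z x *m v" by blast
  show ?thesis
  proof (intro exI conjI allI impI)
    show "v \<noteq> 0" by fact
    fix t i j assume "invt t"
    then show "L t i j ** v = (\<Sum>p\<in>UNIV. \<Sum>q\<in>UNIV. z (i, j, p, q) *m (v ** t p q))"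
      by (simp add: act v z)
  qed
qed

text \<open>A common eigenvector \<open>v\<close> of the commuting operators above intertwines \<open>L\<close> on the matrix part, and
  its eigenvalues are matrix units on the index part, conjugated by some \<open>w\<close>.\<close>

theorem inner:
  obtains w v where "invertible w" "invertible v"
    "\<And>t i j. invt t \<Longrightarrow> L t i j = (\<Sum>p\<in>UNIV. \<Sum>q\<in>UNIV. (w $ i $ p * matrix_inv w $ q $ j) *m (v ** t p q ** matrix_inv v))"
proof -
  obtain v D where v: "v \<noteq> 0"
    and act: "\<And>t i j. invt t \<Longrightarrow> L t i j ** v = (\<Sum>p\<in>UNIV. \<Sum>q\<in>UNIV. D i j p q *m (v ** t p q))"
    using common_eigen by blast
  define DD where "DD p q = (\<chi> i j. D i j p q)" for p q
  \<comment> \<open>Multiplicativity is evaluated on \<open>v\<close> in two ways and the free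
    blocks of \<open>t\<close> and \<open>s\<close> are stripped one after the other. What remains
    are the relations of matrix units for \<open>DD\<close>.\<close>
  have mult: "(\<Sum>m\<in>UNIV. D m j r y * D i m p q) = (if q = r then D i j p y else 0)" for i j p q r y
  proof -
    let ?a = "\<lambda>r y p q. \<Sum>m\<in>UNIV. D m j r y * D i m p q"
    let ?b = "\<lambda>r y p q. if q = r then D i j p y else 0"
    have e: "(\<Sum>r\<in>UNIV. \<Sum>y\<in>UNIV. (\<Sum>p\<in>UNIV. \<Sum>q\<in>UNIV. (?a r y p q *m v) ** t p q) ** s r y)
        = (\<Sum>r\<in>UNIV. \<Sum>y\<in>UNIV. (\<Sum>p\<in>UNIV. \<Sum>q\<in>UNIV. (?b r y p q *m v) ** t p q) ** s r y)"
      if t: "invt t" and s: "invt s" for t s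
    proof -
      have "L (bmul t s) i j ** v = (\<Sum>m\<in>UNIV. L t i m ** (L s m j ** v))"
        using t s by (simp add: bm bmul_def mmult_sum matrix_mul_assoc)
      also have "\<dots> = (\<Sum>m\<in>UNIV. \<Sum>r\<in>UNIV. \<Sum>y\<in>UNIV. D m j r y *m ((L t i m ** v) ** s r y))"
        by (simp add: act[OF s] mmult_sum matrix_mul_assoc)
      also have "\<dots> = (\<Sum>r\<in>UNIV. \<Sum>y\<in>UNIV. \<Sum>m\<in>UNIV. \<Sum>p\<in>UNIV. \<Sum>q\<in>UNIV. (D m j r y * D i m p q) *m (v ** t p q ** s r y))"
        by (subst sum_swap_1_2) (simp add: act[OF t] mmult_sum cscale_sum)
      also have "\<dots> = (\<Sum>r\<in>UNIV. \<Sum>y\<in>UNIV. \<Sum>p\<in>UNIV. \<Sum>q\<in>UNIV. \<Sum>m\<in>UNIV. (D m j r y * D i m p q) *m (v ** t p q ** s r y))"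
        by (intro sum.cong refl sum_swap_1_2)
      also have "\<dots> = (\<Sum>r\<in>UNIV. \<Sum>y\<in>UNIV. (\<Sum>p\<in>UNIV. \<Sum>q\<in>UNIV. (?a r y p q *m v) ** t p q) ** s r y)"
        by (simp add: mmult_sum cscale_sum_left)
      finally have A: "L (bmul t s) i j ** v = \<dots>" .
      have "L (bmul t s) i j ** v = (\<Sum>p\<in>UNIV. \<Sum>y\<in>UNIV. \<Sum>r\<in>UNIV. D i j p y *m (v ** t p r ** s r y))"
        using act[OF invt_bmul[OF t s], of i j] by (simp add: bmul_def mmult_sum cscale_sum matrix_mul_assoc)
      also have "\<dots> = (\<Sum>p\<in>UNIV. \<Sum>y\<in>UNIV. \<Sum>r\<in>UNIV. \<Sum>q\<in>UNIV. if q = r then D i j p y *m (v ** t p q ** s r y) else 0)"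
        by simp
      also have "\<dots> = (\<Sum>p\<in>UNIV. \<Sum>y\<in>UNIV. \<Sum>r\<in>UNIV. \<Sum>q\<in>UNIV. ?b r y p q *m (v ** t p q ** s r y))"
        by (intro sum.cong refl) auto
      also have "\<dots> = (\<Sum>p\<in>UNIV. \<Sum>r\<in>UNIV. \<Sum>y\<in>UNIV. \<Sum>q\<in>UNIV. ?b r y p q *m (v ** t p q ** s r y))"
        by (intro sum.cong refl sum.swap)
      also have "\<dots> = (\<Sum>r\<in>UNIV. \<Sum>y\<in>UNIV. \<Sum>p\<in>UNIV. \<Sum>q\<in>UNIV. ?b r y p q *m (v ** t p q ** s r y))"
        by (rule sum_swap_1_2)
      also have "\<dots> = (\<Sum>r\<in>UNIV. \<Sum>y\<in>UNIV. (\<Sum>p\<in>UNIV. \<Sum>q\<in>UNIV. (?b r y p q *m v) ** t p q) ** s r y)"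
        by (simp only: mmult_sum cscale_mult)
      finally show ?thesis using A by simp
    qed
    have "(\<Sum>p\<in>UNIV. \<Sum>q\<in>UNIV. (?a r y p q *m v) ** t p q) = (\<Sum>p\<in>UNIV. \<Sum>q\<in>UNIV. (?b r y p q *m v) ** t p q)"
      if t: "invt t" for t
      by (rule full_right_eq[of "\<lambda>r y. \<Sum>p\<in>UNIV. \<Sum>q\<in>UNIV. (?a r y p q *m v) ** t p q"
            "\<lambda>r y. \<Sum>p\<in>UNIV. \<Sum>q\<in>UNIV. (?b r y p q *m v) ** t p q"]) (rule e[OF t])
    then have "?a r y p q *m v = ?b r y p q *m v"
      by (rule full_right_eq[of "\<lambda>p q. ?a r y p q *m v" "\<lambda>p q. ?b r y p q *m v"])
    then have "(?a r y p q - ?b r y p q) *m v = 0" by (simp only: cscale_add) simp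
    then show ?thesis using v by (simp only: cscale_eq_0) simp
  qed
  have DD: "DD p q ** DD r y = (if q = r then DD p y else 0)" for p q r y
  proof (rule matrix_eqI)
    fix i j
    have "(DD p q ** DD r y) $ i $ j = (\<Sum>m\<in>UNIV. D m j r y * D i m p q)"
      by (simp add: mmult_nth DD_def mult.commute)
    then show "(DD p q ** DD r y) $ i $ j = (if q = r then DD p y else 0) $ i $ j"
      by (simp add: mult DD_def)
  qed
  have DD1: "(\<Sum>p\<in>UNIV. DD p p) = mat 1"
  proof (rule matrix_eqI)
    fix i j
    have "dblock (mat 1) i j ** v = (\<Sum>p\<in>UNIV. \<Sum>q\<in>UNIV. D i j p q *m (v ** dblock (mat 1) p q))"
      using act[of "dblock (mat 1)" i j] by (simp add: invt_dblock comm_one L_one)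
    also have "\<dots> = (\<Sum>p\<in>UNIV. \<Sum>q\<in>UNIV. if q = p then D i j p q *m v else 0)"
      by (intro sum.cong refl) (simp add: dblock_def)
    also have "\<dots> = (\<Sum>p\<in>UNIV. D i j p p) *m v" by (simp add: cscale_sum_left)
    finally have "((\<Sum>p\<in>UNIV. D i j p p) - (if i = j then 1 else 0)) *m v = 0"
      by (auto simp: cscale_add dblock_def split: if_splits)
    then have "(\<Sum>p\<in>UNIV. D i j p p) = (if i = j then 1 else 0)"
      using v by (simp only: cscale_eq_0) simp
    then show "(\<Sum>p\<in>UNIV. DD p p) $ i $ j = mat 1 $ i $ j" by (simp add: DD_def mat_def)
  qed
  obtain w where w: "invertible w" and Dw: "\<And>p q. DD p q = w ** munit p q ** matrix_inv w"
    using matrix_units_conjugate[OF DD DD1] by blast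
  have D: "D i j p q = w $ i $ p * matrix_inv w $ q $ j" for i j p q
    using arg_cong[OF Dw[of p q], of "\<lambda>X. X $ i $ j"] by (simp add: DD_def munit_conj_nth)
  \<comment> \<open>If \<open>v\<close> killed \<open>x\<close>, undoing the invertible
    \<open>w\<close> would give \<open>v ** t a b *v x = 0\<close> for all invariant
    \<open>t\<close>, hence \<open>v ** M *v x = 0\<close> for every \<open>M\<close>. Since
    \<open>M *v x\<close> can be any vector, \<open>v\<close> would vanish.\<close>
  have "invertible v"
  proof (rule invertible_injI, rule ccontr)
    fix x assume x: "v *v x = 0" "x \<noteq> 0"
    have 1: "(\<Sum>p\<in>UNIV. \<Sum>q\<in>UNIV. D i j p q *s (v ** t p q *v x)) = 0" if "invt t" for t i j
    proof -
      have "(\<Sum>p\<in>UNIV. \<Sum>q\<in>UNIV. D i j p q *s (v ** t p q *v x)) = (L t i j ** v) *v x"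
        by (simp add: act[OF that] mvec_sum)
      then show ?thesis using x by (simp flip: matrix_vector_mul_assoc)
    qed
    have wi: "(\<Sum>i\<in>UNIV. matrix_inv w $ a $ i * w $ i $ p) = (if a = p then 1 else 0)" for a p
      using matrix_inv_mult(2)[OF w] by (auto simp: vec_eq_iff mmult_nth mat_def)
    have "v ** t a b *v x = 0" if t: "invt t" for t a b
    proof -
      let ?m = "\<lambda>i j p q. (matrix_inv w $ a $ i * w $ i $ p * (matrix_inv w $ q $ j * w $ j $ b)) *s (v ** t p q *v x)"
      have "0 = (\<Sum>i\<in>UNIV. \<Sum>j\<in>UNIV. (matrix_inv w $ a $ i * w $ j $ b) *s (\<Sum>p\<in>UNIV. \<Sum>q\<in>UNIV. D i j p q *s (v ** t p q *v x)))"
        by (simp add: 1[OF t])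
      also have "\<dots> = (\<Sum>i\<in>UNIV. \<Sum>j\<in>UNIV. \<Sum>p\<in>UNIV. \<Sum>q\<in>UNIV. ?m i j p q)"
        by (simp add: D vec.scale_sum_right mult_ac)
      also have "\<dots> = (\<Sum>p\<in>UNIV. \<Sum>q\<in>UNIV. \<Sum>i\<in>UNIV. \<Sum>j\<in>UNIV. ?m i j p q)"
        by (rule sum_swap_2_2)
      also have "\<dots> = (\<Sum>p\<in>UNIV. \<Sum>q\<in>UNIV. ((\<Sum>i\<in>UNIV. matrix_inv w $ a $ i * w $ i $ p) * (\<Sum>j\<in>UNIV. matrix_inv w $ q $ j * w $ j $ b)) *s (v ** t p q *v x))"
        by (simp only: sum_product vec.scale_sum_left)
      also have "\<dots> = (\<Sum>p\<in>UNIV. \<Sum>q\<in>UNIV. if p = a then if q = b then v ** t p q *v x else 0 else 0)"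
        by (intro sum.cong refl) (auto simp: wi)
      also have "\<dots> = (\<Sum>p\<in>UNIV. if p = a then v ** t p b *v x else 0)"
        by (intro sum.cong refl) auto
      finally show ?thesis by simp
    qed
    then have vM: "v ** M *v x = 0" for M by (rule slices_full)
    obtain m where m: "x $ m \<noteq> 0" using x by (auto simp: vec_eq_iff)
    have "v *v y = 0" for y
    proof -
      define M :: "complex^'n^'n" where "M = (\<chi> r l. if l = m then y $ r / x $ m else 0)"
      have "(M *v x) $ r = (\<Sum>l\<in>UNIV. if l = m then y $ r / x $ m * x $ l else 0)" for r
        by (subst matrix_vector_mult_def, subst vec_lambda_beta, rule sum.cong) (auto simp: M_def)
      then have "M *v x = y" using m by (simp add: vec_eq_iff)
      then show ?thesis using vM[of M] by (simp flip: matrix_vector_mul_assoc)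
    qed
    then have "v = 0" using matrix_eq_by_vec[of v 0] by simp
    then show False using \<open>v \<noteq> 0\<close> by simp
  qed
  with w show thesis
  proof (rule that)
    fix t i j assume t: "invt t"
    have "L t i j = (L t i j ** v) ** matrix_inv v" by (simp add: matrix_inv_cancel \<open>invertible v\<close>)
    then show "L t i j = (\<Sum>p\<in>UNIV. \<Sum>q\<in>UNIV. (w $ i $ p * matrix_inv w $ q $ j) *m (v ** t p q ** matrix_inv v))"
      by (simp add: act[OF t] D mmult_sum)
  qed
qed

end

section \<open>Operators on the torus state\<close>

definition site_op :: "'s \<Rightarrow> complex^'x^'x \<Rightarrow> (('s \<Rightarrow> 'x::finite) \<Rightarrow> complex) \<Rightarrow> ('s \<Rightarrow> 'x) \<Rightarrow> complex" where
  "site_op x M F = (\<lambda>l. \<Sum>m\<in>UNIV. M $ l x $ m * F (l(x := m)))"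

lemma site_op_site_op: "site_op x M (site_op x N F) = site_op x (M ** N) F"
proof
  fix l
  have "site_op x M (site_op x N F) l = (\<Sum>m\<in>UNIV. \<Sum>k\<in>UNIV. M $ l x $ m * N $ m $ k * F (l(x := k)))"
    by (simp add: site_op_def sum_distrib_left mult.assoc)
  also have "\<dots> = (\<Sum>k\<in>UNIV. \<Sum>m\<in>UNIV. M $ l x $ m * N $ m $ k * F (l(x := k)))" by (rule sum.swap)
  also have "\<dots> = site_op x (M ** N) F l" by (simp add: site_op_def mmult_nth sum_distrib_right)
  finally show "site_op x M (site_op x N F) l = site_op x (M ** N) F l" .
qed

lemma site_op_one [simp]: "site_op x (mat 1) F = F"
proof
  fix l
  have "site_op x (mat 1) F l = (\<Sum>m\<in>UNIV. if m = l x then F (l(x := m)) else 0)"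
    unfolding site_op_def by (rule sum.cong) (auto simp: mat_def)
  then show "site_op x (mat 1) F l = F l" by simp
qed

lemma site_op_comm: "x \<noteq> y \<Longrightarrow> site_op x M (site_op y N F) = site_op y N (site_op x M F)"
proof
  fix l assume xy: "x \<noteq> y"
  have "site_op x M (site_op y N F) l = (\<Sum>m\<in>UNIV. \<Sum>k\<in>UNIV. M $ l x $ m * N $ l y $ k * F (l(x := m, y := k)))"
    using xy by (simp add: site_op_def sum_distrib_left mult.assoc)
  also have "\<dots> = (\<Sum>k\<in>UNIV. \<Sum>m\<in>UNIV. M $ l x $ m * N $ l y $ k * F (l(x := m, y := k)))" by (rule sum.swap)
  also have "\<dots> = site_op y N (site_op x M F) l"
    using xy by (simp add: site_op_def sum_distrib_left mult_ac fun_upd_twist)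
  finally show "site_op x M (site_op y N F) l = site_op y N (site_op x M F) l" .
qed

lemma site_op_matrix_sum: "site_op x (\<Sum>i\<in>I. M i) F l = (\<Sum>i\<in>I. site_op x (M i) F l)"
  unfolding site_op_def by (simp add: sum_distrib_right) (rule sum.swap)

lemma site_op_matrix_cscale: "site_op x (c *m M) F l = c * site_op x M F l"
  by (simp add: site_op_def sum_distrib_left mult.assoc)

lemma site_op_matrix_diff: "site_op x (M - N) F l = site_op x M F l - site_op x N F l"
  by (simp add: site_op_def sum_subtractf left_diff_distrib)

lemma site_op_zero [simp]: "site_op x 0 F = (\<lambda>l. 0)" "site_op x M (\<lambda>l. 0) = (\<lambda>l. 0)"
  by (simp_all add: site_op_def)

lemma site_op_add: "site_op x M (\<lambda>l. F l + H l) = (\<lambda>l. site_op x M F l + site_op x M H l)"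
  by (simp add: site_op_def sum.distrib distrib_left)

lemma site_op_scale: "site_op x M (\<lambda>l. c * F l) = (\<lambda>l. c * site_op x M F l)"
  by (simp add: site_op_def sum_distrib_left mult_ac)

text \<open>The algebra generated by the one-site operators on \<open>S\<close>. It keeps track of
  where an operator acts when no formula for it is at hand; only linearity and commutation across
  disjoint regions are used.\<close>

inductive_set local_ops :: "'s set \<Rightarrow> ((('s \<Rightarrow> 'x::finite) \<Rightarrow> complex) \<Rightarrow> ('s \<Rightarrow> 'x) \<Rightarrow> complex) set" for S where
  site: "x \<in> S \<Longrightarrow> site_op x M \<in> local_ops S"
| ident: "(\<lambda>F. F) \<in> local_ops S"
| comp: "f \<in> local_ops S \<Longrightarrow> g \<in> local_ops S \<Longrightarrow> (\<lambda>F. f (g F)) \<in> local_ops S"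
| plus: "f \<in> local_ops S \<Longrightarrow> g \<in> local_ops S \<Longrightarrow> (\<lambda>F l. f F l + g F l) \<in> local_ops S"
| times: "f \<in> local_ops S \<Longrightarrow> (\<lambda>F l. c * f F l) \<in> local_ops S"

lemma local_ops_linear:
  assumes "f \<in> local_ops S"
  shows "f (\<lambda>l. F l + H l) = (\<lambda>l. f F l + f H l)" "f (\<lambda>l. c * F l) = (\<lambda>l. c * f F l)"
proof -
  have "(\<forall>F H. f (\<lambda>l. F l + H l) = (\<lambda>l. f F l + f H l)) \<and> (\<forall>F c. f (\<lambda>l. c * F l) = (\<lambda>l. c * f F l))"
    using assms by induction (auto simp: site_op_add site_op_scale algebra_simps)
  then show "f (\<lambda>l. F l + H l) = (\<lambda>l. f F l + f H l)" "f (\<lambda>l. c * F l) = (\<lambda>l. c * f F l)" by blast+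
qed

lemma local_ops_zero: "f \<in> local_ops S \<Longrightarrow> f (\<lambda>l. 0) = (\<lambda>l. 0)"
  using local_ops_linear(2)[of f S 0 "\<lambda>l. 0"] by simp

lemma local_ops_apply_sum:
  assumes "f \<in> local_ops S" shows "f (\<lambda>l. \<Sum>i\<in>I. F i l) = (\<lambda>l. \<Sum>i\<in>I. f (F i) l)"
  by (induction I rule: infinite_finite_induct)
    (simp_all add: local_ops_zero[OF assms] local_ops_linear(1)[OF assms])

lemma local_ops_null: "(\<lambda>F l. 0) \<in> local_ops S"
  using local_ops.times[OF local_ops.ident, of 0 S] by simp

lemma local_ops_sum:
  assumes "\<And>i. i \<in> I \<Longrightarrow> f i \<in> local_ops S" shows "(\<lambda>F l. \<Sum>i\<in>I. f i F l) \<in> local_ops S"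
  using assms
  by (induction I rule: infinite_finite_induct) (auto simp: local_ops_null intro: local_ops.plus)

lemma local_ops_mono:
  assumes "f \<in> local_ops S" "S \<subseteq> T" shows "f \<in> local_ops T"
  using assms by induction (auto intro: local_ops.intros)

lemma local_ops_site_op_comm:
  assumes "f \<in> local_ops S" "y \<notin> S" shows "f (site_op y N F) = site_op y N (f F)"
  using assms
proof (induction arbitrary: F)
  case (site x M)
  then show ?case by (metis site_op_comm)
qed (simp_all add: site_op_add site_op_scale)

lemma local_ops_comm:
  assumes f: "f \<in> local_ops S" and g: "g \<in> local_ops T" and "S \<inter> T = {}"
  shows "f (g F) = g (f F)"
  using g assms(3)
proof (induction arbitrary: F)
  case (site x M)
  then show ?case using local_ops_site_op_comm[OF f, of x M F] by blast
qed (simp_all add: local_ops_linear[OF f])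

definition sites_op :: "'s set \<Rightarrow> ('s \<Rightarrow> complex^'x^'x) \<Rightarrow> (('s \<Rightarrow> 'x::finite) \<Rightarrow> complex) \<Rightarrow> ('s \<Rightarrow> 'x) \<Rightarrow> complex" where
  "sites_op S M F = (\<lambda>l. \<Sum>m\<in>S \<rightarrow>\<^sub>E UNIV. (\<Prod>x\<in>S. M x $ l x $ m x) * F (\<lambda>x. if x \<in> S then m x else l x))"

lemma sites_op_empty [simp]: "sites_op {} M F = F"
  by (simp add: sites_op_def)

lemma sites_op_insert:
  assumes "finite S" "x \<notin> S"
  shows "sites_op (insert x S) M F = site_op x (M x) (sites_op S M F)"
proof
  fix l
  let ?T = "UNIV \<times> (S \<rightarrow>\<^sub>E UNIV)"
  have "sites_op (insert x S) M F l = (\<Sum>m\<in>(\<lambda>(y, g). g(x := y)) ` ?T.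
      (\<Prod>z\<in>insert x S. M z $ l z $ m z) * F (\<lambda>z. if z \<in> insert x S then m z else l z))"
    by (simp add: sites_op_def PiE_insert_eq)
  also have "\<dots> = (\<Sum>(y, g)\<in>?T. (\<Prod>z\<in>insert x S. M z $ l z $ (g(x := y)) z) *
      F (\<lambda>z. if z \<in> insert x S then (g(x := y)) z else l z))"
    by (subst sum.reindex[OF inj_combinator[OF assms(2)]]) (simp add: split_def)
  also have "\<dots> = (\<Sum>(y, g)\<in>?T. M x $ l x $ y * ((\<Prod>z\<in>S. M z $ (l(x := y)) z $ g z) *
      F (\<lambda>z. if z \<in> S then g z else (l(x := y)) z)))"
  proof (rule sum.cong[OF refl], clarify)
    fix y g
    have 1: "(\<Prod>z\<in>S. M z $ l z $ (g(x := y)) z) = (\<Prod>z\<in>S. M z $ (l(x := y)) z $ g z)"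
      using assms(2) by (intro prod.cong) auto
    have 2: "(\<lambda>z. if z \<in> insert x S then (g(x := y)) z else l z) = (\<lambda>z. if z \<in> S then g z else (l(x := y)) z)"
      using assms(2) by auto
    show "(\<Prod>z\<in>insert x S. M z $ l z $ (g(x := y)) z) * F (\<lambda>z. if z \<in> insert x S then (g(x := y)) z else l z)
       = M x $ l x $ y * ((\<Prod>z\<in>S. M z $ (l(x := y)) z $ g z) * F (\<lambda>z. if z \<in> S then g z else (l(x := y)) z))"
      unfolding prod.insert[OF assms] 1 2 by (simp add: mult.assoc)
  qed
  also have "\<dots> = site_op x (M x) (sites_op S M F) l"
    unfolding site_op_def sites_op_def sum_distrib_left by (rule sum.cartesian_product[symmetric])
  finally show "sites_op (insert x S) M F l = site_op x (M x) (sites_op S M F) l" .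
qed

lemma sites_op_local_ops: "finite S \<Longrightarrow> sites_op S M \<in> local_ops S"
proof (induction S rule: finite_induct)
  case empty
  have "sites_op {} M = (\<lambda>F. F)" by (intro ext) simp
  then show ?case using local_ops.ident by simp
next
  case (insert x S)
  have "sites_op (insert x S) M = (\<lambda>F. site_op x (M x) (sites_op S M F))"
    using insert by (intro ext) (simp add: sites_op_insert)
  moreover have "sites_op S M \<in> local_ops (insert x S)" using insert.IH by (rule local_ops_mono) auto
  ultimately show ?case by (simp add: local_ops.site local_ops.comp)
qed

lemma sites_op_site_op_comm: "finite S \<Longrightarrow> y \<notin> S \<Longrightarrow> sites_op S M (site_op y N F) = site_op y N (sites_op S M F)"
  by (rule local_ops_site_op_comm[OF sites_op_local_ops])

lemma sites_op_sites_op: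
  assumes "finite S" shows "sites_op S M (sites_op S N F) = sites_op S (\<lambda>x. M x ** N x) F"
  using assms
proof (induction S arbitrary: F rule: finite_induct)
  case (insert x S)
  have "sites_op (insert x S) M (sites_op (insert x S) N F) = site_op x (M x) (site_op x (N x) (sites_op S M (sites_op S N F)))"
    using insert.hyps by (simp add: sites_op_insert sites_op_site_op_comm)
  then show ?case using insert by (simp add: sites_op_insert site_op_site_op)
qed simp

lemma sites_op_union:
  assumes "finite S" "finite T" "S \<inter> T = {}"
  shows "sites_op (S \<union> T) M F = sites_op S M (sites_op T M F)"
  using assms(1,3)
proof (induction S rule: finite_induct)
  case (insert x S)
  then show ?case using assms(2) by (simp add: sites_op_insert)
qed simp

lemma sites_op_split:
  assumes "finite S" "x \<in> S"
  shows "sites_op S M F = site_op x (M x) (sites_op (S - {x}) M F)"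
  using sites_op_insert[of "S - {x}" x M F] assms by (simp add: insert_absorb)

lemma sites_op_cong:
  assumes "\<And>x. x \<in> S \<Longrightarrow> M x = N x" shows "sites_op S M F = sites_op S N F"
  using assms by (simp add: sites_op_def)

lemma sites_op_mat1 [simp]: "finite S \<Longrightarrow> sites_op S (\<lambda>x. mat 1) F = F"
  by (induction S arbitrary: F rule: finite_induct) (simp_all add: sites_op_insert)

lemma site_contract:
  fixes C :: "'s \<Rightarrow> complex^'b::finite^'a" and D :: "'s \<Rightarrow> complex^'c::finite^'b"
  assumes S: "finite S"
  shows "(\<Sum>s\<in>S \<rightarrow>\<^sub>E UNIV. (\<Prod>x\<in>S. C x $ l x $ s x) * (\<Sum>t\<in>S \<rightarrow>\<^sub>E UNIV. (\<Prod>x\<in>S. D x $ s x $ t x) * F t))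
    = (\<Sum>t\<in>S \<rightarrow>\<^sub>E UNIV. (\<Prod>x\<in>S. (C x ** D x) $ l x $ t x) * F t)"
proof -
  have "(\<Sum>s\<in>S \<rightarrow>\<^sub>E UNIV. (\<Prod>x\<in>S. C x $ l x $ s x) * (\<Sum>t\<in>S \<rightarrow>\<^sub>E UNIV. (\<Prod>x\<in>S. D x $ s x $ t x) * F t))
    = (\<Sum>s\<in>S \<rightarrow>\<^sub>E UNIV. \<Sum>t\<in>S \<rightarrow>\<^sub>E UNIV. (\<Prod>x\<in>S. C x $ l x $ s x * D x $ s x $ t x) * F t)"
    by (simp add: sum_distrib_left prod.distrib mult.assoc)
  also have "\<dots> = (\<Sum>t\<in>S \<rightarrow>\<^sub>E UNIV. (\<Sum>s\<in>S \<rightarrow>\<^sub>E UNIV. \<Prod>x\<in>S. C x $ l x $ s x * D x $ s x $ t x) * F t)"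
    by (subst sum.swap) (simp add: sum_distrib_right)
  also have "\<dots> = (\<Sum>t\<in>S \<rightarrow>\<^sub>E UNIV. (\<Prod>x\<in>S. (C x ** D x) $ l x $ t x) * F t)"
    using S by (simp add: mmult_nth prod_sum_PiE)
  finally show ?thesis .
qed

section \<open>The torus state as local tensors applied to entangled bonds\<close>

definition below :: "nat \<Rightarrow> nat \<times> nat \<Rightarrow> nat \<times> nat" where
  "below M = (\<lambda>(i, j). (i, (j + M - 1) mod M))"

definition left_of :: "nat \<Rightarrow> nat \<times> nat \<Rightarrow> nat \<times> nat" where
  "left_of N = (\<lambda>(i, j). ((i + N - 1) mod N, j))"

text \<open>Legs are numbered \<open>0, 1, 2, 3\<close> for up, right, down, left.\<close>

definition leg :: "nat \<Rightarrow> 'n legs \<Rightarrow> 'n" where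
  "leg k = (\<lambda>(a, b, c, d). if k = 0 then a else if k = 1 then b else if k = 2 then c else d)"

definition set_leg :: "nat \<Rightarrow> 'n legs \<Rightarrow> 'n \<Rightarrow> 'n legs" where
  "set_leg k = (\<lambda>(a, b, c, d) z. if k = 0 then (z, b, c, d) else if k = 1 then (a, z, c, d)
     else if k = 2 then (a, b, z, d) else (a, b, c, z))"

lemma leg_simps [simp]: "leg 0 (a, b, c, d) = a" "leg (Suc 0) (a, b, c, d) = b" "leg 1 (a, b, c, d) = b"
  "leg 2 (a, b, c, d) = c" "leg 3 (a, b, c, d) = d"
  by (simp_all add: leg_def)

lemma leg_set_leg: "k < 4 \<Longrightarrow> k' < 4 \<Longrightarrow> leg k (set_leg k' m z) = (if k = k' then z else leg k m)"
  by (cases m) (auto simp: leg_def set_leg_def)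

definition bonds :: "nat \<Rightarrow> nat \<Rightarrow> (((nat \<times> nat) \<times> nat) \<times> ((nat \<times> nat) \<times> nat)) set" where
  "bonds N M = (\<lambda>x. ((below M x, 0), (x, 2))) ` sites N M \<union> (\<lambda>x. ((left_of N x, 1), (x, 3))) ` sites N M"

text \<open>The state obtained from \<open>A = 1\<close>: neighbouring legs are maximally entangled.\<close>

definition bond_state :: "nat \<Rightarrow> nat \<Rightarrow> (nat \<times> nat \<Rightarrow> 'n legs) \<Rightarrow> complex" where
  "bond_state N M l = (if \<forall>((y, k), (x, k'))\<in>bonds N M. leg k (l y) = leg k' (l x) then 1 else 0)"

lemma bond_state_iff: "bond_state N M l = (if \<forall>x\<in>sites N M. leg 0 (l (below M x)) = leg 2 (l x) \<and> leg 1 (l (left_of N x)) = leg 3 (l x) then 1 else 0)"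
  by (simp only: bond_state_def bonds_def ball_Un ball_simps split_conv) (rule if_cong, auto)

lemma below_left_of_sites: "x \<in> sites N M \<Longrightarrow> below M x \<in> sites N M" "x \<in> sites N M \<Longrightarrow> left_of N x \<in> sites N M"
  by (auto simp: sites_def below_def left_of_def)

lemma finite_sites [simp]: "finite (sites N M)"
  by (simp add: sites_def)

text \<open>A sum over bond values equals a sum over all leg values restricted to those that agree
  along each bond; \<open>e\<close> and \<open>j\<close> translate between the two
  descriptions.\<close>

lemma peps_state_bond_state:
  fixes A :: "('n::finite, 'p::finite) tensor"
  shows "peps_state N M A s = (\<Sum>l\<in>configs N M. (\<Prod>x\<in>sites N M. A $ s x $ l x) * bond_state N M l)"
proof -
  let ?S = "sites N M"
  define e where "e h v = restrict (\<lambda>x. (v x, h x, v (below M x), h (left_of N x))) ?S" for h v :: "nat \<times> nat \<Rightarrow> 'n"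
  let ?B = "{l :: nat \<times> nat \<Rightarrow> 'n legs. l \<in> configs N M \<and> bond_state N M l = 1}"
  have fin: "finite (configs N M :: (nat \<times> nat \<Rightarrow> 'n legs) set)" unfolding configs_def by (simp add: finite_PiE)
  have "(\<Sum>l\<in>configs N M. (\<Prod>x\<in>?S. A $ s x $ l x) * bond_state N M l) = (\<Sum>l\<in>?B. \<Prod>x\<in>?S. A $ s x $ l x)"
    using fin by (intro sum.mono_neutral_cong_right) (auto simp: bond_state_def split: if_splits)
  also have "\<dots> = (\<Sum>(h, v)\<in>configs N M \<times> configs N M. \<Prod>x\<in>?S. A $ s x $ e h v x)"
  proof -
    define j where "j l = (restrict (\<lambda>x. leg 1 (l x)) ?S, restrict (\<lambda>x. leg 0 (l x)) ?S)" for l :: "nat \<times> nat \<Rightarrow> 'n legs"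
    have ej: "e (fst (j l)) (snd (j l)) = l" if l: "l \<in> ?B" for l
    proof
      fix x
      show "e (fst (j l)) (snd (j l)) x = l x"
      proof (cases "x \<in> ?S")
        case True
        have "leg 0 (l (below M x)) = leg 2 (l x)" "leg 1 (l (left_of N x)) = leg 3 (l x)"
          using l True by (auto simp: bond_state_iff split: if_splits)
        then show ?thesis using True below_left_of_sites[OF True]
          by (cases "l x") (simp add: e_def j_def)
      next
        case False
        then show ?thesis using l by (cases x) (auto simp: e_def configs_def PiE_def extensional_def)
      qed
    qed
    have jB: "j l \<in> configs N M \<times> configs N M" for l
      by (auto simp: configs_def j_def)
    have je: "j (e (fst z) (snd z)) = z" if "z \<in> configs N M \<times> configs N M" for z
    proof -
      obtain h v where hv: "z = (h, v)" "h \<in> configs N M" "v \<in> configs N M" using \<open>z \<in> _\<close> by (cases z) auto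
      have "restrict h ?S = h" "restrict v ?S = v"
        using hv by (auto simp: configs_def PiE_restrict)
      then show ?thesis by (simp add: hv e_def j_def cong: restrict_cong)
    qed
    have eB: "e h v \<in> ?B" for h v
      using below_left_of_sites by (auto simp: e_def configs_def bond_state_iff)
    show ?thesis
      unfolding split_def
    proof (rule sum.reindex_bij_witness[of _ "\<lambda>z. e (fst z) (snd z)" j])
      fix l assume l: "l \<in> ?B"
      show "e (fst (j l)) (snd (j l)) = l" by (rule ej[OF l])
      show "j l \<in> configs N M \<times> configs N M" by (rule jB)
      show "(\<Prod>x\<in>?S. A $ s x $ e (fst (j l)) (snd (j l)) x) = (\<Prod>x\<in>?S. A $ s x $ l x)"
        by (simp only: ej[OF l])
    qed (rule je eB, assumption?)+
  qed
  also have "\<dots> = (\<Sum>h\<in>configs N M. \<Sum>v\<in>configs N M. \<Prod>x\<in>?S. A $ s x $ e h v x)"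
    by (rule sum.cartesian_product[symmetric])
  also have "\<dots> = peps_state N M A s"
    unfolding peps_state_def
    by (intro sum.cong prod.cong refl) (auto simp: e_def below_def left_of_def)
  finally show ?thesis by simp
qed

text \<open>The free matrices \<open>C x\<close> lead from the physical index back to virtual legs.
  The symmetry of the physical state thereby becomes an identity between operators on the bond
  state, and a different \<open>C x\<close> may be chosen at each site.\<close>

lemma peps_symmetry_sites_op:
  fixes A :: "('n::finite, 'p::finite) tensor" and U :: "complex^'p^'p" and C :: "nat \<times> nat \<Rightarrow> complex^'p^'n legs"
  assumes sym: "\<And>s. s \<in> configs N M \<Longrightarrow> onsite_apply N M U (peps_state N M A) s = peps_state N M A s"
  shows "sites_op (sites N M) (\<lambda>x. C x ** U ** A) (bond_state N M) = sites_op (sites N M) (\<lambda>x. C x ** A) (bond_state N M)"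
proof
  fix l :: "nat \<times> nat \<Rightarrow> 'n legs"
  let ?S = "sites N M"
  have bond_state: "bond_state N M (\<lambda>x. if x \<in> ?S then m x else l x) = (bond_state N M m :: complex)" for m
    unfolding bond_state_iff using below_left_of_sites by auto
  have st: "peps_state N M A s = (\<Sum>l\<in>?S \<rightarrow>\<^sub>E UNIV. (\<Prod>x\<in>?S. A $ s x $ l x) * bond_state N M l)" for s
    by (simp add: peps_state_bond_state configs_def)
  have "sites_op ?S (\<lambda>x. C x ** U ** A) (bond_state N M) l
     = (\<Sum>s\<in>?S \<rightarrow>\<^sub>E UNIV. (\<Prod>x\<in>?S. (C x ** U) $ l x $ s x) * peps_state N M A s)"
    unfolding sites_op_def bond_state st site_contract[OF finite_sites] ..
  also have "\<dots> = (\<Sum>s\<in>?S \<rightarrow>\<^sub>E UNIV. (\<Prod>x\<in>?S. C x $ l x $ s x) * onsite_apply N M U (peps_state N M A) s)"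
    unfolding onsite_apply_def configs_def site_contract[OF finite_sites] ..
  also have "\<dots> = (\<Sum>s\<in>?S \<rightarrow>\<^sub>E UNIV. (\<Prod>x\<in>?S. C x $ l x $ s x) * peps_state N M A s)"
    by (intro sum.cong refl) (simp add: sym configs_def)
  also have "\<dots> = sites_op ?S (\<lambda>x. C x ** A) (bond_state N M) l"
    unfolding sites_op_def bond_state st site_contract[OF finite_sites] ..
  finally show "sites_op ?S (\<lambda>x. C x ** U ** A) (bond_state N M) l = sites_op ?S (\<lambda>x. C x ** A) (bond_state N M) l" .
qed

section \<open>Operators acting on single legs\<close>

definition leg_prod :: "(nat \<Rightarrow> complex^'n^'n) \<Rightarrow> complex^'n legs^'n legs" where
  "leg_prod f = kron4 (f 0) (f 1) (f 2) (f 3)"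

lemma leg_prod_nth: "leg_prod f $ (a, b, c, d) $ (a', b', c', d') = f 0 $ a $ a' * f 1 $ b $ b' * f 2 $ c $ c' * f 3 $ d $ d'"
  by (simp add: leg_prod_def kron4_def)

lemma leg_prod_cong: "(\<And>k. k < 4 \<Longrightarrow> f k = g k) \<Longrightarrow> leg_prod f = leg_prod g"
  by (simp add: leg_prod_def)

lemma sum_legs: "(\<Sum>m\<in>(UNIV :: ('n::finite) legs set). f m) = (\<Sum>a\<in>UNIV. \<Sum>b\<in>UNIV. \<Sum>c\<in>UNIV. \<Sum>d\<in>UNIV. f (a, b, c, d))"
  by (simp add: sum.cartesian_product split_def flip: UNIV_Times_UNIV)

lemma sum_product4:
  fixes f :: "'a::finite \<Rightarrow> complex" and g :: "'b::finite \<Rightarrow> complex" and h :: "'c::finite \<Rightarrow> complex" and k :: "'d::finite \<Rightarrow> complex"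
  shows "(\<Sum>a\<in>UNIV. \<Sum>b\<in>UNIV. \<Sum>c\<in>UNIV. \<Sum>d\<in>UNIV. f a * g b * h c * k d)
    = (\<Sum>a\<in>UNIV. f a) * (\<Sum>b\<in>UNIV. g b) * (\<Sum>c\<in>UNIV. h c) * (\<Sum>d\<in>UNIV. k d)"
  by (simp flip: sum_distrib_left sum_distrib_right)

lemma leg_prod_mult:
  fixes f g :: "nat \<Rightarrow> complex^'n^'n"
  shows "leg_prod f ** leg_prod g = leg_prod (\<lambda>k. f k ** g k)"
proof (rule matrix_eqI)
  fix i j :: "'n legs"
  obtain a b c d where i: "i = (a, b, c, d)" by (cases i)
  obtain a' b' c' d' where j: "j = (a', b', c', d')" by (cases j)
  have "(leg_prod f ** leg_prod g) $ i $ j = (\<Sum>x\<in>UNIV. \<Sum>y\<in>UNIV. \<Sum>z\<in>UNIV. \<Sum>t\<in>UNIV.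
      (f 0 $ a $ x * g 0 $ x $ a') * (f 1 $ b $ y * g 1 $ y $ b') * (f 2 $ c $ z * g 2 $ z $ c') * (f 3 $ d $ t * g 3 $ t $ d'))"
    unfolding mmult_nth sum_legs i j leg_prod_nth by (intro sum.cong refl) (simp add: mult_ac)
  then show "(leg_prod f ** leg_prod g) $ i $ j = leg_prod (\<lambda>k. f k ** g k) $ i $ j"
    unfolding sum_product4 i j leg_prod_nth by (simp add: mmult_nth)
qed

lemma leg_prod_one: "leg_prod (\<lambda>k. mat 1 :: complex^'n^'n) = mat 1"
proof (rule matrix_eqI)
  fix i j :: "'n legs"
  show "leg_prod (\<lambda>k. mat 1 :: complex^'n^'n) $ i $ j = mat 1 $ i $ j"
    by (cases i; cases j) (simp add: leg_prod_nth mat_def)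
qed

definition leg_op :: "nat \<Rightarrow> complex^'n^'n \<Rightarrow> complex^'n legs^'n legs" where
  "leg_op k a = leg_prod ((\<lambda>_. mat 1)(k := a))"

lemma leg_op_mult: "leg_op k a ** leg_op k b = leg_op k (a ** b)"
  unfolding leg_op_def leg_prod_mult by (rule leg_prod_cong) simp

lemma leg_op_comm: "k \<noteq> k' \<Longrightarrow> leg_op k a ** leg_op k' b = leg_op k' b ** leg_op k a"
  unfolding leg_op_def leg_prod_mult by (rule leg_prod_cong) simp

lemma leg_op_one [simp]: "leg_op k (mat 1 :: complex^'n^'n) = mat 1"
proof -
  have "(\<lambda>_. mat 1)(k := mat 1) = (\<lambda>_. mat 1 :: complex^'n^'n)" by auto
  then show ?thesis by (simp only: leg_op_def leg_prod_one)
qed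

lemma leg_op_linear:
  fixes a :: "complex^'n^'n" and f :: "'i \<Rightarrow> complex^'n^'n"
  assumes "k < 4"
  shows "leg_op k (\<Sum>i\<in>I. f i) = (\<Sum>i\<in>I. leg_op k (f i))" "leg_op k (c *m a) = c *m leg_op k a"
proof -
  have k: "k = 0 \<or> k = 1 \<or> k = 2 \<or> k = 3" using assms by auto
  show "leg_op k (\<Sum>i\<in>I. f i) = (\<Sum>i\<in>I. leg_op k (f i))"
  proof (rule matrix_eqI)
    fix i j :: "'n legs"
    obtain a b c d where i: "i = (a, b, c, d)" by (cases i)
    obtain a' b' c' d' where j: "j = (a', b', c', d')" by (cases j)
    show "leg_op k (\<Sum>i\<in>I. f i) $ i $ j = (\<Sum>i\<in>I. leg_op k (f i)) $ i $ j"
      using k by (auto simp: i j leg_op_def leg_prod_nth sum_distrib_left sum_distrib_right)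
  qed
  show "leg_op k (c *m a) = c *m leg_op k a"
  proof (rule matrix_eqI)
    fix i j :: "'n legs"
    obtain a1 b c1 d where i: "i = (a1, b, c1, d)" by (cases i)
    obtain a' b' c' d' where j: "j = (a', b', c', d')" by (cases j)
    show "leg_op k (c *m a) $ i $ j = (c *m leg_op k a) $ i $ j"
      using k by (auto simp: i j leg_op_def leg_prod_nth)
  qed
qed

lemma leg_op_nth: "k < 4 \<Longrightarrow> leg_op k a $ m $ m' = (if m' = set_leg k m (leg k m') then a $ leg k m $ leg k m' else 0)"
  by (cases m; cases m') (auto simp: leg_op_def leg_prod_nth leg_def set_leg_def mat_def)

lemma site_op_leg_op:
  assumes "k < 4"
  shows "site_op x (leg_op k a) F l = (\<Sum>z\<in>UNIV. a $ leg k (l x) $ z * F (l(x := set_leg k (l x) z)))"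
proof -
  have "site_op x (leg_op k a) F l = (\<Sum>m\<in>UNIV. if m = set_leg k (l x) (leg k m) then a $ leg k (l x) $ leg k m * F (l(x := m)) else 0)"
    unfolding site_op_def by (intro sum.cong refl) (simp add: leg_op_nth[OF assms])
  also have "\<dots> = (\<Sum>m\<in>{m. m = set_leg k (l x) (leg k m)}. a $ leg k (l x) $ leg k m * F (l(x := m)))"
    by (simp add: sum.If_cases)
  also have "\<dots> = (\<Sum>z\<in>UNIV. a $ leg k (l x) $ z * F (l(x := set_leg k (l x) z)))"
    by (rule sum.reindex_bij_witness[of _ "\<lambda>z. set_leg k (l x) z" "leg k"]) (use assms in \<open>auto simp: leg_set_leg\<close>)
  finally show ?thesis .
qed

text \<open>The transpose rule for a maximally entangled pair, stated as a property of the state so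
  that it survives operators applied at other sites.\<close>

definition bonded :: "(('s \<Rightarrow> ('n::finite) legs) \<Rightarrow> complex) \<Rightarrow> 's \<Rightarrow> nat \<Rightarrow> 's \<Rightarrow> nat \<Rightarrow> bool" where
  "bonded F y k x k' \<longleftrightarrow> (\<forall>a. site_op y (leg_op k a) F = site_op x (leg_op k' (transpose a)) F)"

lemma bonded_sym: "bonded F y k x k' \<Longrightarrow> bonded F x k' y k"
  unfolding bonded_def by (metis transpose_transpose)

lemma bonded_site_op: "bonded F y k x k' \<Longrightarrow> z \<noteq> x \<Longrightarrow> z \<noteq> y \<Longrightarrow> bonded (site_op z M F) y k x k'"
  unfolding bonded_def by (simp add: site_op_comm[of _ z])

text \<open>No other bond touches the two legs, so the remaining constraints \<open>W\<close> do not
  notice a change of them. Both sides then reduce to the one matrix entry selected by this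
  bond.\<close>

lemma bonded_bond_state:
  fixes F :: "('s \<Rightarrow> ('n::finite) legs) \<Rightarrow> complex"
  assumes b: "((y, k), (x, k')) \<in> B" and k: "k < 4" "k' < 4" and xy: "x \<noteq> y"
    and B4: "\<And>y' j x' j'. ((y', j), (x', j')) \<in> B \<Longrightarrow> j < 4 \<and> j' < 4"
    and uniq: "\<And>y' j x' j'. ((y', j), (x', j')) \<in> B \<Longrightarrow> ((y', j), (x', j')) \<noteq> ((y, k), (x, k')) \<Longrightarrow>
        (y', j) \<notin> {(y, k), (x, k')} \<and> (x', j') \<notin> {(y, k), (x, k')}"
    and F: "\<And>l. F l = (if \<forall>((y, k), (x, k'))\<in>B. leg k (l y) = leg k' (l x) then 1 else 0)"
  shows "bonded F y k x k'"
proof -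
  define W where "W l \<longleftrightarrow> (\<forall>e\<in>B - {((y, k), (x, k'))}. leg (snd (fst e)) (l (fst (fst e))) = leg (snd (snd e)) (l (fst (snd e))))"
    for l :: "'s \<Rightarrow> 'n legs"
  have F': "F l = (if leg k (l y) = leg k' (l x) \<and> W l then 1 else 0)" for l
  proof -
    have "insert ((y, k), (x, k')) (B - {((y, k), (x, k'))}) = B" using b by auto
    then have "(\<forall>e\<in>B. P e) \<longleftrightarrow> P ((y, k), (x, k')) \<and> (\<forall>e\<in>B - {((y, k), (x, k'))}. P e)" for P
      using ball_simps(7)[of "((y, k), (x, k'))" "B - {((y, k), (x, k'))}" P] by simp
    then show ?thesis unfolding F W_def split_def by simp
  qed
  have gy: "leg j ((l(y := set_leg k (l y) z)) w) = leg j (l w)" if "(w, j) \<noteq> (y, k)" "j < 4" for l z w j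
    using that k by (auto simp: leg_set_leg)
  have gx: "leg j ((l(x := set_leg k' (l x) z)) w) = leg j (l w)" if "(w, j) \<noteq> (x, k')" "j < 4" for l z w j
    using that k by (auto simp: leg_set_leg)
  have other: "(fst (fst e), snd (fst e)) \<notin> {(y, k), (x, k')}" "(fst (snd e), snd (snd e)) \<notin> {(y, k), (x, k')}"
    "snd (fst e) < 4" "snd (snd e) < 4" if e: "e \<in> B - {((y, k), (x, k'))}" for e
    using e uniq[of "fst (fst e)" "snd (fst e)" "fst (snd e)" "snd (snd e)"]
      B4[of "fst (fst e)" "snd (fst e)" "fst (snd e)" "snd (snd e)"] by auto
  have Wy: "W (l(y := set_leg k (l y) z)) = W l" for l z
    unfolding W_def
  proof (rule ball_cong[OF refl])
    fix e assume e: "e \<in> B - {((y, k), (x, k'))}"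
    note o = other[OF e]
    show "(leg (snd (fst e)) ((l(y := set_leg k (l y) z)) (fst (fst e))) = leg (snd (snd e)) ((l(y := set_leg k (l y) z)) (fst (snd e))))
      = (leg (snd (fst e)) (l (fst (fst e))) = leg (snd (snd e)) (l (fst (snd e))))"
      using o by (subst (1 2) gy) auto
  qed
  have Wx: "W (l(x := set_leg k' (l x) z)) = W l" for l z
    unfolding W_def
  proof (rule ball_cong[OF refl])
    fix e assume e: "e \<in> B - {((y, k), (x, k'))}"
    note o = other[OF e]
    show "(leg (snd (fst e)) ((l(x := set_leg k' (l x) z)) (fst (fst e))) = leg (snd (snd e)) ((l(x := set_leg k' (l x) z)) (fst (snd e))))
      = (leg (snd (fst e)) (l (fst (fst e))) = leg (snd (snd e)) (l (fst (snd e))))"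
      using o by (subst (1 2) gx) auto
  qed
  have Fy: "F (l(y := set_leg k (l y) z)) = (if z = leg k' (l x) then if W l then 1 else 0 else 0)" for l z
    unfolding F' Wy using k xy by (simp add: leg_set_leg)
  have Fx: "F (l(x := set_leg k' (l x) z)) = (if z = leg k (l y) then if W l then 1 else 0 else 0)" for l z
    unfolding F' Wx using k xy by (auto simp: leg_set_leg)
  show ?thesis
    unfolding bonded_def
  proof (intro allI ext)
    fix a l
    have "site_op y (leg_op k a) F l = (\<Sum>z\<in>UNIV. if z = leg k' (l x) then if W l then a $ leg k (l y) $ z else 0 else 0)"
      unfolding site_op_leg_op[OF k(1)] Fy by (intro sum.cong refl) auto
    also have "\<dots> = (\<Sum>z\<in>UNIV. if z = leg k (l y) then if W l then transpose a $ leg k' (l x) $ z else 0 else 0)"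
      by (simp add: transpose_def)
    also have "\<dots> = site_op x (leg_op k' (transpose a)) F l"
      unfolding site_op_leg_op[OF k(2)] Fx by (intro sum.cong refl) auto
    finally show "site_op y (leg_op k a) F l = site_op x (leg_op k' (transpose a)) F l" .
  qed
qed

section \<open>Moving operators across the torus\<close>

lemma transpose_linear:
  "transpose (\<Sum>i\<in>I. f i :: complex^'n^'m) = (\<Sum>i\<in>I. transpose (f i))" "transpose (c *m X) = c *m transpose X"
  by (auto intro!: matrix_eqI simp: transpose_def)

definition leg_tr :: "nat \<Rightarrow> complex^'n^'n \<Rightarrow> complex^'n^'n" where
  "leg_tr k Y = (if k < 2 then Y else transpose Y)"

lemma leg_tr_linear: "leg_tr k (\<Sum>i\<in>I. f i) = (\<Sum>i\<in>I. leg_tr k (f i))" "leg_tr k (c *m X) = c *m leg_tr k X"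
  by (simp_all add: leg_tr_def transpose_linear)

text \<open>The blocks \<open>X\<close> as an operator on the legs \<open>k1\<close>, \<open>k2\<close>; on the dual legs matrices act by their
  transposes.\<close>

definition leg_pair_op :: "nat \<Rightarrow> nat \<Rightarrow> ('n \<Rightarrow> 'n \<Rightarrow> complex^'n^'n) \<Rightarrow> complex^('n::finite) legs^'n legs" where
  "leg_pair_op k1 k2 X = (\<Sum>a\<in>UNIV. \<Sum>b\<in>UNIV. leg_op k1 (leg_tr k1 (munit a b)) ** leg_op k2 (leg_tr k2 (X a b)))"

context delta_rep
begin

text \<open>The dual legs carry the contragredient representation, which makes the two ends of a
  bond cancel.\<close>

definition leg_rep :: "nat \<Rightarrow> 'g \<Rightarrow> complex^'n^'n" where
  "leg_rep k g = (if k < 2 then u g else transpose (u (inv g)))"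

lemma leg_rep_mult: "g \<in> carrier G \<Longrightarrow> h \<in> carrier G \<Longrightarrow> leg_rep k g ** leg_rep k h = leg_rep k (g \<otimes> h)"
  by (simp add: leg_rep_def u_mult inv_mult_group matrix_transpose_mul)

lemma leg_rep_one [simp]: "leg_rep k \<one> = mat 1"
  by (simp add: leg_rep_def u_one)

lemma leg_rep_opposite:
  "g \<in> carrier G \<Longrightarrow> (k < 2) \<noteq> (k' < 2) \<Longrightarrow> transpose (leg_rep k' g) = leg_rep k (inv g)"
  by (auto simp: leg_rep_def)

lemma leg_rep_leg_tr: "g \<in> carrier G \<Longrightarrow> leg_rep k g ** leg_tr k Y ** leg_rep k (inv g) = leg_tr k (u g ** Y ** u (inv g))"
  by (simp add: leg_rep_def leg_tr_def matrix_transpose_mul matrix_mul_assoc)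

definition leg_dual :: "nat \<Rightarrow> complex^'n^'n" where
  "leg_dual k = (if k < 2 then K else transpose K)"

lemma leg_dual_delta:
  assumes "g \<in> carrier G" shows "trace (leg_dual k ** leg_rep k g) = (if g = \<one> then 1 else 0)"
proof (cases "k < 2")
  case False
  have "trace (leg_dual k ** leg_rep k g) = trace (transpose (u (inv g) ** K))"
    using False by (simp add: leg_dual_def leg_rep_def matrix_transpose_mul)
  also have "\<dots> = trace (K ** u (inv g))"
    using trace_mul_sym[of "u (inv g)" K] by (simp add: trace_def transpose_def)
  finally show ?thesis using K[of "inv g"] assms by simp
qed (simp add: leg_dual_def leg_rep_def K assms)

definition ugauge :: "'g \<Rightarrow> complex^'n legs^'n legs" where
  "ugauge g = leg_prod (\<lambda>k. leg_rep k g)"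

definition ugauge_except :: "nat \<Rightarrow> 'g \<Rightarrow> complex^'n legs^'n legs" where
  "ugauge_except k g = leg_prod ((\<lambda>k. leg_rep k g)(k := mat 1))"

lemma ugauge_ugauge_except: "ugauge g = ugauge_except k g ** leg_op k (leg_rep k g)"
  unfolding ugauge_def ugauge_except_def leg_op_def leg_prod_mult by (rule leg_prod_cong) simp

lemma ugauge_except_leg_op_comm: "ugauge_except k g ** leg_op k a = leg_op k a ** ugauge_except k g"
  unfolding ugauge_except_def leg_op_def leg_prod_mult by (rule leg_prod_cong) simp

lemma ugauge_mult: "g \<in> carrier G \<Longrightarrow> h \<in> carrier G \<Longrightarrow> ugauge g ** ugauge h = ugauge (g \<otimes> h)"
  by (simp add: ugauge_def leg_prod_mult leg_rep_mult)

lemma ugauge_one: "ugauge \<one> = mat 1"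
  by (simp add: ugauge_def leg_prod_one)

definition gproj :: "complex^'n legs^'n legs" where
  "gproj = (1 / N) *m (\<Sum>g\<in>carrier G. ugauge g)"

lemma sum_reindex_right:
  assumes "h \<in> carrier G"
  shows "(\<Sum>g\<in>carrier G. f (g \<otimes> h)) = (\<Sum>g\<in>carrier G. f g)"
  by (rule sum.reindex_bij_witness[of _ "\<lambda>g. g \<otimes> inv h" "\<lambda>g. g \<otimes> h"])
    (use assms in \<open>auto simp: m_assoc\<close>)

lemma gproj_ugauge: "g \<in> carrier G \<Longrightarrow> gproj ** ugauge g = gproj" "g \<in> carrier G \<Longrightarrow> ugauge g ** gproj = gproj"
proof -
  assume g: "g \<in> carrier G"
  show "gproj ** ugauge g = gproj"
    using g sum_reindex_right[OF g, of ugauge] by (simp add: gproj_def mmult_sum ugauge_mult)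
  show "ugauge g ** gproj = gproj"
    using g sum_reindex_left[OF g, of ugauge] by (simp add: gproj_def mmult_sum ugauge_mult)
qed

lemma gproj_idem: "gproj ** gproj = gproj"
proof -
  have "gproj ** gproj = (1 / N) *m (\<Sum>g\<in>carrier G. gproj ** ugauge g)"
    by (subst (2) gproj_def) (simp add: mmult_sum)
  also have "(\<Sum>g\<in>carrier G. gproj ** ugauge g) = N *m gproj"
    unfolding sum_const_N[symmetric] by (intro sum.cong refl) (simp add: gproj_ugauge)
  also have "(1 / N) *m (N *m gproj) = gproj" using N_nonzero by simp
  finally show ?thesis .
qed

text \<open>One average with a common group element at all sites of \<open>S\<close>, as opposed to
  the independent averages in \<open>sites_op S (\<lambda>_. gproj)\<close>.\<close>

definition joint_avg :: "'s set \<Rightarrow> (('s \<Rightarrow> 'n legs) \<Rightarrow> complex) \<Rightarrow> ('s \<Rightarrow> 'n legs) \<Rightarrow> complex" where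
  "joint_avg S F = (\<lambda>l. (1 / N) * (\<Sum>g\<in>carrier G. sites_op S (\<lambda>_. ugauge g) F l))"

lemma joint_avg_single: "joint_avg {x} F = site_op x gproj F"
proof -
  have "sites_op {x} M F = site_op x (M x) F" for M
    using sites_op_insert[of "{}" x M F] by simp
  then show ?thesis by (intro ext) (simp add: joint_avg_def gproj_def site_op_matrix_cscale site_op_matrix_sum)
qed

text \<open>Contraction of the bond between \<open>y\<close> and \<open>x\<close> with the dual functional \<open>K\<close>.\<close>

definition link_op :: "'s \<Rightarrow> nat \<Rightarrow> 's \<Rightarrow> nat \<Rightarrow> (('s \<Rightarrow> 'n legs) \<Rightarrow> complex) \<Rightarrow> ('s \<Rightarrow> 'n legs) \<Rightarrow> complex" where
  "link_op y k x k' F = (\<lambda>l. \<Sum>i\<in>UNIV. \<Sum>j\<in>UNIV. \<Sum>m\<in>UNIV.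
     leg_dual k $ m $ j * site_op y (leg_op k (munit i j)) (site_op x (leg_op k' (munit i m)) F) l)"

lemma link_op_local_ops: "link_op y k x k' \<in> local_ops {y, x}"
proof -
  have "link_op y k x k' = (\<lambda>F l. \<Sum>i\<in>UNIV. \<Sum>j\<in>UNIV. \<Sum>m\<in>UNIV.
     leg_dual k $ m $ j * site_op y (leg_op k (munit i j)) (site_op x (leg_op k' (munit i m)) F) l)"
    by (intro ext) (simp add: link_op_def)
  also have "\<dots> \<in> local_ops {y, x}"
    by (intro local_ops_sum local_ops.times local_ops.comp[of "site_op y _" _ "site_op x _"] local_ops.site) auto
  finally show ?thesis .
qed

text \<open>Through the bond both matrix units can be brought to the leg of \<open>y\<close>, where
  they enclose \<open>m\<close> and reduce it to its entries. The sum with \<open>leg_dual\<close>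
  assembles these to a trace, and the sum over \<open>i\<close> restores the identity.\<close>

lemma link_op_bonded:
  assumes b: "bonded F y k x k'" and xy: "x \<noteq> y" and k: "k < 4"
  shows "link_op y k x k' (site_op y (leg_op k m) F) = (\<lambda>l. trace (leg_dual k ** m) * F l)"
proof
  fix l
  have tm: "transpose (munit a b) = munit b a" for a b :: 'n
    by (auto intro!: matrix_eqI simp: transpose_def munit_nth)
  have 1: "site_op y (leg_op k (munit i j)) (site_op x (leg_op k' (munit i r)) (site_op y (leg_op k m) F)) l
     = m $ j $ r * site_op y (leg_op k (munit i i)) F l" for i j r
  proof -
    have "site_op y (leg_op k (munit i j)) (site_op x (leg_op k' (munit i r)) (site_op y (leg_op k m) F))
       = site_op y (leg_op k (munit i j)) (site_op y (leg_op k m) (site_op x (leg_op k' (munit i r)) F))"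
      using xy by (simp add: site_op_comm)
    also have "site_op x (leg_op k' (munit i r)) F = site_op y (leg_op k (munit r i)) F"
      using b unfolding bonded_def by (simp add: tm)
    also have "site_op y (leg_op k (munit i j)) (site_op y (leg_op k m) (site_op y (leg_op k (munit r i)) F))
        = site_op y (leg_op k (munit i j ** m ** munit r i)) F"
      by (simp add: site_op_site_op leg_op_mult matrix_mul_assoc)
    finally show ?thesis by (simp add: munit_sandwich leg_op_linear(2)[OF k] site_op_matrix_cscale)
  qed
  have "link_op y k x k' (site_op y (leg_op k m) F) l = (\<Sum>i\<in>UNIV. trace (leg_dual k ** m) * site_op y (leg_op k (munit i i)) F l)"
    unfolding link_op_def 1
  proof (rule sum.cong[OF refl])
    fix i
    have "trace (leg_dual k ** m) = (\<Sum>j\<in>UNIV. \<Sum>r\<in>UNIV. leg_dual k $ r $ j * m $ j $ r)"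
      unfolding trace_mult_eq by (rule sum.swap)
    then show "(\<Sum>j\<in>UNIV. \<Sum>r\<in>UNIV. leg_dual k $ r $ j * (m $ j $ r * site_op y (leg_op k (munit i i)) F l))
       = trace (leg_dual k ** m) * site_op y (leg_op k (munit i i)) F l"
      by (simp add: sum_distrib_right mult.assoc)
  qed
  also have "\<dots> = trace (leg_dual k ** m) * site_op y (leg_op k (\<Sum>i\<in>UNIV. munit i i)) F l"
    by (simp add: leg_op_linear(1)[OF k] site_op_matrix_sum sum_distrib_left)
  finally show "link_op y k x k' (site_op y (leg_op k m) F) l = trace (leg_dual k ** m) * F l"
    by (simp add: sum_munit_diag)
qed

text \<open>Transported through the bond, the action of \<open>h\<close> on the leg of
  \<open>x\<close> becomes that of its inverse on the leg of \<open>y\<close>. The bond thus sees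
  only the relative element \<open>g \<otimes> inv h\<close>.\<close>

lemma ugauge_pair:
  assumes b: "bonded F y k x k'" and xy: "x \<noteq> y" and o: "(k < 2) \<noteq> (k' < 2)"
    and g: "g \<in> carrier G" "h \<in> carrier G"
  shows "site_op y (ugauge g) (site_op x (ugauge h) F) = site_op y (ugauge_except k g) (site_op x (ugauge_except k' h) (site_op y (leg_op k (leg_rep k (g \<otimes> inv h))) F))"
proof -
  have "site_op y (ugauge g) (site_op x (ugauge h) F)
     = site_op y (ugauge_except k g) (site_op y (leg_op k (leg_rep k g)) (site_op x (ugauge_except k' h) (site_op x (leg_op k' (leg_rep k' h)) F)))"
    by (simp add: site_op_site_op flip: ugauge_ugauge_except)
  also have "site_op x (leg_op k' (leg_rep k' h)) F = site_op y (leg_op k (leg_rep k (inv h))) F"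
    using b unfolding bonded_def leg_rep_opposite[OF g(2) o, symmetric] by simp
  also have "site_op y (ugauge_except k g) (site_op y (leg_op k (leg_rep k g)) (site_op x (ugauge_except k' h) (site_op y (leg_op k (leg_rep k (inv h))) F)))
    = site_op y (ugauge_except k g) (site_op x (ugauge_except k' h) (site_op y (leg_op k (leg_rep k g)) (site_op y (leg_op k (leg_rep k (inv h))) F)))"
    using xy by (simp add: site_op_comm[of x y])
  finally show ?thesis using g by (simp add: site_op_site_op leg_op_mult leg_rep_mult)
qed

text \<open>Linking a new site to a jointly averaged region forces its group element to agree with
  that of the region.\<close>

lemma link_op_collapse:
  assumes S: "finite S" "y \<in> S" "x \<notin> S" and b: "bonded F y k x k'" and k: "k < 4"
    and o: "(k < 2) \<noteq> (k' < 2)"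
  shows "link_op y k x k' (joint_avg S (site_op x gproj F)) = (\<lambda>l. (1 / N) * joint_avg (insert x S) F l)"
proof -
  have xy: "x \<noteq> y" using S by auto
  let ?S' = "S - {y}"
  have S': "finite ?S'" "y \<notin> ?S'" "x \<notin> ?S'" "{y, x} \<inter> ?S' = {}" using S by auto
  let ?L = "link_op y k x k'"
  have pair: "?L (sites_op S (\<lambda>_. ugauge g) (site_op x (ugauge h) F)) = (\<lambda>l. if g = h then sites_op (insert x S) (\<lambda>_. ugauge g) F l else 0)"
    if g: "g \<in> carrier G" and h: "h \<in> carrier G" for g h
  proof -
    have split: "sites_op S (\<lambda>_. ugauge g) (site_op x (ugauge h) F) = sites_op ?S' (\<lambda>_. ugauge g) (site_op y (ugauge g) (site_op x (ugauge h) F))"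
      unfolding sites_op_split[OF S(1,2)] by (simp add: sites_op_site_op_comm[OF S'(1,2)])
    have c1: "?L (site_op y (ugauge_except k g) A) = site_op y (ugauge_except k g) (?L A)" for A
    proof -
      have "site_op y (leg_op k m) (site_op x n (site_op y (ugauge_except k g) A)) = site_op y (ugauge_except k g) (site_op y (leg_op k m) (site_op x n A))" for m n
        using xy by (simp add: site_op_comm[of x y] site_op_site_op ugauge_except_leg_op_comm)
      then show ?thesis
        unfolding link_op_def
        by (simp add: local_ops_apply_sum[OF local_ops.site[of y "{y}"]] site_op_scale)
    qed
    have c2: "?L (site_op x (ugauge_except k' h) A) = site_op x (ugauge_except k' h) (?L A)" for A
    proof -
      have "site_op y m (site_op x (leg_op k' n) (site_op x (ugauge_except k' h) A)) = site_op x (ugauge_except k' h) (site_op y m (site_op x (leg_op k' n) A))" for m n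
        using xy by (simp add: site_op_comm[of x y] site_op_site_op ugauge_except_leg_op_comm)
      then show ?thesis
        unfolding link_op_def
        by (simp add: local_ops_apply_sum[OF local_ops.site[of x "{x}"]] site_op_scale)
    qed
    have "?L (sites_op S (\<lambda>_. ugauge g) (site_op x (ugauge h) F)) = sites_op ?S' (\<lambda>_. ugauge g) (?L (site_op y (ugauge g) (site_op x (ugauge h) F)))"
      unfolding split by (rule local_ops_comm[OF link_op_local_ops sites_op_local_ops[OF S'(1)] S'(4)])
    also have "?L (site_op y (ugauge g) (site_op x (ugauge h) F)) = site_op y (ugauge_except k g) (site_op x (ugauge_except k' h) (\<lambda>l. (if g = h then 1 else 0) * F l))"
    proof -
      have "g \<otimes> inv h = \<one> \<longleftrightarrow> g = h"
        using g h by (metis inv_closed inv_equality inv_inv r_inv)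
      then show ?thesis
        unfolding ugauge_pair[OF b xy o g h] c1 c2 link_op_bonded[OF b xy k] using g h by (simp add: leg_dual_delta)
    qed
    finally have e: "?L (sites_op S (\<lambda>_. ugauge g) (site_op x (ugauge h) F))
      = sites_op ?S' (\<lambda>_. ugauge g) (site_op y (ugauge_except k g) (site_op x (ugauge_except k' h) (\<lambda>l. (if g = h then 1 else 0) * F l)))" .
    show ?thesis
    proof (cases "g = h")
      case True
      have "sites_op (insert x S) (\<lambda>_. ugauge g) F = sites_op ?S' (\<lambda>_. ugauge g) (site_op y (ugauge g) (site_op x (ugauge g) F))"
        using S S' by (simp add: sites_op_insert sites_op_split[of S y] sites_op_site_op_comm site_op_comm[OF xy])
      then show ?thesis using e True ugauge_pair[OF b xy o g h] g by simp
    next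
      case False
      then show ?thesis using e by (simp add: local_ops_zero[OF sites_op_local_ops[OF S'(1)]])
    qed
  qed
  have x: "site_op x gproj F = (\<lambda>l. (1 / N) * (\<Sum>h\<in>carrier G. site_op x (ugauge h) F l))"
    by (intro ext) (simp add: gproj_def site_op_matrix_cscale site_op_matrix_sum)
  have J: "joint_avg S (site_op x gproj F) = (\<lambda>l. (1 / N) * (\<Sum>g\<in>carrier G. (1 / N) * (\<Sum>h\<in>carrier G. sites_op S (\<lambda>_. ugauge g) (site_op x (ugauge h) F) l)))"
    unfolding joint_avg_def x local_ops_linear(2)[OF sites_op_local_ops[OF S(1)]] local_ops_apply_sum[OF sites_op_local_ops[OF S(1)]] ..
  have "?L (joint_avg S (site_op x gproj F)) = (\<lambda>l. (1 / N) * (\<Sum>g\<in>carrier G. (1 / N) * (\<Sum>h\<in>carrier G. ?L (sites_op S (\<lambda>_. ugauge g) (site_op x (ugauge h) F)) l)))"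
    unfolding J local_ops_linear(2)[OF link_op_local_ops] local_ops_apply_sum[OF link_op_local_ops] ..
  also have "\<dots> = (\<lambda>l. (1 / N) * (\<Sum>g\<in>carrier G. (1 / N) * sites_op (insert x S) (\<lambda>_. ugauge g) F l))"
    using fin by (intro ext arg_cong2[where f = "(*)"] refl sum.cong) (simp add: pair)
  finally show ?thesis by (simp add: joint_avg_def sum_distrib_left)
qed

section \<open>The torus of side 3 and its connected regions\<close>

abbreviation sites3 :: "(nat \<times> nat) set" where "sites3 \<equiv> sites 3 3"
abbreviation bonds3 where "bonds3 \<equiv> bonds 3 3"
abbreviation bond_state3 :: "(nat \<times> nat \<Rightarrow> 'n legs) \<Rightarrow> complex" where "bond_state3 \<equiv> bond_state 3 3"

lemma sites3_eq: "sites3 = {(0,0), (1,0), (2,0), (0,1), (1,1), (2,1), (0,2), (1,2), (2,2)}"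
proof -
  have "{..<3 :: nat} = {0, 1, 2}" by auto
  then show ?thesis unfolding sites_def by auto
qed

lemma bonds3_cases:
  assumes "((y, k), (x, k')) \<in> bonds3"
  obtains "x \<in> sites3" "y = below 3 x" "k = 0" "k' = 2" | "x \<in> sites3" "y = left_of 3 x" "k = 1" "k' = 3"
  using assms unfolding bonds_def by auto

lemma shift_mod_3: "j < 3 \<Longrightarrow> (j + 3 - 1) mod 3 = (if j = 0 then 2 else j - 1)" for j :: nat
  by (cases "j = 0"; cases "j = 1"; cases "j = 2") auto

lemma below_left_of_3:
  assumes "x \<in> sites3"
  shows "below 3 x \<noteq> x" "left_of 3 x \<noteq> x"
    "y \<in> sites3 \<Longrightarrow> below 3 x = below 3 y \<Longrightarrow> x = y" "y \<in> sites3 \<Longrightarrow> left_of 3 x = left_of 3 y \<Longrightarrow> x = y"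
proof -
  obtain i j where x: "x = (i, j)" "i < 3" "j < 3" using assms by (cases x) (auto simp: sites_def)
  have neq: "(a + 3 - 1) mod 3 \<noteq> a" if "a < 3" for a :: nat
    unfolding shift_mod_3[OF that] by auto
  show "below 3 x \<noteq> x" "left_of 3 x \<noteq> x"
    using x neq[of i] neq[of j] unfolding below_def left_of_def by simp_all
  have inj: "a = b" if "(a + 3 - 1) mod 3 = (b + 3 - 1) mod 3" "a < 3" "b < 3" for a b :: nat
    using that unfolding shift_mod_3[OF that(2)] shift_mod_3[OF that(3)] by (auto split: if_splits)
  assume "y \<in> sites3"
  then obtain i' j' where y: "y = (i', j')" "i' < 3" "j' < 3" by (cases y) (auto simp: sites_def)
  show "x = y" if "below 3 x = below 3 y" using that x y inj[of j j'] unfolding below_def by simp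
  show "x = y" if "left_of 3 x = left_of 3 y" using that x y inj[of i i'] unfolding left_of_def by simp
qed

lemma bonds3D:
  assumes "((y, k), (x, k')) \<in> bonds3"
  shows "x \<noteq> y" "k < 4" "k' < 4" "k < 2" "\<not> k' < 2" "x \<in> sites3" "y \<in> sites3"
proof -
  have "x \<noteq> y \<and> k < 4 \<and> k' < 4 \<and> k < 2 \<and> \<not> k' < 2 \<and> x \<in> sites3 \<and> y \<in> sites3"
    by (rule bonds3_cases[OF assms]) (simp_all add: below_left_of_3(1,2)[THEN not_sym] below_left_of_sites)
  then show "x \<noteq> y" "k < 4" "k' < 4" "k < 2" "\<not> k' < 2" "x \<in> sites3" "y \<in> sites3" by blast+
qed

lemma bonds3_or:
  assumes "((y, k), (x, k')) \<in> bonds3 \<or> ((x, k'), (y, k)) \<in> bonds3"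
  shows "x \<noteq> y" "y \<noteq> x" "k < 4" "k' < 4" "(k < 2) \<noteq> (k' < 2)"
  using assms bonds3D[of y k x k'] bonds3D[of x k' y k] by argo+

lemma bonds3_uniq:
  assumes 1: "((y, k), (x, k')) \<in> bonds3" and 2: "((y', j), (x', j')) \<in> bonds3"
    and ne: "((y', j), (x', j')) \<noteq> ((y, k), (x, k'))"
  shows "(y', j) \<notin> {(y, k), (x, k')} \<and> (x', j') \<notin> {(y, k), (x, k')}"
proof -
  have inj: "z = z'" if "below 3 z = below 3 z' \<or> left_of 3 z = left_of 3 z'" "z \<in> sites3" "z' \<in> sites3" for z z'
    using that below_left_of_3(3)[of z z'] below_left_of_3(4)[of z z'] by blast
  have "y = below 3 x \<and> k = 0 \<and> k' = 2 \<or> y = left_of 3 x \<and> k = 1 \<and> k' = 3" "x \<in> sites3"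
    by (rule bonds3_cases[OF 1]; simp)+
  moreover have "y' = below 3 x' \<and> j = 0 \<and> j' = 2 \<or> y' = left_of 3 x' \<and> j = 1 \<and> j' = 3" "x' \<in> sites3"
    by (rule bonds3_cases[OF 2]; simp)+
  ultimately show ?thesis using ne inj[of x x'] inj[of x' x] by auto
qed

lemma bonded_bond_state3:
  assumes b: "((y, k), (x, k')) \<in> bonds3" shows "bonded bond_state3 y k x k'"
proof (rule bonded_bond_state[OF b])
  show "k < 4" "k' < 4" "x \<noteq> y" using bonds3D[OF b] by blast+
  show "j < 4 \<and> j' < 4" if "((y', j), (x', j')) \<in> bonds3" for y' j x' j'
    using bonds3D(2,3)[OF that] by blast
  show "(y', j) \<notin> {(y, k), (x, k')} \<and> (x', j') \<notin> {(y, k), (x, k')}"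
    if "((y', j), (x', j')) \<in> bonds3" "((y', j), (x', j')) \<noteq> ((y, k), (x, k'))" for y' j x' j'
    using bonds3_uniq[OF b that] .
qed (rule bond_state_def)

text \<open>Records the bond relations inside \<open>S\<close> that remain valid after operators
  have been applied outside of \<open>S\<close>.\<close>

definition matched :: "((nat \<times> nat \<Rightarrow> 'n legs) \<Rightarrow> complex) \<Rightarrow> (nat \<times> nat) set \<Rightarrow> bool" where
  "matched F S \<longleftrightarrow> (\<forall>y k x k'. ((y, k), (x, k')) \<in> bonds3 \<longrightarrow> x \<in> S \<longrightarrow> y \<in> S \<longrightarrow> bonded F y k x k')"

lemma matched_bond_state3: "matched bond_state3 S"
  by (simp add: matched_def bonded_bond_state3)

lemma matched_bonded:
  assumes F: "matched F S" and b: "((y, k), (x, k')) \<in> bonds3 \<or> ((x, k'), (y, k)) \<in> bonds3"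
    and S: "x \<in> S" "y \<in> S"
  shows "bonded F y k x k'"
  using b
proof
  assume "((y, k), (x, k')) \<in> bonds3"
  then show ?thesis using F S unfolding matched_def by blast
next
  assume "((x, k'), (y, k)) \<in> bonds3"
  then have "bonded F x k' y k" using F S unfolding matched_def by blast
  then show ?thesis by (rule bonded_sym)
qed

lemma matched_mono: "matched F S \<Longrightarrow> T \<subseteq> S \<Longrightarrow> matched F T"
  unfolding matched_def by blast

lemma matched_site_op: "matched F S \<Longrightarrow> z \<notin> S \<Longrightarrow> matched (site_op z M F) S"
  unfolding matched_def by (blast intro: bonded_site_op)

lemma matched_sites_op: "finite T \<Longrightarrow> matched F S \<Longrightarrow> T \<inter> S = {} \<Longrightarrow> matched (sites_op T M F) S"
  by (induction T rule: finite_induct) (auto simp: sites_op_insert intro: matched_site_op)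

text \<open>On a connected region the separate averages over the group can be synchronised by an operator on
  the region.\<close>

definition conn :: "(nat \<times> nat) set \<Rightarrow> bool" where
  "conn S \<longleftrightarrow> (\<exists>f\<in>local_ops S. \<forall>F. matched F S \<longrightarrow> f (sites_op S (\<lambda>_. gproj) F) = joint_avg S F)"

lemma conn_single: "conn {x}"
  unfolding conn_def
proof (intro bexI[of _ "\<lambda>F. F"] allI impI)
  fix F
  show "sites_op {x} (\<lambda>_. gproj) F = joint_avg {x} F"
    using sites_op_insert[of "{}" x "\<lambda>_. gproj" F] by (simp add: joint_avg_single)
qed (rule local_ops.ident)

text \<open>The operator for \<open>S\<close> commutes with the projector at the new site, so
  \<open>S\<close> is synchronised first and the link then ties \<open>x\<close> to it. The factor
  \<open>N\<close> compensates the \<open>1 / N\<close> from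
  \<open>link_op_collapse\<close>.\<close>

lemma conn_insert:
  assumes "conn S" "finite S" "y \<in> S" "x \<notin> S"
    and b: "((y, k), (x, k')) \<in> bonds3 \<or> ((x, k'), (y, k)) \<in> bonds3"
  shows "conn (insert x S)"
proof -
  from assms(1)[unfolded conn_def] obtain f where f: "f \<in> local_ops S"
    and "\<forall>F. matched F S \<longrightarrow> f (sites_op S (\<lambda>_. gproj) F) = joint_avg S F" by (elim bexE)
  note fJ = this(2)[rule_format]
  note k = bonds3_or(3,5)[OF b]
  let ?f = "\<lambda>F l. N * link_op y k x k' (f F) l"
  show ?thesis
    unfolding conn_def
  proof (intro bexI[of _ ?f] allI impI)
    have "f \<in> local_ops (insert x S)" by (rule local_ops_mono[OF f]) auto
    moreover have "link_op y k x k' \<in> local_ops (insert x S)"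
      by (rule local_ops_mono[OF link_op_local_ops]) (use assms(3) in simp)
    ultimately show "?f \<in> local_ops (insert x S)" by (rule local_ops.times[OF local_ops.comp, rotated])
    fix F assume F: "matched F (insert x S)"
    have "bonded F y k x k'"
      by (rule matched_bonded[OF F b]) (use assms(3) in simp_all)
    then have 1: "link_op y k x k' (joint_avg S (site_op x gproj F)) = (\<lambda>l. (1 / N) * joint_avg (insert x S) F l)"
      by (rule link_op_collapse[OF assms(2,3,4) _ k])
    have "matched (site_op x gproj F) S"
      by (rule matched_site_op[OF matched_mono[OF F] assms(4)]) auto
    then have 2: "f (sites_op S (\<lambda>_. gproj) (site_op x gproj F)) = joint_avg S (site_op x gproj F)" by (rule fJ)
    have 3: "sites_op (insert x S) (\<lambda>_. gproj) F = sites_op S (\<lambda>_. gproj) (site_op x gproj F)"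
      by (simp only: sites_op_insert[OF assms(2,4)] sites_op_site_op_comm[OF assms(2,4)])
    show "?f (sites_op (insert x S) (\<lambda>_. gproj) F) = joint_avg (insert x S) F"
      unfolding 3 2 1 using N_nonzero by simp
  qed
qed

lemma conn_triple:
  assumes "((a, k), (c, k')) \<in> bonds3 \<or> ((c, k'), (a, k)) \<in> bonds3"
    and "((c, j), (b, j')) \<in> bonds3 \<or> ((b, j'), (c, j)) \<in> bonds3" and "a \<noteq> b"
  shows "conn {a, b, c}"
proof -
  have "a \<noteq> c" "b \<noteq> c" using bonds3_or(2)[OF assms(1)] bonds3_or(1)[OF assms(2)] .
  have "conn {c, a}" by (rule conn_insert[OF conn_single _ _ _ assms(1)]) (use \<open>a \<noteq> c\<close> in auto)
  then have "conn {b, c, a}"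
    by (rule conn_insert[OF _ _ _ _ assms(2)]) (use assms(3) \<open>b \<noteq> c\<close> in auto)
  then show ?thesis by (simp add: insert_commute)
qed

definition pair_gauge :: "nat \<Rightarrow> nat \<Rightarrow> 'g \<Rightarrow> complex^'n legs^'n legs" where
  "pair_gauge k1 k2 g = leg_op k1 (leg_rep k1 g) ** leg_op k2 (leg_rep k2 g)"

text \<open>Conjugating the matrix units by \<open>u g\<close> produces the twist of
  \<open>X\<close>, which invariance turns into the inverse conjugation on the other leg. On dual
  legs \<open>leg_rep\<close> and \<open>leg_tr\<close> hide the same computation for
  transposes.\<close>

lemma leg_pair_op_invariant:
  assumes X: "invt X" and g: "g \<in> carrier G" and k: "k1 < 4" "k2 < 4" "k1 \<noteq> k2"
  shows "pair_gauge k1 k2 g ** leg_pair_op k1 k2 X = leg_pair_op k1 k2 X ** pair_gauge k1 k2 g"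
proof -
  have gi: "inv g \<in> carrier G" using g by simp
  have "pair_gauge k1 k2 g ** leg_pair_op k1 k2 X ** pair_gauge k1 k2 (inv g)
     = (\<Sum>a\<in>UNIV. \<Sum>b\<in>UNIV. leg_op k1 (leg_rep k1 g ** leg_tr k1 (munit a b) ** leg_rep k1 (inv g)) ** leg_op k2 (leg_rep k2 g ** leg_tr k2 (X a b) ** leg_rep k2 (inv g)))"
  proof -
    have "leg_op k1 r1 ** leg_op k2 r2 ** (leg_op k1 x ** leg_op k2 y) ** (leg_op k1 s1 ** leg_op k2 s2)
       = leg_op k1 (r1 ** x ** s1) ** leg_op k2 (r2 ** y ** s2)" for r1 r2 x y s1 s2 :: "complex^'n^'n"
      unfolding leg_op_def leg_prod_mult by (rule leg_prod_cong) (use k in auto)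
    then show ?thesis by (simp add: pair_gauge_def leg_pair_op_def mmult_sum)
  qed
  also have "\<dots> = (\<Sum>a\<in>UNIV. \<Sum>b\<in>UNIV. leg_op k1 (leg_tr k1 (u g ** munit a b ** u (inv g))) ** leg_op k2 (leg_tr k2 (u g ** X a b ** u (inv g))))"
    by (simp add: leg_rep_leg_tr[OF g])
  also have "\<dots> = (\<Sum>a\<in>UNIV. \<Sum>b\<in>UNIV. \<Sum>c\<in>UNIV. \<Sum>d\<in>UNIV. (u g $ c $ a * u (inv g) $ b $ d) *m (leg_op k1 (leg_tr k1 (munit c d)) ** leg_op k2 (leg_tr k2 (u g ** X a b ** u (inv g)))))"
  proof (intro sum.cong refl)
    fix a b
    have "u g ** munit a b ** u (inv g) = (\<Sum>c\<in>UNIV. \<Sum>d\<in>UNIV. (u g $ c $ a * u (inv g) $ b $ d) *m munit c d)"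
      by (subst matrix_eq_sum_munit) (simp add: munit_conj_nth)
    then show "leg_op k1 (leg_tr k1 (u g ** munit a b ** u (inv g))) ** leg_op k2 (leg_tr k2 (u g ** X a b ** u (inv g)))
      = (\<Sum>c\<in>UNIV. \<Sum>d\<in>UNIV. (u g $ c $ a * u (inv g) $ b $ d) *m (leg_op k1 (leg_tr k1 (munit c d)) ** leg_op k2 (leg_tr k2 (u g ** X a b ** u (inv g)))))"
      by (simp add: leg_tr_linear leg_op_linear[OF k(1)] mmult_sum)
  qed
  also have "\<dots> = (\<Sum>c\<in>UNIV. \<Sum>d\<in>UNIV. \<Sum>a\<in>UNIV. \<Sum>b\<in>UNIV. (u g $ c $ a * u (inv g) $ b $ d) *m (leg_op k1 (leg_tr k1 (munit c d)) ** leg_op k2 (leg_tr k2 (u g ** X a b ** u (inv g)))))"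
    by (rule sum_swap_2_2)
  also have "\<dots> = (\<Sum>c\<in>UNIV. \<Sum>d\<in>UNIV. leg_op k1 (leg_tr k1 (munit c d)) ** leg_op k2 (leg_tr k2 (u g ** twist g X c d ** u (inv g))))"
    by (simp add: twist_def mmult_sum leg_tr_linear leg_op_linear[OF k(2)])
  also have "\<dots> = leg_pair_op k1 k2 X"
    using g by (simp add: leg_pair_op_def invtD[OF X g, symmetric] uconj_def matrix_mul_assoc u_cancel u_inv)
  finally have e: "pair_gauge k1 k2 g ** leg_pair_op k1 k2 X ** pair_gauge k1 k2 (inv g) = leg_pair_op k1 k2 X" .
  have "pair_gauge k1 k2 (inv g) ** pair_gauge k1 k2 g = mat 1"
  proof -
    have "leg_op k1 r1 ** leg_op k2 r2 ** (leg_op k1 s1 ** leg_op k2 s2) = leg_op k1 (r1 ** s1) ** leg_op k2 (r2 ** s2)" for r1 r2 s1 s2 :: "complex^'n^'n"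
      unfolding leg_op_def leg_prod_mult by (rule leg_prod_cong) (use k in auto)
    then show ?thesis using g by (simp add: pair_gauge_def leg_rep_mult)
  qed
  then have "pair_gauge k1 k2 g ** leg_pair_op k1 k2 X = pair_gauge k1 k2 g ** leg_pair_op k1 k2 X ** pair_gauge k1 k2 (inv g) ** pair_gauge k1 k2 g"
    by (metis matrix_mul_assoc matrix_mul_rid)
  then show ?thesis unfolding e .
qed

text \<open>Carried through its two bonds, the operator meets gauge elements at \<open>a\<close> and
  at \<open>b\<close>. It passes them only if they agree, because \<open>X\<close> is invariant
  under the joint action. So the region is synchronised first, then the transported operator
  \<open>X'\<close> acts, and finally the projectors turn the common average back into separate
  ones.\<close>

lemma move_operator:
  assumes S: "conn S" "finite S" "a \<in> S" "b \<in> S" "a \<noteq> b" "p \<notin> S"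
    and X: "invt X" and k: "k1 < 4" "k2 < 4" "k1 \<noteq> k2"
    and ba: "((p, k1), (a, k1')) \<in> bonds3 \<or> ((a, k1'), (p, k1)) \<in> bonds3"
    and bb: "((p, k2), (b, k2')) \<in> bonds3 \<or> ((b, k2'), (p, k2)) \<in> bonds3"
  shows "\<exists>f\<in>local_ops S. \<forall>F. matched F (insert p S) \<longrightarrow>
     site_op p (leg_pair_op k1 k2 X) (sites_op S (\<lambda>_. gproj) F) = f (sites_op S (\<lambda>_. gproj) F)"
proof -
  from S(1)[unfolded conn_def] obtain f where f: "f \<in> local_ops S"
    and "\<forall>F. matched F S \<longrightarrow> f (sites_op S (\<lambda>_. gproj) F) = joint_avg S F" by (elim bexE)
  note fJ = this(2)[rule_format]
  note o = bonds3_or(5)[OF ba] bonds3_or(5)[OF bb] and pa = bonds3_or(2)[OF ba] bonds3_or(2)[OF bb]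
  let ?x = "\<lambda>c d. leg_tr k1 (munit c d) :: complex^'n^'n" and ?y = "\<lambda>c d. leg_tr k2 (X c d)"
  define X' where "X' F = (\<lambda>l. \<Sum>c\<in>UNIV. \<Sum>d\<in>UNIV. site_op a (leg_op k1' (transpose (?x c d))) (site_op b (leg_op k2' (transpose (?y c d))) F) l)" for F
  have X': "X' \<in> local_ops S"
  proof -
    have "X' = (\<lambda>F l. \<Sum>c\<in>UNIV. \<Sum>d\<in>UNIV. site_op a (leg_op k1' (transpose (?x c d))) (site_op b (leg_op k2' (transpose (?y c d))) F) l)"
      by (intro ext) (simp add: X'_def)
    also have "\<dots> \<in> local_ops S"
      by (intro local_ops_sum local_ops.comp[of "site_op a _" _ "site_op b _"] local_ops.site S)
    finally show ?thesis .
  qed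
  let ?S' = "S - {a} - {b}"
  have S': "finite ?S'" "a \<notin> ?S'" "b \<notin> ?S'" using S by auto
  have JX: "X' (joint_avg S F) = site_op p (leg_pair_op k1 k2 X) (joint_avg S F)" if F: "matched F (insert p S)" for F
  proof -
    have bd: "bonded F p k1 a k1'" "bonded F p k2 b k2'"
      by (rule matched_bonded[OF F ba] matched_bonded[OF F bb]; use S(3,4) in simp)+
    have one: "X' (sites_op S (\<lambda>_. ugauge g) F) = site_op p (leg_pair_op k1 k2 X) (sites_op S (\<lambda>_. ugauge g) F)" if g: "g \<in> carrier G" for g
    proof -
      let ?R = "\<lambda>F. sites_op ?S' (\<lambda>_. ugauge g) (site_op a (ugauge_except k1' g) (site_op b (ugauge_except k2' g) F))"
      have sp: "sites_op S (\<lambda>_. ugauge g) F = ?R (site_op a (leg_op k1' (leg_rep k1' g)) (site_op b (leg_op k2' (leg_rep k2' g)) F))"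
      proof -
        have "sites_op S (\<lambda>_. ugauge g) F = site_op a (ugauge g) (site_op b (ugauge g) (sites_op ?S' (\<lambda>_. ugauge g) F))"
          using S by (simp add: sites_op_split[of S a] sites_op_split[of "S - {a}" b])
        also have "\<dots> = sites_op ?S' (\<lambda>_. ugauge g) (site_op a (ugauge g) (site_op b (ugauge g) F))"
          using S' by (simp add: sites_op_site_op_comm)
        also have "site_op a (ugauge g) (site_op b (ugauge g) F)
           = site_op a (ugauge_except k1' g) (site_op a (leg_op k1' (leg_rep k1' g)) (site_op b (ugauge_except k2' g) (site_op b (leg_op k2' (leg_rep k2' g)) F)))"
          by (simp add: site_op_site_op flip: ugauge_ugauge_except)
        also have "\<dots> = site_op a (ugauge_except k1' g) (site_op b (ugauge_except k2' g) (site_op a (leg_op k1' (leg_rep k1' g)) (site_op b (leg_op k2' (leg_rep k2' g)) F)))"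
          using S(5) by (simp add: site_op_comm[of a b])
        finally show ?thesis .
      qed
      have mv: "site_op a (leg_op k1' (transpose m)) (site_op b (leg_op k2' (transpose n)) F) = site_op p (leg_op k1 m ** leg_op k2 n) F" for m n
      proof -
        have "site_op b (leg_op k2' (transpose n)) F = site_op p (leg_op k2 n) F" using bd(2) by (simp add: bonded_def)
        then have "site_op a (leg_op k1' (transpose m)) (site_op b (leg_op k2' (transpose n)) F) = site_op p (leg_op k2 n) (site_op a (leg_op k1' (transpose m)) F)"
          using pa by (simp add: site_op_comm)
        also have "site_op a (leg_op k1' (transpose m)) F = site_op p (leg_op k1 m) F" using bd(1) by (simp add: bonded_def)
        finally show ?thesis using k(3) by (simp add: site_op_site_op leg_op_comm)
      qed
      have r: "leg_rep k1' g = transpose (leg_rep k1 (inv g))" "leg_rep k2' g = transpose (leg_rep k2 (inv g))"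
        using leg_rep_opposite[OF g] o by (metis transpose_transpose)+
      have sp': "sites_op S (\<lambda>_. ugauge g) F = ?R (site_op p (pair_gauge k1 k2 (inv g)) F)"
        unfolding sp r mv pair_gauge_def ..
      have Rp: "?R (site_op p m A) = site_op p m (?R A)" for m A
        using S pa S' by (simp add: site_op_comm[of _ p] sites_op_site_op_comm)
      have Rsum: "?R (\<lambda>l. \<Sum>i\<in>I. A i l) = (\<lambda>l. \<Sum>i\<in>I. ?R (A i) l)" for I :: "'n set" and A
        by (simp only: local_ops_apply_sum[OF local_ops.site[OF insertI1]] local_ops_apply_sum[OF sites_op_local_ops[OF S'(1)]])
      have cR: "site_op a (leg_op k1' m) (site_op b (leg_op k2' n) (?R A)) = ?R (site_op a (leg_op k1' m) (site_op b (leg_op k2' n) A))" for m n A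
      proof -
        have "site_op b (leg_op k2' n) (?R A) = sites_op ?S' (\<lambda>_. ugauge g) (site_op a (ugauge_except k1' g) (site_op b (leg_op k2' n) (site_op b (ugauge_except k2' g) A)))"
          using S(5) S' by (simp add: sites_op_site_op_comm[symmetric] site_op_comm[of b a])
        also have "site_op b (leg_op k2' n) (site_op b (ugauge_except k2' g) A) = site_op b (ugauge_except k2' g) (site_op b (leg_op k2' n) A)"
          by (simp add: site_op_site_op ugauge_except_leg_op_comm)
        finally have "site_op a (leg_op k1' m) (site_op b (leg_op k2' n) (?R A))
            = sites_op ?S' (\<lambda>_. ugauge g) (site_op a (leg_op k1' m) (site_op a (ugauge_except k1' g) (site_op b (ugauge_except k2' g) (site_op b (leg_op k2' n) A))))"
          using S' by (simp add: sites_op_site_op_comm[symmetric])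
        also have "site_op a (leg_op k1' m) (site_op a (ugauge_except k1' g) (site_op b (ugauge_except k2' g) (site_op b (leg_op k2' n) A)))
            = site_op a (ugauge_except k1' g) (site_op b (ugauge_except k2' g) (site_op a (leg_op k1' m) (site_op b (leg_op k2' n) A)))"
        proof -
          have "site_op a (leg_op k1' m) (site_op a (ugauge_except k1' g) B) = site_op a (ugauge_except k1' g) (site_op a (leg_op k1' m) B)" for B
            by (simp add: site_op_site_op ugauge_except_leg_op_comm)
          then show ?thesis using S(5) by (simp add: site_op_comm[of a b])
        qed
        finally show ?thesis .
      qed
      have each: "site_op a (leg_op k1' (transpose (?x c d))) (site_op b (leg_op k2' (transpose (?y c d))) (sites_op S (\<lambda>_. ugauge g) F))
         = ?R (site_op p (pair_gauge k1 k2 (inv g) ** (leg_op k1 (?x c d) ** leg_op k2 (?y c d))) F)" for c d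
      proof -
        have "site_op a (leg_op k1' (transpose (?x c d))) (site_op b (leg_op k2' (transpose (?y c d))) (sites_op S (\<lambda>_. ugauge g) F))
          = ?R (site_op a (leg_op k1' (transpose (?x c d))) (site_op b (leg_op k2' (transpose (?y c d))) (site_op a (leg_op k1' (leg_rep k1' g)) (site_op b (leg_op k2' (leg_rep k2' g)) F))))"
          unfolding sp cR ..
        also have "site_op a (leg_op k1' (transpose (?x c d))) (site_op b (leg_op k2' (transpose (?y c d))) (site_op a (leg_op k1' (leg_rep k1' g)) (site_op b (leg_op k2' (leg_rep k2' g)) F)))
          = site_op a (leg_op k1' (transpose (?x c d) ** leg_rep k1' g)) (site_op b (leg_op k2' (transpose (?y c d) ** leg_rep k2' g)) F)"
          using S(5) by (simp add: site_op_comm[of b a] site_op_site_op leg_op_mult)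
        also have "\<dots> = site_op a (leg_op k1' (transpose (leg_rep k1 (inv g) ** ?x c d))) (site_op b (leg_op k2' (transpose (leg_rep k2 (inv g) ** ?y c d))) F)"
          by (simp add: r matrix_transpose_mul)
        also have "\<dots> = site_op p (pair_gauge k1 k2 (inv g) ** (leg_op k1 (?x c d) ** leg_op k2 (?y c d))) F"
        proof -
          have "leg_op k1 (leg_rep k1 (inv g) ** ?x c d) ** leg_op k2 (leg_rep k2 (inv g) ** ?y c d)
             = pair_gauge k1 k2 (inv g) ** (leg_op k1 (?x c d) ** leg_op k2 (?y c d))"
            unfolding pair_gauge_def leg_op_def leg_prod_mult by (rule leg_prod_cong) (use k in auto)
          then show ?thesis unfolding mv by simp
        qed
        finally show ?thesis .
      qed
      have "X' (sites_op S (\<lambda>_. ugauge g) F) = ?R (site_op p (pair_gauge k1 k2 (inv g) ** leg_pair_op k1 k2 X) F)"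
        unfolding X'_def each leg_pair_op_def mmult_sum site_op_matrix_sum[abs_def] Rsum ..
      also have "\<dots> = site_op p (leg_pair_op k1 k2 X) (?R (site_op p (pair_gauge k1 k2 (inv g)) F))"
        using leg_pair_op_invariant[OF X _ k, of "inv g"] g by (simp add: Rp site_op_site_op flip: site_op_site_op)
      finally show ?thesis unfolding sp' .
    qed
    show ?thesis
      unfolding joint_avg_def local_ops_linear(2)[OF X'] local_ops_apply_sum[OF X'] site_op_scale local_ops_apply_sum[OF local_ops.site[of p "{p}", OF singletonI]]
      by (intro ext arg_cong2[where f = "(*)"] refl sum.cong) (simp add: one)
  qed
  show ?thesis
  proof (intro bexI[of _ "\<lambda>F. sites_op S (\<lambda>_. gproj) (X' (f F))"] allI impI)
    show "(\<lambda>F. sites_op S (\<lambda>_. gproj) (X' (f F))) \<in> local_ops S"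
      by (rule local_ops.comp[OF sites_op_local_ops[OF S(2)] local_ops.comp[OF X' f]])
    fix F assume F: "matched F (insert p S)"
    have PJ: "sites_op S (\<lambda>_. gproj) (joint_avg S F) = sites_op S (\<lambda>_. gproj) F"
    proof -
      have "sites_op S (\<lambda>_. gproj) (sites_op S (\<lambda>_. ugauge g) F) = sites_op S (\<lambda>_. gproj) F" if "g \<in> carrier G" for g
        using that S by (simp add: sites_op_sites_op gproj_ugauge)
      then show ?thesis
        unfolding joint_avg_def local_ops_linear(2)[OF sites_op_local_ops[OF S(2)]] local_ops_apply_sum[OF sites_op_local_ops[OF S(2)]]
        using N_nonzero by (intro ext) (simp add: N_def)
    qed
    have "f (sites_op S (\<lambda>_. gproj) F) = joint_avg S F" by (rule fJ[OF matched_mono[OF F]]) auto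
    then show "site_op p (leg_pair_op k1 k2 X) (sites_op S (\<lambda>_. gproj) F) = sites_op S (\<lambda>_. gproj) (X' (f (sites_op S (\<lambda>_. gproj) F)))"
      using S by (simp add: JX[OF F] sites_op_site_op_comm PJ)
  qed
qed

end

section \<open>Rigidity of averaged gauges\<close>

text \<open>Pairs each leg of \<open>M\<close> with a matrix by a trace. On the dual legs the index
  order is reversed because a gauge acts there by transposes.\<close>

definition contract :: "complex^'n^'n \<Rightarrow> complex^'n^'n \<Rightarrow> complex^'n^'n \<Rightarrow> complex^'n^'n \<Rightarrow> complex^('n::finite) legs^'n legs \<Rightarrow> complex" where
  "contract Z1 Z2 Z3 Z4 M = (\<Sum>m\<in>UNIV. \<Sum>m'\<in>UNIV.
     (Z1 $ leg 0 m' $ leg 0 m * Z2 $ leg 1 m' $ leg 1 m * Z3 $ leg 2 m $ leg 2 m' * Z4 $ leg 3 m $ leg 3 m') * M $ m $ m')"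

lemma contract_sum: "contract Z1 Z2 Z3 Z4 (\<Sum>i\<in>I. M i) = (\<Sum>i\<in>I. contract Z1 Z2 Z3 Z4 (M i))"
proof (induction I rule: infinite_finite_induct)
  case (insert x F)
  have "contract Z1 Z2 Z3 Z4 (A + B) = contract Z1 Z2 Z3 Z4 A + contract Z1 Z2 Z3 Z4 B" for A B
    by (simp add: contract_def distrib_left sum.distrib)
  then show ?case using insert by simp
qed (simp_all add: contract_def)

lemma contract_gauge:
  fixes Y X :: "complex^'n::finite^'n"
  shows "contract Z1 Z2 Z3 Z4 (gauge Y X) = trace (Z1 ** Y) * trace (Z2 ** X) * trace (Z3 ** matrix_inv Y) * trace (Z4 ** matrix_inv X)"
proof -
  let ?f = "\<lambda>(a, a'). Z1 $ a' $ a * Y $ a $ a'" and ?g = "\<lambda>(b, b'). Z2 $ b' $ b * X $ b $ b'"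
  let ?h = "\<lambda>(c, c'). Z3 $ c $ c' * matrix_inv Y $ c' $ c" and ?k = "\<lambda>(d, d'). Z4 $ d $ d' * matrix_inv X $ d' $ d"
  have t: "trace (Z1 ** Y) = sum ?f UNIV" "trace (Z2 ** X) = sum ?g UNIV"
    "trace (Z3 ** matrix_inv Y) = sum ?h UNIV" "trace (Z4 ** matrix_inv X) = sum ?k UNIV"
    unfolding trace_mult_eq UNIV_Times_UNIV[symmetric] sum.cartesian_product[symmetric]
    by (rule sum.swap sum.swap refl refl)+
  have "contract Z1 Z2 Z3 Z4 (gauge Y X) = (\<Sum>((a, b, c, d), (a', b', c', d'))\<in>UNIV. ?f (a, a') * ?g (b, b') * ?h (c, c') * ?k (d, d'))"
    unfolding contract_def sum.cartesian_product UNIV_Times_UNIV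
    by (intro sum.cong refl) (auto simp: gauge_def kron4_def transpose_def mult_ac)
  also have "\<dots> = (\<Sum>(p, q, r, s)\<in>UNIV. ?f p * ?g q * ?h r * ?k s)"
    by (rule sum.reindex_bij_witness[of _ "\<lambda>((a, a'), (b, b'), (c, c'), (d, d')). ((a, b, c, d), (a', b', c', d'))"
          "\<lambda>((a, b, c, d), (a', b', c', d')). ((a, a'), (b, b'), (c, c'), (d, d'))"]) auto
  also have "\<dots> = (\<Sum>p\<in>UNIV. \<Sum>q\<in>UNIV. \<Sum>r\<in>UNIV. \<Sum>s\<in>UNIV. ?f p * ?g q * ?h r * ?k s)"
    by (simp add: sum.cartesian_product flip: UNIV_Times_UNIV)
  finally show ?thesis unfolding sum_product4 t .
qed

lemma gauge_mult:
  fixes Y X Y' X' :: "complex^'n::finite^'n"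
  assumes "invertible Y" "invertible X" "invertible Y'" "invertible X'"
  shows "gauge Y X ** gauge Y' X' = gauge (Y ** Y') (X ** X')"
proof -
  have g: "gauge A C = leg_prod (\<lambda>k. if k = 0 then A else if k = 1 then C else if k = 2 then transpose (matrix_inv A) else transpose (matrix_inv C))"
    for A C :: "complex^'n^'n" by (simp add: gauge_def leg_prod_def)
  show ?thesis unfolding g leg_prod_mult using assms
    by (intro leg_prod_cong) (simp add: matrix_inv_mult_distrib matrix_transpose_mul)
qed

lemma gauge_one: "gauge (mat 1) (mat 1 :: complex^'n::finite^'n) = mat 1"
  using leg_prod_one[where 'n = 'n] by (simp add: gauge_def leg_prod_def)

lemma gauge_cscale:
  fixes Y X :: "complex^'n::finite^'n"
  assumes "invertible Y" "invertible X" "c \<noteq> 0" "d \<noteq> 0"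
  shows "gauge (c *m Y) (d *m X) = gauge Y X"
proof (rule matrix_eqI)
  fix i j :: "'n legs"
  show "gauge (c *m Y) (d *m X) $ i $ j = gauge Y X $ i $ j"
    using assms by (cases i; cases j) (simp add: gauge_def kron4_def transpose_def matrix_inv_cscale field_simps)
qed

lemma gauge_inv:
  fixes Y X :: "complex^'n::finite^'n"
  assumes "invertible Y" "invertible X"
  shows "gauge Y X ** gauge (matrix_inv Y) (matrix_inv X) = mat 1"
    "gauge (matrix_inv Y) (matrix_inv X) ** gauge Y X = mat 1"
  using assms by (simp_all add: gauge_mult invertible_matrix_inv matrix_inv_mult gauge_one)

lemma scalar_from_trace:
  fixes Y :: "complex^'n^'n"
  assumes "c \<noteq> 0" "\<And>Z. c * trace (Z ** Y) = d * trace Z"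
  shows "Y = (d / c) *m mat 1"
proof (rule trace_mult_cong)
  fix Z
  have "trace (Z ** Y) = (d / c) * trace Z" using assms(1) assms(2)[of Z] by (simp add: field_simps)
  then show "trace (Z ** Y) = trace (Z ** ((d / c) *m mat 1))" by (simp add: trace_cscale)
qed

context delta_rep
begin

lemma ugauge_gauge: "g \<in> carrier G \<Longrightarrow> ugauge g = gauge (u g) (u g)"
  by (simp add: ugauge_def leg_prod_def gauge_def leg_rep_def u_matrix_inv)

lemma gproj_group_average: "gproj = group_average G u"
  by (rule matrix_eqI) (simp add: gproj_def group_average_def N_def ugauge_gauge)

text \<open>Contracting three legs with dual functionals isolates one term of each sum, so a sum of
  product operators can equal the group sum only if the terms match.\<close>

lemma gauge_family_rigid:
  fixes Y X :: "'g \<Rightarrow> complex^'n^'n"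
  assumes eq: "(\<Sum>h\<in>carrier G. gauge (Y h) (X h)) = (\<Sum>h\<in>carrier G. ugauge h)"
    and inv: "\<And>h. h \<in> carrier G \<Longrightarrow> invertible (Y h) \<and> invertible (X h)"
    and DY: "\<And>h h'. h \<in> carrier G \<Longrightarrow> h' \<in> carrier G \<Longrightarrow> trace (DY h ** Y h') = (if h = h' then 1 else 0)"
    and DX: "\<And>h h'. h \<in> carrier G \<Longrightarrow> h' \<in> carrier G \<Longrightarrow> trace (DX h ** X h') = (if h = h' then 1 else 0)"
  shows "\<exists>h\<in>carrier G. \<exists>c d. c \<noteq> 0 \<and> d \<noteq> 0 \<and> Y h = c *m mat 1 \<and> X h = d *m mat 1"
proof -
  \<comment> \<open>The fourth leg is contracted with \<open>K\<close> throughout. On the group side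
    only the term of \<open>\<one>\<close> survives; on the other side the weights
    \<open>\<gamma> h\<close> appear, and they cannot all vanish.\<close>
  define \<gamma> where "\<gamma> h = trace (K ** matrix_inv (X h))" for h
  have n: "trace (mat 1 :: complex^'n^'n) \<noteq> 0" by (simp add: trace_I)
  have sumK: "(\<Sum>h\<in>carrier G. f h * trace (K ** u (inv h))) = f \<one>" for f
  proof -
    have "(\<Sum>h\<in>carrier G. f h * trace (K ** u (inv h))) = (\<Sum>h\<in>carrier G. if h = \<one> then f h else 0)"
      by (intro sum.cong refl) (simp add: K)
    then show ?thesis using fin by simp
  qed
  have key: "(\<Sum>h\<in>carrier G. trace (Z1 ** Y h) * trace (Z2 ** X h) * trace (Z3 ** matrix_inv (Y h)) * \<gamma> h)
     = trace Z1 * trace Z2 * trace Z3" for Z1 Z2 Z3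
  proof -
    have "(\<Sum>h\<in>carrier G. trace (Z1 ** Y h) * trace (Z2 ** X h) * trace (Z3 ** matrix_inv (Y h)) * \<gamma> h)
       = contract Z1 Z2 Z3 K (\<Sum>h\<in>carrier G. ugauge h)"
      unfolding eq[symmetric] contract_sum contract_gauge \<gamma>_def ..
    also have "\<dots> = (\<Sum>h\<in>carrier G. (trace (Z1 ** u h) * trace (Z2 ** u h) * trace (Z3 ** u (inv h))) * trace (K ** u (inv h)))"
      unfolding contract_sum by (intro sum.cong refl) (simp add: ugauge_gauge contract_gauge u_matrix_inv)
    finally show ?thesis unfolding sumK by (simp add: u_one)
  qed
  obtain h where h: "h \<in> carrier G" "\<gamma> h \<noteq> 0"
  proof (rule ccontr)
    assume a: "\<not> thesis"
    have "(\<Sum>h\<in>carrier G. trace (mat 1 ** Y h) * trace (mat 1 ** X h) * trace (mat 1 ** matrix_inv (Y h)) * \<gamma> h) = 0"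
      by (rule sum.neutral) (use a that in auto)
    then show False using n unfolding key by simp
  qed
  have iY: "trace (Y h ** matrix_inv (Y h)) = trace (mat 1 :: complex^'n^'n)" "trace (matrix_inv (Y h) ** Y h) = trace (mat 1 :: complex^'n^'n)"
    using inv[OF h(1)] by (simp_all add: matrix_inv_mult)
  \<comment> \<open>The functional \<open>DX h\<close> removes all other terms. With
    \<open>Z3 = Y h\<close> the second trace becomes the trace of the identity, so all traces
    against \<open>Y h\<close> are multiples of \<open>trace Z1\<close>, which makes
    \<open>Y h\<close> scalar.\<close>
  have one: "trace (Z1 ** Y h) * trace (Z3 ** matrix_inv (Y h)) * \<gamma> h = trace Z1 * trace (DX h) * trace Z3" for Z1 Z3
  proof -
    have "(\<Sum>h'\<in>carrier G. trace (Z1 ** Y h') * trace (DX h ** X h') * trace (Z3 ** matrix_inv (Y h')) * \<gamma> h')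
       = (\<Sum>h'\<in>carrier G. if h' = h then trace (Z1 ** Y h') * trace (Z3 ** matrix_inv (Y h')) * \<gamma> h' else 0)"
      using h by (intro sum.cong refl) (simp add: DX)
    then show ?thesis using key[of Z1 "DX h" Z3] h fin by simp
  qed
  have two: "trace (Z2 ** X h) * trace (Z3 ** matrix_inv (Y h)) * \<gamma> h = trace (DY h) * trace Z2 * trace Z3" for Z2 Z3
  proof -
    have "(\<Sum>h'\<in>carrier G. trace (DY h ** Y h') * trace (Z2 ** X h') * trace (Z3 ** matrix_inv (Y h')) * \<gamma> h')
       = (\<Sum>h'\<in>carrier G. if h' = h then trace (Z2 ** X h') * trace (Z3 ** matrix_inv (Y h')) * \<gamma> h' else 0)"
      using h by (intro sum.cong refl) (simp add: DY)
    then show ?thesis using key[of "DY h" Z2 Z3] h fin by simp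
  qed
  let ?t = "trace (mat 1 :: complex^'n^'n)"
  have "(?t * \<gamma> h) * trace (Z ** Y h) = (trace (DX h) * trace (Y h)) * trace Z" for Z
    using one[of Z "Y h"] unfolding iY by (simp add: mult_ac)
  from scalar_from_trace[OF _ this] n h obtain c where c: "Y h = c *m mat 1" by auto
  have "(?t * \<gamma> h) * trace (Z ** X h) = (trace (DY h) * trace (Y h)) * trace Z" for Z
    using two[of Z "Y h"] unfolding iY by (simp add: mult_ac)
  from scalar_from_trace[OF _ this] n h obtain d where d: "X h = d *m mat 1" by auto
  have "c \<noteq> 0" "d \<noteq> 0"
    using inv[OF h(1)] c d invertible_nonzero[of "Y h"] invertible_nonzero[of "X h"] by auto
  then show ?thesis using h c d by blast
qed

text \<open>Cyclicity of the trace turns \<open>K\<close> into dual functionals for the translated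
  family \<open>u h ** z\<close>, so \<open>gauge_family_rigid\<close> applies. The member that is
  scalar exhibits \<open>y\<close> and \<open>x\<close> as multiples of one and the same group
  matrix, the inverse of \<open>u h\<close>.\<close>

lemma gproj_gauge_rigid:
  assumes e: "gproj ** gauge y x = gproj" and inv: "invertible y" "invertible x"
  shows "\<exists>h\<in>carrier G. \<exists>c d. c \<noteq> 0 \<and> d \<noteq> 0 \<and> y = c *m u h \<and> x = d *m u h"
proof -
  have iu: "h \<in> carrier G \<Longrightarrow> invertible (u h ** y)" "h \<in> carrier G \<Longrightarrow> invertible (u h ** x)" for h
    using inv u_matrix_inv by (simp_all add: invertible_mult)
  have "N *m (gproj ** gauge y x) = N *m gproj" using e by simp
  then have eq: "(\<Sum>h\<in>carrier G. gauge (u h ** y) (u h ** x)) = (\<Sum>h\<in>carrier G. ugauge h)"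
    using N_nonzero inv by (simp add: gproj_def mmult_sum ugauge_gauge gauge_mult u_matrix_inv)
  have tr: "trace (matrix_inv z ** K ** u (inv h) ** (u h' ** z)) = (if h = h' then 1 else 0)"
    if "invertible z" "h \<in> carrier G" "h' \<in> carrier G" for z :: "complex^'n^'n" and h h'
  proof -
    have "trace (matrix_inv z ** (K ** u (inv h) ** u h' ** z)) = trace (K ** u (inv h) ** u h' ** z ** matrix_inv z)"
      by (rule trace_mul_sym)
    also have "\<dots> = trace (K ** (u (inv h) ** u h'))"
      by (simp only: matrix_inv_cancel(3)[OF that(1)] matrix_mul_assoc)
    finally show ?thesis using K_delta that by (simp add: matrix_mul_assoc)
  qed
  obtain h c d where h: "h \<in> carrier G" "c \<noteq> 0" "d \<noteq> 0" "u h ** y = c *m mat 1" "u h ** x = d *m mat 1"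
    using gauge_family_rigid[OF eq _ tr[OF inv(1)] tr[OF inv(2)]] iu by blast
  have "y = c *m u (inv h)" "x = d *m u (inv h)"
  proof -
    have "y = u (inv h) ** (u h ** y)" "x = u (inv h) ** (u h ** x)" using h(1) by (simp_all add: u_cancel)
    then show "y = c *m u (inv h)" "x = d *m u (inv h)" unfolding h by simp_all
  qed
  then show ?thesis using h by blast
qed

lemma gauge_gproj_rigid:
  assumes e: "gauge y x ** gproj = gproj" and inv: "invertible y" "invertible x"
  shows "\<exists>h\<in>carrier G. \<exists>c d. c \<noteq> 0 \<and> d \<noteq> 0 \<and> y = c *m u h \<and> x = d *m u h"
proof -
  have iu: "h \<in> carrier G \<Longrightarrow> invertible (y ** u h)" "h \<in> carrier G \<Longrightarrow> invertible (x ** u h)" for h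
    using inv u_matrix_inv by (simp_all add: invertible_mult)
  have "N *m (gauge y x ** gproj) = N *m gproj" using e by simp
  then have eq: "(\<Sum>h\<in>carrier G. gauge (y ** u h) (x ** u h)) = (\<Sum>h\<in>carrier G. ugauge h)"
    using N_nonzero inv by (simp add: gproj_def mmult_sum ugauge_gauge gauge_mult u_matrix_inv)
  have tr: "trace (K ** u (inv h) ** matrix_inv z ** (z ** u h')) = (if h = h' then 1 else 0)"
    if "invertible z" "h \<in> carrier G" "h' \<in> carrier G" for z :: "complex^'n^'n" and h h'
  proof -
    have "K ** u (inv h) ** matrix_inv z ** (z ** u h') = K ** (u (inv h) ** u h')"
      by (simp only: matrix_inv_cancel(4)[OF that(1)] matrix_mul_assoc)
    then show ?thesis using K_delta that by simp
  qed
  obtain h c d where h: "h \<in> carrier G" "c \<noteq> 0" "d \<noteq> 0" "y ** u h = c *m mat 1" "x ** u h = d *m mat 1"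
    using gauge_family_rigid[OF eq _ tr[OF inv(1)] tr[OF inv(2)]] iu by blast
  have "y = c *m u (inv h)" "x = d *m u (inv h)"
  proof -
    have "y = (y ** u h) ** u (inv h)" "x = (x ** u h) ** u (inv h)" using h(1) by (simp_all add: u_cancel)
    then show "y = c *m u (inv h)" "x = d *m u (inv h)" unfolding h by simp_all
  qed
  then show ?thesis using h by blast
qed

end

lemma sites_op_absorb:
  assumes "finite S" "x \<in> S"
  shows "sites_op S M (site_op x a F) = sites_op S (M(x := M x ** a)) F"
proof -
  have "sites_op S M (site_op x a F) = site_op x (M x) (site_op x a (sites_op (S - {x}) M F))"
    using assms by (simp add: sites_op_split[OF assms] sites_op_site_op_comm)
  moreover have "sites_op (S - {x}) (M(x := M x ** a)) F = sites_op (S - {x}) M F"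
    by (rule sites_op_cong) simp
  ultimately show ?thesis using assms by (simp add: sites_op_split[OF assms] site_op_site_op)
qed

text \<open>All four bonds of the origin lead to other sites, so a configuration of those sites can
  prescribe every leg of the origin. The state is then a delta function of the origin, and the
  entries of \<open>M\<close> can be read off.\<close>

lemma site_op_bond_state3_zero:
  fixes M :: "complex^('n::finite) legs^'n legs"
  assumes "site_op (0, 0) M (bond_state 3 3) = (\<lambda>l. 0)" shows "M = 0"
proof (rule matrix_eqI)
  fix m m' :: "'n legs"
  obtain a b c d where m': "m' = (a, b, c, d)" by (cases m')
  \<comment> \<open>The bonds below and to the left of the origin are stored at
    \<open>(0, 2)\<close> and \<open>(2, 0)\<close> because of the wrap-around.\<close>
  define v h where "v x = (if x = (0, 2) then c else a)" and "h x = (if x = (2, 0) then d else b)" for x :: "nat \<times> nat"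
  define l where "l x = (v x, h x, v (below 3 x), h (left_of 3 x))" for x
  have o: "(0, 0) \<in> sites 3 3" "(0, 1) \<in> sites 3 3" "(1, 0) \<in> sites 3 3" by (simp_all add: sites_def)
  have lo: "l (0, 0) = m'" by (simp add: l_def v_def h_def m' below_def left_of_def)
  have Oml: "bond_state 3 3 l = 1" by (simp add: bond_state_iff l_def)
  have bond_state: "bond_state 3 3 (l((0, 0) := m'')) = (if m'' = m' then 1 else 0)" for m''
  proof (cases "m'' = m'")
    case True
    then show ?thesis using Oml lo by (simp add: fun_upd_idem)
  next
    case False
    have "bond_state 3 3 (l((0, 0) := m'')) \<noteq> 1"
    proof
      let ?l = "l((0, 0) := m'')"
      assume "bond_state 3 3 ?l = 1"
      then have all: "\<And>x. x \<in> sites 3 3 \<Longrightarrow> leg 0 (?l (below 3 x)) = leg 2 (?l x) \<and> leg 1 (?l (left_of 3 x)) = leg 3 (?l x)"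
        by (simp only: bond_state_iff split: if_splits) auto
      have "m'' = m'" using all[OF o(1)] all[OF o(2)] all[OF o(3)]
        by (cases m'') (simp add: l_def v_def h_def m' below_def left_of_def)
      then show False using False by simp
    qed
    then show ?thesis using False by (simp add: bond_state_def split: if_splits)
  qed
  have "0 = site_op (0, 0) M (bond_state 3 3) (l((0, 0) := m))" using assms by simp
  also have "\<dots> = (\<Sum>k\<in>UNIV. if k = m' then M $ m $ k else 0)"
    by (simp add: site_op_def bond_state if_distrib cong: if_cong)
  finally show "M $ m $ m' = 0 $ m $ m'" by simp
qed

context delta_rep
begin

text \<open>On each bond the representation on one leg cancels its contragredient on the other.
  Bonds are processed one at a time; \<open>cov\<close> marks the legs already reduced to the
  identity, and in the end every leg of every site is marked.\<close>

lemma bond_state3_invariant: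
  assumes g: "g \<in> carrier G"
  shows "sites_op sites3 (\<lambda>_. ugauge g) bond_state3 = bond_state3"
proof -
  define cov where "cov B x k \<longleftrightarrow> (\<exists>e\<in>B. fst e = (x, k) \<or> snd e = (x, k))"
    for B :: "(((nat \<times> nat) \<times> nat) \<times> ((nat \<times> nat) \<times> nat)) set" and x k
  define M where "M B x = leg_prod (\<lambda>k. if cov B x k then mat 1 else leg_rep k g)" for B x
  have fb: "finite bonds3" by (simp add: bonds_def)
  have "sites_op sites3 (M B) bond_state3 = sites_op sites3 (\<lambda>_. ugauge g) bond_state3" if "finite B" "B \<subseteq> bonds3" for B
    using that
  proof (induction B rule: finite_induct)
    case empty
    show ?case by (rule sites_op_cong) (simp add: M_def cov_def ugauge_def)
  next
    case (insert e B)
    obtain y k x k' where e: "e = ((y, k), (x, k'))" by (cases e) auto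
    have b: "((y, k), (x, k')) \<in> bonds3" using insert.prems e by simp
    note D = bonds3D[OF b]
    have nc: "\<not> cov B y k" "\<not> cov B x k'"
    proof -
      have "fst e' \<notin> {(y, k), (x, k')} \<and> snd e' \<notin> {(y, k), (x, k')}" if e': "e' \<in> B" for e'
      proof -
        obtain y' j x' j' where p: "e' = ((y', j), (x', j'))" by (cases e') auto
        have "e' \<in> bonds3" "e' \<noteq> e" using e' insert.prems insert.hyps by auto
        then show ?thesis using bonds3_uniq[OF b, of y' j x' j'] unfolding p e by simp
      qed
      then show "\<not> cov B y k" "\<not> cov B x k'" unfolding cov_def by auto
    qed
    let ?M = "M (insert e B)"
    have cov': "cov (insert e B) z j \<longleftrightarrow> cov B z j \<or> (z, j) = (y, k) \<or> (z, j) = (x, k')" for z j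
      unfolding cov_def e by auto
    have My: "?M y ** leg_op k (leg_rep k g) = M B y"
      unfolding M_def leg_op_def leg_prod_mult using nc D by (intro leg_prod_cong) (auto simp: cov')
    have Mx: "?M x ** leg_op k' (leg_rep k' g) = M B x"
      unfolding M_def leg_op_def leg_prod_mult using nc D by (intro leg_prod_cong) (auto simp: cov')
    have Mz: "z \<noteq> x \<Longrightarrow> z \<noteq> y \<Longrightarrow> ?M z = M B z" for z
      unfolding M_def by (intro leg_prod_cong) (auto simp: cov')
    have "bond_state3 = site_op y (leg_op k (leg_rep k g)) (site_op x (leg_op k' (leg_rep k' g)) bond_state3)"
    proof -
      have "site_op x (leg_op k' (leg_rep k' g)) bond_state3 = site_op y (leg_op k (leg_rep k (inv g))) bond_state3"
      proof -
        have "(k < 2) \<noteq> (k' < 2)" using D by simp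
        then have t: "transpose (leg_rep k (inv g)) = leg_rep k' g"
          using leg_rep_opposite[of "inv g" k' k] g by simp
        have "site_op y (leg_op k (leg_rep k (inv g))) bond_state3 = site_op x (leg_op k' (transpose (leg_rep k (inv g)))) bond_state3"
          using bonded_bond_state3[OF b] unfolding bonded_def by (rule spec)
        then show ?thesis unfolding t by (rule sym)
      qed
      then show ?thesis using g by (simp add: site_op_site_op leg_op_mult leg_rep_mult)
    qed
    then have "sites_op sites3 ?M bond_state3 = sites_op sites3 ?M (site_op y (leg_op k (leg_rep k g)) (site_op x (leg_op k' (leg_rep k' g)) bond_state3))" by simp
    also have "\<dots> = sites_op sites3 ((?M(y := ?M y ** leg_op k (leg_rep k g)))(x := (?M(y := ?M y ** leg_op k (leg_rep k g))) x ** leg_op k' (leg_rep k' g))) bond_state3"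
      using D by (simp add: sites_op_absorb)
    also have "\<dots> = sites_op sites3 (M B) bond_state3"
    proof (rule sites_op_cong)
      fix z
      show "((?M(y := ?M y ** leg_op k (leg_rep k g)))(x := (?M(y := ?M y ** leg_op k (leg_rep k g))) x ** leg_op k' (leg_rep k' g))) z = M B z"
        using D(1) My Mx Mz[of z] by (cases "z = x"; cases "z = y") simp_all
    qed
    finally show ?case using insert by simp
  qed
  from this[OF fb subset_refl] have "sites_op sites3 (M bonds3) bond_state3 = sites_op sites3 (\<lambda>_. ugauge g) bond_state3" .
  moreover have "sites_op sites3 (M bonds3) bond_state3 = sites_op sites3 (\<lambda>_. mat 1) bond_state3"
  proof (rule sites_op_cong)
    fix x assume x: "x \<in> sites3"
    have cov: "cov bonds3 x k" if "k < 4" for k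
    proof -
      have "k = 0 \<or> k = 1 \<or> k = 2 \<or> k = 3" using that by auto
      moreover obtain z z' where z: "z \<in> sites3" "below 3 z = x" "z' \<in> sites3" "left_of 3 z' = x"
      proof -
        obtain i j where ij: "x = (i, j)" "i < 3" "j < 3" using x by (cases x) (auto simp: sites_def)
        have m: "(Suc a mod 3 + 2) mod 3 = a" if "a < 3" for a :: nat
          using that by (cases "a = 0"; cases "a = 1"; cases "a = 2") simp_all
        show thesis
          by (rule that[of "(i, Suc j mod 3)" "(Suc i mod 3, j)"]) (use ij m in \<open>simp_all add: sites_def below_def left_of_def\<close>)
      qed
      moreover have "((x, 0), (z, 2)) \<in> bonds3" "((x, 1), (z', 3)) \<in> bonds3"
      proof -
        have "((below 3 z, 0), (z, 2)) \<in> bonds3" "((left_of 3 z', 1), (z', 3)) \<in> bonds3"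
          using z(1,3) by (auto simp: bonds_def)
        then show "((x, 0), (z, 2)) \<in> bonds3" "((x, 1), (z', 3)) \<in> bonds3" unfolding z by simp_all
      qed
      moreover have "((below 3 x, 0), (x, 2)) \<in> bonds3" "((left_of 3 x, 1), (x, 3)) \<in> bonds3"
        using x by (auto simp: bonds_def)
      ultimately show ?thesis unfolding cov_def by (metis fst_conv snd_conv)
    qed
    have "M bonds3 x = leg_prod (\<lambda>k. mat 1)" unfolding M_def by (rule leg_prod_cong) (simp add: cov)
    then show "M bonds3 x = mat 1" by (simp add: leg_prod_one)
  qed
  ultimately show ?thesis by simp
qed

section \<open>The averaged state and operators at its origin\<close>

abbreviation rest :: "(nat \<times> nat) set" where "rest \<equiv> sites3 - {(0, 0)}"

lemma rest_eq: "rest = {(1,0), (2,0), (0,1), (1,1), (2,1), (0,2), (1,2), (2,2)}"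
  unfolding sites3_eq by auto

lemma bonds3_rl: "x \<in> sites3 \<Longrightarrow> ((below 3 x, 0), (x, 2)) \<in> bonds3" "x \<in> sites3 \<Longrightarrow> ((left_of 3 x, 1), (x, 3)) \<in> bonds3"
  by (auto simp: bonds_def)

lemma bonds3_list:
  "(((0,0),0),((0,1),2)) \<in> bonds3" "(((0,0),1),((1,0),3)) \<in> bonds3"
  "(((0,2),0),((0,0),2)) \<in> bonds3" "(((2,0),1),((0,0),3)) \<in> bonds3"
  "(((0,1),1),((1,1),3)) \<in> bonds3" "(((1,0),0),((1,1),2)) \<in> bonds3"
  "(((0,1),0),((0,2),2)) \<in> bonds3" "(((2,2),1),((0,2),3)) \<in> bonds3"
  "(((2,2),0),((2,0),2)) \<in> bonds3" "(((1,1),0),((1,2),2)) \<in> bonds3"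
  "(((1,1),1),((2,1),3)) \<in> bonds3" "(((2,1),1),((0,1),3)) \<in> bonds3"
  "(((2,0),0),((2,1),2)) \<in> bonds3" "(((0,2),1),((1,2),3)) \<in> bonds3"
  "(((1,2),0),((1,0),2)) \<in> bonds3"
proof -
  note r = bonds3_rl[unfolded sites3_eq below_def left_of_def split_conv]
  show "(((0,0),0),((0,1),2)) \<in> bonds3" using r(1)[of "(0,1)"] by (simp add: numeral_2_eq_2)
  show "(((0,0),1),((1,0),3)) \<in> bonds3" using r(2)[of "(1,0)"] by (simp add: numeral_2_eq_2)
  show "(((0,2),0),((0,0),2)) \<in> bonds3" using r(1)[of "(0,0)"] by (simp add: numeral_2_eq_2)
  show "(((2,0),1),((0,0),3)) \<in> bonds3" using r(2)[of "(0,0)"] by (simp add: numeral_2_eq_2)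
  show "(((0,1),1),((1,1),3)) \<in> bonds3" using r(2)[of "(1,1)"] by (simp add: numeral_2_eq_2)
  show "(((1,0),0),((1,1),2)) \<in> bonds3" using r(1)[of "(1,1)"] by (simp add: numeral_2_eq_2)
  show "(((0,1),0),((0,2),2)) \<in> bonds3" using r(1)[of "(0,2)"] by (simp add: numeral_2_eq_2)
  show "(((2,2),1),((0,2),3)) \<in> bonds3" using r(2)[of "(0,2)"] by (simp add: numeral_2_eq_2)
  show "(((2,2),0),((2,0),2)) \<in> bonds3" using r(1)[of "(2,0)"] by (simp add: numeral_2_eq_2)
  show "(((1,1),0),((1,2),2)) \<in> bonds3" using r(1)[of "(1,2)"] by (simp add: numeral_2_eq_2)
  show "(((1,1),1),((2,1),3)) \<in> bonds3" using r(2)[of "(2,1)"] by (simp add: numeral_2_eq_2)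
  show "(((2,1),1),((0,1),3)) \<in> bonds3" using r(2)[of "(0,1)"] by (simp add: numeral_2_eq_2)
  show "(((2,0),0),((2,1),2)) \<in> bonds3" using r(1)[of "(2,1)"] by (simp add: numeral_2_eq_2)
  show "(((0,2),1),((1,2),3)) \<in> bonds3" using r(2)[of "(1,2)"] by (simp add: numeral_2_eq_2)
  show "(((1,2),0),((1,0),2)) \<in> bonds3" using r(1)[of "(1,0)"] by (simp add: numeral_2_eq_2)
qed

lemma conn_rest: "conn rest"
proof -
  note c = conn_insert[rotated 4]
  have "conn {(0,1)}" by (rule conn_single)
  then have "conn {(1,1), (0,1)}" by (rule c[OF disjI1[OF bonds3_list(5)]]) auto
  then have "conn {(1,0), (1,1), (0,1)}" by (rule c[OF disjI2[OF bonds3_list(6)]]) auto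
  then have "conn {(0,2), (1,0), (1,1), (0,1)}" by (rule c[OF disjI1[OF bonds3_list(7)]]) auto
  then have "conn {(2,2), (0,2), (1,0), (1,1), (0,1)}" by (rule c[OF disjI2[OF bonds3_list(8)]]) auto
  then have "conn {(2,0), (2,2), (0,2), (1,0), (1,1), (0,1)}" by (rule c[OF disjI1[OF bonds3_list(9)]]) auto
  then have "conn {(1,2), (2,0), (2,2), (0,2), (1,0), (1,1), (0,1)}" by (rule c[OF disjI1[OF bonds3_list(10)]]) auto
  then have "conn {(2,1), (1,2), (2,0), (2,2), (0,2), (1,0), (1,1), (0,1)}" by (rule c[OF disjI1[OF bonds3_list(11)]]) auto
  also have "{(2,1), (1,2), (2,0), (2,2), (0,2), (1,0), (1,1), (0,1)} = rest" unfolding rest_eq by auto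
  finally show ?thesis .
qed

definition avg_state :: "(nat \<times> nat \<Rightarrow> 'n legs) \<Rightarrow> complex" where
  "avg_state = sites_op sites3 (\<lambda>_. gproj) bond_state3"

lemma o_sites3: "(0, 0) \<in> sites3" by (simp add: sites_def)

lemma sites3_split: "sites_op sites3 M F = site_op (0, 0) (M (0, 0)) (sites_op rest M F)"
  by (rule sites_op_split[OF finite_sites o_sites3])

lemma avg_state_split: "avg_state = site_op (0, 0) gproj (sites_op rest (\<lambda>_. gproj) bond_state3)"
  unfolding avg_state_def by (rule sites3_split)

text \<open>An operator away from the origin synchronises the averages of all other sites. By
  \<open>bond_state3_invariant\<close> their common element can be shifted to the origin, where
  \<open>gproj\<close> absorbs it. This leaves the bond state with \<open>gproj\<close> at the
  origin only, to which \<open>site_op_bond_state3_zero\<close> applies.\<close>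

lemma avg_state_zero:
  assumes z: "site_op (0, 0) Z avg_state = (\<lambda>l. 0)" shows "Z ** gproj = 0"
proof -
  from conn_rest[unfolded conn_def] obtain f where f: "f \<in> local_ops rest"
    and "\<forall>F. matched F rest \<longrightarrow> f (sites_op rest (\<lambda>_. gproj) F) = joint_avg rest F" by (elim bexE)
  note fJ = this(2)[rule_format]
  have fr: "finite rest" by simp
  have nr: "(0, 0) \<notin> rest" by simp
  have R: "sites_op rest (\<lambda>_. ugauge g) bond_state3 = site_op (0, 0) (ugauge (inv g)) bond_state3" if g: "g \<in> carrier G" for g
  proof -
    have "site_op (0, 0) (ugauge (inv g)) bond_state3 = site_op (0, 0) (ugauge (inv g)) (sites_op sites3 (\<lambda>_. ugauge g) bond_state3)"
      by (simp add: bond_state3_invariant[OF g])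
    also have "\<dots> = sites_op rest (\<lambda>_. ugauge g) bond_state3"
      unfolding sites3_split using g by (simp add: site_op_site_op ugauge_mult ugauge_one)
    finally show ?thesis ..
  qed
  have "f avg_state = f (sites_op rest (\<lambda>_. gproj) (site_op (0, 0) gproj bond_state3))"
    unfolding avg_state_split sites_op_site_op_comm[OF fr nr] ..
  also have "\<dots> = joint_avg rest (site_op (0, 0) gproj bond_state3)"
    by (rule fJ[OF matched_site_op[OF matched_bond_state3 nr]])
  also have "\<dots> = (\<lambda>l. (1 / N) * (\<Sum>g\<in>carrier G. site_op (0, 0) gproj bond_state3 l))"
    unfolding joint_avg_def sites_op_site_op_comm[OF fr nr]
    by (intro ext arg_cong2[where f = "(*)"] refl sum.cong) (simp add: R site_op_site_op gproj_ugauge)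
  also have "\<dots> = site_op (0, 0) gproj bond_state3"
    using N_nonzero by (intro ext) (simp add: N_def)
  finally have fPsi: "f avg_state = site_op (0, 0) gproj bond_state3" .
  have "site_op (0, 0) (Z ** gproj) bond_state3 = site_op (0, 0) Z (f avg_state)" by (simp add: fPsi site_op_site_op)
  also have "\<dots> = f (site_op (0, 0) Z avg_state)" by (rule local_ops_site_op_comm[OF f nr, symmetric])
  also have "\<dots> = (\<lambda>l. 0)" unfolding z by (rule local_ops_zero[OF f])
  finally show ?thesis by (rule site_op_bond_state3_zero)
qed

lemma leg_pair_op_ugauge:
  assumes X: "invt X" and g: "g \<in> carrier G" and k: "k1 < 4" "k2 < 4" "k1 \<noteq> k2"
  shows "ugauge g ** leg_pair_op k1 k2 X = leg_pair_op k1 k2 X ** ugauge g"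
proof -
  let ?r = "leg_prod ((\<lambda>k. leg_rep k g)(k1 := mat 1, k2 := mat 1))"
  have 1: "ugauge g = ?r ** pair_gauge k1 k2 g"
    unfolding ugauge_def pair_gauge_def leg_op_def leg_prod_mult by (rule leg_prod_cong) (use k in auto)
  have "?r ** (leg_op k1 a ** leg_op k2 b) = (leg_op k1 a ** leg_op k2 b) ** ?r" for a b
    unfolding leg_op_def leg_prod_mult by (rule leg_prod_cong) (use k in auto)
  then have 2: "?r ** leg_pair_op k1 k2 X = leg_pair_op k1 k2 X ** ?r"
    by (simp add: leg_pair_op_def mmult_sum)
  have "?r ** pair_gauge k1 k2 g ** leg_pair_op k1 k2 X = ?r ** leg_pair_op k1 k2 X ** pair_gauge k1 k2 g"
    by (simp add: leg_pair_op_invariant[OF X g k] flip: matrix_mul_assoc)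
  then show ?thesis unfolding 1 2 by (simp add: matrix_mul_assoc)
qed

lemma leg_pair_op_gproj:
  assumes "invt X" "k1 < 4" "k2 < 4" "k1 \<noteq> k2"
  shows "gproj ** leg_pair_op k1 k2 X = leg_pair_op k1 k2 X ** gproj"
proof -
  have "(\<Sum>g\<in>carrier G. ugauge g ** leg_pair_op k1 k2 X) = (\<Sum>g\<in>carrier G. leg_pair_op k1 k2 X ** ugauge g)"
    by (intro sum.cong refl leg_pair_op_ugauge assms)
  then show ?thesis by (simp add: gproj_def mmult_sum)
qed

lemma move_avg_state:
  assumes S: "conn S" "S \<subseteq> rest" "a \<in> S" "b \<in> S" "a \<noteq> b"
    and X: "invt X" and k: "k1 < 4" "k2 < 4" "k1 \<noteq> k2"
    and ba: "(((0, 0), k1), (a, k1')) \<in> bonds3 \<or> ((a, k1'), ((0, 0), k1)) \<in> bonds3"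
    and bb: "(((0, 0), k2), (b, k2')) \<in> bonds3 \<or> ((b, k2'), ((0, 0), k2)) \<in> bonds3"
  shows "\<exists>f\<in>local_ops S. site_op (0, 0) (leg_pair_op k1 k2 X) avg_state = f avg_state"
proof -
  have fS: "finite S" using S(2) finite_subset by fastforce
  have oS: "(0, 0) \<notin> S" using S(2) by auto
  from move_operator[OF S(1) fS S(3-5) oS X k ba bb] obtain f where f: "f \<in> local_ops S"
    and "\<forall>F. matched F (insert (0, 0) S) \<longrightarrow> site_op (0, 0) (leg_pair_op k1 k2 X) (sites_op S (\<lambda>_. gproj) F) = f (sites_op S (\<lambda>_. gproj) F)"
    by (elim bexE)
  note fX = this(2)[rule_format]
  let ?F = "sites_op (rest - S) (\<lambda>_. gproj) bond_state3"
  have F: "matched ?F (insert (0, 0) S)"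
    by (rule matched_sites_op[OF _ matched_bond_state3]) auto
  have "rest = S \<union> (rest - S)" using S(2) by auto
  then have "sites_op rest (\<lambda>_. gproj) bond_state3 = sites_op S (\<lambda>_. gproj) ?F"
    using fS sites_op_union[of S "rest - S" "\<lambda>_. gproj" bond_state3] by simp
  then have P: "avg_state = site_op (0, 0) gproj (sites_op S (\<lambda>_. gproj) ?F)" unfolding avg_state_split by simp
  have "site_op (0, 0) (leg_pair_op k1 k2 X) avg_state = site_op (0, 0) gproj (site_op (0, 0) (leg_pair_op k1 k2 X) (sites_op S (\<lambda>_. gproj) ?F))"
    unfolding P by (simp add: site_op_site_op leg_pair_op_gproj[OF X k])
  also have "\<dots> = site_op (0, 0) gproj (f (sites_op S (\<lambda>_. gproj) ?F))" unfolding fX[OF F] ..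
  also have "\<dots> = f avg_state" unfolding P by (rule local_ops_site_op_comm[OF f oS, symmetric])
  finally show ?thesis using f by (intro bexI[of _ f])
qed

text \<open>The region consists of two neighbours of the origin and the corner between them. It is
  disjoint from the region in \<open>move_23\<close>; \<open>move_03\<close> and
  \<open>move_21\<close> form the second disjoint pair.\<close>

lemma move_01: "invt X \<Longrightarrow> \<exists>f\<in>local_ops {(0,1), (1,0), (1,1)}. site_op (0, 0) (leg_pair_op 0 1 X) avg_state = f avg_state"
  by (rule move_avg_state[OF conn_triple[OF disjI1[OF bonds3_list(5)] disjI2[OF bonds3_list(6)]] _ _ _ _ _ _ _ _
        disjI1[OF bonds3_list(1)] disjI1[OF bonds3_list(2)]])
    (auto simp: sites3_eq)

lemma move_23: "invt X \<Longrightarrow> \<exists>f\<in>local_ops {(0,2), (2,0), (2,2)}. site_op (0, 0) (leg_pair_op 2 3 X) avg_state = f avg_state"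
  by (rule move_avg_state[OF conn_triple[OF disjI2[OF bonds3_list(8)] disjI1[OF bonds3_list(9)]] _ _ _ _ _ _ _ _
        disjI2[OF bonds3_list(3)] disjI2[OF bonds3_list(4)]])
    (auto simp: sites3_eq)

lemma move_03: "invt X \<Longrightarrow> \<exists>f\<in>local_ops {(0,1), (2,0), (2,1)}. site_op (0, 0) (leg_pair_op 0 3 X) avg_state = f avg_state"
  by (rule move_avg_state[OF conn_triple[OF disjI2[OF bonds3_list(12)] disjI2[OF bonds3_list(13)]] _ _ _ _ _ _ _ _
        disjI1[OF bonds3_list(1)] disjI2[OF bonds3_list(4)]])
    (auto simp: sites3_eq)

lemma move_21: "invt X \<Longrightarrow> \<exists>f\<in>local_ops {(0,2), (1,0), (1,2)}. site_op (0, 0) (leg_pair_op 2 1 X) avg_state = f avg_state"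
  by (rule move_avg_state[OF conn_triple[OF disjI1[OF bonds3_list(14)] disjI1[OF bonds3_list(15)]] _ _ _ _ _ _ _ _
        disjI2[OF bonds3_list(3)] disjI1[OF bonds3_list(2)]])
    (auto simp: sites3_eq)

text \<open>Because \<open>L\<close> on all sites fixes the state, \<open>Li\<close> and
  \<open>L\<close> at the origin can be exchanged for their inverses on the other sites. Around
  \<open>f\<close> these cancel outside of \<open>S\<close>, so the conjugated operator still acts
  like an operator on \<open>S\<close> and commutes with \<open>h\<close>, which acts on
  \<open>T\<close>. At the origin this is commutation up to \<open>gproj\<close>.\<close>

lemma commute_on_avg_state:
  assumes f: "f \<in> local_ops S" "site_op (0, 0) X avg_state = f avg_state" and h: "h \<in> local_ops T" "site_op (0, 0) W avg_state = h avg_state"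
    and ST: "S \<subseteq> rest" "T \<subseteq> rest" "S \<inter> T = {}"
    and L: "L ** Li = gproj" "Li ** L = gproj" "gproj ** L = L" "L ** gproj = L" "gproj ** Li = Li" "Li ** gproj = Li"
    and LO: "sites_op sites3 (\<lambda>_. L) avg_state = avg_state" "sites_op sites3 (\<lambda>_. Li) avg_state = avg_state"
  shows "(Li ** X ** L) ** W ** gproj = W ** (Li ** X ** L) ** gproj"
proof -
  have fS: "finite S" "finite (rest - S)" "finite rest" using ST(1) finite_subset by fastforce+
  have oS: "(0, 0) \<notin> S" "(0, 0) \<notin> T" "(0, 0) \<notin> rest" using ST by auto
  have d: "(rest - S) \<inter> S = {}" by auto
  have PP: "site_op (0, 0) gproj avg_state = avg_state" unfolding avg_state_split by (simp add: site_op_site_op gproj_idem)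
  have PR: "sites_op (rest - S) (\<lambda>_. gproj) avg_state = avg_state"
  proof -
    have 2: "sites_op rest M F = sites_op (rest - S) M (sites_op S M F)" for M F
      using sites_op_union[OF fS(2) fS(1) d, of M F] ST(1) by (simp add: Un_absorb2)
    have "sites_op (rest - S) (\<lambda>_. gproj) (sites_op rest (\<lambda>_. gproj) F) = sites_op rest (\<lambda>_. gproj) F" for F
      unfolding 2 sites_op_sites_op[OF fS(2)] gproj_idem ..
    then show ?thesis unfolding avg_state_split by (simp add: sites_op_site_op_comm fS)
  qed
  \<comment> \<open>If \<open>b\<close> on all sites fixes the state, its inverse \<open>a\<close>
    at the origin has the same effect as \<open>b\<close> on all other sites.\<close>
  have swap: "site_op (0, 0) a avg_state = sites_op rest (\<lambda>_. b) avg_state"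
    if ab: "a ** b = gproj" and b: "sites_op sites3 (\<lambda>_. b) avg_state = avg_state" for a b
  proof -
    have "site_op (0, 0) a avg_state = site_op (0, 0) a (sites_op sites3 (\<lambda>_. b) avg_state)" by (simp add: b)
    also have "\<dots> = site_op (0, 0) gproj (sites_op rest (\<lambda>_. b) avg_state)" by (simp add: sites3_split site_op_site_op ab)
    also have "\<dots> = sites_op rest (\<lambda>_. b) (site_op (0, 0) gproj avg_state)" by (rule sites_op_site_op_comm[OF fS(3) oS(3), symmetric])
    finally show ?thesis by (simp add: PP)
  qed
  let ?f = "\<lambda>F. sites_op S (\<lambda>_. Li) (f (sites_op S (\<lambda>_. L) F))"
  have f': "?f \<in> local_ops S"
    by (rule local_ops.comp[OF sites_op_local_ops[OF fS(1)] local_ops.comp[OF f(1) sites_op_local_ops[OF fS(1)]]])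
  have 1: "site_op (0, 0) (Li ** X ** L) avg_state = ?f avg_state"
  proof -
    have "site_op (0, 0) (Li ** X ** L) avg_state = site_op (0, 0) Li (site_op (0, 0) X (sites_op rest (\<lambda>_. Li) avg_state))"
      unfolding swap[OF L(1) LO(2), symmetric] by (simp add: site_op_site_op matrix_mul_assoc)
    also have "\<dots> = sites_op rest (\<lambda>_. Li) (f (site_op (0, 0) Li avg_state))"
      by (simp add: sites_op_site_op_comm[OF fS(3) oS(3), symmetric] f(2) local_ops_site_op_comm[OF f(1) oS(1), symmetric])
    also have "\<dots> = sites_op rest (\<lambda>_. Li) (f (sites_op rest (\<lambda>_. L) avg_state))"
      unfolding swap[OF L(2) LO(1)] ..
    also have "\<dots> = sites_op S (\<lambda>_. Li) (sites_op (rest - S) (\<lambda>_. Li) (f (sites_op (rest - S) (\<lambda>_. L) (sites_op S (\<lambda>_. L) avg_state))))"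
    proof -
      have 1: "sites_op rest M F = sites_op S M (sites_op (rest - S) M F)" for M F
        using sites_op_union[of S "rest - S" M F] fS ST(1) by (simp add: Un_absorb1)
      have 2: "sites_op rest M F = sites_op (rest - S) M (sites_op S M F)" for M F
        using sites_op_union[OF fS(2) fS(1) d, of M F] ST(1) by (simp add: Un_absorb2)
      show ?thesis by (simp only: 1[of "\<lambda>_. Li"] 2[of "\<lambda>_. L"])
    qed
    also have "\<dots> = sites_op S (\<lambda>_. Li) (f (sites_op (rest - S) (\<lambda>_. Li) (sites_op (rest - S) (\<lambda>_. L) (sites_op S (\<lambda>_. L) avg_state))))"
      by (simp only: local_ops_comm[OF f(1) sites_op_local_ops[OF fS(2)] Diff_disjoint])
    also have "\<dots> = sites_op S (\<lambda>_. Li) (f (sites_op (rest - S) (\<lambda>_. gproj) (sites_op S (\<lambda>_. L) avg_state)))"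
      by (simp only: sites_op_sites_op[OF fS(2)] L(2))
    also have "\<dots> = ?f (sites_op (rest - S) (\<lambda>_. gproj) avg_state)"
      by (simp only: local_ops_comm[OF sites_op_local_ops[OF fS(1)] sites_op_local_ops[OF fS(2)] Diff_disjoint])
    finally show ?thesis unfolding PR .
  qed
  have a: "site_op (0, 0) ((Li ** X ** L) ** W) avg_state = h (?f avg_state)"
    by (simp only: site_op_site_op[symmetric, of _ "Li ** X ** L" W] h(2) local_ops_site_op_comm[OF h(1) oS(2), symmetric] 1)
  have b: "site_op (0, 0) (W ** (Li ** X ** L)) avg_state = ?f (h avg_state)"
    by (simp only: site_op_site_op[symmetric, of _ W "Li ** X ** L"] 1 local_ops_site_op_comm[OF f' oS(1), symmetric] h(2))
  have "?f (h avg_state) = h (?f avg_state)" by (rule local_ops_comm[OF f' h(1) ST(3)])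
  then have "site_op (0, 0) ((Li ** X ** L) ** W - W ** (Li ** X ** L)) avg_state = (\<lambda>l. 0)"
    unfolding site_op_matrix_diff[abs_def] a b by simp
  then have "((Li ** X ** L) ** W - W ** (Li ** X ** L)) ** gproj = 0" by (rule avg_state_zero)
  then show ?thesis by (simp add: mmult_diff)
qed

end

section \<open>From the symmetry of the state to virtual matrices\<close>

definition vec_of :: "('n \<Rightarrow> 'n \<Rightarrow> complex^'n^'n) \<Rightarrow> complex^('n::finite) legs" where
  "vec_of T = (\<chi> x. case x of (i, r, j, l) \<Rightarrow> T i j $ r $ l)"

definition blocks_of :: "complex^('n::finite) legs \<Rightarrow> 'n \<Rightarrow> 'n \<Rightarrow> complex^'n^'n" where
  "blocks_of t i j = (\<chi> r l. t $ (i, r, j, l))"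

lemma vec_of_nth: "vec_of T $ (i, r, j, l) = T i j $ r $ l"
  by (simp add: vec_of_def)

lemma vec_of_blocks_of [simp]: "vec_of (blocks_of t) = t"
  by (simp add: vec_eq_iff vec_of_nth blocks_of_def)

lemma blocks_of_vec_of [simp]: "blocks_of (vec_of T) = T"
  by (intro ext matrix_eqI) (simp add: blocks_of_def vec_of_nth)

lemma vec_of_eq_iff: "vec_of T = vec_of S \<longleftrightarrow> T = S"
  by (metis blocks_of_vec_of)

lemma leg_prod_vec_of:
  "leg_prod f *v vec_of T = vec_of (\<lambda>i j. \<Sum>p\<in>UNIV. \<Sum>q\<in>UNIV. (f 0 $ i $ p * f 2 $ j $ q) *m (f 1 ** T p q ** transpose (f 3)))"
proof (subst vec_eq_iff, rule allI)
  fix x :: "'a legs"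
  obtain i r j l where x: "x = (i, r, j, l)" by (cases x)
  have "(leg_prod f *v vec_of T) $ x = (\<Sum>p\<in>UNIV. \<Sum>a\<in>UNIV. \<Sum>q\<in>UNIV. \<Sum>b\<in>UNIV. f 0 $ i $ p * f 2 $ j $ q * (f 1 $ r $ a * T p q $ a $ b * f 3 $ l $ b))"
    unfolding x matrix_vector_mult_def by (simp add: sum_legs leg_prod_nth vec_of_nth mult_ac)
  also have "\<dots> = (\<Sum>p\<in>UNIV. \<Sum>q\<in>UNIV. \<Sum>b\<in>UNIV. \<Sum>a\<in>UNIV. f 0 $ i $ p * f 2 $ j $ q * (f 1 $ r $ a * T p q $ a $ b * f 3 $ l $ b))"
    by (rule sum.cong[OF refl], rule sum_swap_1_2)
  also have "\<dots> = (\<Sum>p\<in>UNIV. \<Sum>q\<in>UNIV. f 0 $ i $ p * f 2 $ j $ q * (f 1 ** T p q ** transpose (f 3)) $ r $ l)"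
    by (simp add: mmult_nth transpose_def sum_distrib_left sum_distrib_right)
  finally show "(leg_prod f *v vec_of T) $ x = vec_of (\<lambda>i j. \<Sum>p\<in>UNIV. \<Sum>q\<in>UNIV. (f 0 $ i $ p * f 2 $ j $ q) *m (f 1 ** T p q ** transpose (f 3))) $ x"
    by (simp add: x vec_of_nth)
qed

lemma vec_of_sum: "(\<Sum>x\<in>S. vec_of (t x)) = vec_of (\<lambda>i j. \<Sum>x\<in>S. t x i j)"
  by (simp add: vec_eq_iff vec_of_nth)

lemma vec_of_add: "vec_of (\<lambda>i j. t i j + s i j) = vec_of t + vec_of s"
  by (simp add: vec_eq_iff vec_of_nth)

lemma vec_of_cscale: "vec_of (\<lambda>i j. c *m t i j) = c *s vec_of t"
  by (simp add: vec_eq_iff vec_of_nth)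

lemma vec_of_zero: "vec_of (\<lambda>i j. 0) = 0"
  by (simp add: vec_eq_iff vec_of_nth)

lemma blocks_of_linear: "blocks_of (x + y) = (\<lambda>i j. blocks_of x i j + blocks_of y i j)" "blocks_of (c *s x) = (\<lambda>i j. c *m blocks_of x i j)" "blocks_of 0 = (\<lambda>i j. 0)"
  by (intro ext matrix_eqI; simp add: blocks_of_def)+

lemma sum_pick2: "(\<Sum>a\<in>UNIV. \<Sum>b\<in>UNIV. if a = i \<and> b = j then F a b else 0) = (F (i :: 'a::finite) (j :: 'b::finite) :: 'c::comm_monoid_add)"
proof -
  have "(\<Sum>a\<in>UNIV. \<Sum>b\<in>UNIV. if a = i \<and> b = j then F a b else 0) = (\<Sum>a\<in>UNIV. if a = i then (\<Sum>b\<in>UNIV. if b = j then F a b else 0) else 0)"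
    by (intro sum.cong refl) auto
  then show ?thesis by simp
qed

text \<open>Here the two products originate: for each splitting, an operator on one pair multiplies
  from the left and an operator on the complementary pair from the right.\<close>

lemma leg_pair_op_vec_of:
  fixes X T :: "'n::finite \<Rightarrow> 'n \<Rightarrow> complex^'n^'n"
  shows "leg_pair_op 0 1 X *v vec_of T = vec_of (bmul X T)" "leg_pair_op 2 3 X *v vec_of T = vec_of (bmul T X)"
    "leg_pair_op 0 3 X *v vec_of T = vec_of (omul X T)" "leg_pair_op 2 1 X *v vec_of T = vec_of (omul T X)"
proof -
  have tm: "transpose (munit a b) = munit b a" for a b :: 'n
    by (auto intro!: matrix_eqI simp: transpose_def munit_nth)
  have u: "munit a b $ i $ p = (if a = i \<and> b = p then 1 else 0)" for a b i p :: 'n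
    by (auto simp: munit_nth)
  have m1: "(mat 1 :: complex^'n^'n) $ j $ q = (if q = j then 1 else 0)" for j q
    by (auto simp: mat_def)
  have pull: "(\<Sum>a\<in>UNIV. \<Sum>b\<in>UNIV. \<Sum>p\<in>UNIV. \<Sum>q\<in>UNIV. F a b p q) = (\<Sum>p\<in>UNIV. \<Sum>q\<in>UNIV. \<Sum>a\<in>UNIV. \<Sum>b\<in>UNIV. F a b p q)"
    for F :: "'n \<Rightarrow> 'n \<Rightarrow> 'n \<Rightarrow> 'n \<Rightarrow> complex^'n^'n" by (rule sum_swap_2_2)
  have row: "(\<Sum>a\<in>UNIV. \<Sum>b\<in>UNIV. \<Sum>p\<in>UNIV. \<Sum>q\<in>UNIV. (munit a b $ i $ p * mat 1 $ j $ q) *m F a b p q) = (\<Sum>p\<in>UNIV. F i p p j)"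
    for F :: "'n \<Rightarrow> 'n \<Rightarrow> 'n \<Rightarrow> 'n \<Rightarrow> complex^'n^'n" and i j
  proof -
    have "(\<Sum>a\<in>UNIV. \<Sum>b\<in>UNIV. \<Sum>p\<in>UNIV. \<Sum>q\<in>UNIV. (munit a b $ i $ p * mat 1 $ j $ q) *m F a b p q)
      = (\<Sum>p\<in>UNIV. \<Sum>q\<in>UNIV. \<Sum>a\<in>UNIV. \<Sum>b\<in>UNIV. if a = i \<and> b = p then if q = j then F a b p q else 0 else 0)"
      by (rule trans[OF pull]) (intro sum.cong refl, auto simp: u m1)
    then show ?thesis unfolding sum_pick2 by simp
  qed
  have col: "(\<Sum>a\<in>UNIV. \<Sum>b\<in>UNIV. \<Sum>p\<in>UNIV. \<Sum>q\<in>UNIV. (mat 1 $ i $ p * munit b a $ j $ q) *m F a b p q) = (\<Sum>q\<in>UNIV. F q j i q)"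
    for F :: "'n \<Rightarrow> 'n \<Rightarrow> 'n \<Rightarrow> 'n \<Rightarrow> complex^'n^'n" and i j
  proof -
    have "(\<Sum>a\<in>UNIV. \<Sum>b\<in>UNIV. \<Sum>p\<in>UNIV. \<Sum>q\<in>UNIV. (mat 1 $ i $ p * munit b a $ j $ q) *m F a b p q)
      = (\<Sum>p\<in>UNIV. \<Sum>q\<in>UNIV. \<Sum>a\<in>UNIV. \<Sum>b\<in>UNIV. if a = q \<and> b = j then if p = i then F a b p q else 0 else 0)"
      by (rule trans[OF pull]) (intro sum.cong refl, auto simp: u m1)
    also have "\<dots> = (\<Sum>q\<in>UNIV. \<Sum>p\<in>UNIV. if p = i then F q j p q else 0)"
      unfolding sum_pick2 by (rule sum.swap)
    finally show ?thesis by simp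
  qed
  show "leg_pair_op 0 1 X *v vec_of T = vec_of (bmul X T)"
    by (simp add: leg_pair_op_def leg_op_def leg_prod_mult mvec_sum leg_prod_vec_of vec_of_sum vec_of_eq_iff fun_eq_iff leg_tr_def row bmul_def)
  show "leg_pair_op 2 3 X *v vec_of T = vec_of (bmul T X)"
    by (simp add: leg_pair_op_def leg_op_def leg_prod_mult mvec_sum leg_prod_vec_of vec_of_sum vec_of_eq_iff fun_eq_iff leg_tr_def tm col bmul_def)
  show "leg_pair_op 0 3 X *v vec_of T = vec_of (omul X T)"
    by (simp add: leg_pair_op_def leg_op_def leg_prod_mult mvec_sum leg_prod_vec_of vec_of_sum vec_of_eq_iff fun_eq_iff leg_tr_def row omul_def)
  show "leg_pair_op 2 1 X *v vec_of T = vec_of (omul T X)"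
    by (simp add: leg_pair_op_def leg_op_def leg_prod_mult mvec_sum leg_prod_vec_of vec_of_sum vec_of_eq_iff fun_eq_iff leg_tr_def tm col omul_def)
qed

definition leaves_invariant :: "complex^'p^'p \<Rightarrow> ('n::finite, 'p::finite) tensor \<Rightarrow> bool" where
  "leaves_invariant U A \<longleftrightarrow> (\<forall>N\<ge>1. \<forall>M\<ge>1. \<forall>s\<in>configs N M.
     onsite_apply N M U (peps_state N M A) s = peps_state N M A s)"

context delta_rep
begin

lemma invt_iff: "invt T \<longleftrightarrow> gproj *v vec_of T = vec_of T"
proof -
  have ugauge: "ugauge g *v vec_of T = vec_of (\<lambda>i j. u g ** twist g T i j ** u (inv g))" if "g \<in> carrier G" for g
    unfolding ugauge_def leg_prod_vec_of by (simp add: leg_rep_def twist_def mmult_sum transpose_def)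
  have iff: "ugauge g *v vec_of T = vec_of T \<longleftrightarrow> (\<forall>a b. twist g T a b = uconj g (T a b))" if g: "g \<in> carrier G" for g
  proof -
    have "u g ** a ** u (inv g) = b \<longleftrightarrow> a = uconj g b" for a b
      unfolding uconj_def using g by (auto simp: u_cancel u_inv matrix_mul_assoc)
    then show ?thesis unfolding ugauge[OF g] vec_of_eq_iff fun_eq_iff by simp
  qed
  show ?thesis
  proof
    assume "invt T"
    then have "ugauge g *v vec_of T = vec_of T" if "g \<in> carrier G" for g using that iff by (simp add: invt_def)
    then have "gproj *v vec_of T = (1 / N) *s (\<Sum>g\<in>carrier G. vec_of T)"
      by (simp add: gproj_def mvec_sum)
    moreover have "(\<Sum>g\<in>carrier G. vec_of T) = N *s vec_of T"
      by (subst vec_eq_iff) (simp only: sum_component vector_smult_component, simp add: N_def)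
    ultimately show "gproj *v vec_of T = vec_of T" using N_nonzero by simp
  next
    assume P: "gproj *v vec_of T = vec_of T"
    show "invt T" unfolding invt_def
    proof
      fix g assume g: "g \<in> carrier G"
      have "ugauge g *v vec_of T = vec_of T" using P gproj_ugauge(2)[OF g] by (metis matrix_vector_mul_assoc)
      then show "\<forall>a b. twist g T a b = uconj g (T a b)" using iff[OF g] by simp
    qed
  qed
qed

lemma invt_blocks_of: "invt (blocks_of (gproj *v x))"
  by (simp add: invt_iff matrix_vector_mul_assoc gproj_idem)

text \<open>An operator that commutes with right multiplications is determined by its value at the
  unit: it is left multiplication by that value. The conjugate of left multiplication by
  \<open>T\<close> has this property, and its value is the image of \<open>T\<close> since the unit
  is preserved. \<open>X\<close> and \<open>W\<close> stand for left and right multiplication in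
  either product.\<close>

lemma multiplicative_of_commuting:
  assumes L: "L ** Li = gproj" "gproj ** Li = Li"
    and one: "L *v vec_of (dblock (mat 1)) = vec_of (dblock (mat 1))" "Li *v vec_of (dblock (mat 1)) = vec_of (dblock (mat 1))"
    and X: "\<And>T S. X T *v vec_of S = vec_of (mul T S)" and W: "\<And>T S. W T *v vec_of S = vec_of (mul S T)"
    and mul1: "\<And>T. mul T (dblock (mat 1)) = T" "\<And>T. mul (dblock (mat 1)) T = T"
    and c: "\<And>T S. invt T \<Longrightarrow> invt S \<Longrightarrow> (Li ** X T ** L) ** W S ** gproj = W S ** (Li ** X T ** L) ** gproj"
    and TS: "invt T" "invt S"
  shows "blocks_of (Li *v vec_of (mul T S)) = mul (blocks_of (Li *v vec_of T)) (blocks_of (Li *v vec_of S))"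
proof -
  let ?S = "blocks_of (Li *v vec_of S)"
  have S': "invt ?S" unfolding invt_iff vec_of_blocks_of by (simp add: matrix_vector_mul_assoc L)
  have P1: "gproj *v vec_of (dblock (mat 1)) = vec_of (dblock (mat 1))" using comm_one by (simp flip: invt_iff add: invt_dblock)
  have PS: "gproj *v vec_of S = vec_of S" using TS by (simp flip: invt_iff)
  have "(Li ** X T ** L) *v (W ?S *v (gproj *v vec_of (dblock (mat 1)))) = W ?S *v ((Li ** X T ** L) *v (gproj *v vec_of (dblock (mat 1))))"
    using c[OF TS(1) S'] by (simp add: matrix_vector_mul_assoc matrix_mul_assoc)
  then have "(Li ** X T ** L) *v vec_of ?S = W ?S *v ((Li ** X T ** L) *v vec_of (dblock (mat 1)))"
    unfolding P1 W mul1 .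
  moreover have "(Li ** X T ** L) *v vec_of ?S = Li *v vec_of (mul T S)"
  proof -
    have "(Li ** X T ** L) *v vec_of ?S = Li *v (X T *v ((L ** Li) *v vec_of S))"
      by (simp flip: matrix_vector_mul_assoc)
    then show ?thesis unfolding L PS X .
  qed
  moreover have "(Li ** X T ** L) *v vec_of (dblock (mat 1)) = vec_of (blocks_of (Li *v vec_of T))"
  proof -
    have "(Li ** X T ** L) *v vec_of (dblock (mat 1)) = Li *v (X T *v (L *v vec_of (dblock (mat 1))))"
      by (simp flip: matrix_vector_mul_assoc)
    then show ?thesis unfolding one X mul1 vec_of_blocks_of .
  qed
  ultimately have "Li *v vec_of (mul T S) = W ?S *v vec_of (blocks_of (Li *v vec_of T))" by simp
  then show ?thesis by (simp only: W blocks_of_vec_of)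
qed

text \<open>A test operator at the origin that vanishes on \<open>U ** A\<close> kills the
  transformed state, hence by symmetry also the original one, and \<open>avg_state_zero\<close>
  makes it vanish on \<open>A\<close>. In effect \<open>Ui\<close> maps the range of
  \<open>A\<close>, onto which \<open>A ** B\<close> projects, into itself.\<close>

lemma leaves_invariant_range:
  assumes BA: "B ** A = gproj" "A ** gproj = A" and U: "Ui ** U = mat 1"
    and inv: "leaves_invariant U A"
  shows "U ** A ** B ** Ui ** A = A"
proof -
  let ?Z = "U ** A ** B ** Ui ** A - A"
  have ABA: "A ** B ** A = A" using BA by (simp flip: matrix_mul_assoc)
  have U0: "U ** A ** B ** Ui ** U ** A = U ** A"
    using U ABA by (metis matrix_mul_assoc matrix_mul_rid)
  have s: "sites_op sites3 (\<lambda>x. C x ** U ** A) bond_state3 = sites_op sites3 (\<lambda>x. C x ** A) bond_state3" for C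
    by (rule peps_symmetry_sites_op) (use inv in \<open>simp add: leaves_invariant_def\<close>)
  have "C ** ?Z = 0" for C :: "complex^_^'n legs"
  proof -
    \<comment> \<open>At the other sites \<open>B\<close> turns the tensor into
      \<open>gproj\<close>; at the origin a free \<open>C\<close> tests the physical components of
      \<open>?Z\<close>.\<close>
    let ?C = "\<lambda>x :: nat \<times> nat. if x = (0, 0) then C ** (U ** A ** B ** Ui - mat 1) else B"
    have "(U ** A ** B ** Ui - mat 1) ** (U ** A) = 0"
      using U0 by (simp add: mmult_diff matrix_mul_assoc)
    then have z: "?C (0, 0) ** U ** A = 0" by (simp flip: matrix_mul_assoc)
    have "site_op (0, 0) (?C (0, 0) ** A) (sites_op rest (\<lambda>x. ?C x ** A) bond_state3) = (\<lambda>l. 0)"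
      using s[of ?C] unfolding sites3_split z by simp
    moreover have "sites_op rest (\<lambda>x. ?C x ** A) bond_state3 = sites_op rest (\<lambda>_. gproj) bond_state3"
      by (rule sites_op_cong) (auto simp: BA)
    ultimately have "site_op (0, 0) (?C (0, 0) ** A) avg_state = (\<lambda>l. 0)"
      unfolding avg_state_split site_op_site_op by (simp add: BA flip: matrix_mul_assoc)
    then have "?C (0, 0) ** A ** gproj = 0" by (rule avg_state_zero)
    then show ?thesis using BA by (simp add: mmult_diff flip: matrix_mul_assoc)
  qed
  then have "?Z = 0"
  proof -
    assume a: "\<And>C :: complex^_^'n legs. C ** ?Z = 0"
    show "?Z = 0"
    proof (rule matrix_eqI)
      fix i j
      have "(munit j i ** ?Z) $ j $ j = 0" using a[of "munit j i"] by simp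
      then show "?Z $ i $ j = 0 $ i $ j" unfolding munit_mult_nth by simp
    qed
  qed
  then show ?thesis by simp
qed

text \<open>On the torus with a single site, up is bonded to down and right to left, so the bond
  state itself is the vector of the unit.\<close>

lemma fixes_identity_block:
  assumes BA: "B ** A = gproj" and inv: "leaves_invariant U A"
  shows "(B ** U ** A) *v vec_of (dblock (mat 1)) = vec_of (dblock (mat 1))"
proof -
  have sites1: "sites 1 1 = {(0, 0)}" by (auto simp: sites_def)
  have s: "sites_op (sites 1 1) (\<lambda>x. B ** U ** A) (bond_state 1 1) = sites_op (sites 1 1) (\<lambda>x. B ** A) (bond_state 1 1)"
    by (rule peps_symmetry_sites_op) (use inv in \<open>simp add: leaves_invariant_def\<close>)
  have Om1: "bond_state 1 1 (l((0, 0) := m)) = (vec_of (dblock (mat 1)) :: complex^'n legs) $ m" for l :: "nat \<times> nat \<Rightarrow> 'n legs" and m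
    by (cases m) (simp add: bond_state_iff sites1[simplified] below_def left_of_def vec_of_nth dblock_def mat_def)
  have sop1: "sites_op (sites 1 1) (\<lambda>x. X) (bond_state 1 1) (\<lambda>_. m) = (X *v vec_of (dblock (mat 1))) $ m" for X :: "complex^'n legs^'n legs" and m
    unfolding sites1 using sites_op_insert[of "{}" "(0 :: nat, 0 :: nat)" "\<lambda>x. X" "bond_state 1 1"]
    by (simp add: site_op_def Om1[simplified] matrix_vector_mult_def)
  have "(B ** U ** A) *v vec_of (dblock (mat 1)) = (B ** A) *v vec_of (dblock (mat 1))"
    unfolding vec_eq_iff sop1[symmetric] s by simp
  also have "\<dots> = vec_of (dblock (mat 1))"
    unfolding BA using comm_one by (simp flip: invt_iff add: invt_dblock)
  finally show ?thesis .
qed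

theorem torus_gauge:
  fixes A :: "('n, 'p::finite) tensor"
  assumes BA: "B ** A = gproj" "A ** gproj = A" and U: "Ui ** U = mat 1" "U ** Ui = mat 1"
    and inv: "leaves_invariant U A" "leaves_invariant Ui A"
  shows "\<exists>w v. invertible w \<and> invertible v \<and> U ** A = A ** gauge w v"
proof -
  define L where "L = B ** U ** A"
  define Li where "Li = B ** Ui ** A"
  note r = leaves_invariant_range[OF BA U(1) inv(1)] leaves_invariant_range[OF BA U(2) inv(2)]
  have AL: "A ** L = U ** A"
  proof -
    have "U ** A = U ** (Ui ** A ** B ** U ** A)" using r(2) by simp
    also have "\<dots> = (U ** Ui) ** A ** B ** U ** A" by (simp only: matrix_mul_assoc)
    finally show ?thesis unfolding U L_def by (simp add: matrix_mul_assoc)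
  qed
  have ALi: "A ** Li = Ui ** A"
  proof -
    have "Ui ** A = Ui ** (U ** A ** B ** Ui ** A)" using r(1) by simp
    also have "\<dots> = (Ui ** U) ** A ** B ** Ui ** A" by (simp only: matrix_mul_assoc)
    finally show ?thesis unfolding U Li_def by (simp add: matrix_mul_assoc)
  qed
  have L1: "L ** Li = gproj"
  proof -
    have "L ** Li = B ** U ** (A ** Li)" unfolding L_def by (simp add: matrix_mul_assoc)
    also have "\<dots> = B ** (U ** Ui) ** A" unfolding ALi by (simp add: matrix_mul_assoc)
    finally show ?thesis by (simp add: U BA)
  qed
  have L2: "Li ** L = gproj"
  proof -
    have "Li ** L = B ** Ui ** (A ** L)" unfolding Li_def by (simp add: matrix_mul_assoc)
    also have "\<dots> = B ** (Ui ** U) ** A" unfolding AL by (simp add: matrix_mul_assoc)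
    finally show ?thesis by (simp add: U BA)
  qed
  have LP: "L ** gproj = L" "Li ** gproj = Li" unfolding L_def Li_def using BA(2) by (simp_all flip: matrix_mul_assoc)
  have PL: "gproj ** L = L" "gproj ** Li = Li"
    unfolding BA(1)[symmetric] using AL ALi by (simp_all add: L_def Li_def flip: matrix_mul_assoc)
  have LO: "sites_op sites3 (\<lambda>_. B ** V ** A) avg_state = avg_state" if "leaves_invariant V A" for V
  proof -
    have "sites_op sites3 (\<lambda>_. B ** V ** A) avg_state = sites_op sites3 (\<lambda>_. B ** V ** A) bond_state3"
      unfolding avg_state_def sites_op_sites_op[OF finite_sites] using BA(2) by (simp flip: matrix_mul_assoc)
    also have "\<dots> = sites_op sites3 (\<lambda>_. B ** A) bond_state3"
      by (rule peps_symmetry_sites_op) (use that in \<open>simp add: leaves_invariant_def\<close>)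
    finally show ?thesis unfolding BA avg_state_def .
  qed
  have c1: "(Li ** leg_pair_op 0 1 X ** L) ** leg_pair_op 2 3 W ** gproj = leg_pair_op 2 3 W ** (Li ** leg_pair_op 0 1 X ** L) ** gproj"
    "(L ** leg_pair_op 0 1 X ** Li) ** leg_pair_op 2 3 W ** gproj = leg_pair_op 2 3 W ** (L ** leg_pair_op 0 1 X ** Li) ** gproj"
    "(Li ** leg_pair_op 0 3 X ** L) ** leg_pair_op 2 1 W ** gproj = leg_pair_op 2 1 W ** (Li ** leg_pair_op 0 3 X ** L) ** gproj"
    "(L ** leg_pair_op 0 3 X ** Li) ** leg_pair_op 2 1 W ** gproj = leg_pair_op 2 1 W ** (L ** leg_pair_op 0 3 X ** Li) ** gproj"
    if XW: "invt X" "invt W" for X W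
  proof -
    note LO1 = LO[OF inv(1), folded L_def] and LO2 = LO[OF inv(2), folded Li_def]
    obtain f1 where f1: "f1 \<in> local_ops {(0,1), (1,0), (1,1)}" "site_op (0, 0) (leg_pair_op 0 1 X) avg_state = f1 avg_state" using move_01[OF XW(1)] by (elim bexE)
    obtain f2 where f2: "f2 \<in> local_ops {(0,1), (2,0), (2,1)}" "site_op (0, 0) (leg_pair_op 0 3 X) avg_state = f2 avg_state" using move_03[OF XW(1)] by (elim bexE)
    obtain h1 where h1: "h1 \<in> local_ops {(0,2), (2,0), (2,2)}" "site_op (0, 0) (leg_pair_op 2 3 W) avg_state = h1 avg_state" using move_23[OF XW(2)] by (elim bexE)
    obtain h2 where h2: "h2 \<in> local_ops {(0,2), (1,0), (1,2)}" "site_op (0, 0) (leg_pair_op 2 1 W) avg_state = h2 avg_state" using move_21[OF XW(2)] by (elim bexE)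
    show "(Li ** leg_pair_op 0 1 X ** L) ** leg_pair_op 2 3 W ** gproj = leg_pair_op 2 3 W ** (Li ** leg_pair_op 0 1 X ** L) ** gproj"
      by (rule commute_on_avg_state[OF f1 h1 _ _ _ L1 L2 PL(1) LP(1) PL(2) LP(2) LO1 LO2]) (auto simp: sites3_eq)
    show "(L ** leg_pair_op 0 1 X ** Li) ** leg_pair_op 2 3 W ** gproj = leg_pair_op 2 3 W ** (L ** leg_pair_op 0 1 X ** Li) ** gproj"
      by (rule commute_on_avg_state[OF f1 h1 _ _ _ L2 L1 PL(2) LP(2) PL(1) LP(1) LO2 LO1]) (auto simp: sites3_eq)
    show "(Li ** leg_pair_op 0 3 X ** L) ** leg_pair_op 2 1 W ** gproj = leg_pair_op 2 1 W ** (Li ** leg_pair_op 0 3 X ** L) ** gproj"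
      by (rule commute_on_avg_state[OF f2 h2 _ _ _ L1 L2 PL(1) LP(1) PL(2) LP(2) LO1 LO2]) (auto simp: sites3_eq)
    show "(L ** leg_pair_op 0 3 X ** Li) ** leg_pair_op 2 1 W ** gproj = leg_pair_op 2 1 W ** (L ** leg_pair_op 0 3 X ** Li) ** gproj"
      by (rule commute_on_avg_state[OF f2 h2 _ _ _ L2 L1 PL(2) LP(2) PL(1) LP(1) LO2 LO1]) (auto simp: sites3_eq)
  qed
  note one = fixes_identity_block[OF BA(1) inv(1), folded L_def] fixes_identity_block[OF BA(1) inv(2), folded Li_def]
  define Lb where "Lb t = blocks_of (L *v vec_of t)" for t
  have b1: "bmul t (dblock (mat 1)) = t" "bmul (dblock (mat 1)) t = t" "omul t (dblock (mat 1)) = t" "omul (dblock (mat 1)) t = t"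
    for t :: "'n \<Rightarrow> 'n \<Rightarrow> complex^'n^'n"
    by (intro ext; simp add: bmul_dblock omul_dblock)+
  have "block_automorphism G u K Lb"
  proof unfold_locales
    show "Lb (\<lambda>i j. t i j + s i j) = (\<lambda>i j. Lb t i j + Lb s i j)" for t s
      by (simp add: Lb_def vec_of_add matrix_vector_right_distrib blocks_of_linear)
    show "Lb (\<lambda>i j. c *m t i j) = (\<lambda>i j. c *m Lb t i j)" for c t
      by (simp add: Lb_def vec_of_cscale blocks_of_linear)
    show "invt (Lb t)" for t
      unfolding Lb_def invt_iff vec_of_blocks_of by (simp add: matrix_vector_mul_assoc PL)
    show "\<exists>t. invt t \<and> Lb t = s" if "invt s" for s
    proof (intro exI conjI)
      show "invt (blocks_of (Li *v vec_of s))" unfolding invt_iff vec_of_blocks_of by (simp add: matrix_vector_mul_assoc PL)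
      show "Lb (blocks_of (Li *v vec_of s)) = s" using that by (simp add: Lb_def matrix_vector_mul_assoc L1 invt_iff)
    qed
    show "t = (\<lambda>i j. 0)" if "invt t" "Lb t = (\<lambda>i j. 0)" for t
    proof -
      have "L *v vec_of t = vec_of (Lb t)" by (simp add: Lb_def)
      then have "L *v vec_of t = 0" unfolding that(2) vec_of_zero .
      then have "gproj *v vec_of t = 0" unfolding L2[symmetric] by (simp flip: matrix_vector_mul_assoc)
      then have "vec_of t = vec_of (\<lambda>i j. 0)" using that(1) by (simp add: invt_iff vec_of_zero)
      then show ?thesis by (simp only: vec_of_eq_iff)
    qed
    \<comment> \<open>The lemma concerns the second of its two mutually inverse matrices, so it is
      used with \<open>L\<close> and \<open>Li\<close> exchanged.\<close>
    show "Lb (bmul t s) = bmul (Lb t) (Lb s)" if "invt t" "invt s" for t s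
      unfolding Lb_def
      by (rule multiplicative_of_commuting[OF L2 PL(1) one(2) one(1) leg_pair_op_vec_of(1) leg_pair_op_vec_of(2) b1(1) b1(2) c1(2) that])
    show "Lb (omul t s) = omul (Lb t) (Lb s)" if "invt t" "invt s" for t s
      unfolding Lb_def
      by (rule multiplicative_of_commuting[OF L2 PL(1) one(2) one(1) leg_pair_op_vec_of(3) leg_pair_op_vec_of(4) b1(3) b1(4) c1(4) that])
  qed
  then obtain w v where wv: "invertible w" "invertible v"
    and Lwv: "\<And>t i j. invt t \<Longrightarrow> Lb t i j = (\<Sum>p\<in>UNIV. \<Sum>q\<in>UNIV. (w $ i $ p * matrix_inv w $ q $ j) *m (v ** t p q ** matrix_inv v))"
    by (rule block_automorphism.inner) blast
  let ?g = "gauge w v" and ?gi = "gauge (matrix_inv w) (matrix_inv v)"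
  note gi = gauge_inv[OF wv]
  have gk: "?g = leg_prod (\<lambda>k. if k = 0 then w else if k = 1 then v else if k = 2 then transpose (matrix_inv w) else transpose (matrix_inv v))"
    by (simp add: gauge_def leg_prod_def)
  have L_g: "L = ?g ** gproj"
  proof (rule matrix_eq_by_vec)
    fix x
    let ?t = "blocks_of (gproj *v x)"
    have "L *v x = vec_of (Lb ?t)" by (simp add: Lb_def matrix_vector_mul_assoc LP)
    also have "Lb ?t = (\<lambda>i j. \<Sum>p\<in>UNIV. \<Sum>q\<in>UNIV. (w $ i $ p * matrix_inv w $ q $ j) *m (v ** ?t p q ** matrix_inv v))"
      by (intro ext Lwv invt_blocks_of)
    also have "vec_of \<dots> = ?g *v vec_of ?t" unfolding gk leg_prod_vec_of by (simp add: transpose_def)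
    finally show "L *v x = (?g ** gproj) *v x" by (simp add: matrix_vector_mul_assoc)
  qed
  have Li_g: "Li = ?gi ** gproj"
  proof -
    have "?gi ** gproj = ?gi ** (?g ** gproj) ** Li" unfolding L_g[symmetric] using L1 by (simp flip: matrix_mul_assoc)
    also have "\<dots> = Li" by (simp add: matrix_mul_assoc gi PL)
    finally show ?thesis ..
  qed
  \<comment> \<open>The description \<open>L = ?g ** gproj\<close> determines the gauge only after
    the projector. To drop the projector, note that the conjugate of \<open>ugauge g\<close> fixes
    \<open>gproj\<close> from the left, so by rigidity it is some \<open>ugauge h\<close>; hence it
    is absorbed from the other side too.\<close>
  have conj: "gproj ** (?g ** ugauge g ** ?gi) = gproj" if g: "g \<in> carrier G" for g
  proof -
    let ?y = "w ** u g ** matrix_inv w" and ?x = "v ** u g ** matrix_inv v"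
    have G: "?g ** ugauge g ** ?gi = gauge ?y ?x"
      unfolding ugauge_gauge[OF g] using wv g by (simp add: gauge_mult u_matrix_inv invertible_matrix_inv invertible_mult)
    have "?g ** ugauge g ** ?gi ** gproj = ?g ** ugauge g ** (gproj ** Li)" by (simp only: PL(2)) (simp only: Li_g matrix_mul_assoc)
    also have "\<dots> = ?g ** (ugauge g ** gproj) ** Li" by (simp only: matrix_mul_assoc)
    also have "\<dots> = gproj" unfolding gproj_ugauge(2)[OF g] L_g[symmetric] L1 ..
    finally have "gauge ?y ?x ** gproj = gproj" unfolding G .
    moreover have "invertible ?y" "invertible ?x" using wv g by (simp_all add: u_matrix_inv invertible_matrix_inv invertible_mult)
    ultimately obtain h c d where h: "h \<in> carrier G" "c \<noteq> 0" "d \<noteq> 0" "?y = c *m u h" "?x = d *m u h"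
      using gauge_gproj_rigid by blast
    have "gauge ?y ?x = ugauge h" unfolding h(4,5) ugauge_gauge[OF h(1)] using h by (simp add: gauge_cscale u_matrix_inv)
    then show ?thesis unfolding G using gproj_ugauge(1)[OF h(1)] by simp
  qed
  have "gproj ** ?g ** gproj ** ?gi = gproj"
  proof -
    have "gproj ** ?g ** gproj ** ?gi = (1 / N) *m (\<Sum>g\<in>carrier G. gproj ** (?g ** ugauge g ** ?gi))"
      by (subst (2) gproj_def) (simp add: mmult_sum matrix_mul_assoc)
    also have "\<dots> = (1 / N) *m (\<Sum>g\<in>carrier G. gproj)" by (simp add: conj)
    also have "\<dots> = gproj" unfolding sum_const_N using N_nonzero by simp
    finally show ?thesis .
  qed
  then have "gproj ** ?g ** gproj ** (?gi ** ?g) = gproj ** ?g" by (simp add: matrix_mul_assoc)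
  then have comm: "gproj ** (?g ** gproj) = gproj ** ?g" unfolding gi by (simp add: matrix_mul_assoc)
  have "U ** A = A ** L" by (simp add: AL)
  also have "\<dots> = A ** (gproj ** (?g ** gproj))" by (simp add: PL flip: L_g)
  also have "\<dots> = A ** ?g" by (simp only: comm) (simp only: matrix_mul_assoc BA)
  finally show ?thesis using wv by blast
qed

end

section \<open>Linear independence of the group matrices\<close>

definition cip :: "complex^'m \<Rightarrow> complex^'m \<Rightarrow> complex" where
  "cip x y = (\<Sum>i\<in>UNIV. cnj (x $ i) * y $ i)"

lemma cip_linear: "cip x (y + z) = cip x y + cip x z" "cip x (y - z) = cip x y - cip x z" "cip x 0 = 0"
  "cip x (c *s y) = c * cip x y" "cip 0 y = 0"
  by (simp_all add: cip_def sum.distrib sum_subtractf algebra_simps sum_distrib_left)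

lemma cip_self: "cip x x = complex_of_real (\<Sum>i\<in>UNIV. (cmod (x $ i))\<^sup>2)"
proof -
  have "cnj z * z = complex_of_real ((cmod z)\<^sup>2)" for z
    using complex_norm_square[of z] by (simp only: mult.commute)
  then show ?thesis unfolding cip_def of_real_sum by simp
qed

lemma cip_self_eq_0: "cip x x = 0 \<longleftrightarrow> x = 0"
  unfolding cip_self of_real_eq_0_iff by (subst sum_nonneg_eq_0_iff) (auto simp: vec_eq_iff)

lemma cnj_cip_self: "cnj (cip x x) = cip x x"
  unfolding cip_self by simp

lemma cadjoint_nth: "cadjoint X $ i $ j = cnj (X $ j $ i)"
  by (simp add: cadjoint_def)

lemma cadjoint_cadjoint [simp]: "cadjoint (cadjoint X) = X"
  by (simp add: cadjoint_def vec_eq_iff)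

lemma cadjoint_simps: "cadjoint (mat 1 :: complex^'m^'m) = mat 1" "cadjoint (X + Y) = cadjoint X + cadjoint Y"
  "cadjoint (X - Y) = cadjoint X - cadjoint Y" "cadjoint 0 = 0" "cadjoint (c *m X) = cnj c *m cadjoint X"
  by (auto simp: cadjoint_def vec_eq_iff mat_def)

lemma cadjoint_sum: "cadjoint (\<Sum>i\<in>S. f i) = (\<Sum>i\<in>S. cadjoint (f i))"
  by (auto simp: cadjoint_def vec_eq_iff)

lemma cadjoint_mult: "cadjoint (X ** Y) = cadjoint Y ** cadjoint X"
  by (rule matrix_eqI) (simp add: cadjoint_nth mmult_nth mult.commute)

lemma cip_cadjoint: "cip x (E *v y) = cip (cadjoint E *v x) y"
  unfolding cip_def matrix_vector_mult_def
  by (simp add: sum_distrib_left sum_distrib_right cadjoint_nth mult_ac) (rule sum.swap)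

text \<open>Gram-Schmidt: the projector for \<open>S\<close> is enlarged by the rank-one projector
  onto the residual \<open>r\<close> of the new vector, unless that residual is zero.\<close>

lemma orthogonal_projector_exists:
  fixes b :: "'i \<Rightarrow> complex^'m"
  assumes "finite S"
  shows "\<exists>E :: complex^'m^'m. E ** E = E \<and> cadjoint E = E \<and>
    (\<forall>x. \<exists>c. E *v x = (\<Sum>s\<in>S. c s *s b s)) \<and> (\<forall>s\<in>S. E *v b s = b s)"
  using assms
proof (induction S rule: finite_induct)
  case empty
  show ?case by (rule exI[of _ 0]) (auto simp: cadjoint_simps)
next
  case (insert a S)
  then obtain E :: "complex^'m^'m" where E: "E ** E = E" "cadjoint E = E"
    and span: "\<And>x. \<exists>c. E *v x = (\<Sum>s\<in>S. c s *s b s)" and fixS: "\<And>s. s \<in> S \<Longrightarrow> E *v b s = b s" by blast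
  define r where "r = b a - E *v b a"
  have Er: "E *v r = 0" by (simp add: r_def matrix_vector_mult_diff_distrib matrix_vector_mul_assoc E)
  show ?case
  proof (cases "r = 0")
    case True
    have "\<exists>c. E *v x = (\<Sum>s\<in>insert a S. c s *s b s)" for x
    proof -
      obtain c where c: "E *v x = (\<Sum>s\<in>S. c s *s b s)" using span by blast
      have "(\<Sum>s\<in>insert a S. (c(a := 0)) s *s b s) = (\<Sum>s\<in>S. c s *s b s)"
        using insert.hyps by (auto intro!: sum.cong)
      then show ?thesis unfolding c by metis
    qed
    then show ?thesis using E fixS True by (intro exI[of _ E]) (auto simp: r_def)
  next
    case False
    define n where "n = cip r r"
    have n: "n \<noteq> 0" "cnj n = n" using False by (simp_all add: n_def cip_self_eq_0 cnj_cip_self)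
    define R where "R = (\<chi> i j. r $ i * cnj (r $ j) / n)"
    have Rv: "R *v x = (cip r x / n) *s r" for x
      by (simp add: vec_eq_iff R_def matrix_vector_mult_def cip_def sum_distrib_left sum_distrib_right sum_divide_distrib mult_ac)
    have Ra: "cadjoint R = R" by (rule matrix_eqI) (simp add: cadjoint_nth R_def n mult.commute)
    have RR: "R ** R = R"
      by (rule matrix_eq_by_vec) (simp add: Rv n cip_linear n_def[symmetric] flip: matrix_vector_mul_assoc)
    have ER: "E ** R = 0"
      by (rule matrix_eq_by_vec) (simp add: Rv Er flip: matrix_vector_mul_assoc)
    have RE: "R ** E = 0" using arg_cong[OF ER, of cadjoint] by (simp add: cadjoint_mult cadjoint_simps Ra E)
    have Rb: "R *v (E *v x) = 0" for x by (simp add: matrix_vector_mul_assoc RE)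
    have "\<exists>c. (E + R) *v x = (\<Sum>s\<in>insert a S. c s *s b s)" for x
    proof -
      obtain c where c: "E *v x = (\<Sum>s\<in>S. c s *s b s)" using span by blast
      obtain d where d: "E *v b a = (\<Sum>s\<in>S. d s *s b s)" using span by blast
      let ?k = "cip r x / n"
      have "(E + R) *v x = (\<Sum>s\<in>S. c s *s b s) + ?k *s (b a - (\<Sum>s\<in>S. d s *s b s))"
        by (simp add: matrix_vector_mult_add_rdistrib Rv c r_def d)
      also have "\<dots> = (\<Sum>s\<in>S. (c s - ?k * d s) *s b s) + ?k *s b a"
        by (simp add: vec.scale_right_diff_distrib vec.scale_left_diff_distrib sum_subtractf vec.scale_sum_right)
      also have "\<dots> = (\<Sum>s\<in>insert a S. (if s = a then ?k else c s - ?k * d s) *s b s)"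
        using insert.hyps by (auto simp: add.commute intro!: sum.cong)
      finally show ?thesis by (rule exI[of _ "\<lambda>s. if s = a then ?k else c s - ?k * d s"])
    qed
    moreover have "(E + R) *v b s = b s" if "s \<in> insert a S" for s
    proof (cases "s \<in> S")
      case True
      then show ?thesis using Rb[of "b s"] by (simp add: matrix_vector_mult_add_rdistrib fixS)
    next
      case False
      then have s: "b s = r + E *v b a" using that by (simp add: r_def)
      have "cip r r / n = 1" using n by (simp add: n_def)
      moreover have "E *v (E *v b a) = E *v b a" by (simp add: matrix_vector_mul_assoc E)
      ultimately show ?thesis unfolding s
        by (simp add: matrix_vector_mult_add_rdistrib matrix_vector_right_distrib Rb Er Rv[of r])
    qed
    ultimately show ?thesis
      by (intro exI[of _ "E + R"]) (simp add: mmult_add E RR ER RE cadjoint_simps Ra)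
  qed
qed

text \<open>By independence the component of \<open>b a\<close> orthogonal to the other vectors is
  nonzero. The inner product with it, divided by its squared norm, is the functional.\<close>

lemma dual_functional:
  fixes b :: "'i \<Rightarrow> complex^'m"
  assumes S: "finite S" "a \<in> S" and indep: "\<And>c. (\<Sum>s\<in>S. c s *s b s) = 0 \<Longrightarrow> \<forall>s\<in>S. c s = 0"
  shows "\<exists>y :: complex^'m. \<forall>s\<in>S. (\<Sum>i\<in>UNIV. y $ i * b s $ i) = (if s = a then 1 else 0)"
proof -
  have "finite (S - {a})" using S by simp
  from orthogonal_projector_exists[OF this, of b] obtain E :: "complex^'m^'m" where E: "E ** E = E" "cadjoint E = E"
    and span: "\<And>x. \<exists>c. E *v x = (\<Sum>s\<in>S - {a}. c s *s b s)" and fixS: "\<And>s. s \<in> S - {a} \<Longrightarrow> E *v b s = b s" by blast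
  define r where "r = b a - E *v b a"
  have Er: "E *v r = 0" by (simp add: r_def matrix_vector_mult_diff_distrib matrix_vector_mul_assoc E)
  have "r \<noteq> 0"
  proof
    assume "r = 0"
    obtain c where c: "E *v b a = (\<Sum>s\<in>S - {a}. c s *s b s)" using span by blast
    have "(\<Sum>s\<in>S. (if s = a then - 1 else c s) *s b s) = - b a + (\<Sum>s\<in>S - {a}. c s *s b s)"
      using S by (subst sum.remove[of _ a]) (auto intro!: sum.cong)
    then have "(\<Sum>s\<in>S. (if s = a then - 1 else c s) *s b s) = 0" using \<open>r = 0\<close> by (simp add: r_def c)
    from indep[OF this] S show False by auto
  qed
  have rE: "cip r (E *v x) = 0" for x unfolding cip_cadjoint E Er by (simp add: cip_linear)
  have ra: "cip r (b a) = cip r r"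
  proof -
    have "cip r r = cip r (b a) - cip r (E *v b a)" by (subst (2) r_def) (rule cip_linear)
    then show ?thesis by (simp add: rE)
  qed
  show ?thesis
  proof (intro exI ballI)
    fix s assume s: "s \<in> S"
    have "(\<Sum>i\<in>UNIV. (\<chi> i. cnj (r $ i) / cip r r) $ i * b s $ i) = cip r (b s) / cip r r"
      by (simp add: cip_def[of r "b s"] sum_divide_distrib)
    also have "\<dots> = (if s = a then 1 else 0)"
    proof (cases "s = a")
      case True
      then show ?thesis using \<open>r \<noteq> 0\<close> by (simp add: ra cip_self_eq_0)
    next
      case False
      then show ?thesis using rE[of "b s"] fixS[of s] s by simp
    qed
    finally show "(\<Sum>i\<in>UNIV. (\<chi> i. cnj (r $ i) / cip r r) $ i * b s $ i) = (if s = a then 1 else 0)" .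
  qed
qed

text \<open>Induction on \<open>k\<close> splits off the last coordinate. The count matters: a
  proper subspace has fewer than \<open>k\<close> generators, which is what contradicts minimality
  in \<open>minimal_family_irreducible\<close>.\<close>

lemma coord_subspace_spanned:
  fixes S :: "(nat \<Rightarrow> complex) set"
  assumes "S \<subseteq> coord_space k" "(\<lambda>_. 0) \<in> S"
    and "\<And>x y. x \<in> S \<Longrightarrow> y \<in> S \<Longrightarrow> (\<lambda>i. x i + y i) \<in> S" "\<And>c x. x \<in> S \<Longrightarrow> (\<lambda>i. c * x i) \<in> S"
  shows "\<exists>r\<le>k. \<exists>b. (\<forall>j<r. b j \<in> S) \<and> (\<forall>x\<in>S. \<exists>c. x = (\<lambda>i. \<Sum>j<r. c j * b j i)) \<and> (r = k \<longrightarrow> S = coord_space k)"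
  using assms
proof (induction k arbitrary: S)
  case 0
  then have "S = {\<lambda>_. 0}" by (auto simp: coord_space_def)
  then show ?case by (auto simp: coord_space_def)
next
  case (Suc k)
  note add = Suc.prems(3) and scale = Suc.prems(4)
  let ?S' = "S \<inter> coord_space k"
  have "\<exists>r\<le>k. \<exists>b. (\<forall>j<r. b j \<in> ?S') \<and> (\<forall>x\<in>?S'. \<exists>c. x = (\<lambda>i. \<Sum>j<r. c j * b j i)) \<and> (r = k \<longrightarrow> ?S' = coord_space k)"
    by (rule Suc.IH) (use Suc.prems in \<open>auto simp: coord_space_def\<close>)
  then obtain r b where r: "r \<le> k" and b: "\<And>j. j < r \<Longrightarrow> b j \<in> ?S'"
    and span: "\<And>x. x \<in> ?S' \<Longrightarrow> \<exists>c. x = (\<lambda>i. \<Sum>j<r. c j * b j i)" and full: "r = k \<Longrightarrow> ?S' = coord_space k" by blast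
  show ?case
  proof (cases "S \<subseteq> coord_space k")
    case True
    then have "?S' = S" by auto
    then show ?thesis using r b span by (intro exI[of _ r] conjI exI[of _ b]) auto
  next
    case False
    then obtain x where x: "x \<in> S" "x \<notin> coord_space k" by auto
    have xk: "x k \<noteq> 0"
    proof
      assume "x k = 0"
      moreover have "x i = 0" if "i \<ge> Suc k" for i
        using x(1) Suc.prems(1) that by (auto simp: coord_space_def)
      ultimately have "x i = 0" if "i \<ge> k" for i using that by (cases "i = k") auto
      then have "x \<in> coord_space k" by (simp add: coord_space_def)
      then show False using x by simp
    qed
    define b' where "b' = b(r := x)"
    have red: "(\<lambda>i. y i + (- (y k / x k)) * x i) \<in> ?S'" if y: "y \<in> S" for y
    proof
      show m: "(\<lambda>i. y i + (- (y k / x k)) * x i) \<in> S" by (rule add[OF y scale[OF x(1)]])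
      have "y i + (- (y k / x k)) * x i = 0" if "i \<ge> k" for i
      proof (cases "i = k")
        case True then show ?thesis using xk by simp
      next
        case False
        then have "y i = 0" "x i = 0" using y x(1) Suc.prems(1) that by (auto simp: coord_space_def)
        then show ?thesis by simp
      qed
      then show "(\<lambda>i. y i + (- (y k / x k)) * x i) \<in> coord_space k" unfolding coord_space_def by blast
    qed
    have "\<exists>c. y = (\<lambda>i. \<Sum>j<Suc r. c j * b' j i)" if y: "y \<in> S" for y
    proof -
      obtain c where c: "(\<lambda>i. y i + (- (y k / x k)) * x i) = (\<lambda>i. \<Sum>j<r. c j * b j i)" using span[OF red[OF y]] by blast
      have "y i = (\<Sum>j<Suc r. (c(r := y k / x k)) j * b' j i)" for i
      proof -
        have "(\<Sum>j<Suc r. (c(r := y k / x k)) j * b' j i) = (\<Sum>j<r. c j * b j i) + y k / x k * x i"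
          by (simp add: b'_def)
        then show ?thesis using fun_cong[OF c, of i] by (simp add: algebra_simps)
      qed
      then show ?thesis by blast
    qed
    moreover have "b' j \<in> S" if "j < Suc r" for j
      using that b[of j] x by (auto simp: b'_def less_Suc_eq)
    moreover have "S = coord_space (Suc k)" if "Suc r = Suc k"
    proof
      show "S \<subseteq> coord_space (Suc k)" by (rule Suc.prems)
      show "coord_space (Suc k) \<subseteq> S"
      proof
        fix y assume y: "y \<in> coord_space (Suc k)"
        let ?z = "\<lambda>i. y i + (- (y k / x k)) * x i"
        have "?z i = 0" if "i \<ge> k" for i
        proof (cases "i = k")
          case True then show ?thesis using xk by simp
        next
          case False
          then have "y i = 0" "x i = 0" using y x(1) Suc.prems(1) that by (auto simp: coord_space_def)
          then show ?thesis by simp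
        qed
        then have "?z \<in> coord_space k" unfolding coord_space_def by blast
        then have "?z \<in> S" using full that by auto
        from add[OF this scale[OF x(1), of "y k / x k"]] show "y \<in> S" by simp
      qed
    qed
    ultimately show ?thesis using r by (intro exI[of _ "Suc r"]) auto
  qed
qed


text \<open>The kernel of the extension of \<open>u\<close> to the group algebra, whose elements are
  represented by their coefficient functions.\<close>

definition annihilator :: "('g, 'b) monoid_scheme \<Rightarrow> ('g \<Rightarrow> complex^'n^'n) \<Rightarrow> ('g \<Rightarrow> complex) set" where
  "annihilator G u = {f. (\<Sum>g\<in>carrier G. f g *m u g) = 0}"

text \<open>A nonzero left-translation-invariant space of functions inside the annihilator, spanned by the
  family \<open>w\<close>.\<close>

definition invariant_family ::
  "('g, 'b) monoid_scheme \<Rightarrow> ('g \<Rightarrow> complex^'n^'n) \<Rightarrow> 'i set \<Rightarrow> ('i \<Rightarrow> 'g \<Rightarrow> complex) \<Rightarrow> bool" where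
  "invariant_family G u J w \<longleftrightarrow> (\<forall>j\<in>J. w j \<in> annihilator G u) \<and> (\<exists>j\<in>J. \<exists>h\<in>carrier G. w j h \<noteq> 0) \<and>
     (\<forall>g\<in>carrier G. \<forall>j\<in>J. \<exists>c. \<forall>h\<in>carrier G. w j (inv\<^bsub>G\<^esub> g \<otimes>\<^bsub>G\<^esub> h) = (\<Sum>i\<in>J. c i * w i h))"

lemma annihilator_linear:
  assumes "\<And>j. j \<in> J \<Longrightarrow> w j \<in> annihilator G u"
  shows "(\<lambda>h. \<Sum>j\<in>J. c j * w j h) \<in> annihilator G u"
proof -
  have "(\<Sum>g\<in>carrier G. (\<Sum>j\<in>J. c j * w j g) *m u g) = (\<Sum>j\<in>J. c j *m (\<Sum>g\<in>carrier G. w j g *m u g))"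
    by (simp add: cscale_sum_left cscale_sum) (rule sum.swap)
  also have "\<dots> = 0" using assms by (simp add: annihilator_def)
  finally show ?thesis by (simp add: annihilator_def)
qed

lemma invariant_family_reindex:
  assumes "invariant_family G u J w" "finite J"
  shows "\<exists>w'. invariant_family G u {..<card J} w'"
proof -
  obtain h where h: "bij_betw h {..<card J} J"
    using ex_bij_betw_nat_finite[OF assms(2)] by (metis atLeast0LessThan)
  have im: "J = h ` {..<card J}" and inj: "inj_on h {..<card J}" using h by (auto simp: bij_betw_def)
  have "invariant_family G u {..<card J} (w \<circ> h)"
    unfolding invariant_family_def
  proof (intro conjI ballI)
    show "(w \<circ> h) j \<in> annihilator G u" if "j \<in> {..<card J}" for j
      using that assms(1) im unfolding invariant_family_def by auto
    show "\<exists>j\<in>{..<card J}. \<exists>ha\<in>carrier G. (w \<circ> h) j ha \<noteq> 0"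
    proof -
      obtain j x where "j \<in> J" "x \<in> carrier G" "w j x \<noteq> 0"
        using assms(1) unfolding invariant_family_def by blast
      moreover then obtain i where "i \<in> {..<card J}" "j = h i" using im by auto
      ultimately show ?thesis by (intro bexI[of _ i] bexI[of _ x]) simp_all
    qed
    fix g j assume g: "g \<in> carrier G" and j: "j \<in> {..<card J}"
    have "h j \<in> J" using im j by auto
    then obtain c where c: "\<And>x. x \<in> carrier G \<Longrightarrow> w (h j) (inv\<^bsub>G\<^esub> g \<otimes>\<^bsub>G\<^esub> x) = (\<Sum>i\<in>J. c i * w i x)"
      using assms(1) g unfolding invariant_family_def by blast
    have "(\<Sum>i\<in>J. c i * w i x) = (\<Sum>i<card J. c (h i) * w (h i) x)" for x
      using sum.reindex_bij_betw[OF h, of "\<lambda>i. c i * w i x"] by simp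
    then show "\<exists>c. \<forall>x\<in>carrier G. (w \<circ> h) j (inv\<^bsub>G\<^esub> g \<otimes>\<^bsub>G\<^esub> x) = (\<Sum>i<card J. c i * (w \<circ> h) i x)"
      using c by (intro exI[of _ "c \<circ> h"]) simp
  qed
  then show ?thesis by (rule exI[of _ "w \<circ> h"])
qed

lemma (in group) annihilator_translate:
  assumes "representation G u" "f \<in> annihilator G u" "g \<in> carrier G"
  shows "(\<lambda>h. f (inv g \<otimes> h)) \<in> annihilator G u"
proof -
  have "(\<Sum>h\<in>carrier G. f (inv g \<otimes> h) *m u h) = (\<Sum>h\<in>carrier G. f h *m u (g \<otimes> h))"
    by (rule sum.reindex_bij_witness[of _ "\<lambda>h. g \<otimes> h" "\<lambda>h. inv g \<otimes> h"]) (use assms(3) in \<open>auto simp flip: m_assoc\<close>)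
  also have "\<dots> = u g ** (\<Sum>h\<in>carrier G. f h *m u h)"
    using assms by (simp add: mmult_sum representation_def)
  finally show ?thesis using assms(2) by (simp add: annihilator_def)
qed

text \<open>The matrices \<open>u g\<close> need not be unitary, but they are unitary for the
  averaged inner product with Gram matrix \<open>H\<close>. The adjoint of a linear relation with
  respect to \<open>H\<close> is again a relation, and \<open>H\<close> can be cancelled because it
  is positive definite.\<close>

lemma (in group) annihilator_star:
  assumes u: "representation G u" and fin: "finite (carrier G)" and f: "f \<in> annihilator G u"
  shows "(\<lambda>g. cnj (f (inv g))) \<in> annihilator G u"
proof -
  define H where "H = (\<Sum>g\<in>carrier G. cadjoint (u g) ** u g)"
  have u1: "u \<one> = mat 1" and um: "g \<in> carrier G \<Longrightarrow> h \<in> carrier G \<Longrightarrow> u (g \<otimes> h) = u g ** u h" for g h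
    using u by (simp_all add: representation_def)
  have Hu: "cadjoint (u g) ** H = H ** u (inv g)" if g: "g \<in> carrier G" for g
  proof -
    have "cadjoint (u g) ** H = (\<Sum>h\<in>carrier G. cadjoint (u (h \<otimes> g)) ** u h)"
      using g by (simp add: H_def mmult_sum um cadjoint_mult matrix_mul_assoc)
    also have "\<dots> = (\<Sum>h\<in>carrier G. cadjoint (u h) ** u (h \<otimes> inv g))"
      by (rule sum.reindex_bij_witness[of _ "\<lambda>h. h \<otimes> inv g" "\<lambda>h. h \<otimes> g"]) (use g in \<open>auto simp: m_assoc\<close>)
    finally show ?thesis using g by (simp add: H_def mmult_sum um matrix_mul_assoc)
  qed
  have Hinj: "x = 0" if "H *v x = 0" for x
  proof -
    have "cip x (H *v x) = (\<Sum>g\<in>carrier G. cip (u g *v x) (u g *v x))"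
    proof -
      have "cip x (\<Sum>g\<in>S. y g) = (\<Sum>g\<in>S. cip x (y g))" for S and y :: "'a \<Rightarrow> complex^_"
        by (induction S rule: infinite_finite_induct) (simp_all add: cip_linear)
      then show ?thesis by (simp add: H_def mvec_sum cip_cadjoint flip: matrix_vector_mul_assoc)
    qed
    also have "\<dots> = complex_of_real (\<Sum>g\<in>carrier G. \<Sum>i\<in>UNIV. (cmod ((u g *v x) $ i))\<^sup>2)"
      by (simp only: cip_self of_real_sum)
    finally have "complex_of_real (\<Sum>g\<in>carrier G. \<Sum>i\<in>UNIV. (cmod ((u g *v x) $ i))\<^sup>2) = 0"
      unfolding that cip_linear ..
    then have "(\<Sum>g\<in>carrier G. \<Sum>i\<in>UNIV. (cmod ((u g *v x) $ i))\<^sup>2) = 0"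
      by (simp only: of_real_eq_0_iff)
    then have "(\<Sum>i\<in>UNIV. (cmod ((u \<one> *v x) $ i))\<^sup>2) = 0"
      using fin by (subst (asm) sum_nonneg_eq_0_iff) (auto intro: sum_nonneg)
    then show ?thesis unfolding u1 by (subst (asm) sum_nonneg_eq_0_iff) (auto simp: vec_eq_iff)
  qed
  have "0 = cadjoint (\<Sum>g\<in>carrier G. f g *m u g) ** H"
    using f by (simp add: annihilator_def cadjoint_simps)
  also have "\<dots> = (\<Sum>g\<in>carrier G. cnj (f g) *m (H ** u (inv g)))"
    by (simp add: cadjoint_sum cadjoint_simps mmult_sum Hu)
  also have "\<dots> = (\<Sum>g\<in>carrier G. cnj (f (inv g)) *m (H ** u g))"
    by (rule sum.reindex_bij_witness[of _ "\<lambda>g. inv g" "\<lambda>g. inv g"]) auto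
  also have "\<dots> = H ** (\<Sum>g\<in>carrier G. cnj (f (inv g)) *m u g)" by (simp add: mmult_sum)
  finally have "H ** (\<Sum>g\<in>carrier G. cnj (f (inv g)) *m u g) = 0" ..
  then have "(\<Sum>g\<in>carrier G. cnj (f (inv g)) *m u g) = 0"
  proof -
    assume z: "H ** (\<Sum>g\<in>carrier G. cnj (f (inv g)) *m u g) = 0"
    show ?thesis
    proof (rule matrix_eq_by_vec)
      fix x
      have "H *v ((\<Sum>g\<in>carrier G. cnj (f (inv g)) *m u g) *v x) = 0"
        unfolding matrix_vector_mul_assoc z by simp
      then show "(\<Sum>g\<in>carrier G. cnj (f (inv g)) *m u g) *v x = 0 *v x" using Hinj by simp
    qed
  qed
  then show ?thesis by (simp add: annihilator_def)
qed

text \<open>Minimality makes the family linearly independent, since a dependent member could be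
  dropped; the translation coefficients are then unique and form a representation. A nonzero proper
  invariant subspace would provide a shorter invariant family.\<close>

lemma (in group) minimal_family_irreducible:
  assumes u: "representation G u" and fin: "finite (carrier G)"
    and fam: "invariant_family G u {..<k} w"
    and min: "\<And>r w'. r < k \<Longrightarrow> \<not> invariant_family G u {..<r :: nat} w'"
    and \<rho>: "\<And>g j h. g \<in> carrier G \<Longrightarrow> j < k \<Longrightarrow> h \<in> carrier G \<Longrightarrow> w j (inv g \<otimes> h) = (\<Sum>i<k. \<rho> g i j * w i h)"
  shows "irreducible_matrix_rep G k \<rho>"
proof -
  have wI: "j < k \<Longrightarrow> w j \<in> annihilator G u" for j using fam by (simp add: invariant_family_def)
  obtain j0 h0 where j0: "j0 < k" "h0 \<in> carrier G" "w j0 h0 \<noteq> 0"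
    using fam by (auto simp: invariant_family_def)
  have indep: "\<forall>i<k. c i = 0" if c: "\<And>h. h \<in> carrier G \<Longrightarrow> (\<Sum>i<k. c i * w i h) = 0" for c
  proof (rule ccontr)
    assume "\<not> (\<forall>i<k. c i = 0)"
    then obtain m where m: "m < k" "c m \<noteq> 0" by auto
    let ?J = "{..<k} - {m}"
    have sm: "(\<Sum>i<k. F i) = F m + (\<Sum>i\<in>?J. F i)" for F :: "nat \<Rightarrow> complex"
      using m by (subst sum.remove[of _ m]) auto
    have wm: "w m h = (\<Sum>i\<in>?J. (- c i / c m) * w i h)" if "h \<in> carrier G" for h
    proof -
      have "c m * w m h = - (\<Sum>i\<in>?J. c i * w i h)" using c[OF that] unfolding sm by (simp add: add_eq_0_iff2)
      then have "w m h = - (\<Sum>i\<in>?J. c i * w i h) / c m" using m by (simp add: field_simps)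
      then show ?thesis by (simp add: sum_divide_distrib sum_negf)
    qed
    have "invariant_family G u ?J w"
      unfolding invariant_family_def
    proof (intro conjI ballI)
      show "w j \<in> annihilator G u" if "j \<in> ?J" for j using that wI by auto
      show "\<exists>j\<in>?J. \<exists>h\<in>carrier G. w j h \<noteq> 0"
      proof (rule ccontr)
        assume a: "\<not> (\<exists>j\<in>?J. \<exists>h\<in>carrier G. w j h \<noteq> 0)"
        then have "w m h = 0" if "h \<in> carrier G" for h unfolding wm[OF that] using that by (intro sum.neutral) auto
        then show False using a j0 by (cases "j0 = m") auto
      qed
      fix g j assume g: "g \<in> carrier G" and j: "j \<in> ?J"
      have "w j (inv g \<otimes> h) = (\<Sum>i\<in>?J. (\<rho> g i j + \<rho> g m j * (- c i / c m)) * w i h)" if h: "h \<in> carrier G" for h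
      proof -
        have "w j (inv g \<otimes> h) = \<rho> g m j * w m h + (\<Sum>i\<in>?J. \<rho> g i j * w i h)"
          using \<rho>[OF g _ h, of j] j unfolding sm by simp
        then show ?thesis unfolding wm[OF h] by (simp add: sum_distrib_left sum.distrib[symmetric] algebra_simps)
      qed
      then show "\<exists>c. \<forall>h\<in>carrier G. w j (inv g \<otimes> h) = (\<Sum>i\<in>?J. c i * w i h)"
        by (intro exI[of _ "\<lambda>i. \<rho> g i j + \<rho> g m j * (- c i / c m)"] ballI)
    qed
    from invariant_family_reindex[OF this] min[of "card ?J"] m show False by auto
  qed
  have uniq: "\<forall>i<k. c i = d i" if "\<And>h. h \<in> carrier G \<Longrightarrow> (\<Sum>i<k. c i * w i h) = (\<Sum>i<k. d i * w i h)" for c d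
    using indep[of "\<lambda>i. c i - d i"] that by (simp add: left_diff_distrib sum_subtractf)
  have one: "\<forall>i<k. \<rho> \<one> i j = (if i = j then 1 else 0)" if j: "j < k" for j
  proof (rule uniq)
    fix h assume h: "h \<in> carrier G"
    have "(\<Sum>i<k. (if i = j then 1 else 0) * w i h) = (\<Sum>i<k. if i = j then w i h else 0)"
      by (intro sum.cong) auto
    then show "(\<Sum>i<k. \<rho> \<one> i j * w i h) = (\<Sum>i<k. (if i = j then 1 else 0) * w i h)"
      using \<rho>[OF one_closed j h] h j by simp
  qed
  have mult: "\<forall>i<k. \<rho> (g \<otimes> g') i j = (\<Sum>l<k. \<rho> g i l * \<rho> g' l j)" if g: "g \<in> carrier G" "g' \<in> carrier G" and j: "j < k" for g g' j
  proof (rule uniq)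
    fix h assume h: "h \<in> carrier G"
    have "(\<Sum>i<k. \<rho> (g \<otimes> g') i j * w i h) = w j (inv g' \<otimes> (inv g \<otimes> h))"
      using \<rho>[of "g \<otimes> g'" j h] g h j by (simp add: inv_mult_group m_assoc)
    also have "\<dots> = (\<Sum>l<k. \<rho> g' l j * w l (inv g \<otimes> h))" using g h j by (intro \<rho>) auto
    also have "\<dots> = (\<Sum>l<k. \<Sum>i<k. \<rho> g i l * \<rho> g' l j * w i h)"
      using g h by (intro sum.cong refl) (simp add: \<rho>[OF g(1)] sum_distrib_left mult_ac)
    also have "\<dots> = (\<Sum>i<k. (\<Sum>l<k. \<rho> g i l * \<rho> g' l j) * w i h)"
      by (subst sum.swap) (simp add: sum_distrib_right)
    finally show "(\<Sum>i<k. \<rho> (g \<otimes> g') i j * w i h) = (\<Sum>i<k. (\<Sum>l<k. \<rho> g i l * \<rho> g' l j) * w i h)" .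
  qed
  show ?thesis
    unfolding irreducible_matrix_rep_def matrix_rep_def
  proof (intro conjI allI impI ballI)
    show "0 < k" using j0 by simp
    show "\<rho> \<one> i j = (if i = j then 1 else 0)" if "i < k" "j < k" for i j using one that by simp
    show "\<rho> (g \<otimes> h) i j = (\<Sum>l<k. \<rho> g i l * \<rho> h l j)" if "g \<in> carrier G" "h \<in> carrier G" "i < k" "j < k" for g h i j
      using mult that by simp
    fix W assume "W \<subseteq> coord_space k \<and> (\<lambda>_. 0) \<in> W \<and> (\<forall>x\<in>W. \<forall>y\<in>W. (\<lambda>i. x i + y i) \<in> W) \<and>
       (\<forall>c. \<forall>x\<in>W. (\<lambda>i. c * x i) \<in> W) \<and> (\<forall>g\<in>carrier G. \<forall>x\<in>W. array_apply k (\<rho> g) x \<in> W)"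
    then have W: "W \<subseteq> coord_space k" "(\<lambda>_. 0) \<in> W" "\<And>x y. x \<in> W \<Longrightarrow> y \<in> W \<Longrightarrow> (\<lambda>i. x i + y i) \<in> W"
      "\<And>c x. x \<in> W \<Longrightarrow> (\<lambda>i. c * x i) \<in> W" "\<And>g x. g \<in> carrier G \<Longrightarrow> x \<in> W \<Longrightarrow> array_apply k (\<rho> g) x \<in> W"
      by blast+
    from coord_subspace_spanned[OF W(1-4)] obtain r b where r: "r \<le> k" "r = k \<Longrightarrow> W = coord_space k"
      and b: "\<And>j. j < r \<Longrightarrow> b j \<in> W" and span: "\<And>x. x \<in> W \<Longrightarrow> \<exists>c. x = (\<lambda>i. \<Sum>j<r. c j * b j i)" by blast
    show "W = {\<lambda>_. 0} \<or> W = coord_space k"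
    proof (rule ccontr)
      assume a: "\<not> (W = {\<lambda>_. 0} \<or> W = coord_space k)"
      then have rk: "r < k" using r by (metis le_neq_implies_less)
      have "\<exists>j<r. b j \<noteq> (\<lambda>_. 0)"
      proof (rule ccontr)
        assume n: "\<not> (\<exists>j<r. b j \<noteq> (\<lambda>_. 0))"
        have "x = (\<lambda>_. 0)" if x: "x \<in> W" for x
        proof -
          obtain c where c: "x = (\<lambda>i. \<Sum>j<r. c j * b j i)" using span[OF x] by blast
          show ?thesis unfolding c using n by (intro ext sum.neutral) auto
        qed
        then have "W = {\<lambda>_. 0}" using W(2) by blast
        then show False using a by blast
      qed
      then obtain j1 where j1: "j1 < r" "b j1 \<noteq> (\<lambda>_. 0)" by blast
      let ?w = "\<lambda>j h. \<Sum>i<k. b j i * w i h"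
      have "invariant_family G u {..<r} ?w"
        unfolding invariant_family_def
      proof (intro conjI ballI)
        show "?w j \<in> annihilator G u" for j by (rule annihilator_linear) (simp add: wI)
        show "\<exists>j\<in>{..<r}. \<exists>h\<in>carrier G. ?w j h \<noteq> 0"
        proof (rule ccontr)
          assume "\<not> ?thesis"
          then have "\<forall>i<k. b j1 i = 0" using indep[of "b j1"] j1 by blast
          moreover have "b j1 i = 0" if "\<not> i < k" for i using b[OF j1(1)] W(1) that by (auto simp: coord_space_def)
          ultimately show False using j1 by (metis ext)
        qed
        fix g j assume g: "g \<in> carrier G" and j: "j \<in> {..<r}"
        obtain c where c: "array_apply k (\<rho> g) (b j) = (\<lambda>i. \<Sum>l<r. c l * b l i)"
          using span[OF W(5)[OF g b]] j by blast
        have "?w j (inv g \<otimes> h) = (\<Sum>l<r. c l * ?w l h)" if h: "h \<in> carrier G" for h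
        proof -
          have "?w j (inv g \<otimes> h) = (\<Sum>i<k. \<Sum>l<k. \<rho> g l i * b j i * w l h)"
            using g h by (intro sum.cong refl) (simp add: \<rho> sum_distrib_left mult_ac)
          also have "\<dots> = (\<Sum>l<k. array_apply k (\<rho> g) (b j) l * w l h)"
            by (subst sum.swap) (simp add: array_apply_def sum_distrib_right)
          also have "\<dots> = (\<Sum>l<r. c l * ?w l h)"
            unfolding c by (simp add: sum_distrib_left sum_distrib_right mult_ac) (rule sum.swap)
          finally show ?thesis .
        qed
        then show "\<exists>c. \<forall>h\<in>carrier G. ?w j (inv g \<otimes> h) = (\<Sum>i<r. c i * ?w i h)"
          by (intro exI[of _ c] ballI)
      qed
      with min[OF rk] show False by blast
    qed
  qed
qed

text \<open>A minimal left ideal in the annihilator would be an irreducible representation, hence occur in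
  \<open>u\<close>, hence be killed by the star-closed annihilator; but \<open>w\<^sup>* * w\<close> does not vanish at \<open>\<one>\<close>.\<close>

lemma (in group) annihilator_trivial:
  assumes u: "representation G u" and fin: "finite (carrier G)" and irr: "contains_all_irreps G u"
    and f: "f \<in> annihilator G u" and g0: "g0 \<in> carrier G"
  shows "f g0 = 0"
proof (rule ccontr)
  assume fg: "f g0 \<noteq> 0"
  have "invariant_family G u (carrier G) (\<lambda>j h. f (inv j \<otimes> h))"
    unfolding invariant_family_def
  proof (intro conjI ballI)
    show "(\<lambda>h. f (inv j \<otimes> h)) \<in> annihilator G u" if "j \<in> carrier G" for j
      by (rule annihilator_translate[OF u f that])
    show "\<exists>j\<in>carrier G. \<exists>h\<in>carrier G. f (inv j \<otimes> h) \<noteq> 0"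
      using fg g0 by (intro bexI[of _ \<one>] bexI[of _ g0]) auto
    fix g j assume gj: "g \<in> carrier G" "j \<in> carrier G"
    have "f (inv j \<otimes> (inv g \<otimes> h)) = (\<Sum>i\<in>carrier G. (if i = g \<otimes> j then 1 else 0) * f (inv i \<otimes> h))" if h: "h \<in> carrier G" for h
    proof -
      have "(\<Sum>i\<in>carrier G. (if i = g \<otimes> j then 1 else 0) * f (inv i \<otimes> h)) = (\<Sum>i\<in>carrier G. if i = g \<otimes> j then f (inv i \<otimes> h) else 0)"
        by (intro sum.cong) auto
      then show ?thesis using gj h fin by (simp add: inv_mult_group m_assoc)
    qed
    then show "\<exists>c. \<forall>h\<in>carrier G. f (inv j \<otimes> (inv g \<otimes> h)) = (\<Sum>i\<in>carrier G. c i * f (inv i \<otimes> h))"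
      by (intro exI[of _ "\<lambda>i. if i = g \<otimes> j then 1 else 0"] ballI)
  qed
  from invariant_family_reindex[OF this fin] have ex: "\<exists>k w. invariant_family G u {..<k :: nat} w" by blast
  define k where "k = (LEAST k. \<exists>w. invariant_family G u {..<k :: nat} w)"
  from LeastI_ex[OF ex] obtain w where w: "invariant_family G u {..<k} w" unfolding k_def by blast
  have min: "\<not> invariant_family G u {..<r :: nat} w'" if "r < k" for r w'
    using not_less_Least[of r "\<lambda>k. \<exists>w. invariant_family G u {..<k :: nat} w"] that unfolding k_def by blast
  have "\<forall>g j. \<exists>c. g \<in> carrier G \<longrightarrow> j < k \<longrightarrow> (\<forall>h\<in>carrier G. w j (inv g \<otimes> h) = (\<Sum>i<k. c i * w i h))"
    using w unfolding invariant_family_def by (metis lessThan_iff)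
  then obtain \<sigma> where \<sigma>: "\<And>g j h. g \<in> carrier G \<Longrightarrow> j < k \<Longrightarrow> h \<in> carrier G \<Longrightarrow> w j (inv g \<otimes> h) = (\<Sum>i<k. \<sigma> g j i * w i h)"
    by metis
  define \<rho> where "\<rho> g i j = \<sigma> g j i" for g i j
  have \<rho>: "w j (inv g \<otimes> h) = (\<Sum>i<k. \<rho> g i j * w i h)" if "g \<in> carrier G" "j < k" "h \<in> carrier G" for g j h
    using \<sigma>[OF that] by (simp add: \<rho>_def)
  have "irreducible_matrix_rep G k \<rho>"
    by (rule minimal_family_irreducible[OF u fin w min \<rho>])
  then obtain T where T: "\<And>c. (\<Sum>j<k. c j *s T j) = 0 \<Longrightarrow> \<forall>j<k. c j = 0"
    and uT: "\<And>g j. g \<in> carrier G \<Longrightarrow> j < k \<Longrightarrow> u g *v T j = (\<Sum>i<k. \<rho> g i j *s T i)"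
    using irr unfolding contains_all_irreps_def contains_rep_def by blast
  \<comment> \<open>An element of the annihilator acts as zero on the copy of \<open>\<rho>\<close>
    spanned by \<open>T\<close>, so its convolution with each \<open>w j\<close> vanishes.\<close>
  have kill: "(\<Sum>g\<in>carrier G. f g * w j (inv g \<otimes> h)) = 0"
    if f: "f \<in> annihilator G u" and j: "j < k" and h: "h \<in> carrier G" for f j h
  proof -
    have "0 = (\<Sum>g\<in>carrier G. f g *m u g) *v T j" using f by (simp add: annihilator_def)
    also have "\<dots> = (\<Sum>g\<in>carrier G. \<Sum>i<k. (f g * \<rho> g i j) *s T i)"
      using j by (simp add: mvec_sum uT vec.scale_sum_right)
    also have "\<dots> = (\<Sum>i<k. (\<Sum>g\<in>carrier G. f g * \<rho> g i j) *s T i)"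
      by (subst sum.swap) (simp add: vec.scale_sum_left)
    finally have "(\<Sum>i<k. (\<Sum>g\<in>carrier G. f g * \<rho> g i j) *s T i) = 0" ..
    then have "\<forall>i<k. (\<Sum>g\<in>carrier G. f g * \<rho> g i j) = 0" by (rule T)
    moreover have "(\<Sum>g\<in>carrier G. f g * w j (inv g \<otimes> h)) = (\<Sum>i<k. (\<Sum>g\<in>carrier G. f g * \<rho> g i j) * w i h)"
      using j h by (simp add: \<rho> sum_distrib_left sum_distrib_right mult.assoc) (rule sum.swap)
    ultimately show ?thesis by simp
  qed
  obtain j h where j: "j < k" and h: "h \<in> carrier G" "w j h \<noteq> 0"
    using w by (auto simp: invariant_family_def)
  have wj: "w j \<in> annihilator G u" using w j by (simp add: invariant_family_def)
  have "0 = (\<Sum>g\<in>carrier G. cnj (w j (inv g)) * w j (inv g \<otimes> \<one>))"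
    using kill[OF annihilator_star[OF u fin wj] j one_closed] ..
  also have "\<dots> = (\<Sum>g\<in>carrier G. cnj (w j g) * w j g)"
    by (rule sum.reindex_bij_witness[of _ "\<lambda>g. inv g" "\<lambda>g. inv g"]) auto
  also have "\<dots> = complex_of_real (\<Sum>g\<in>carrier G. (cmod (w j g))\<^sup>2)"
  proof -
    have "cnj z * z = complex_of_real ((cmod z)\<^sup>2)" for z
      using complex_norm_square[of z] by (simp only: mult.commute)
    then show ?thesis by simp
  qed
  finally have "(\<Sum>g\<in>carrier G. (cmod (w j g))\<^sup>2) = 0" by (metis of_real_eq_0_iff)
  then show False using h fin by (subst (asm) sum_nonneg_eq_0_iff) auto
qed

text \<open>The matrices, flattened to vectors over pairs of indices, are linearly independent. The
  transpose of the dual vector belonging to \<open>\<one>\<close> is \<open>K\<close>, the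
  transposition coming from the trace pairing.\<close>

theorem delta_rep_exists:
  fixes u :: "'g \<Rightarrow> complex^'n^'n"
  assumes G: "group G" and fin: "finite (carrier G)" and u: "representation G u" and irr: "contains_all_irreps G u"
  shows "\<exists>K. delta_rep G u K"
proof -
  interpret group G by (rule G)
  let ?b = "\<lambda>g. \<chi> p. u g $ fst p $ snd p"
  have "\<exists>y :: complex^('n \<times> 'n). \<forall>s\<in>carrier G. (\<Sum>i\<in>UNIV. y $ i * ?b s $ i) = (if s = \<one>\<^bsub>G\<^esub> then 1 else 0)"
  proof (rule dual_functional[OF fin one_closed], intro ballI)
    fix c g assume c: "(\<Sum>s\<in>carrier G. c s *s ?b s) = 0" and g: "g \<in> carrier G"
    have "(\<Sum>s\<in>carrier G. c s *m u s) = 0"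
    proof (rule matrix_eqI)
      fix i j
      have "(\<Sum>s\<in>carrier G. c s *s ?b s) $ (i, j) = 0" unfolding c by simp
      then show "(\<Sum>s\<in>carrier G. c s *m u s) $ i $ j = 0 $ i $ j" by simp
    qed
    then show "c g = 0" by (intro annihilator_trivial[OF u fin irr _ g]) (simp add: annihilator_def)
  qed
  then obtain y :: "complex^('n \<times> 'n)" where y: "\<And>s. s \<in> carrier G \<Longrightarrow> (\<Sum>i\<in>UNIV. y $ i * ?b s $ i) = (if s = \<one>\<^bsub>G\<^esub> then 1 else 0)"
    by blast
  have "trace ((\<chi> i j. y $ (j, i)) ** X) = (\<Sum>p\<in>UNIV. y $ p * X $ fst p $ snd p)" for X :: "complex^'n^'n"
  proof -
    have "(\<Sum>p\<in>UNIV. y $ p * X $ fst p $ snd p) = (\<Sum>i\<in>UNIV. \<Sum>j\<in>UNIV. y $ (i, j) * X $ i $ j)"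
      by (simp add: sum.cartesian_product split_def flip: UNIV_Times_UNIV)
    then show ?thesis unfolding trace_mult_eq by simp (rule sum.swap)
  qed
  then have "delta_rep G u (\<chi> i j. y $ (j, i))"
    by unfold_locales (use y fin u in simp_all)
  then show ?thesis by (rule exI)
qed

section \<open>The induced pair\<close>

lemma proportional_iff: "proportional X Y \<longleftrightarrow> (\<exists>c. c \<noteq> 0 \<and> X = c *m Y)"
  unfolding proportional_def vec_eq_iff cscale_nth ..

lemma proportionalI: "c \<noteq> 0 \<Longrightarrow> X = c *m Y \<Longrightarrow> proportional X Y"
  unfolding proportional_iff by blast

lemma proportional_refl [simp]: "proportional X X"
  by (rule proportionalI[of 1]) simp_all

lemma proportional_sym: "proportional X Y \<Longrightarrow> proportional Y X"
proof -
  assume "proportional X Y"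
  then obtain c where "c \<noteq> 0" "X = c *m Y" unfolding proportional_iff by blast
  then show ?thesis by (intro proportionalI[of "inverse c"]) simp_all
qed

lemma proportional_trans [trans]: "proportional X Y \<Longrightarrow> proportional Y Z \<Longrightarrow> proportional X Z"
proof -
  assume "proportional X Y" "proportional Y Z"
  then obtain c d where "c \<noteq> 0" "X = c *m Y" "d \<noteq> 0" "Y = d *m Z" unfolding proportional_iff by blast
  then show ?thesis by (intro proportionalI[of "c * d"]) simp_all
qed

lemma proportional_mult:
  fixes X X' :: "complex^'n^'n"
  assumes "proportional X Y" "proportional X' Y'" shows "proportional (X ** X') (Y ** Y')"
proof -
  from assms obtain c d where "c \<noteq> 0" "X = c *m Y" "d \<noteq> 0" "X' = d *m Y'" unfolding proportional_iff by blast
  then show ?thesis by (intro proportionalI[of "c * d"]) (simp_all add: mult.commute)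
qed

lemma proportional_cancel_right:
  fixes X Y Z :: "complex^'n^'n"
  assumes "invertible Z" "proportional (X ** Z) (Y ** Z)" shows "proportional X Y"
  using proportional_mult[OF assms(2) proportional_refl[of "matrix_inv Z"]] assms(1)
  by (simp add: matrix_inv_cancel)

lemma proportional_conj_iff:
  fixes X Y Z :: "complex^'n^'n"
  assumes "invertible Z" shows "proportional (X ** matrix_inv Z) Y \<longleftrightarrow> proportional X (Y ** Z)"
proof
  assume "proportional (X ** matrix_inv Z) Y"
  from proportional_mult[OF this proportional_refl[of Z]] show "proportional X (Y ** Z)"
    using assms by (simp add: matrix_inv_cancel)
next
  assume "proportional X (Y ** Z)"
  from proportional_mult[OF this proportional_refl[of "matrix_inv Z"]] show "proportional (X ** matrix_inv Z) Y"
    using assms by (simp add: matrix_inv_cancel)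
qed

lemma induces_pair_iff:
  assumes "\<forall>q\<in>carrier Q. invertible (v q)" "group Q"
  shows "induces_pair G Q u v (\<phi>, \<omega>) \<longleftrightarrow>
     (\<forall>q\<in>carrier Q. \<forall>g\<in>carrier G. \<phi> q g \<in> carrier G \<and> proportional (v q ** u g) (u (\<phi> q g) ** v q)) \<and>
     (\<forall>k\<in>carrier Q. \<forall>q\<in>carrier Q. \<omega> k q \<in> carrier G \<and> proportional (v k ** v q) (u (\<omega> k q) ** v (k \<otimes>\<^bsub>Q\<^esub> q)))"
proof -
  interpret Q: group Q by fact
  show ?thesis
    unfolding induces_pair_def split_conv Pi_iff
    using assms(1) by (auto simp: proportional_conj_iff)
qed

context delta_rep
begin

text \<open>Since \<open>K\<close> separates group matrices even up to scalars, the scalar freedom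
  in the virtual matrices does not blur the elements of \<open>G\<close> extracted from
  them.\<close>

lemma proportional_u:
  assumes "g \<in> carrier G" "h \<in> carrier G" "proportional (u g) (u h)" shows "g = h"
proof -
  obtain c where c: "u g = c *m u h" using assms(3) unfolding proportional_iff by blast
  have "trace (K ** (u (inv g) ** u g)) = c * trace (K ** (u (inv g) ** u h))"
    unfolding c by (simp add: trace_cscale)
  then show ?thesis using assms(1,2) by (simp add: K_delta split: if_splits)
qed

end

section \<open>Uniqueness of the virtual matrices and the cocycle relations\<close>

locale injective_tensor = delta_rep G u K
  for G :: "('g, 'b) monoid_scheme" (structure) and u :: "'g \<Rightarrow> complex^'n^'n" and K +
  fixes A :: "('n, 'p::finite) tensor" and B :: "complex^'p^('n legs)"
  assumes BA: "B ** A = gproj" and AP: "A ** gproj = A"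
begin

lemma A_ugauge: "g \<in> carrier G \<Longrightarrow> A ** ugauge g = A"
  using AP gproj_ugauge(1)[of g] by (metis matrix_mul_assoc)

text \<open>Cancelling one gauge against the other and applying \<open>B\<close> reduces the claim
  to \<open>gproj_gauge_rigid\<close>. That the same \<open>h\<close> serves both directions is the
  reason why \<open>v\<close> and \<open>w\<close> induce the same pair.\<close>

lemma gauge_determined:
  assumes e: "A ** gauge y x = A ** gauge y' x'"
    and inv: "invertible y" "invertible x" "invertible y'" "invertible x'"
  shows "\<exists>h\<in>carrier G. proportional y (u h ** y') \<and> proportional x (u h ** x')"
proof -
  note iv = invertible_matrix_inv[OF inv(3)] invertible_matrix_inv[OF inv(4)]
  have "A ** gauge y x ** gauge (matrix_inv y') (matrix_inv x') = A"
    unfolding e by (simp add: gauge_inv[OF inv(3,4)] flip: matrix_mul_assoc)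
  then have "A ** gauge (y ** matrix_inv y') (x ** matrix_inv x') = A"
    using inv iv by (simp add: gauge_mult flip: matrix_mul_assoc)
  then have "gproj ** gauge (y ** matrix_inv y') (x ** matrix_inv x') = gproj"
    unfolding BA[symmetric] by (simp flip: matrix_mul_assoc)
  then obtain h c d where h: "h \<in> carrier G" "c \<noteq> 0" "d \<noteq> 0"
      "y ** matrix_inv y' = c *m u h" "x ** matrix_inv x' = d *m u h"
    using gproj_gauge_rigid[of "y ** matrix_inv y'" "x ** matrix_inv x'"] inv iv by (auto simp: invertible_mult)
  then have "proportional (y ** matrix_inv y') (u h)" "proportional (x ** matrix_inv x') (u h)"
    by (auto intro: proportionalI)
  then show ?thesis using h(1) inv by (intro bexI[of _ h]) (simp_all add: proportional_conj_iff)
qed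

end

locale symmetric_tensor = injective_tensor G u K A B + Q: group Q
  for G :: "('g, 'b) monoid_scheme" (structure) and Q :: "('q, 'c) monoid_scheme"
    and u :: "'g \<Rightarrow> complex^'n^'n" and K and A :: "('n, 'p::finite) tensor" and B +
  fixes U :: "'q \<Rightarrow> complex^'p^'p"
  assumes U_rep: "representation Q U"
    and U_inv: "\<And>q. q \<in> carrier Q \<Longrightarrow> leaves_invariant (U q) A"
begin

lemma U_mult: "k \<in> carrier Q \<Longrightarrow> q \<in> carrier Q \<Longrightarrow> U (k \<otimes>\<^bsub>Q\<^esub> q) = U k ** U q"
  and U_one: "U \<one>\<^bsub>Q\<^esub> = mat 1"
  using U_rep by (simp_all add: representation_def)

lemma virtual_symmetry_exists: "\<exists>v w. virtual_symmetry Q U A v w"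
proof -
  have "\<exists>w v. q \<in> carrier Q \<longrightarrow> invertible w \<and> invertible v \<and> U q ** A = A ** gauge w v" for q
  proof (cases "q \<in> carrier Q")
    case True
    then have "U (inv\<^bsub>Q\<^esub> q) ** U q = mat 1" "U q ** U (inv\<^bsub>Q\<^esub> q) = mat 1"
      by (simp_all add: U_one flip: U_mult)
    from torus_gauge[OF BA AP this U_inv[OF True] U_inv] True show ?thesis by simp
  qed simp
  then show ?thesis unfolding virtual_symmetry_def by metis
qed

lemma virtual_rigid:
  assumes "virtual_symmetry Q U A v w" "virtual_symmetry Q U A v' w'" "q \<in> carrier Q"
  shows "\<exists>h\<in>carrier G. proportional (w' q) (u h ** w q) \<and> proportional (v' q) (u h ** v q)"
  using assms by (intro gauge_determined) (auto simp: virtual_symmetry_def)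

text \<open>Since \<open>A\<close> absorbs \<open>u g\<close>, the matrices
  \<open>w q ** u g\<close>, \<open>v q ** u g\<close> implement \<open>U q\<close> as well, and
  products of virtual matrices implement \<open>U k ** U q\<close>. Comparison with the given choice
  by \<open>gauge_determined\<close> supplies the group elements.\<close>

lemma virtual_pair:
  assumes V: "virtual_symmetry Q U A v w"
  shows "\<exists>p. induces_pair G Q u v p \<and> induces_pair G Q u w p"
proof -
  have inv: "q \<in> carrier Q \<Longrightarrow> invertible (v q)" "q \<in> carrier Q \<Longrightarrow> invertible (w q)"
    and UA: "q \<in> carrier Q \<Longrightarrow> U q ** A = A ** gauge (w q) (v q)" for q
    using V by (auto simp: virtual_symmetry_def)
  have 1: "\<exists>h. h \<in> carrier G \<and> proportional (w q ** u g) (u h ** w q) \<and> proportional (v q ** u g) (u h ** v q)"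
    if q: "q \<in> carrier Q" and g: "g \<in> carrier G" for q g
  proof -
    have "A ** gauge (w q ** u g) (v q ** u g) = A ** gauge (w q) (v q) ** ugauge g"
      using q g inv by (simp add: ugauge_gauge gauge_mult u_matrix_inv flip: matrix_mul_assoc)
    also have "\<dots> = U q ** (A ** ugauge g)" by (simp add: matrix_mul_assoc flip: UA[OF q])
    also have "\<dots> = A ** gauge (w q) (v q)" by (simp add: A_ugauge[OF g] UA[OF q])
    finally have "\<exists>h\<in>carrier G. proportional (w q ** u g) (u h ** w q) \<and> proportional (v q ** u g) (u h ** v q)"
      by (rule gauge_determined) (use q g inv in \<open>simp_all add: invertible_mult u_matrix_inv\<close>)
    then show ?thesis by blast
  qed
  have 2: "\<exists>h. h \<in> carrier G \<and> proportional (w k ** w q) (u h ** w (k \<otimes>\<^bsub>Q\<^esub> q)) \<and> proportional (v k ** v q) (u h ** v (k \<otimes>\<^bsub>Q\<^esub> q))"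
    if q: "k \<in> carrier Q" "q \<in> carrier Q" for k q
  proof -
    have "A ** gauge (w k ** w q) (v k ** v q) = A ** gauge (w k) (v k) ** gauge (w q) (v q)"
      using q inv by (simp add: gauge_mult flip: matrix_mul_assoc)
    also have "\<dots> = U k ** (A ** gauge (w q) (v q))" by (simp add: matrix_mul_assoc flip: UA[OF q(1)])
    also have "\<dots> = U (k \<otimes>\<^bsub>Q\<^esub> q) ** A" using q by (simp add: U_mult matrix_mul_assoc flip: UA)
    also have "\<dots> = A ** gauge (w (k \<otimes>\<^bsub>Q\<^esub> q)) (v (k \<otimes>\<^bsub>Q\<^esub> q))" using q by (intro UA) simp
    finally have "\<exists>h\<in>carrier G. proportional (w k ** w q) (u h ** w (k \<otimes>\<^bsub>Q\<^esub> q)) \<and> proportional (v k ** v q) (u h ** v (k \<otimes>\<^bsub>Q\<^esub> q))"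
      by (rule gauge_determined) (use q inv in \<open>simp_all add: invertible_mult\<close>)
    then show ?thesis by blast
  qed
  obtain \<phi> where \<phi>: "\<And>q g. q \<in> carrier Q \<Longrightarrow> g \<in> carrier G \<Longrightarrow> \<phi> q g \<in> carrier G \<and>
      proportional (w q ** u g) (u (\<phi> q g) ** w q) \<and> proportional (v q ** u g) (u (\<phi> q g) ** v q)"
    using 1 by metis
  obtain \<omega> where \<omega>: "\<And>k q. k \<in> carrier Q \<Longrightarrow> q \<in> carrier Q \<Longrightarrow> \<omega> k q \<in> carrier G \<and>
      proportional (w k ** w q) (u (\<omega> k q) ** w (k \<otimes>\<^bsub>Q\<^esub> q)) \<and> proportional (v k ** v q) (u (\<omega> k q) ** v (k \<otimes>\<^bsub>Q\<^esub> q))"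
    using 2 by metis
  have "induces_pair G Q u v (\<phi>, \<omega>)" "induces_pair G Q u w (\<phi>, \<omega>)"
    using \<phi> \<omega> inv by (simp_all add: induces_pair_iff Q.group_axioms)
  then show ?thesis by blast
qed

context
  fixes v :: "'q \<Rightarrow> complex^'n^'n" and \<phi> \<omega>
  assumes inv: "\<And>q. q \<in> carrier Q \<Longrightarrow> invertible (v q)" and ind: "induces_pair G Q u v (\<phi>, \<omega>)"
begin

lemma ind_phi: "q \<in> carrier Q \<Longrightarrow> g \<in> carrier G \<Longrightarrow> \<phi> q g \<in> carrier G"
    "q \<in> carrier Q \<Longrightarrow> g \<in> carrier G \<Longrightarrow> proportional (v q ** u g) (u (\<phi> q g) ** v q)"
  and ind_omega: "k \<in> carrier Q \<Longrightarrow> q \<in> carrier Q \<Longrightarrow> \<omega> k q \<in> carrier G"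
    "k \<in> carrier Q \<Longrightarrow> q \<in> carrier Q \<Longrightarrow> proportional (v k ** v q) (u (\<omega> k q) ** v (k \<otimes>\<^bsub>Q\<^esub> q))"
proof -
  have "\<forall>q\<in>carrier Q. invertible (v q)" using inv by blast
  note i = ind[unfolded induces_pair_iff[OF this Q.group_axioms]]
  show "q \<in> carrier Q \<Longrightarrow> g \<in> carrier G \<Longrightarrow> \<phi> q g \<in> carrier G"
    "q \<in> carrier Q \<Longrightarrow> g \<in> carrier G \<Longrightarrow> proportional (v q ** u g) (u (\<phi> q g) ** v q)"
    "k \<in> carrier Q \<Longrightarrow> q \<in> carrier Q \<Longrightarrow> \<omega> k q \<in> carrier G"
    "k \<in> carrier Q \<Longrightarrow> q \<in> carrier Q \<Longrightarrow> proportional (v k ** v q) (u (\<omega> k q) ** v (k \<otimes>\<^bsub>Q\<^esub> q))"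
    using i by blast+
qed

lemma eq_of_proportional:
  assumes "g \<in> carrier G" "h \<in> carrier G" "q \<in> carrier Q" "proportional (u g ** v q) (u h ** v q)"
  shows "g = h"
  by (rule proportional_u[OF assms(1,2) proportional_cancel_right[OF inv[OF assms(3)] assms(4)]])

text \<open>Each relation comes from bringing one product of virtual and group matrices into two
  forms; \<open>eq_of_proportional\<close> then cancels the common \<open>v\<close> together with
  all scalars. The twisted conjugation and the 2-cocycle relation both reflect
  associativity.\<close>

lemma induced_cocycle: "(\<phi>, \<omega>) \<in> cocycle_pairs G Q"
proof -
  note pm = proportional_mult
  have hom: "\<phi> q (g \<otimes> h) = \<phi> q g \<otimes> \<phi> q h" if q: "q \<in> carrier Q" and gh: "g \<in> carrier G" "h \<in> carrier G" for q g h
  proof (rule eq_of_proportional[OF _ _ q])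
    have "proportional (u (\<phi> q (g \<otimes> h)) ** v q) (v q ** u (g \<otimes> h))"
      using q gh by (intro proportional_sym[OF ind_phi(2)]) auto
    also have "v q ** u (g \<otimes> h) = (v q ** u g) ** u h" using gh by (simp add: u_mult matrix_mul_assoc)
    also have "proportional \<dots> ((u (\<phi> q g) ** v q) ** u h)" by (rule pm[OF ind_phi(2)[OF q gh(1)] proportional_refl])
    also have "(u (\<phi> q g) ** v q) ** u h = u (\<phi> q g) ** (v q ** u h)" by (simp add: matrix_mul_assoc)
    also have "proportional \<dots> (u (\<phi> q g) ** (u (\<phi> q h) ** v q))" by (rule pm[OF proportional_refl ind_phi(2)[OF q gh(2)]])
    also have "u (\<phi> q g) ** (u (\<phi> q h) ** v q) = u (\<phi> q g \<otimes> \<phi> q h) ** v q"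
      using q gh by (simp add: u_mult ind_phi matrix_mul_assoc)
    finally show "proportional (u (\<phi> q (g \<otimes> h)) ** v q) (u (\<phi> q g \<otimes> \<phi> q h) ** v q)" .
  qed (use q gh in \<open>auto simp: ind_phi\<close>)
  have iso: "\<phi> q \<in> iso G G" if q: "q \<in> carrier Q" for q
  proof -
    have "inj_on (\<phi> q) (carrier G)"
    proof (rule inj_onI)
      fix g h assume gh: "g \<in> carrier G" "h \<in> carrier G" "\<phi> q g = \<phi> q h"
      have "proportional (v q ** u g) (v q ** u h)"
        using proportional_trans[OF ind_phi(2)[OF q gh(1)] proportional_sym[OF ind_phi(2)[OF q gh(2)], folded gh(3)]] .
      from pm[OF proportional_refl[of "matrix_inv (v q)"] this] have "proportional (u g) (u h)"
        using inv[OF q] by (simp add: matrix_inv_cancel)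
      then show "g = h" using gh by (intro proportional_u)
    qed
    moreover have "\<phi> q ` carrier G \<subseteq> carrier G" using ind_phi q by auto
    ultimately have "bij_betw (\<phi> q) (carrier G) (carrier G)"
      using fin endo_inj_surj by (metis bij_betw_def)
    then show ?thesis using hom[OF q] ind_phi(1)[OF q] by (auto simp: iso_def hom_def)
  qed
  have twist: "\<phi> k (\<phi> q g) = \<omega> k q \<otimes> \<phi> (k \<otimes>\<^bsub>Q\<^esub> q) g \<otimes> inv (\<omega> k q)"
    if q: "k \<in> carrier Q" "q \<in> carrier Q" and g: "g \<in> carrier G" for k q g
  proof -
    have kq: "k \<otimes>\<^bsub>Q\<^esub> q \<in> carrier Q" using q by simp
    have "\<phi> k (\<phi> q g) \<otimes> \<omega> k q = \<omega> k q \<otimes> \<phi> (k \<otimes>\<^bsub>Q\<^esub> q) g"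
    proof (rule eq_of_proportional[OF _ _ kq])
      have "u (\<phi> k (\<phi> q g) \<otimes> \<omega> k q) ** v (k \<otimes>\<^bsub>Q\<^esub> q) = u (\<phi> k (\<phi> q g)) ** (u (\<omega> k q) ** v (k \<otimes>\<^bsub>Q\<^esub> q))"
        using q g by (simp add: u_mult ind_phi ind_omega matrix_mul_assoc)
      also have "proportional \<dots> (u (\<phi> k (\<phi> q g)) ** (v k ** v q))"
        by (rule pm[OF proportional_refl proportional_sym[OF ind_omega(2)[OF q]]])
      also have "u (\<phi> k (\<phi> q g)) ** (v k ** v q) = (u (\<phi> k (\<phi> q g)) ** v k) ** v q" by (simp add: matrix_mul_assoc)
      also have "proportional \<dots> ((v k ** u (\<phi> q g)) ** v q)"
        by (rule pm[OF proportional_sym[OF ind_phi(2)[OF q(1) ind_phi(1)[OF q(2) g]]] proportional_refl])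
      also have "(v k ** u (\<phi> q g)) ** v q = v k ** (u (\<phi> q g) ** v q)" by (simp add: matrix_mul_assoc)
      also have "proportional \<dots> (v k ** (v q ** u g))"
        by (rule pm[OF proportional_refl proportional_sym[OF ind_phi(2)[OF q(2) g]]])
      also have "v k ** (v q ** u g) = (v k ** v q) ** u g" by (simp add: matrix_mul_assoc)
      also have "proportional \<dots> ((u (\<omega> k q) ** v (k \<otimes>\<^bsub>Q\<^esub> q)) ** u g)"
        by (rule pm[OF ind_omega(2)[OF q] proportional_refl])
      also have "(u (\<omega> k q) ** v (k \<otimes>\<^bsub>Q\<^esub> q)) ** u g = u (\<omega> k q) ** (v (k \<otimes>\<^bsub>Q\<^esub> q) ** u g)" by (simp add: matrix_mul_assoc)
      also have "proportional \<dots> (u (\<omega> k q) ** (u (\<phi> (k \<otimes>\<^bsub>Q\<^esub> q) g) ** v (k \<otimes>\<^bsub>Q\<^esub> q)))"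
        by (rule pm[OF proportional_refl ind_phi(2)[OF kq g]])
      also have "u (\<omega> k q) ** (u (\<phi> (k \<otimes>\<^bsub>Q\<^esub> q) g) ** v (k \<otimes>\<^bsub>Q\<^esub> q)) = u (\<omega> k q \<otimes> \<phi> (k \<otimes>\<^bsub>Q\<^esub> q) g) ** v (k \<otimes>\<^bsub>Q\<^esub> q)"
        using q g kq by (simp add: u_mult ind_phi ind_omega matrix_mul_assoc)
      finally show "proportional (u (\<phi> k (\<phi> q g) \<otimes> \<omega> k q) ** v (k \<otimes>\<^bsub>Q\<^esub> q)) (u (\<omega> k q \<otimes> \<phi> (k \<otimes>\<^bsub>Q\<^esub> q) g) ** v (k \<otimes>\<^bsub>Q\<^esub> q))" .
    qed (use q g kq in \<open>auto simp: ind_phi ind_omega\<close>)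
    then show ?thesis using q g kq by (metis ind_phi(1) ind_omega(1) inv_solve_right m_closed)
  qed
  have cc: "\<omega> k q \<otimes> \<omega> (k \<otimes>\<^bsub>Q\<^esub> q) p = \<phi> k (\<omega> q p) \<otimes> \<omega> k (q \<otimes>\<^bsub>Q\<^esub> p)"
    if q: "k \<in> carrier Q" "q \<in> carrier Q" "p \<in> carrier Q" for k q p
  proof -
    have kq: "k \<otimes>\<^bsub>Q\<^esub> q \<in> carrier Q" "q \<otimes>\<^bsub>Q\<^esub> p \<in> carrier Q" "k \<otimes>\<^bsub>Q\<^esub> (q \<otimes>\<^bsub>Q\<^esub> p) \<in> carrier Q"
      and as: "k \<otimes>\<^bsub>Q\<^esub> q \<otimes>\<^bsub>Q\<^esub> p = k \<otimes>\<^bsub>Q\<^esub> (q \<otimes>\<^bsub>Q\<^esub> p)" using q by (simp_all add: Q.m_assoc)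
    show ?thesis
    proof (rule eq_of_proportional[OF _ _ kq(3)])
      have "u (\<omega> k q \<otimes> \<omega> (k \<otimes>\<^bsub>Q\<^esub> q) p) ** v (k \<otimes>\<^bsub>Q\<^esub> (q \<otimes>\<^bsub>Q\<^esub> p)) = u (\<omega> k q) ** (u (\<omega> (k \<otimes>\<^bsub>Q\<^esub> q) p) ** v (k \<otimes>\<^bsub>Q\<^esub> q \<otimes>\<^bsub>Q\<^esub> p))"
        using q kq by (simp add: u_mult ind_omega matrix_mul_assoc as)
      also have "proportional \<dots> (u (\<omega> k q) ** (v (k \<otimes>\<^bsub>Q\<^esub> q) ** v p))"
        by (rule pm[OF proportional_refl proportional_sym[OF ind_omega(2)[OF kq(1) q(3)]]])
      also have "u (\<omega> k q) ** (v (k \<otimes>\<^bsub>Q\<^esub> q) ** v p) = (u (\<omega> k q) ** v (k \<otimes>\<^bsub>Q\<^esub> q)) ** v p" by (simp add: matrix_mul_assoc)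
      also have "proportional \<dots> ((v k ** v q) ** v p)"
        by (rule pm[OF proportional_sym[OF ind_omega(2)[OF q(1,2)]] proportional_refl])
      also have "(v k ** v q) ** v p = v k ** (v q ** v p)" by (simp add: matrix_mul_assoc)
      also have "proportional \<dots> (v k ** (u (\<omega> q p) ** v (q \<otimes>\<^bsub>Q\<^esub> p)))"
        by (rule pm[OF proportional_refl ind_omega(2)[OF q(2,3)]])
      also have "v k ** (u (\<omega> q p) ** v (q \<otimes>\<^bsub>Q\<^esub> p)) = (v k ** u (\<omega> q p)) ** v (q \<otimes>\<^bsub>Q\<^esub> p)" by (simp add: matrix_mul_assoc)
      also have "proportional \<dots> ((u (\<phi> k (\<omega> q p)) ** v k) ** v (q \<otimes>\<^bsub>Q\<^esub> p))"
        by (rule pm[OF ind_phi(2)[OF q(1) ind_omega(1)[OF q(2,3)]] proportional_refl])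
      also have "(u (\<phi> k (\<omega> q p)) ** v k) ** v (q \<otimes>\<^bsub>Q\<^esub> p) = u (\<phi> k (\<omega> q p)) ** (v k ** v (q \<otimes>\<^bsub>Q\<^esub> p))" by (simp add: matrix_mul_assoc)
      also have "proportional \<dots> (u (\<phi> k (\<omega> q p)) ** (u (\<omega> k (q \<otimes>\<^bsub>Q\<^esub> p)) ** v (k \<otimes>\<^bsub>Q\<^esub> (q \<otimes>\<^bsub>Q\<^esub> p))))"
        by (rule pm[OF proportional_refl ind_omega(2)[OF q(1) kq(2)]])
      also have "\<dots> = u (\<phi> k (\<omega> q p) \<otimes> \<omega> k (q \<otimes>\<^bsub>Q\<^esub> p)) ** v (k \<otimes>\<^bsub>Q\<^esub> (q \<otimes>\<^bsub>Q\<^esub> p))"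
        using q kq by (simp add: u_mult ind_phi ind_omega matrix_mul_assoc)
      finally show "proportional (u (\<omega> k q \<otimes> \<omega> (k \<otimes>\<^bsub>Q\<^esub> q) p) ** v (k \<otimes>\<^bsub>Q\<^esub> (q \<otimes>\<^bsub>Q\<^esub> p))) \<dots>" .
    qed (use q kq in \<open>auto simp: ind_phi ind_omega\<close>)
  qed
  show ?thesis
    unfolding cocycle_pairs_def using iso twist cc ind_omega(1) by auto
qed

lemma induced_unique:
  assumes "induces_pair G Q u v (\<phi>', \<omega>')"
  shows "k \<in> carrier Q \<Longrightarrow> g \<in> carrier G \<Longrightarrow> \<phi>' k g = \<phi> k g"
    "k \<in> carrier Q \<Longrightarrow> q \<in> carrier Q \<Longrightarrow> \<omega>' k q = \<omega> k q"
proof -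
  have "\<forall>q\<in>carrier Q. invertible (v q)" using inv by blast
  note i = assms[unfolded induces_pair_iff[OF this Q.group_axioms]]
  show "\<phi>' k g = \<phi> k g" if k: "k \<in> carrier Q" and g: "g \<in> carrier G"
  proof (rule eq_of_proportional[OF _ _ k])
    have "\<phi>' k g \<in> carrier G" and p: "proportional (v k ** u g) (u (\<phi>' k g) ** v k)" using i k g by blast+
    then show "\<phi>' k g \<in> carrier G" by blast
    show "proportional (u (\<phi>' k g) ** v k) (u (\<phi> k g) ** v k)"
      by (rule proportional_trans[OF proportional_sym[OF p] ind_phi(2)[OF k g]])
  qed (rule ind_phi(1)[OF k g])
  show "\<omega>' k q = \<omega> k q" if k: "k \<in> carrier Q" and q: "q \<in> carrier Q"
  proof (rule eq_of_proportional[OF _ _ Q.m_closed[OF k q]])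
    have "\<omega>' k q \<in> carrier G" and p: "proportional (v k ** v q) (u (\<omega>' k q) ** v (k \<otimes>\<^bsub>Q\<^esub> q))" using i k q by blast+
    then show "\<omega>' k q \<in> carrier G" by blast
    show "proportional (u (\<omega>' k q) ** v (k \<otimes>\<^bsub>Q\<^esub> q)) (u (\<omega> k q) ** v (k \<otimes>\<^bsub>Q\<^esub> q))"
      by (rule proportional_trans[OF proportional_sym[OF p] ind_omega(2)[OF k q]])
  qed (rule ind_omega(1)[OF k q])
qed

text \<open>Moving \<open>u (\<gamma> q)\<close> to the left past \<open>v k\<close> turns it into
  \<open>u (\<phi> k (\<gamma> q))\<close>, which explains the shape of the formulas in
  \<open>pair_equiv\<close>.\<close>

lemma induced_regauge:
  assumes inv': "\<And>q. q \<in> carrier Q \<Longrightarrow> invertible (v' q)"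
    and \<gamma>: "\<And>q. q \<in> carrier Q \<Longrightarrow> \<gamma> q \<in> carrier G" and v': "\<And>q. q \<in> carrier Q \<Longrightarrow> proportional (v' q) (u (\<gamma> q) ** v q)"
    and \<phi>': "\<And>k g. k \<in> carrier Q \<Longrightarrow> g \<in> carrier G \<Longrightarrow> \<phi>' k g = \<gamma> k \<otimes> \<phi> k g \<otimes> inv (\<gamma> k)"
    and \<omega>': "\<And>k q. k \<in> carrier Q \<Longrightarrow> q \<in> carrier Q \<Longrightarrow>
        \<omega>' k q = \<gamma> k \<otimes> \<phi> k (\<gamma> q) \<otimes> \<omega> k q \<otimes> inv (\<gamma> (k \<otimes>\<^bsub>Q\<^esub> q))"
  shows "induces_pair G Q u v' (\<phi>', \<omega>')"
proof -
  have "\<forall>q\<in>carrier Q. invertible (v' q)" using inv' by blast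
  note iff = induces_pair_iff[OF this Q.group_axioms]
  show ?thesis unfolding iff
  proof (intro conjI ballI)
    note pm = proportional_mult
    fix k g assume k: "k \<in> carrier Q" and g: "g \<in> carrier G"
    show "\<phi>' k g \<in> carrier G" using k g by (simp add: \<phi>' \<gamma> ind_phi)
    show "proportional (v' k ** u g) (u (\<phi>' k g) ** v' k)"
    proof -
      have "proportional (v' k ** u g) ((u (\<gamma> k) ** v k) ** u g)" by (rule pm[OF v'[OF k] proportional_refl])
      also have "(u (\<gamma> k) ** v k) ** u g = u (\<gamma> k) ** (v k ** u g)" by (simp add: matrix_mul_assoc)
      also have "proportional \<dots> (u (\<gamma> k) ** (u (\<phi> k g) ** v k))" by (rule pm[OF proportional_refl ind_phi(2)[OF k g]])
      also have "\<dots> = u (\<phi>' k g) ** (u (\<gamma> k) ** v k)"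
        using k g by (simp add: \<phi>' u_mult \<gamma> ind_phi matrix_mul_assoc u_cancel)
      also have "proportional \<dots> (u (\<phi>' k g) ** v' k)" by (rule pm[OF proportional_refl proportional_sym[OF v'[OF k]]])
      finally show ?thesis .
    qed
  next
    note pm = proportional_mult
    fix k q assume k: "k \<in> carrier Q" and q: "q \<in> carrier Q"
    have kq: "k \<otimes>\<^bsub>Q\<^esub> q \<in> carrier Q" using k q by simp
    show "\<omega>' k q \<in> carrier G" using k q kq by (simp add: \<omega>' \<gamma> ind_phi ind_omega)
    have "proportional (v' k ** v' q) ((u (\<gamma> k) ** v k) ** (u (\<gamma> q) ** v q))" by (rule pm[OF v'[OF k] v'[OF q]])
    also have "\<dots> = u (\<gamma> k) ** ((v k ** u (\<gamma> q)) ** v q)" by (simp add: matrix_mul_assoc)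
    also have "proportional \<dots> (u (\<gamma> k) ** ((u (\<phi> k (\<gamma> q)) ** v k) ** v q))"
      by (rule pm[OF proportional_refl pm[OF ind_phi(2)[OF k \<gamma>[OF q]] proportional_refl]])
    also have "\<dots> = (u (\<gamma> k) ** u (\<phi> k (\<gamma> q))) ** (v k ** v q)" by (simp add: matrix_mul_assoc)
    also have "proportional \<dots> ((u (\<gamma> k) ** u (\<phi> k (\<gamma> q))) ** (u (\<omega> k q) ** v (k \<otimes>\<^bsub>Q\<^esub> q)))"
      by (rule pm[OF proportional_refl ind_omega(2)[OF k q]])
    also have "\<dots> = u (\<omega>' k q) ** (u (\<gamma> (k \<otimes>\<^bsub>Q\<^esub> q)) ** v (k \<otimes>\<^bsub>Q\<^esub> q))"
      using k q kq by (simp add: \<omega>' u_mult \<gamma> ind_phi ind_omega matrix_mul_assoc u_cancel)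
    also have "proportional \<dots> (u (\<omega>' k q) ** v' (k \<otimes>\<^bsub>Q\<^esub> q))"
      by (rule pm[OF proportional_refl proportional_sym[OF v'[OF kq]]])
    finally show "proportional (v' k ** v' q) (u (\<omega>' k q) ** v' (k \<otimes>\<^bsub>Q\<^esub> q))" .
  qed
qed

end

text \<open>Any two choices of virtual matrices differ by scalars and some
  \<open>u (\<gamma> q)\<close>; conversely such a factor may be inserted in \<open>v\<close> and
  \<open>w\<close> together, because \<open>A\<close> absorbs it. Therefore the pairs fill a whole
  equivalence class.\<close>

theorem symmetry_class_eq:
  assumes p: "p \<in> symmetry_class G Q u U A"
  shows "p \<in> cocycle_pairs G Q" "symmetry_class G Q u U A = pair_equiv G Q `` {p}"
proof -
  obtain \<phi> \<omega> where pp: "p = (\<phi>, \<omega>)" by (cases p)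
  obtain v w where V: "virtual_symmetry Q U A v w" and iv: "induces_pair G Q u v (\<phi>, \<omega>)" and iw: "induces_pair G Q u w (\<phi>, \<omega>)"
    using p unfolding symmetry_class_def pp by blast
  have inv: "q \<in> carrier Q \<Longrightarrow> invertible (v q)" "q \<in> carrier Q \<Longrightarrow> invertible (w q)"
    and UA: "q \<in> carrier Q \<Longrightarrow> U q ** A = A ** gauge (w q) (v q)" for q
    using V by (auto simp: virtual_symmetry_def)
  have coc: "(\<phi>, \<omega>) \<in> cocycle_pairs G Q" by (rule induced_cocycle[OF inv(1) iv])
  then show "p \<in> cocycle_pairs G Q" by (simp add: pp)
  show "symmetry_class G Q u U A = pair_equiv G Q `` {p}"
  proof (intro Set.set_eqI iffI)
    fix p' assume p': "p' \<in> symmetry_class G Q u U A"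
    obtain \<phi>' \<omega>' where pp': "p' = (\<phi>', \<omega>')" by (cases p')
    obtain v' w' where V': "virtual_symmetry Q U A v' w'" and iv': "induces_pair G Q u v' (\<phi>', \<omega>')"
      using p' unfolding symmetry_class_def pp' by blast
    have inv': "q \<in> carrier Q \<Longrightarrow> invertible (v' q)" for q using V' by (auto simp: virtual_symmetry_def)
    have "\<exists>h. q \<in> carrier Q \<longrightarrow> h \<in> carrier G \<and> proportional (v' q) (u h ** v q)" for q
      using virtual_rigid[OF V V', of q] by blast
    then obtain \<gamma> where \<gamma>: "\<And>q. q \<in> carrier Q \<Longrightarrow> \<gamma> q \<in> carrier G"
      and v': "\<And>q. q \<in> carrier Q \<Longrightarrow> proportional (v' q) (u (\<gamma> q) ** v q)" by metis
    let ?\<phi> = "\<lambda>k g. \<gamma> k \<otimes> \<phi> k g \<otimes> inv (\<gamma> k)"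
      and ?\<omega> = "\<lambda>k q. \<gamma> k \<otimes> \<phi> k (\<gamma> q) \<otimes> \<omega> k q \<otimes> inv (\<gamma> (k \<otimes>\<^bsub>Q\<^esub> q))"
    have "induces_pair G Q u v' (?\<phi>, ?\<omega>)" by (rule induced_regauge[OF inv(1) iv inv' \<gamma> v']) simp_all
    from induced_unique[OF inv' this iv'] have
      "\<And>k g. k \<in> carrier Q \<Longrightarrow> g \<in> carrier G \<Longrightarrow> \<phi>' k g = ?\<phi> k g"
      "\<And>k q. k \<in> carrier Q \<Longrightarrow> q \<in> carrier Q \<Longrightarrow> \<omega>' k q = ?\<omega> k q" by simp_all
    then have "(p, p') \<in> pair_equiv G Q" unfolding pp pp'
      by (intro pair_equivI[OF coc induced_cocycle[OF inv' iv'], of \<gamma>]) (use \<gamma> in auto)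
    then show "p' \<in> pair_equiv G Q `` {p}" by simp
  next
    fix p' assume "p' \<in> pair_equiv G Q `` {p}"
    then have pe: "((\<phi>, \<omega>), p') \<in> pair_equiv G Q" by (simp add: pp)
    obtain \<phi>' \<omega>' where pp': "p' = (\<phi>', \<omega>')" by (cases p')
    from pe obtain \<gamma> where \<gamma>0: "\<gamma> \<in> carrier Q \<rightarrow> carrier G"
      and 1: "\<And>k g. k \<in> carrier Q \<Longrightarrow> g \<in> carrier G \<Longrightarrow> \<phi>' k g = \<gamma> k \<otimes> \<phi> k g \<otimes> inv (\<gamma> k)"
      and 2: "\<And>k q. k \<in> carrier Q \<Longrightarrow> q \<in> carrier Q \<Longrightarrow> \<omega>' k q = \<gamma> k \<otimes> \<phi> k (\<gamma> q) \<otimes> \<omega> k q \<otimes> inv (\<gamma> (k \<otimes>\<^bsub>Q\<^esub> q))"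
      unfolding pp' by (auto simp: pair_equiv_def)
    have \<gamma>: "\<And>q. q \<in> carrier Q \<Longrightarrow> \<gamma> q \<in> carrier G" using \<gamma>0 by auto
    let ?v = "\<lambda>q. u (\<gamma> q) ** v q" and ?w = "\<lambda>q. u (\<gamma> q) ** w q"
    have inv': "q \<in> carrier Q \<Longrightarrow> invertible (?v q)" "q \<in> carrier Q \<Longrightarrow> invertible (?w q)" for q
      using inv \<gamma> by (simp_all add: invertible_mult u_matrix_inv)
    have "A ** gauge (?w q) (?v q) = A ** gauge (w q) (v q)" if q: "q \<in> carrier Q" for q
    proof -
      have "A ** gauge (?w q) (?v q) = A ** ugauge (\<gamma> q) ** gauge (w q) (v q)"
        using q inv \<gamma> by (simp add: ugauge_gauge gauge_mult u_matrix_inv flip: matrix_mul_assoc)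
      then show ?thesis by (simp add: A_ugauge \<gamma> q)
    qed
    then have "virtual_symmetry Q U A ?v ?w" using UA inv' by (simp add: virtual_symmetry_def)
    moreover have "induces_pair G Q u ?v (\<phi>', \<omega>')"
      by (rule induced_regauge[OF inv(1) iv inv'(1) \<gamma> _ 1 2]) simp_all
    moreover have "induces_pair G Q u ?w (\<phi>', \<omega>')"
      by (rule induced_regauge[OF inv(2) iw inv'(2) \<gamma> _ 1 2]) simp_all
    ultimately show "p' \<in> symmetry_class G Q u U A" unfolding symmetry_class_def pp' by blast
  qed
qed

theorem symmetry_class_quotient: "symmetry_class G Q u U A \<in> cocycle_pairs G Q // pair_equiv G Q"
proof -
  obtain v w where V: "virtual_symmetry Q U A v w" using virtual_symmetry_exists by blast
  then obtain p where "p \<in> symmetry_class G Q u U A"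
    using virtual_pair[OF V] unfolding symmetry_class_def by blast
  from symmetry_class_eq[OF this] show ?thesis by (simp add: quotientI)
qed

end

section \<open>Stability under perturbations\<close>

lemma tendsto_mmult:
  fixes F :: "'e \<Rightarrow> complex^'n^'m" and H :: "'e \<Rightarrow> complex^'k^'n"
  assumes "(F \<longlongrightarrow> X) net" "(H \<longlongrightarrow> Y) net" shows "((\<lambda>e. F e ** H e) \<longlongrightarrow> X ** Y) net"
  unfolding matrix_matrix_mult_def
  by (intro tendsto_vec_lambda tendsto_sum tendsto_mult tendsto_vec_nth assms)

lemma tendsto_cscale:
  assumes "(c \<longlongrightarrow> d) net" "(F \<longlongrightarrow> X) net" shows "((\<lambda>e. c e *m F e) \<longlongrightarrow> d *m X) net"
  unfolding cscale_def by (intro tendsto_vec_lambda tendsto_mult tendsto_vec_nth assms)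

lemma tendsto_transpose:
  assumes "(F \<longlongrightarrow> X) net" shows "((\<lambda>e. transpose (F e)) \<longlongrightarrow> transpose X) net"
  unfolding transpose_def by (intro tendsto_vec_lambda tendsto_vec_nth assms)

lemma tendsto_cadjoint:
  assumes "(F \<longlongrightarrow> X) net" shows "((\<lambda>e. cadjoint (F e)) \<longlongrightarrow> cadjoint X) net"
  unfolding cadjoint_def by (intro tendsto_vec_lambda tendsto_cnj tendsto_vec_nth assms)

lemma tendsto_trace:
  fixes F :: "'e \<Rightarrow> complex^'n^'n"
  assumes "(F \<longlongrightarrow> X) net" shows "((\<lambda>e. trace (F e)) \<longlongrightarrow> trace X) net"
  unfolding trace_def by (intro tendsto_sum tendsto_vec_nth assms)

lemma tendsto_kron4:
  assumes "(F1 \<longlongrightarrow> X1) net" "(F2 \<longlongrightarrow> X2) net" "(F3 \<longlongrightarrow> X3) net" "(F4 \<longlongrightarrow> X4) net"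
  shows "((\<lambda>e. kron4 (F1 e) (F2 e) (F3 e) (F4 e)) \<longlongrightarrow> kron4 X1 X2 X3 X4) net"
  unfolding kron4_def split_def by (intro tendsto_vec_lambda tendsto_mult tendsto_vec_nth assms)

lemma tendsto_det:
  fixes F :: "'e \<Rightarrow> complex^'n^'n"
  assumes "(F \<longlongrightarrow> X) net" shows "((\<lambda>e. det (F e)) \<longlongrightarrow> det X) net"
  unfolding det_def by (intro tendsto_sum tendsto_mult tendsto_prod tendsto_vec_nth tendsto_const assms)

text \<open>Cramer's rule, in a form that shows the entries of the inverse to be continuous wherever
  the determinant does not vanish.\<close>

lemma matrix_inv_entry:
  fixes X :: "complex^'n^'n"
  assumes "invertible X"
  shows "matrix_inv X $ i $ j = det (\<chi> a b. if b = i then if a = j then 1 else 0 else X $ a $ b) / det X"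
proof -
  let ?b = "(\<chi> a. if a = j then 1 else 0) :: complex^'n" and ?x = "(\<chi> k. matrix_inv X $ k $ j) :: complex^'n"
  have "X *v ?x = ?b"
  proof (subst vec_eq_iff, rule allI)
    fix a
    have "(X *v ?x) $ a = (X ** matrix_inv X) $ a $ j" by (simp add: matrix_vector_mult_def mmult_nth)
    then show "(X *v ?x) $ a = ?b $ a" by (simp add: matrix_inv_mult[OF assms] mat_def)
  qed
  moreover have "det X \<noteq> 0" using assms invertible_det_nz by blast
  ultimately have "?x = (\<chi> k. det (\<chi> a b. if b = k then ?b $ a else X $ a $ b) / det X)" using cramer by blast
  then have "?x $ i = (\<chi> k. det (\<chi> a b. if b = k then ?b $ a else X $ a $ b) / det X) $ i" by (rule arg_cong)
  then show ?thesis unfolding vec_lambda_beta .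
qed

lemma tendsto_matrix_inv:
  fixes F :: "'e \<Rightarrow> complex^'n^'n"
  assumes F: "(F \<longlongrightarrow> X) net" and X: "invertible X"
  shows "\<forall>\<^sub>F e in net. invertible (F e)" "((\<lambda>e. matrix_inv (F e)) \<longlongrightarrow> matrix_inv X) net"
proof -
  have d: "det X \<noteq> 0" using X invertible_det_nz by blast
  show ev: "\<forall>\<^sub>F e in net. invertible (F e)"
    unfolding invertible_det_nz by (rule tendsto_imp_eventually_ne[OF tendsto_det[OF F] d])
  let ?C = "\<lambda>Y :: complex^'n^'n. \<chi> i j. det (\<chi> a b. if b = i then if a = j then 1 else 0 else Y $ a $ b) / det Y"
  have m: "matrix_inv Y = ?C Y" if "invertible Y" for Y
    by (rule matrix_eqI) (simp add: matrix_inv_entry[OF that])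
  have entry: "((\<lambda>e. if b = i then if a = j then 1 else 0 else F e $ a $ b) \<longlongrightarrow>
     (if b = i then if a = j then 1 else 0 else X $ a $ b)) net" for a b i j
  proof (cases "b = i")
    case False
    have "((\<lambda>e. F e $ a $ b) \<longlongrightarrow> X $ a $ b) net" by (intro tendsto_vec_nth F)
    then show ?thesis using False by simp
  qed simp
  have "((\<lambda>e. ?C (F e)) \<longlongrightarrow> ?C X) net"
    by (intro tendsto_vec_lambda tendsto_divide tendsto_det F d entry)
  moreover have "\<forall>\<^sub>F e in net. ?C (F e) = matrix_inv (F e)" using ev by eventually_elim (simp add: m)
  ultimately show "((\<lambda>e. matrix_inv (F e)) \<longlongrightarrow> matrix_inv X) net"
    unfolding m[OF X] by (rule Lim_transform_eventually)
qed

lemma entry_le_norm: "cmod (X $ i $ j) \<le> norm (X :: complex^'n^'m)"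
  using Finite_Cartesian_Product.norm_nth_le[of "X $ i" j] Finite_Cartesian_Product.norm_nth_le[of X i] by simp

lemma norm_le_entries: "norm (X :: complex^'n^'m) \<le> (\<Sum>i\<in>UNIV. \<Sum>j\<in>UNIV. cmod (X $ i $ j))"
proof -
  have "norm X \<le> (\<Sum>i\<in>UNIV. norm (X $ i))" unfolding norm_vec_def by (rule L2_set_le_sum) simp
  also have "\<dots> \<le> (\<Sum>i\<in>UNIV. \<Sum>j\<in>UNIV. cmod (X $ i $ j))"
    by (intro sum_mono) (simp add: norm_vec_def L2_set_le_sum)
  finally show ?thesis .
qed

lemma norm_cscale: "norm (c *m X) = cmod c * norm (X :: complex^'n^'m)"
proof -
  have L: "L2_set (\<lambda>i. a * f i) UNIV = a * L2_set f UNIV" if "a \<ge> 0" for a and f :: "'z::finite \<Rightarrow> real"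
    using that by (simp add: L2_set_right_distrib)
  have "norm ((c *m X) $ i) = cmod c * norm (X $ i)" for i
    unfolding norm_vec_def by (simp add: norm_mult L)
  then show ?thesis by (subst (1 2) norm_vec_def) (simp add: L)
qed

lemma contract_bound:
  fixes M :: "complex^('n::finite) legs^'n legs"
  assumes "\<And>i j. cmod (Z1 $ i $ j) \<le> z1" "\<And>i j. cmod (Z2 $ i $ j) \<le> z2" "\<And>i j. cmod (Z3 $ i $ j) \<le> z3"
    "\<And>i j. cmod (Z4 $ i $ j) \<le> z4" "\<And>i j. cmod (M $ i $ j) \<le> c"
  shows "cmod (contract Z1 Z2 Z3 Z4 M) \<le> (real CARD('n legs))\<^sup>2 * (z1 * z2 * z3 * z4 * c)"
proof -
  have p: "0 \<le> z1" "0 \<le> z2" "0 \<le> z3" "0 \<le> z4" "0 \<le> c"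
    using assms norm_ge_zero order_trans by blast+
  have "cmod (contract Z1 Z2 Z3 Z4 M) \<le> (\<Sum>m\<in>(UNIV :: 'n legs set). \<Sum>m'\<in>(UNIV :: 'n legs set). z1 * z2 * z3 * z4 * c)"
    unfolding contract_def
    by (intro sum_norm_le) (simp only: norm_mult, intro mult_mono assms p mult_nonneg_nonneg norm_ge_zero)
  then show ?thesis by (simp add: power2_eq_square)
qed

section \<open>Condition numbers of averaged gauges\<close>

context delta_rep
begin

lemma gproj_gauge: "invertible y \<Longrightarrow> invertible x \<Longrightarrow>
    gproj ** gauge y x = (1 / N) *m (\<Sum>h\<in>carrier G. gauge (u h ** y) (u h ** x))"
  by (simp add: gproj_def mmult_sum ugauge_gauge gauge_mult u_matrix_inv)

text \<open>The sum of gauges is symmetric under exchange of the vertical and the horizontal legs,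
  so an estimate for \<open>y\<close> in terms of \<open>x\<close> can be reversed.\<close>

lemma gproj_gauge_swap:
  assumes "invertible y" "invertible x"
  shows "(gproj ** gauge x y) $ (a, b, c, d) $ (a', b', c', d') = (gproj ** gauge y x) $ (b, a, d, c) $ (b', a', d', c')"
  unfolding gproj_gauge[OF assms] gproj_gauge[OF assms(2,1)]
  by (simp add: gauge_def kron4_def mult_ac)

text \<open>Two copies of the average are linked through one leg of each, which forces their group elements
  to agree; the functional \<open>x\<^sup>-\<^sup>1 K\<close> then isolates the identity. The linked legs cancel, so that only one
  factor \<open>x\<close> and one \<open>x\<^sup>-\<^sup>1\<close> is paid for two factors \<open>y\<close> and \<open>y\<^sup>-\<^sup>1\<close>.\<close>

lemma linked_copies:
  assumes inv: "invertible y" "invertible x"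
  defines "S \<equiv> (\<Sum>h\<in>carrier G. gauge (u h ** y) (u h ** x))"
  shows "(\<Sum>i\<in>UNIV. \<Sum>j\<in>UNIV. \<Sum>l\<in>UNIV. K $ l $ i *
      (contract (munit b a) (munit j i) (munit d c) x S * contract (munit b a) (matrix_inv x ** K) (munit d c) (munit l j) S))
    = (y $ a $ b * matrix_inv y $ c $ d)\<^sup>2 * of_nat CARD('n)"
proof -
  let ?X = "\<lambda>h. u h ** x" and ?Y = "\<lambda>h. u h ** y"
  have iX: "matrix_inv (?X h) = matrix_inv x ** u (inv h)" "matrix_inv (?Y h) = matrix_inv y ** u (inv h)" if "h \<in> carrier G" for h
    using that inv by (simp_all add: matrix_inv_mult_distrib u_matrix_inv)
  let ?p = "\<lambda>h. (?Y h) $ a $ b * matrix_inv (?Y h) $ c $ d"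
  let ?q = "\<lambda>h. trace (x ** matrix_inv (?X h))" and ?r = "\<lambda>h. trace (matrix_inv x ** K ** ?X h)"
  have c1: "contract (munit b a) (munit j i) (munit d c) x S = (\<Sum>h\<in>carrier G. ?p h * ?q h * (?X h) $ i $ j)" for i j
    unfolding S_def contract_sum contract_gauge trace_munit_mult by (simp add: mult_ac)
  have c2: "contract (munit b a) (matrix_inv x ** K) (munit d c) (munit l j) S = (\<Sum>h\<in>carrier G. ?p h * ?r h * matrix_inv (?X h) $ j $ l)" for l j
    unfolding S_def contract_sum contract_gauge trace_munit_mult by (simp add: mult_ac)
  have link: "(\<Sum>i\<in>UNIV. \<Sum>j\<in>UNIV. \<Sum>l\<in>UNIV. K $ l $ i * ((?X h) $ i $ j * matrix_inv (?X h') $ j $ l)) = (if h = h' then 1 else 0)"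
    if h: "h \<in> carrier G" "h' \<in> carrier G" for h h'
  proof -
    have "(\<Sum>i\<in>UNIV. \<Sum>j\<in>UNIV. \<Sum>l\<in>UNIV. K $ l $ i * ((?X h) $ i $ j * matrix_inv (?X h') $ j $ l))
       = (\<Sum>l\<in>UNIV. \<Sum>i\<in>UNIV. K $ l $ i * (\<Sum>j\<in>UNIV. (?X h) $ i $ j * matrix_inv (?X h') $ j $ l))"
      unfolding sum_distrib_left
      by (rule trans[OF sum.cong[OF refl sum.swap] sum.swap])
    also have "\<dots> = trace (K ** (?X h ** matrix_inv (?X h')))"
      unfolding trace_mult_eq by (simp add: mmult_nth)
    also have "?X h ** matrix_inv (?X h') = u (h \<otimes> inv h')"
    proof -
      have "?X h ** matrix_inv (?X h') = u h ** (x ** matrix_inv x) ** u (inv h')"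
        unfolding iX[OF h(2)] by (simp only: matrix_mul_assoc)
      then show ?thesis using h by (simp add: matrix_inv_mult[OF inv(2)] u_mult)
    qed
    also have "trace (K ** u (h \<otimes> inv h')) = (if h = h' then 1 else 0)"
    proof -
      have "h \<otimes> inv h' = \<one> \<longleftrightarrow> h = h'" using h by (metis inv_closed inv_equality inv_inv r_inv)
      then show ?thesis using h by (simp add: K)
    qed
    finally show ?thesis .
  qed
  have "(\<Sum>i\<in>UNIV. \<Sum>j\<in>UNIV. \<Sum>l\<in>UNIV. K $ l $ i *
      (contract (munit b a) (munit j i) (munit d c) x S * contract (munit b a) (matrix_inv x ** K) (munit d c) (munit l j) S))
    = (\<Sum>i\<in>UNIV. \<Sum>j\<in>UNIV. \<Sum>l\<in>UNIV. \<Sum>h\<in>carrier G. \<Sum>h'\<in>carrier G.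
        (?p h * ?q h * (?p h' * ?r h')) * (K $ l $ i * ((?X h) $ i $ j * matrix_inv (?X h') $ j $ l)))"
  proof (intro sum.cong refl)
    fix i j l
    have e: "K $ l $ i * (\<Sum>h\<in>carrier G. \<Sum>h'\<in>carrier G. f h * g h') = (\<Sum>h\<in>carrier G. \<Sum>h'\<in>carrier G. K $ l $ i * (f h * g h'))" for f g
      by (simp only: sum_distrib_left)
    show "K $ l $ i * (contract (munit b a) (munit j i) (munit d c) x S * contract (munit b a) (matrix_inv x ** K) (munit d c) (munit l j) S)
      = (\<Sum>h\<in>carrier G. \<Sum>h'\<in>carrier G.
        (?p h * ?q h * (?p h' * ?r h')) * (K $ l $ i * ((?X h) $ i $ j * matrix_inv (?X h') $ j $ l)))"
      unfolding c1 c2 sum_product e by (intro sum.cong refl) (simp only: mult_ac)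
  qed
  also have "\<dots> = (\<Sum>h\<in>carrier G. \<Sum>h'\<in>carrier G. \<Sum>i\<in>UNIV. \<Sum>j\<in>UNIV. \<Sum>l\<in>UNIV.
        (?p h * ?q h * (?p h' * ?r h')) * (K $ l $ i * ((?X h) $ i $ j * matrix_inv (?X h') $ j $ l)))"
  proof -
    have "(\<Sum>i\<in>UNIV. \<Sum>j\<in>UNIV. \<Sum>l\<in>UNIV. \<Sum>h\<in>C. \<Sum>h'\<in>C. f i j l h h') = (\<Sum>h\<in>C. \<Sum>h'\<in>C. \<Sum>i\<in>UNIV. \<Sum>j\<in>UNIV. \<Sum>l\<in>UNIV. f i j l h h')"
      for f :: "'n \<Rightarrow> 'n \<Rightarrow> 'n \<Rightarrow> 'g \<Rightarrow> 'g \<Rightarrow> complex" and C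
    proof -
      have "(\<Sum>i\<in>UNIV. \<Sum>j\<in>UNIV. \<Sum>l\<in>UNIV. \<Sum>h\<in>C. \<Sum>h'\<in>C. f i j l h h') = (\<Sum>i\<in>UNIV. \<Sum>j\<in>UNIV. \<Sum>h\<in>C. \<Sum>h'\<in>C. \<Sum>l\<in>UNIV. f i j l h h')"
        by (intro sum.cong refl sum_swap_1_2)
      also have "\<dots> = (\<Sum>i\<in>UNIV. \<Sum>h\<in>C. \<Sum>h'\<in>C. \<Sum>j\<in>UNIV. \<Sum>l\<in>UNIV. f i j l h h')"
        by (intro sum.cong refl sum_swap_1_2)
      also have "\<dots> = (\<Sum>h\<in>C. \<Sum>h'\<in>C. \<Sum>i\<in>UNIV. \<Sum>j\<in>UNIV. \<Sum>l\<in>UNIV. f i j l h h')"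
        by (rule sum_swap_1_2)
      finally show ?thesis .
    qed
    then show ?thesis .
  qed
  also have "\<dots> = (\<Sum>h\<in>carrier G. \<Sum>h'\<in>carrier G. if h = h' then ?p h * ?q h * (?p h * ?r h) else 0)"
    by (intro sum.cong refl) (simp only: link sum_distrib_left[symmetric], simp)
  also have "\<dots> = (\<Sum>h\<in>carrier G. ?p h * ?q h * (?p h * ?r h))"
    using fin by (intro sum.cong refl) simp
  also have "\<dots> = (\<Sum>h\<in>carrier G. if h = \<one> then ?p h * ?q h * ?p h else 0)"
  proof (intro sum.cong refl)
    fix h assume h: "h \<in> carrier G"
    have "?r h = trace (u h ** x ** (matrix_inv x ** K))" by (rule trace_mul_sym)
    also have "\<dots> = trace (u h ** K)" using inv by (simp add: matrix_inv_cancel flip: matrix_mul_assoc)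
    also have "\<dots> = trace (K ** u h)" by (rule trace_mul_sym)
    finally have "?r h = (if h = \<one> then 1 else 0)" using h by (simp add: K)
    then show "?p h * ?q h * (?p h * ?r h) = (if h = \<one> then ?p h * ?q h * ?p h else 0)" by simp
  qed
  also have "\<dots> = (y $ a $ b * matrix_inv y $ c $ d)\<^sup>2 * of_nat CARD('n)"
    using fin inv by (simp add: u_one matrix_inv_mult trace_I power2_eq_square mult_ac)
  finally show ?thesis .
qed

text \<open>By \<open>linked_copies\<close> the square of a product of entries of \<open>y\<close>
  and its inverse is expressed by bounded contractions at the price of one \<open>x\<close> and one
  inverse of \<open>x\<close>. The estimate is thus quadratic in one condition number and linear in
  the other.\<close>

lemma gauge_bound_half:
  assumes c0: "c0 \<ge> 0"
  shows "\<exists>C\<ge>0. \<forall>y x. invertible y \<longrightarrow> invertible x \<longrightarrow> (\<forall>i j. cmod ((gproj ** gauge y x) $ i $ j) \<le> c0) \<longrightarrow>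
     (norm y * norm (matrix_inv y))\<^sup>2 \<le> C * (norm x * norm (matrix_inv x))"
proof -
  \<comment> \<open>In \<open>?D\<close> the factor \<open>?n ^ 3\<close> counts the terms of the
    triple sum, \<open>?k\<close> bounds the entry of \<open>K\<close>, each \<open>?m * ?N\<close>
    comes from one contraction, and \<open>?n * ?k\<close> from the entries of
    \<open>matrix_inv x ** K\<close>.\<close>
  let ?n = "real CARD('n)" and ?m = "(real CARD('n legs))\<^sup>2" and ?k = "norm K" and ?N = "cmod N * c0"
  let ?D = "?n ^ 3 * (?k * (?m * ?N * (?m * ?N * (?n * ?k))))"
  have D0: "?D \<ge> 0" using c0 by simp
  have n1: "?n \<ge> 1" by (simp add: Suc_leI)
  show ?thesis
  \<comment> \<open>Each norm is bounded by a sum of \<open>?n\<^sup>2\<close> absolute values of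
    entries, so the product of two norms costs \<open>?n ^ 4\<close> and its square
    \<open>?n ^ 8\<close>.\<close>
  proof (intro exI[of _ "?n ^ 8 * ?D"] conjI allI impI)
    show "?n ^ 8 * ?D \<ge> 0" by (rule mult_nonneg_nonneg[OF _ D0]) simp
    fix y x :: "complex^'n^'n"
    assume inv: "invertible y" "invertible x" and b: "\<forall>i j. cmod ((gproj ** gauge y x) $ i $ j) \<le> c0"
    let ?S = "\<Sum>h\<in>carrier G. gauge (u h ** y) (u h ** x)"
    let ?kx = "norm x * norm (matrix_inv x)"
    have S: "cmod (?S $ i $ j) \<le> ?N" for i j
    proof -
      have "?S = N *m (gproj ** gauge y x)" using N_nonzero by (simp add: gproj_gauge[OF inv])
      then have "?S $ i $ j = N * (gproj ** gauge y x) $ i $ j" by (simp only: cscale_nth)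
      moreover have "cmod ((gproj ** gauge y x) $ i $ j) \<le> c0" using b by blast
      ultimately show ?thesis by (simp only: norm_mult mult_left_mono norm_ge_zero)
    qed
    have mu: "cmod (munit i j $ k $ l) \<le> 1" for i j k l :: 'n by (simp add: munit_nth)
    have xK: "cmod ((matrix_inv x ** K) $ i $ j) \<le> ?n * (norm (matrix_inv x) * ?k)" for i j
    proof -
      have "cmod ((matrix_inv x ** K) $ i $ j) \<le> (\<Sum>l\<in>(UNIV :: 'n set). norm (matrix_inv x) * ?k)"
        unfolding mmult_nth by (rule sum_norm_le) (simp add: norm_mult mult_mono entry_le_norm)
      then show ?thesis by simp
    qed
    have entry: "(cmod (y $ a $ b) * cmod (matrix_inv y $ c $ d))\<^sup>2 \<le> ?D * ?kx" for a b c d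
    proof -
      have "(cmod (y $ a $ b) * cmod (matrix_inv y $ c $ d))\<^sup>2 \<le> (cmod (y $ a $ b) * cmod (matrix_inv y $ c $ d))\<^sup>2 * ?n"
        using mult_left_mono[OF n1, of "(cmod (y $ a $ b) * cmod (matrix_inv y $ c $ d))\<^sup>2"] by simp
      also have "\<dots> = cmod ((y $ a $ b * matrix_inv y $ c $ d)\<^sup>2 * of_nat CARD('n))"
        by (simp add: norm_mult norm_power)
      also have "\<dots> \<le> (\<Sum>i\<in>(UNIV :: 'n set). \<Sum>j\<in>(UNIV :: 'n set). \<Sum>l\<in>(UNIV :: 'n set).
          ?k * ((?m * (1 * 1 * 1 * norm x * ?N)) * (?m * (1 * (?n * (norm (matrix_inv x) * ?k)) * 1 * 1 * ?N))))"
        unfolding linked_copies[OF inv, symmetric]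
        by (intro sum_norm_le) (simp only: norm_mult, intro mult_mono contract_bound entry_le_norm mu xK S
            mult_nonneg_nonneg norm_ge_zero zero_le_power2 of_nat_0_le_iff c0 zero_le_one)
      also have "\<dots> = ?D * ?kx" by (simp add: power3_eq_cube mult_ac)
      finally show ?thesis .
    qed
    have e': "cmod (y $ a $ b) * cmod (matrix_inv y $ c $ d) \<le> sqrt (?D * ?kx)" for a b c d
      by (rule real_le_rsqrt[OF entry])
    have "norm y * norm (matrix_inv y) \<le> (\<Sum>a\<in>UNIV. \<Sum>b\<in>UNIV. cmod (y $ a $ b)) * (\<Sum>c\<in>UNIV. \<Sum>d\<in>UNIV. cmod (matrix_inv y $ c $ d))"
      by (intro mult_mono norm_le_entries norm_ge_zero sum_nonneg)
    also have "\<dots> = (\<Sum>a\<in>UNIV. \<Sum>c\<in>UNIV. \<Sum>b\<in>UNIV. \<Sum>d\<in>UNIV. cmod (y $ a $ b) * cmod (matrix_inv y $ c $ d))"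
      by (simp only: sum_product)
    also have "\<dots> \<le> (\<Sum>a\<in>(UNIV :: 'n set). \<Sum>c\<in>(UNIV :: 'n set). \<Sum>b\<in>(UNIV :: 'n set). \<Sum>d\<in>(UNIV :: 'n set). sqrt (?D * ?kx))"
      by (intro sum_mono e')
    also have "\<dots> = ?n ^ 4 * sqrt (?D * ?kx)" by (simp add: power4_eq_xxxx)
    finally have "norm y * norm (matrix_inv y) \<le> ?n ^ 4 * sqrt (?D * ?kx)" .
    then have "(norm y * norm (matrix_inv y))\<^sup>2 \<le> (?n ^ 4 * sqrt (?D * ?kx))\<^sup>2"
      by (rule power_mono) simp
    also have "\<dots> = ?n ^ 8 * (?D * ?kx)"
    proof -
      have "0 \<le> ?D * ?kx" by (rule mult_nonneg_nonneg[OF D0 mult_nonneg_nonneg[OF norm_ge_zero norm_ge_zero]])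
      then show ?thesis by (simp only: power_mult_distrib real_sqrt_pow2 power_mult[symmetric]) simp
    qed
    finally show "(norm y * norm (matrix_inv y))\<^sup>2 \<le> ?n ^ 8 * ?D * ?kx" by (simp only: mult.assoc)
  qed
qed

lemma gauge_bound:
  assumes "c0 \<ge> 0"
  shows "\<exists>C. \<forall>y x. invertible y \<longrightarrow> invertible x \<longrightarrow> (\<forall>i j. cmod ((gproj ** gauge y x) $ i $ j) \<le> c0) \<longrightarrow>
     norm y * norm (matrix_inv y) \<le> C \<and> norm x * norm (matrix_inv x) \<le> C"
proof -
  obtain C where C: "C \<ge> 0" and half: "\<And>y x. invertible y \<Longrightarrow> invertible x \<Longrightarrow> \<forall>i j. cmod ((gproj ** gauge y x) $ i $ j) \<le> c0 \<Longrightarrow>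
     (norm y * norm (matrix_inv y))\<^sup>2 \<le> C * (norm x * norm (matrix_inv x))"
    using gauge_bound_half[OF assms] by blast
  \<comment> \<open>The two crossed estimates close up because each is quadratic on the left and
    only linear on the right.\<close>
  have key: "a \<le> C" if ab: "a\<^sup>2 \<le> C * b" "b\<^sup>2 \<le> C * a" "0 \<le> a" "0 \<le> b" for a b :: real
  proof (rule ccontr)
    assume "\<not> a \<le> C"
    then have a: "C < a" by simp
    have "a * a \<le> C * b" using ab by (simp add: power2_eq_square)
    also have "C * b \<le> a * b" using a ab by (intro mult_right_mono) auto
    finally have "a \<le> b" using a C by simp
    have "b * b \<le> C * a" using ab by (simp add: power2_eq_square)
    also have "C * a < a * a" using a C by simp
    also have "a * a \<le> b * b" using \<open>a \<le> b\<close> ab by (intro mult_mono) auto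
    finally show False by simp
  qed
  show ?thesis
  proof (intro exI[of _ C] allI impI)
    fix y x :: "complex^'n^'n"
    assume inv: "invertible y" "invertible x" and b: "\<forall>i j. cmod ((gproj ** gauge y x) $ i $ j) \<le> c0"
    have b': "\<forall>i j. cmod ((gproj ** gauge x y) $ i $ j) \<le> c0"
    proof (intro allI)
      fix i j :: "'n legs"
      obtain a1 b1 c1 d1 a2 b2 c2 d2 where ij: "i = (a1, b1, c1, d1)" "j = (a2, b2, c2, d2)" by (cases i; cases j) auto
      show "cmod ((gproj ** gauge x y) $ i $ j) \<le> c0" unfolding ij gproj_gauge_swap[OF inv] using b by blast
    qed
    show "norm y * norm (matrix_inv y) \<le> C \<and> norm x * norm (matrix_inv x) \<le> C"
      using key[OF half[OF inv b] half[OF inv(2,1) b']] key[OF half[OF inv(2,1) b'] half[OF inv b]] by simp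
  qed
qed

text \<open>A gauge does not change under scaling. Once the norm is 1, a bound on the condition
  number bounds the inverse, and this keeps limits of such matrices invertible.\<close>

lemma normalized_inverse:
  fixes z :: "complex^'n^'n"
  assumes "invertible z" "norm z * norm (matrix_inv z) \<le> C"
  defines "z' \<equiv> complex_of_real (inverse (norm z)) *m z"
  shows "invertible z'" "norm z' = 1" "norm (matrix_inv z') \<le> C" "norm z \<noteq> 0"
proof -
  show z: "norm z \<noteq> 0" using invertible_nonzero[OF assms(1)] by simp
  then have c: "complex_of_real (inverse (norm z)) \<noteq> 0" by simp
  show "invertible z'" unfolding z'_def by (rule matrix_inv_cscale(2)[OF assms(1) c])
  show "norm z' = 1" using z unfolding z'_def norm_cscale by (simp add: norm_inverse)
  show "norm (matrix_inv z') \<le> C"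
    using assms(2) z unfolding z'_def matrix_inv_cscale(1)[OF assms(1) c] norm_cscale by simp
qed

text \<open>The normalised matrices together with their inverses are bounded, so a subsequence
  converges and its limits are again inverse to each other. The limit gauge is absorbed by
  \<open>gproj\<close>, hence its matrices are multiples of a group matrix; \<open>h\<close> and the
  scalars \<open>c n\<close> undo exactly this freedom.\<close>

lemma gauge_limit:
  assumes inv: "\<And>n. invertible (y n)" "\<And>n. invertible (x n)"
    and lim: "(\<lambda>n. gproj ** gauge (y n) (x n)) \<longlonglongrightarrow> gproj"
  shows "\<exists>r h c. strict_mono (r :: nat \<Rightarrow> nat) \<and> h \<in> carrier G \<and> (\<forall>n. c n \<noteq> 0) \<and>
     (\<lambda>n. c n *m (u (inv h) ** x (r n))) \<longlonglongrightarrow> mat 1"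
proof -
  have "bounded (range (\<lambda>n. gproj ** gauge (y n) (x n)))" using lim by (rule convergent_imp_bounded)
  then obtain c0 where c0: "\<And>n. norm (gproj ** gauge (y n) (x n)) \<le> c0" unfolding bounded_iff by blast
  have c0p: "c0 \<ge> 0" using c0[of 0] norm_ge_zero order_trans by blast
  from gauge_bound[OF c0p] obtain C where C: "\<And>y x. invertible y \<Longrightarrow> invertible x \<Longrightarrow> \<forall>i j. cmod ((gproj ** gauge y x) $ i $ j) \<le> c0 \<Longrightarrow>
     norm y * norm (matrix_inv y) \<le> C \<and> norm x * norm (matrix_inv x) \<le> C" by blast
  have b: "norm (y n) * norm (matrix_inv (y n)) \<le> C" "norm (x n) * norm (matrix_inv (x n)) \<le> C" for n
    using C[OF inv, of n n] c0[of n] entry_le_norm order_trans by blast+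
  define y' x' where "y' n = complex_of_real (inverse (norm (y n))) *m y n"
    and "x' n = complex_of_real (inverse (norm (x n))) *m x n" for n
  note ny = normalized_inverse[OF inv(1) b(1), folded y'_def] and nx = normalized_inverse[OF inv(2) b(2), folded x'_def]
  let ?z = "\<lambda>n. ((y' n, matrix_inv (y' n)), (x' n, matrix_inv (x' n)))"
  have "norm (?z n) \<le> (1 + C) + (1 + C)" for n
    by (rule order_trans[OF norm_Pair_le add_mono[OF order_trans[OF norm_Pair_le] order_trans[OF norm_Pair_le]]])
      (use ny(2,3)[of n] nx(2,3)[of n] in simp_all)
  then have "bounded (range ?z)" unfolding bounded_iff by blast
  then obtain r Y Yi X Xi where r: "strict_mono (r :: nat \<Rightarrow> nat)" and z: "(?z \<circ> r) \<longlonglongrightarrow> ((Y, Yi), (X, Xi))"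
  proof -
    obtain l r where "strict_mono (r :: nat \<Rightarrow> nat)" "(?z \<circ> r) \<longlonglongrightarrow> l"
      using bounded_imp_convergent_subsequence[OF \<open>bounded (range ?z)\<close>] by blast
    then show thesis using that by (cases l) auto
  qed
  have Y: "(\<lambda>n. y' (r n)) \<longlonglongrightarrow> Y" using tendsto_fst[OF tendsto_fst[OF z]] by (simp add: o_def)
  have Yi: "(\<lambda>n. matrix_inv (y' (r n))) \<longlonglongrightarrow> Yi" using tendsto_snd[OF tendsto_fst[OF z]] by (simp add: o_def)
  have X: "(\<lambda>n. x' (r n)) \<longlonglongrightarrow> X" using tendsto_fst[OF tendsto_snd[OF z]] by (simp add: o_def)
  have Xi: "(\<lambda>n. matrix_inv (x' (r n))) \<longlonglongrightarrow> Xi" using tendsto_snd[OF tendsto_snd[OF z]] by (simp add: o_def)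
  have "(\<lambda>n. y' (r n) ** matrix_inv (y' (r n))) \<longlonglongrightarrow> Y ** Yi" by (rule tendsto_mmult[OF Y Yi])
  then have "Y ** Yi = mat 1" unfolding matrix_inv_mult[OF ny(1)] LIMSEQ_const_iff by (rule sym)
  then have Yinv: "invertible Y" "Yi = matrix_inv Y" using matrix_inv_unique by metis+
  have "(\<lambda>n. x' (r n) ** matrix_inv (x' (r n))) \<longlonglongrightarrow> X ** Xi" by (rule tendsto_mmult[OF X Xi])
  then have "X ** Xi = mat 1" unfolding matrix_inv_mult[OF nx(1)] LIMSEQ_const_iff by (rule sym)
  then have Xinv: "invertible X" "Xi = matrix_inv X" using matrix_inv_unique by metis+
  have g: "gauge (y' n) (x' n) = gauge (y n) (x n)" for n
    unfolding y'_def x'_def using ny(4)[of n] nx(4)[of n] by (intro gauge_cscale inv) simp_all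
  have "(\<lambda>n. gproj ** gauge (y' (r n)) (x' (r n))) \<longlonglongrightarrow> gproj ** gauge Y X"
    unfolding gauge_def Yinv(2)[symmetric] Xinv(2)[symmetric]
    by (intro tendsto_mmult tendsto_const tendsto_kron4 tendsto_transpose Y Yi X Xi)
  moreover have "(\<lambda>n. gproj ** gauge (y' (r n)) (x' (r n))) \<longlonglongrightarrow> gproj"
    unfolding g using LIMSEQ_subseq_LIMSEQ[OF lim r] by (simp add: o_def)
  ultimately have "gproj ** gauge Y X = gproj" by (rule LIMSEQ_unique)
  from gproj_gauge_rigid[OF this Yinv(1) Xinv(1)] obtain h d where h: "h \<in> carrier G" "d \<noteq> 0" "X = d *m u h" by blast
  let ?c = "\<lambda>n. inverse d * complex_of_real (inverse (norm (x (r n))))"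
  have "(\<lambda>n. inverse d *m (u (inv h) ** x' (r n))) \<longlonglongrightarrow> inverse d *m (u (inv h) ** X)"
    by (intro tendsto_cscale tendsto_const tendsto_mmult X)
  also have "inverse d *m (u (inv h) ** X) = mat 1" using h by (simp add: u_inv)
  finally have "(\<lambda>n. ?c n *m (u (inv h) ** x (r n))) \<longlonglongrightarrow> mat 1" by (simp add: x'_def)
  moreover have "?c n \<noteq> 0" for n using h nx(4)[of "r n"] by simp
  ultimately show ?thesis using r h(1) by (intro exI[of _ r] exI[of _ h] exI[of _ ?c]) blast
qed

end

section \<open>Persistence of the discrete data under small perturbations\<close>

lemma trace_nonzero_near:
  fixes M a b c :: "complex^'n^'n"
  assumes "trace (M ** a ** b ** c) \<noteq> 0"
  shows "\<exists>\<eta>>0. \<forall>a' b' c'. dist a' a < \<eta> \<longrightarrow> dist b' b < \<eta> \<longrightarrow> dist c' c < \<eta> \<longrightarrow> trace (M ** a' ** b' ** c') \<noteq> 0"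
proof -
  let ?f = "\<lambda>p :: (complex^'n^'n) \<times> (complex^'n^'n) \<times> (complex^'n^'n). trace (M ** fst p ** fst (snd p) ** snd (snd p))"
  have id: "((\<lambda>p. p) \<longlongrightarrow> (a, b, c)) (nhds (a, b, c))" by (rule filterlim_ident)
  have "(?f \<longlongrightarrow> ?f (a, b, c)) (nhds (a, b, c))"
    by (intro tendsto_trace tendsto_mmult tendsto_const tendsto_fst tendsto_snd id)
  from tendsto_imp_eventually_ne[OF this, of 0] assms have "\<forall>\<^sub>F p in nhds (a, b, c). ?f p \<noteq> 0" by simp
  then obtain d where d: "d > 0" "\<And>p. dist p (a, b, c) < d \<Longrightarrow> ?f p \<noteq> 0" unfolding eventually_nhds_metric by blast
  show ?thesis
  proof (intro exI[of _ "d / 3"] conjI allI impI)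
    fix a' b' c' assume n: "dist a' a < d / 3" "dist b' b < d / 3" "dist c' c < d / 3"
    have D: "dist (x, y) (x', y') \<le> dist x x' + dist y y'" for x x' :: "'a1::metric_space" and y y' :: "'b1::metric_space"
      unfolding dist_prod_def by (simp add: sqrt_sum_squares_le_sum)
    have "dist (a', b', c') (a, b, c) \<le> dist a' a + (dist b' b + dist c' c)"
      by (rule order_trans[OF D add_left_mono[OF D]])
    then have "dist (a', b', c') (a, b, c) < d" using n by simp
    from d(2)[OF this] show "trace (M ** a' ** b' ** c') \<noteq> 0" by simp
  qed (use d in simp)
qed

lemma finite_uniform_radius:
  assumes "finite I" "\<And>i. i \<in> I \<Longrightarrow> \<exists>\<eta>>0. T i \<eta>"
    and "\<And>i \<eta> \<eta>'. T i \<eta> \<Longrightarrow> 0 < \<eta>' \<Longrightarrow> \<eta>' \<le> \<eta> \<Longrightarrow> T i (\<eta>' :: real)"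
  shows "\<exists>\<eta>>0. \<forall>i\<in>I. T i \<eta>"
  using assms(1,2)
proof (induction I rule: finite_induct)
  case empty
  show ?case by (intro exI[of _ 1]) simp
next
  case (insert x F)
  then obtain \<eta> \<eta>' where e: "\<eta> > 0" "\<forall>i\<in>F. T i \<eta>" "\<eta>' > 0" "T x \<eta>'" by (metis insertCI)
  have "\<forall>i\<in>insert x F. T i (min \<eta> \<eta>')"
    using e assms(3)[of _ \<eta> "min \<eta> \<eta>'"] assms(3)[of _ \<eta>' "min \<eta> \<eta>'"] by auto
  then show ?case using e by (intro exI[of _ "min \<eta> \<eta>'"]) simp
qed

context symmetric_tensor
begin

lemma deformed_tensor:
  assumes "invertible X" "\<And>q. q \<in> carrier Q \<Longrightarrow> leaves_invariant (U q) (X ** A)"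
  shows "symmetric_tensor G Q u K (X ** A) (B ** matrix_inv X) U"
proof unfold_locales
  have "B ** matrix_inv X ** (X ** A) = B ** (matrix_inv X ** (X ** A))" by (simp only: matrix_mul_assoc)
  then show "B ** matrix_inv X ** (X ** A) = gproj" by (simp only: matrix_inv_cancel[OF assms(1)] BA)
  show "X ** A ** gproj = X ** A" using AP by (simp flip: matrix_mul_assoc)
  show "representation Q U" by (rule U_rep)
  show "leaves_invariant (U q) (X ** A)" if "q \<in> carrier Q" for q by (rule assms(2)[OF that])
qed

context
  fixes R :: "real \<Rightarrow> complex^'p^'p"
  assumes R: "(R \<longlongrightarrow> mat 1) (nhds 0)"
    and R_inv: "\<forall>\<^sub>F \<epsilon> in nhds 0. \<forall>q\<in>carrier Q. leaves_invariant (U q) (R \<epsilon> ** A)"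
begin

lemma eventually_symmetric_tensor:
  "\<forall>\<^sub>F \<epsilon> in nhds 0. invertible (R \<epsilon>) \<and> symmetric_tensor G Q u K (R \<epsilon> ** A) (B ** matrix_inv (R \<epsilon>)) U"
  using tendsto_matrix_inv(1)[OF R matrix_inv_mat1(2)] R_inv by eventually_elim (blast intro: deformed_tensor)

text \<open>Otherwise some sequence of perturbations tends to 0 without admitting close virtual
  matrices. Relative to \<open>v0\<close>, \<open>w0\<close> their gauges tend to the trivial one
  behind \<open>gproj\<close>, so \<open>gauge_limit\<close> makes a subsequence converge after a
  correction by group matrices and scalars, which is a legitimate change of virtual matrices. Only
  \<open>v\<close> is kept close, because \<open>w\<close> induces the same pair.\<close>

lemma virtual_near:
  assumes q: "q \<in> carrier Q" and inv0: "invertible v0" "invertible w0" and e0: "U q ** A = A ** gauge w0 v0" and \<eta>: "\<eta> > 0"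
  shows "\<forall>\<^sub>F \<epsilon> in nhds 0. \<exists>v w. invertible v \<and> invertible w \<and> U q ** (R \<epsilon> ** A) = R \<epsilon> ** A ** gauge w v \<and>
     dist v v0 < \<eta> \<and> dist (matrix_inv v) (matrix_inv v0) < \<eta>" (is "\<forall>\<^sub>F \<epsilon> in _. ?P \<epsilon>")
proof (rule ccontr)
  let ?good = "\<lambda>\<epsilon>. invertible (R \<epsilon>) \<and> symmetric_tensor G Q u K (R \<epsilon> ** A) (B ** matrix_inv (R \<epsilon>)) U"
  assume n: "\<not> (\<forall>\<^sub>F \<epsilon> in nhds 0. ?P \<epsilon>)"
  have "\<exists>\<epsilon>. dist \<epsilon> 0 < inverse (real (Suc n)) \<and> ?good \<epsilon> \<and> \<not> ?P \<epsilon>" for n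
  proof (rule ccontr)
    assume a: "\<not> ?thesis"
    have "\<forall>\<^sub>F \<epsilon> in nhds (0 :: real). dist \<epsilon> 0 < inverse (real (Suc n))"
      unfolding eventually_nhds_metric by (intro exI[of _ "inverse (real (Suc n))"]) simp
    then have "\<forall>\<^sub>F \<epsilon> in nhds 0. ?P \<epsilon>"
      using eventually_symmetric_tensor by eventually_elim (use a in blast)
    then show False using n by blast
  qed
  then obtain e where e: "\<And>n. dist (e n) 0 < inverse (real (Suc n))" and good: "\<And>n. ?good (e n)" and bad: "\<And>n. \<not> ?P (e n)"
    by metis
  have e_lim: "e \<longlonglongrightarrow> 0"
    by (rule metric_tendsto_imp_tendsto[OF LIMSEQ_inverse_real_of_nat]) (use e in \<open>simp add: less_imp_le\<close>)
  have Re: "(\<lambda>n. R (e n)) \<longlonglongrightarrow> mat 1" by (rule filterlim_compose[OF R e_lim])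
  have "\<exists>v w. invertible v \<and> invertible w \<and> U q ** (R (e n) ** A) = R (e n) ** A ** gauge w v" for n
  proof -
    interpret S: symmetric_tensor G Q u K "R (e n) ** A" "B ** matrix_inv (R (e n))" U using good by blast
    obtain v w where "virtual_symmetry Q U (R (e n) ** A) v w" using S.virtual_symmetry_exists by blast
    then show ?thesis using q unfolding virtual_symmetry_def by blast
  qed
  then obtain v w where inv: "\<And>n. invertible (v n)" "\<And>n. invertible (w n)"
    and vw: "\<And>n. U q ** (R (e n) ** A) = R (e n) ** A ** gauge (w n) (v n)" by metis
  let ?vi = "matrix_inv v0" and ?wi = "matrix_inv w0"
  note ii = invertible_matrix_inv[OF inv0(1)] invertible_matrix_inv[OF inv0(2)]
  have Ri: "invertible (R (e n))" for n using good by blast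
  have M: "B ** matrix_inv (R (e n)) ** (U q ** (R (e n) ** A)) = gproj ** gauge (w n) (v n)" for n
  proof -
    have "B ** matrix_inv (R (e n)) ** (U q ** (R (e n) ** A)) = B ** (matrix_inv (R (e n)) ** (R (e n) ** A)) ** gauge (w n) (v n)"
      unfolding vw by (simp only: matrix_mul_assoc)
    then show ?thesis by (simp only: matrix_inv_cancel[OF Ri] BA)
  qed
  have "(\<lambda>n. B ** matrix_inv (R (e n)) ** (U q ** (R (e n) ** A)) ** gauge ?wi ?vi) \<longlonglongrightarrow> B ** matrix_inv (mat 1) ** (U q ** (mat 1 ** A)) ** gauge ?wi ?vi"
    by (intro tendsto_mmult tendsto_const tendsto_matrix_inv(2) Re matrix_inv_mat1)
  also have "B ** matrix_inv (mat 1) ** (U q ** (mat 1 ** A)) ** gauge ?wi ?vi = B ** A ** (gauge w0 v0 ** gauge ?wi ?vi)"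
    by (simp add: e0 matrix_mul_assoc)
  also have "\<dots> = gproj" by (simp add: gauge_inv[OF inv0(2,1)] BA)
  finally have "(\<lambda>n. gproj ** gauge (w n ** ?wi) (v n ** ?vi)) \<longlonglongrightarrow> gproj"
    unfolding M using inv ii by (simp add: gauge_mult flip: matrix_mul_assoc)
  from gauge_limit[OF _ _ this] inv ii obtain r h c where r: "strict_mono (r :: nat \<Rightarrow> nat)" and h: "h \<in> carrier G"
    and c: "\<And>n. c n \<noteq> 0" and lim: "(\<lambda>n. c n *m (u (inv h) ** (v (r n) ** ?vi))) \<longlonglongrightarrow> mat 1"
    by (auto simp: invertible_mult)
  define V where "V n = c n *m (u (inv h) ** v (r n))" for n
  have hi: "invertible (u (inv h))" "inv h \<in> carrier G" using h by (simp_all add: u_matrix_inv)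
  have Vinv: "invertible (V n)" for n unfolding V_def by (intro matrix_inv_cscale(2) invertible_mult hi inv c)
  have "(\<lambda>n. c n *m (u (inv h) ** (v (r n) ** ?vi)) ** v0) \<longlonglongrightarrow> mat 1 ** v0" by (intro tendsto_mmult lim tendsto_const)
  moreover have "c n *m (u (inv h) ** (v (r n) ** ?vi)) ** v0 = V n" for n
    by (simp add: V_def matrix_mul_assoc matrix_inv_cancel[OF inv0(1)])
  ultimately have Vlim: "V \<longlonglongrightarrow> v0" by simp
  have "\<forall>\<^sub>F n in sequentially. dist (V n) v0 < \<eta>" using Vlim \<eta> by (rule tendstoD)
  moreover have "\<forall>\<^sub>F n in sequentially. dist (matrix_inv (V n)) ?vi < \<eta>"
    using tendsto_matrix_inv(2)[OF Vlim inv0(1)] \<eta> by (rule tendstoD)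
  ultimately have "\<forall>\<^sub>F n in sequentially. dist (V n) v0 < \<eta> \<and> dist (matrix_inv (V n)) ?vi < \<eta>" by (rule eventually_conj)
  then obtain n where near: "dist (V n) v0 < \<eta>" "dist (matrix_inv (V n)) ?vi < \<eta>"
    using eventually_happens'[OF sequentially_bot] by blast
  let ?W = "u (inv h) ** w (r n)" and ?A = "R (e (r n)) ** A"
  have "?A ** gauge ?W (V n) = ?A ** gauge ?W (u (inv h) ** v (r n))"
    unfolding V_def using gauge_cscale[of ?W "u (inv h) ** v (r n)" 1 "c n"] inv hi c by (simp add: invertible_mult)
  also have "\<dots> = R (e (r n)) ** (A ** ugauge (inv h)) ** gauge (w (r n)) (v (r n))"
    using inv hi by (simp add: ugauge_gauge gauge_mult flip: matrix_mul_assoc)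
  also have "\<dots> = U q ** ?A" unfolding A_ugauge[OF hi(2)] vw ..
  finally have "?P (e (r n))" using Vinv[of n] near inv hi by (intro exI[of _ "V n"] exI[of _ ?W]) (simp add: invertible_mult)
  then show False using bad by blast
qed

theorem symmetry_class_stable:
  assumes finQ: "finite (carrier Q)"
  shows "\<forall>\<^sub>F \<epsilon> in nhds 0. symmetry_class G Q u U (R \<epsilon> ** A) = symmetry_class G Q u U A"
proof -
  obtain v0 w0 where V0: "virtual_symmetry Q U A v0 w0" using virtual_symmetry_exists by blast
  then obtain \<phi> \<omega> where iv0: "induces_pair G Q u v0 (\<phi>, \<omega>)" and iw0: "induces_pair G Q u w0 (\<phi>, \<omega>)"
    using virtual_pair[OF V0] by (metis prod.collapse)
  have p0: "(\<phi>, \<omega>) \<in> symmetry_class G Q u U A" using V0 iv0 iw0 unfolding symmetry_class_def by blast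
  have inv0: "q \<in> carrier Q \<Longrightarrow> invertible (v0 q)" "q \<in> carrier Q \<Longrightarrow> invertible (w0 q)"
    and UA0: "q \<in> carrier Q \<Longrightarrow> U q ** A = A ** gauge (w0 q) (v0 q)" for q
    using V0 by (auto simp: virtual_symmetry_def)
  have ip: "q \<in> carrier Q \<Longrightarrow> g \<in> carrier G \<Longrightarrow> \<phi> q g \<in> carrier G"
    and io: "k \<in> carrier Q \<Longrightarrow> q \<in> carrier Q \<Longrightarrow> \<omega> k q \<in> carrier G" for q g k
    using iv0 by (auto simp: induces_pair_def)
  have tr: "trace (K ** u (inv g) ** (c *m u g')) = (if g = g' then c else 0)" if "g \<in> carrier G" "g' \<in> carrier G" for g g' c
    using K_delta[OF that] by (simp add: trace_cscale flip: matrix_mul_assoc)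
  \<comment> \<open>\<open>?t1\<close> and \<open>?t2\<close> are detectors for the labels
    \<open>\<phi> q g\<close> and \<open>\<omega> k q\<close>: by \<open>tr\<close> they vanish on
    multiples of every other group matrix. As they are nonzero at the unperturbed matrices, they
    stay nonzero nearby, which pins down the labels.\<close>
  let ?t1 = "\<lambda>q g a b. trace (K ** u (inv (\<phi> q g)) ** a ** u g ** b)"
  let ?t2 = "\<lambda>k q a b c. trace (K ** u (inv (\<omega> k q)) ** a ** b ** c)"
  have "\<exists>\<eta>>0. \<forall>p\<in>carrier Q \<times> carrier G. \<forall>a b. dist a (v0 (fst p)) < \<eta> \<longrightarrow> dist b (matrix_inv (v0 (fst p))) < \<eta> \<longrightarrow> ?t1 (fst p) (snd p) a b \<noteq> 0"
  proof (rule finite_uniform_radius)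
    show "finite (carrier Q \<times> carrier G)" using fin finQ by simp
    fix p assume "p \<in> carrier Q \<times> carrier G"
    then obtain q g where p: "p = (q, g)" "q \<in> carrier Q" "g \<in> carrier G" by auto
    have "proportional (v0 q ** u g ** matrix_inv (v0 q)) (u (\<phi> q g))"
      using iv0 p by (simp add: induces_pair_def)
    then obtain c where c: "c \<noteq> 0" "v0 q ** u g ** matrix_inv (v0 q) = c *m u (\<phi> q g)" unfolding proportional_iff by blast
    have "K ** u (inv (\<phi> q g)) ** v0 q ** u g ** matrix_inv (v0 q) = K ** u (inv (\<phi> q g)) ** (v0 q ** u g ** matrix_inv (v0 q))"
      by (simp only: matrix_mul_assoc)
    then have "?t1 q g (v0 q) (matrix_inv (v0 q)) \<noteq> 0" unfolding c using tr[of "\<phi> q g" "\<phi> q g" c] ip[OF p(2,3)] c by simp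
    from trace_nonzero_near[OF this] obtain \<eta> where \<eta>: "\<eta> > 0"
      "\<And>a b. dist a (v0 q) < \<eta> \<Longrightarrow> dist b (matrix_inv (v0 q)) < \<eta> \<Longrightarrow> ?t1 q g a b \<noteq> 0"
      by (metis dist_self)
    then show "\<exists>\<eta>>0. \<forall>a b. dist a (v0 (fst p)) < \<eta> \<longrightarrow> dist b (matrix_inv (v0 (fst p))) < \<eta> \<longrightarrow> ?t1 (fst p) (snd p) a b \<noteq> 0"
      unfolding p by (intro exI[of _ \<eta>]) simp
  qed (meson order_less_le_trans)
  then obtain \<eta>1 where \<eta>1: "\<eta>1 > 0" "\<And>q g a b. q \<in> carrier Q \<Longrightarrow> g \<in> carrier G \<Longrightarrow> dist a (v0 q) < \<eta>1 \<Longrightarrow>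
      dist b (matrix_inv (v0 q)) < \<eta>1 \<Longrightarrow> ?t1 q g a b \<noteq> 0" by (metis SigmaI fst_conv snd_conv)
  have "\<exists>\<eta>>0. \<forall>p\<in>carrier Q \<times> carrier Q. \<forall>a b c. dist a (v0 (fst p)) < \<eta> \<longrightarrow> dist b (v0 (snd p)) < \<eta> \<longrightarrow>
      dist c (matrix_inv (v0 (fst p \<otimes>\<^bsub>Q\<^esub> snd p))) < \<eta> \<longrightarrow> ?t2 (fst p) (snd p) a b c \<noteq> 0"
  proof (rule finite_uniform_radius)
    show "finite (carrier Q \<times> carrier Q)" using finQ by simp
    fix p assume "p \<in> carrier Q \<times> carrier Q"
    then obtain k q where p: "p = (k, q)" "k \<in> carrier Q" "q \<in> carrier Q" by auto
    let ?i = "matrix_inv (v0 (k \<otimes>\<^bsub>Q\<^esub> q))"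
    have "proportional (v0 k ** v0 q ** ?i) (u (\<omega> k q))"
      using iv0 p by (simp add: induces_pair_def)
    then obtain c where c: "c \<noteq> 0" "v0 k ** v0 q ** ?i = c *m u (\<omega> k q)" unfolding proportional_iff by blast
    have "K ** u (inv (\<omega> k q)) ** v0 k ** v0 q ** ?i = K ** u (inv (\<omega> k q)) ** (v0 k ** v0 q ** ?i)"
      by (simp only: matrix_mul_assoc)
    then have "?t2 k q (v0 k) (v0 q) ?i \<noteq> 0" unfolding c using tr[of "\<omega> k q" "\<omega> k q" c] io[OF p(2,3)] c by simp
    from trace_nonzero_near[OF this]
    show "\<exists>\<eta>>0. \<forall>a b c. dist a (v0 (fst p)) < \<eta> \<longrightarrow> dist b (v0 (snd p)) < \<eta> \<longrightarrow>
      dist c (matrix_inv (v0 (fst p \<otimes>\<^bsub>Q\<^esub> snd p))) < \<eta> \<longrightarrow> ?t2 (fst p) (snd p) a b c \<noteq> 0"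
      unfolding p by simp
  qed (meson order_less_le_trans)
  then obtain \<eta>2 where \<eta>2: "\<eta>2 > 0" "\<And>k q a b c. k \<in> carrier Q \<Longrightarrow> q \<in> carrier Q \<Longrightarrow> dist a (v0 k) < \<eta>2 \<Longrightarrow> dist b (v0 q) < \<eta>2 \<Longrightarrow>
      dist c (matrix_inv (v0 (k \<otimes>\<^bsub>Q\<^esub> q))) < \<eta>2 \<Longrightarrow> ?t2 k q a b c \<noteq> 0" by (metis SigmaI fst_conv snd_conv)
  define \<eta> where "\<eta> = min \<eta>1 \<eta>2"
  have \<eta>: "\<eta> > 0" "\<eta> \<le> \<eta>1" "\<eta> \<le> \<eta>2" using \<eta>1 \<eta>2 by (simp_all add: \<eta>_def)
  let ?P = "\<lambda>\<epsilon> q v w. invertible v \<and> invertible w \<and> U q ** (R \<epsilon> ** A) = R \<epsilon> ** A ** gauge w v \<and>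
     dist v (v0 q) < \<eta> \<and> dist (matrix_inv v) (matrix_inv (v0 q)) < \<eta>"
  have "\<forall>\<^sub>F \<epsilon> in nhds 0. \<exists>v w. ?P \<epsilon> q v w" if q: "q \<in> carrier Q" for q
    by (rule virtual_near[OF q inv0(1)[OF q] inv0(2)[OF q] UA0[OF q] \<eta>(1)])
  then have "\<forall>\<^sub>F \<epsilon> in nhds 0. \<forall>q\<in>carrier Q. \<exists>v w. ?P \<epsilon> q v w"
    by (intro eventually_ball_finite finQ ballI)
  with eventually_symmetric_tensor show ?thesis
  proof eventually_elim
    fix \<epsilon>
    assume S: "invertible (R \<epsilon>) \<and> symmetric_tensor G Q u K (R \<epsilon> ** A) (B ** matrix_inv (R \<epsilon>)) U"
      and ex: "\<forall>q\<in>carrier Q. \<exists>v w. ?P \<epsilon> q v w"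
    interpret S: symmetric_tensor G Q u K "R \<epsilon> ** A" "B ** matrix_inv (R \<epsilon>)" U using S by blast
    obtain v w where vw: "\<And>q. q \<in> carrier Q \<Longrightarrow> ?P \<epsilon> q (v q) (w q)" using ex by metis
    have V: "virtual_symmetry Q U (R \<epsilon> ** A) v w" using vw unfolding virtual_symmetry_def by blast
    have inv: "\<forall>q\<in>carrier Q. invertible (v q)" "\<forall>q\<in>carrier Q. invertible (w q)" using vw by blast+
    obtain \<phi>' \<omega>' where iv: "induces_pair G Q u v (\<phi>', \<omega>')" and iw: "induces_pair G Q u w (\<phi>', \<omega>')"
      using S.virtual_pair[OF V] by (metis prod.collapse)
    have near: "dist (v q) (v0 q) < \<eta>1" "dist (v q) (v0 q) < \<eta>2" "dist (matrix_inv (v q)) (matrix_inv (v0 q)) < \<eta>1"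
      "dist (matrix_inv (v q)) (matrix_inv (v0 q)) < \<eta>2" if "q \<in> carrier Q" for q
      using vw[OF that] \<eta> by linarith+
    have \<phi>: "\<phi>' q g = \<phi> q g" if q: "q \<in> carrier Q" and g: "g \<in> carrier G" for q g
    proof -
      have "proportional (v q ** u g ** matrix_inv (v q)) (u (\<phi>' q g))" and m: "\<phi>' q g \<in> carrier G"
        using iv q g by (auto simp: induces_pair_def)
      then obtain c where c: "v q ** u g ** matrix_inv (v q) = c *m u (\<phi>' q g)" unfolding proportional_iff by blast
      have "K ** u (inv (\<phi> q g)) ** v q ** u g ** matrix_inv (v q) = K ** u (inv (\<phi> q g)) ** (v q ** u g ** matrix_inv (v q))"
        by (simp only: matrix_mul_assoc)
      then have "trace (K ** u (inv (\<phi> q g)) ** (c *m u (\<phi>' q g))) \<noteq> 0"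
        using \<eta>1(2)[OF q g near(1)[OF q] near(3)[OF q]] unfolding c by simp
      then show ?thesis using tr[OF ip[OF q g] m] by (simp split: if_splits)
    qed
    have \<omega>: "\<omega>' k q = \<omega> k q" if k: "k \<in> carrier Q" and q: "q \<in> carrier Q" for k q
    proof -
      let ?i = "matrix_inv (v (k \<otimes>\<^bsub>Q\<^esub> q))"
      have kq: "k \<otimes>\<^bsub>Q\<^esub> q \<in> carrier Q" using k q by simp
      have "proportional (v k ** v q ** ?i) (u (\<omega>' k q))" and m: "\<omega>' k q \<in> carrier G"
        using iv k q by (auto simp: induces_pair_def)
      then obtain c where c: "v k ** v q ** ?i = c *m u (\<omega>' k q)" unfolding proportional_iff by blast
      have "K ** u (inv (\<omega> k q)) ** v k ** v q ** ?i = K ** u (inv (\<omega> k q)) ** (v k ** v q ** ?i)"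
        by (simp only: matrix_mul_assoc)
      then have "trace (K ** u (inv (\<omega> k q)) ** (c *m u (\<omega>' k q))) \<noteq> 0"
        using \<eta>2(2)[OF k q near(2)[OF k] near(2)[OF q] near(4)[OF kq]] unfolding c by simp
      then show ?thesis using tr[OF io[OF k q] m] by (simp split: if_splits)
    qed
    have "induces_pair G Q u v (\<phi>, \<omega>)" "induces_pair G Q u w (\<phi>, \<omega>)"
      using iv iw \<phi> \<omega> by (simp_all add: induces_pair_iff[OF inv(1) Q.group_axioms] induces_pair_iff[OF inv(2) Q.group_axioms])
    then have "(\<phi>, \<omega>) \<in> symmetry_class G Q u U (R \<epsilon> ** A)" using V unfolding symmetry_class_def by blast
    from S.symmetry_class_eq(2)[OF this] symmetry_class_eq(2)[OF p0]
    show "symmetry_class G Q u U (R \<epsilon> ** A) = symmetry_class G Q u U A" by simp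
  qed
qed

end

end

section \<open>Continuity of the parent Hamiltonian\<close>

lemma patch_map_mult:
  fixes A :: "('n::finite, 'p::finite) tensor" and R :: "complex^'p^'p"
  shows "patch_map (R ** A) = kron4 R R R R ** patch_map A"
proof (rule matrix_eqI)
  fix s :: "'p legs" and l :: "('n \<times> 'n) \<times> ('n \<times> 'n) \<times> ('n \<times> 'n) \<times> ('n \<times> 'n)"
  obtain s0 s1 s2 s3 where s: "s = (s0, s1, s2, s3)" by (cases s)
  obtain d00 l00 d10 r10 u01 l01 u11 r11 where l: "l = ((d00, l00), (d10, r10), (u01, l01), (u11, r11))"
    by (cases l) auto
  define f where "f x t = (case x of (x1, x2, y1, y2) \<Rightarrow> case t of (t0, t1, t2, t3) \<Rightarrow>
     (R $ s0 $ t0 * A $ t0 $ (y1, x1, d00, l00)) * (R $ s1 $ t1 * A $ t1 $ (y2, r10, d10, x1)) *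
     (R $ s2 $ t2 * A $ t2 $ (u01, x2, y1, l01)) * (R $ s3 $ t3 * A $ t3 $ (u11, r11, y2, x2)))"
    for x :: "'n legs" and t :: "'p legs"
  have "patch_map (R ** A) $ s $ l = (\<Sum>x\<in>UNIV. \<Sum>t\<in>UNIV. f x t)"
    unfolding sum_legs f_def split_conv sum_product4 by (simp add: patch_map_def s l mmult_nth)
  also have "\<dots> = (\<Sum>t\<in>UNIV. \<Sum>x\<in>UNIV. f x t)" by (rule sum.swap)
  also have "\<dots> = (\<Sum>t\<in>UNIV. kron4 R R R R $ s $ t * patch_map A $ t $ l)"
  proof (rule sum.cong[OF refl])
    fix t :: "'p legs"
    obtain t0 t1 t2 t3 where t: "t = (t0, t1, t2, t3)" by (cases t)
    show "(\<Sum>x\<in>UNIV. f x t) = kron4 R R R R $ s $ t * patch_map A $ t $ l"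
      unfolding sum_legs f_def split_conv t
      by (simp add: patch_map_def kron4_def s l sum_distrib_left mult_ac)
  qed
  finally show "patch_map (R ** A) $ s $ l = (kron4 R R R R ** patch_map A) $ s $ l"
    by (simp add: mmult_nth)
qed

text \<open>Two orthogonal projectors with the same kernel absorb each other on the right, and
  taking adjoints turns this into equality. This justifies the definite description in
  \<open>parent_term\<close>.\<close>

lemma parent_term_eqI:
  fixes A :: "('n::finite, 'p::finite) tensor"
  assumes P: "P ** P = P" "cadjoint P = P" "{x. P *v x = 0} = patch_space A"
  shows "parent_term A = P"
  unfolding parent_term_def
proof (rule the_equality)
  fix P' assume P': "P' ** P' = P' \<and> cadjoint P' = P' \<and> {x. P' *v x = 0} = patch_space A"
  have absorb: "P1 ** P2 = P1" if P1: "P2 ** P2 = P2" and ker: "{x. P1 *v x = 0} = {x. P2 *v x = 0}"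
    for P1 P2 :: "complex^('p \<times> 'p \<times> 'p \<times> 'p)^('p \<times> 'p \<times> 'p \<times> 'p)"
  proof (rule matrix_eq_by_vec)
    fix x
    have "P2 *v (x - P2 *v x) = 0" by (simp add: matrix_vector_mult_diff_distrib matrix_vector_mul_assoc P1)
    then have "P1 *v (x - P2 *v x) = 0" using ker by auto
    then show "(P1 ** P2) *v x = P1 *v x" by (simp add: matrix_vector_mult_diff_distrib flip: matrix_vector_mul_assoc)
  qed
  have 1: "P' ** P = P'" by (rule absorb[OF P(1)]) (use P(3) P' in blast)
  have 2: "P ** P' = P" by (rule absorb) (use P(3) P' in blast)+
  have "P' = cadjoint (P' ** P)" unfolding 1 using P' by simp
  also have "\<dots> = P ** P'" using P(2) P' by (simp add: cadjoint_mult)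
  finally show "P' = P" unfolding 2 .
qed (use P in blast)

text \<open>The orthogonal projector onto the image of \<open>range E\<^sub>0\<close> under an invertible \<open>X\<close>, in a form
  depending continuously on \<open>X\<close>.\<close>

definition moved_projector :: "complex^'m^'m \<Rightarrow> complex^'m^'m \<Rightarrow> complex^'m^'m" where
  "moved_projector E\<^sub>0 X = X ** E\<^sub>0 ** matrix_inv (E\<^sub>0 ** cadjoint X ** X ** E\<^sub>0 + (mat 1 - E\<^sub>0)) ** E\<^sub>0 ** cadjoint X"

text \<open>The first summand is the Gram matrix of \<open>X\<close> on the range of
  \<open>E\<^sub>0\<close>, positive definite there because \<open>X\<close> is injective; the
  second summand completes it by the identity on the orthogonal complement.\<close>

lemma gram_invertible:
  fixes E\<^sub>0 X :: "complex^'m^'m"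
  assumes E\<^sub>0: "E\<^sub>0 ** E\<^sub>0 = E\<^sub>0" "cadjoint E\<^sub>0 = E\<^sub>0" and X: "invertible X"
  shows "invertible (E\<^sub>0 ** cadjoint X ** X ** E\<^sub>0 + (mat 1 - E\<^sub>0))"
proof (rule invertible_injI)
  fix x
  define y where "y = E\<^sub>0 *v x"
  have Py: "E\<^sub>0 *v y = y" by (simp add: y_def matrix_vector_mul_assoc E\<^sub>0)
  assume "(E\<^sub>0 ** cadjoint X ** X ** E\<^sub>0 + (mat 1 - E\<^sub>0)) *v x = 0"
  then have e: "E\<^sub>0 *v (cadjoint X *v (X *v y)) + (x - y) = 0"
    by (simp add: matrix_vector_mult_add_rdistrib matrix_vector_mult_diff_rdistrib y_def flip: matrix_vector_mul_assoc)
  have "E\<^sub>0 *v (E\<^sub>0 *v (cadjoint X *v (X *v y)) + (x - y)) = E\<^sub>0 *v (cadjoint X *v (X *v y))"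
    by (simp add: matrix_vector_right_distrib matrix_vector_mult_diff_distrib Py y_def[symmetric])
      (simp add: matrix_vector_mul_assoc E\<^sub>0 matrix_mul_assoc)
  then have z: "E\<^sub>0 *v (cadjoint X *v (X *v y)) = 0" unfolding e by simp
  then have xy: "x = y" using e by simp
  have "cip (X *v y) (X *v y) = cip y (E\<^sub>0 *v (cadjoint X *v (X *v y)))"
    by (simp add: cip_cadjoint E\<^sub>0 Py)
  then have "X *v y = 0" unfolding z by (simp add: cip_linear cip_self_eq_0)
  then have "matrix_inv X *v (X *v y) = 0" by simp
  then show "x = 0" by (simp add: xy matrix_vector_mul_assoc matrix_inv_mult[OF X])
qed

text \<open>This is the formula \<open>M (M\<^sup>* M)\<^sup>-\<^sup>1 M\<^sup>*\<close> for the
  projector onto the range of \<open>M = X ** E\<^sub>0\<close>. The completed Gram matrix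
  \<open>H\<close> commutes with \<open>E\<^sub>0\<close>, so its inverse acts within the range of
  \<open>E\<^sub>0\<close> as required.\<close>

lemma moved_projector:
  fixes E\<^sub>0 X :: "complex^'m^'m"
  assumes E\<^sub>0: "E\<^sub>0 ** E\<^sub>0 = E\<^sub>0" "cadjoint E\<^sub>0 = E\<^sub>0" and X: "invertible X"
  defines "E \<equiv> moved_projector E\<^sub>0 X"
  shows "E ** E = E" "cadjoint E = E" "range (\<lambda>x. E *v x) = range (\<lambda>x. X *v (E\<^sub>0 *v x))"
    "E ** (X ** E\<^sub>0) = X ** E\<^sub>0"
proof -
  define H where "H = E\<^sub>0 ** cadjoint X ** X ** E\<^sub>0 + (mat 1 - E\<^sub>0)"
  have Hinv: "invertible H" unfolding H_def by (rule gram_invertible[OF assms(1-3)])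
  have H1: "E\<^sub>0 ** H = E\<^sub>0 ** cadjoint X ** X ** E\<^sub>0" "H ** E\<^sub>0 = E\<^sub>0 ** cadjoint X ** X ** E\<^sub>0"
    unfolding H_def by (simp_all add: mmult_add mmult_diff E\<^sub>0 matrix_mul_assoc) (simp add: E\<^sub>0 flip: matrix_mul_assoc)
  have Ha: "cadjoint H = H"
    by (simp add: H_def cadjoint_simps cadjoint_mult E\<^sub>0 matrix_mul_assoc)
  have "cadjoint (matrix_inv H) ** H = mat 1"
    using arg_cong[OF matrix_inv_mult(1)[OF Hinv], of cadjoint] by (simp add: cadjoint_mult Ha cadjoint_simps)
  then have Hia: "cadjoint (matrix_inv H) = matrix_inv H"
    using matrix_inv_cancel(3)[OF Hinv, of "cadjoint (matrix_inv H)"] by simp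
  have c: "matrix_inv H ** E\<^sub>0 = E\<^sub>0 ** matrix_inv H"
  proof -
    have "matrix_inv H ** E\<^sub>0 = matrix_inv H ** (E\<^sub>0 ** H) ** matrix_inv H"
      by (simp add: matrix_inv_cancel[OF Hinv] flip: matrix_mul_assoc) (simp add: matrix_inv_mult[OF Hinv])
    also have "\<dots> = matrix_inv H ** (H ** E\<^sub>0) ** matrix_inv H" unfolding H1 ..
    also have "\<dots> = E\<^sub>0 ** matrix_inv H" by (simp add: matrix_inv_cancel[OF Hinv])
    finally show ?thesis .
  qed
  have E: "E = X ** E\<^sub>0 ** matrix_inv H ** E\<^sub>0 ** cadjoint X" by (simp add: E_def moved_projector_def H_def)
  show EX: "E ** (X ** E\<^sub>0) = X ** E\<^sub>0"
  proof -
    have "E ** (X ** E\<^sub>0) = X ** E\<^sub>0 ** matrix_inv H ** (E\<^sub>0 ** cadjoint X ** X ** E\<^sub>0)" by (simp add: E matrix_mul_assoc)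
    also have "\<dots> = X ** E\<^sub>0 ** matrix_inv H ** (H ** E\<^sub>0)" unfolding H1 ..
    also have "\<dots> = X ** (E\<^sub>0 ** E\<^sub>0)" by (simp add: matrix_mul_assoc matrix_inv_cancel[OF Hinv])
    finally show ?thesis by (simp add: E\<^sub>0)
  qed
  have E': "E = X ** E\<^sub>0 ** (matrix_inv H ** E\<^sub>0 ** cadjoint X)" by (simp add: E matrix_mul_assoc)
  show "E ** E = E"
  proof -
    have "E ** E = E ** (X ** E\<^sub>0) ** (matrix_inv H ** E\<^sub>0 ** cadjoint X)" by (subst (2) E') (simp add: matrix_mul_assoc)
    then show ?thesis unfolding EX E'[symmetric] .
  qed
  show "cadjoint E = E" by (simp add: E cadjoint_mult Hia E\<^sub>0 matrix_mul_assoc)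
  show "range (\<lambda>x. E *v x) = range (\<lambda>x. X *v (E\<^sub>0 *v x))"
  proof (intro equalityI subsetI)
    fix z assume "z \<in> range (\<lambda>x. E *v x)"
    then obtain x where "z = E *v x" by blast
    then have "z = X *v (E\<^sub>0 *v ((matrix_inv H ** E\<^sub>0 ** cadjoint X) *v x))" by (simp add: E' matrix_vector_mul_assoc matrix_mul_assoc)
    then show "z \<in> range (\<lambda>x. X *v (E\<^sub>0 *v x))" by blast
  next
    fix z assume "z \<in> range (\<lambda>x. X *v (E\<^sub>0 *v x))"
    then obtain x where x: "z = X *v (E\<^sub>0 *v x)" by blast
    have "E *v z = z" unfolding x using EX by (simp add: matrix_vector_mul_assoc matrix_mul_assoc)
    then show "z \<in> range (\<lambda>x. E *v x)" by (metis rangeI)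
  qed
qed

lemma tendsto_moved_projector:
  fixes E\<^sub>0 X :: "complex^'m^'m"
  assumes "E\<^sub>0 ** E\<^sub>0 = E\<^sub>0" "cadjoint E\<^sub>0 = E\<^sub>0" "invertible X" "(F \<longlongrightarrow> X) net"
  shows "((\<lambda>e. moved_projector E\<^sub>0 (F e)) \<longlongrightarrow> moved_projector E\<^sub>0 X) net"
  unfolding moved_projector_def
  by (intro tendsto_mmult tendsto_const tendsto_matrix_inv(2) tendsto_add tendsto_cadjoint assms gram_invertible)

lemma range_projector_exists:
  fixes M :: "complex^'k^'m"
  shows "\<exists>E\<^sub>0 :: complex^'m^'m. E\<^sub>0 ** E\<^sub>0 = E\<^sub>0 \<and> cadjoint E\<^sub>0 = E\<^sub>0 \<and> range (\<lambda>x. E\<^sub>0 *v x) = range (\<lambda>x. M *v x)"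
proof -
  let ?b = "\<lambda>k. (\<chi> i. M $ i $ k) :: complex^'m"
  have M: "M *v c = (\<Sum>k\<in>UNIV. c $ k *s ?b k)" for c
    by (simp add: vec_eq_iff matrix_vector_mult_def mult.commute)
  obtain E\<^sub>0 :: "complex^'m^'m" where P: "E\<^sub>0 ** E\<^sub>0 = E\<^sub>0" "cadjoint E\<^sub>0 = E\<^sub>0"
    and span: "\<And>x. \<exists>c. E\<^sub>0 *v x = (\<Sum>k\<in>UNIV. c k *s ?b k)" and fx: "\<And>k. E\<^sub>0 *v ?b k = ?b k"
    using orthogonal_projector_exists[of UNIV ?b] by auto
  have "range (\<lambda>x. E\<^sub>0 *v x) = range (\<lambda>x. M *v x)"
  proof (intro equalityI subsetI)
    fix z assume "z \<in> range (\<lambda>x. E\<^sub>0 *v x)"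
    then obtain x where "z = E\<^sub>0 *v x" by blast
    moreover obtain c where "E\<^sub>0 *v x = (\<Sum>k\<in>UNIV. c k *s ?b k)" using span by blast
    ultimately have "z = M *v (\<chi> k. c k)" by (simp add: M)
    then show "z \<in> range (\<lambda>x. M *v x)" by blast
  next
    fix z assume "z \<in> range (\<lambda>x. M *v x)"
    then obtain c where "z = M *v c" by blast
    then have "E\<^sub>0 *v z = z" by (simp add: M mvec_sum fx)
    then show "z \<in> range (\<lambda>x. E\<^sub>0 *v x)" by (metis rangeI)
  qed
  then show ?thesis using P by blast
qed

text \<open>An invertible operator on each physical index moves the patch space without changing its
  dimension, so the projector cannot jump. One fixed \<open>E\<^sub>0\<close> serves for all
  \<open>X\<close>, which leaves the whole dependence to the continuous formula
  \<open>moved_projector\<close>.\<close>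

lemma parent_term_deformed:
  fixes A :: "('n::finite, 'p::finite) tensor"
  shows "\<exists>E\<^sub>0. E\<^sub>0 ** E\<^sub>0 = E\<^sub>0 \<and> cadjoint E\<^sub>0 = E\<^sub>0 \<and>
    (\<forall>X. invertible X \<longrightarrow> invertible (kron4 X X X X) \<and> parent_term (X ** A) = mat 1 - moved_projector E\<^sub>0 (kron4 X X X X))"
proof -
  obtain E\<^sub>0 :: "complex^('p \<times> 'p \<times> 'p \<times> 'p)^('p \<times> 'p \<times> 'p \<times> 'p)"
    where P: "E\<^sub>0 ** E\<^sub>0 = E\<^sub>0" "cadjoint E\<^sub>0 = E\<^sub>0" and rg: "range (\<lambda>x. E\<^sub>0 *v x) = range (\<lambda>x. patch_map A *v x)"
    using range_projector_exists[of "patch_map A"] by blast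
  have "invertible (kron4 X X X X) \<and> parent_term (X ** A) = mat 1 - moved_projector E\<^sub>0 (kron4 X X X X)"
    if X: "invertible X" for X :: "complex^'p^'p"
  proof
    let ?X = "kron4 X X X X"
    have "leg_prod (\<lambda>_. X) ** leg_prod (\<lambda>_. matrix_inv X) = mat 1"
      unfolding leg_prod_mult by (simp add: matrix_inv_mult[OF X] leg_prod_one)
    then show inv: "invertible ?X" using matrix_inv_unique(2) unfolding leg_prod_def by blast
    note m = moved_projector[OF P inv]
    let ?E = "moved_projector E\<^sub>0 ?X"
    show "parent_term (X ** A) = mat 1 - ?E"
    proof (rule parent_term_eqI)
      show "(mat 1 - ?E) ** (mat 1 - ?E) = mat 1 - ?E" by (simp add: mmult_diff m)
      show "cadjoint (mat 1 - ?E) = mat 1 - ?E" by (simp add: cadjoint_simps m)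
      have "{x. (mat 1 - ?E) *v x = 0} = range (\<lambda>x. ?E *v x)"
      proof (intro equalityI subsetI)
        fix x assume "x \<in> {x. (mat 1 - ?E) *v x = 0}"
        then have "x = ?E *v x" by (simp add: matrix_vector_mult_diff_rdistrib)
        then show "x \<in> range (\<lambda>x. ?E *v x)" by (metis rangeI)
      next
        fix x assume "x \<in> range (\<lambda>x. ?E *v x)"
        then obtain y where "x = ?E *v y" by blast
        then show "x \<in> {x. (mat 1 - ?E) *v x = 0}"
          by (simp add: matrix_vector_mult_diff_rdistrib matrix_vector_mul_assoc m)
      qed
      also have "\<dots> = (\<lambda>y. ?X *v y) ` range (\<lambda>x. E\<^sub>0 *v x)" unfolding m(3) by (simp add: image_image)
      also have "\<dots> = patch_space (X ** A)"
        unfolding rg by (simp add: image_image patch_space_def patch_map_mult matrix_vector_mul_assoc)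
      finally show "{x. (mat 1 - ?E) *v x = 0} = patch_space (X ** A)" .
    qed
  qed
  then show ?thesis using P by blast
qed

lemma continuous_parent_term:
  fixes A :: "('n::finite, 'p::finite) tensor" and R :: "'e::topological_space \<Rightarrow> complex^'p^'p"
  assumes R: "continuous_on S R" and inv: "\<And>e. e \<in> S \<Longrightarrow> invertible (R e)"
  shows "continuous_on S (\<lambda>e. parent_term (R e ** A))"
proof -
  obtain E\<^sub>0 where P: "E\<^sub>0 ** E\<^sub>0 = E\<^sub>0" "cadjoint E\<^sub>0 = E\<^sub>0"
    and pt: "\<And>X. invertible X \<Longrightarrow> invertible (kron4 X X X X) \<and> parent_term (X ** A) = mat 1 - moved_projector E\<^sub>0 (kron4 X X X X)"
    using parent_term_deformed[of A] by blast
  have "continuous_on S (\<lambda>e. mat 1 - moved_projector E\<^sub>0 (kron4 (R e) (R e) (R e) (R e)))"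
    unfolding continuous_on_def
  proof
    fix x assume x: "x \<in> S"
    then have "(R \<longlongrightarrow> R x) (at x within S)" using R by (simp add: continuous_on_def)
    then show "((\<lambda>e. mat 1 - moved_projector E\<^sub>0 (kron4 (R e) (R e) (R e) (R e))) \<longlongrightarrow>
        mat 1 - moved_projector E\<^sub>0 (kron4 (R x) (R x) (R x) (R x))) (at x within S)"
      by (intro tendsto_diff tendsto_const tendsto_moved_projector P tendsto_kron4) (use pt inv x in blast)+
  qed
  then show ?thesis by (rule continuous_on_eq) (simp add: pt inv)
qed

lemma continuous_parent_hamiltonian:
  fixes A :: "('n::finite, 'p::finite) tensor" and R :: "'e::topological_space \<Rightarrow> complex^'p^'p"
  assumes "continuous_on S R" "\<And>e. e \<in> S \<Longrightarrow> invertible (R e)"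
  shows "continuous_on S (\<lambda>e. parent_hamiltonian N M (R e ** A) s t)"
proof -
  have pt: "continuous_on S (\<lambda>e. parent_term (R e ** A) $ a $ b)" for a b
  proof -
    have "continuous_on S (\<lambda>e. parent_term (R e ** A))" by (rule continuous_parent_term) (use assms in auto)
    then show ?thesis unfolding continuous_on_def by (intro ballI tendsto_vec_nth) simp
  qed
  show ?thesis
    unfolding parent_hamiltonian_def split_def Let_def
  proof (rule continuous_on_sum)
    fix p
    show "continuous_on S (\<lambda>e. if P then parent_term (R e ** A) $ a $ b else 0)" for P a b
      by (cases P) (simp_all add: pt)
  qed
qed

theorem theorem3p1:
  fixes G :: "('g, 'b) monoid_scheme" and Q :: "('q, 'c) monoid_scheme"
    and u :: "'g \<Rightarrow> complex^'n^'n" and U :: "'q \<Rightarrow> complex^'p^'p"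
    and A :: "complex^('n \<times> 'n \<times> 'n \<times> 'n)^'p"
  assumes "group G" and "finite (carrier G)"
    and "group Q" and "finite (carrier Q)"
    and "G_injective G u A"
    and "onsite_symmetry Q U A"
  shows "(\<exists>v w. virtual_symmetry Q U A v w) \<and>
    (\<forall>v w. virtual_symmetry Q U A v w \<longrightarrow>
       (\<exists>p. induces_pair G Q u v p \<and> induces_pair G Q u w p)) \<and>
    symmetry_class G Q u U A \<in> cocycle_pairs G Q // pair_equiv G Q \<and>
    (G_isometric G u A \<longrightarrow>
      (\<forall>R. natural_perturbation Q U A R \<longrightarrow>
        (\<forall>\<^sub>F \<epsilon> in nhds (0::real).
           G_injective G u (R \<epsilon> ** A) \<and>
           symmetry_class G Q u U (R \<epsilon> ** A) = symmetry_class G Q u U A) \<and>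
        (\<exists>\<delta>>0. \<forall>N\<ge>2. \<forall>M\<ge>2. \<forall>s\<in>configs N M. \<forall>t\<in>configs N M.
           continuous_on (ball 0 \<delta>) (\<lambda>\<epsilon>. parent_hamiltonian N M (R \<epsilon> ** A) s t))))"
proof -
  obtain B where u: "representation G u" and irr: "contains_all_irreps G u"
    and A: "\<And>g. g \<in> carrier G \<Longrightarrow> A ** gauge (u g) (u g) = A" and B: "B ** A = group_average G u"
    using assms(5) unfolding G_injective_def by blast
  obtain K where "delta_rep G u K" using delta_rep_exists[OF assms(1,2) u irr] by blast
  then interpret delta_rep G u K .
  interpret Q: group Q by (rule assms(3))
  have inj: "A ** gproj = A"
  proof -
    have "A ** gproj = (1 / N) *m (\<Sum>g\<in>carrier G. A)" by (simp add: gproj_def mmult_sum ugauge_gauge A)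
    also have "(\<Sum>g\<in>carrier G. A) = N *m A"
      by (rule matrix_eqI) (simp only: sum_component, simp add: N_def)
    finally show ?thesis using N_nonzero by simp
  qed
  interpret symmetric_tensor G Q u K A B U
    by unfold_locales (use assms(6) B inj in \<open>auto simp: gproj_group_average onsite_symmetry_def leaves_invariant_def\<close>)
  have pert: "(\<forall>\<^sub>F \<epsilon> in nhds (0::real). G_injective G u (R \<epsilon> ** A) \<and>
      symmetry_class G Q u U (R \<epsilon> ** A) = symmetry_class G Q u U A) \<and>
    (\<exists>\<delta>>0. \<forall>N\<ge>2. \<forall>M\<ge>2. \<forall>s\<in>configs N M. \<forall>t\<in>configs N M.
      continuous_on (ball 0 \<delta>) (\<lambda>\<epsilon>. parent_hamiltonian N M (R \<epsilon> ** A) s t))"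
    if np: "natural_perturbation Q U A R" for R
  proof -
    obtain r where r: "r > 0" and cont: "continuous_on (ball 0 r) R" and lim: "(R \<longlongrightarrow> mat 1) (at 0)"
      and sym: "\<And>\<epsilon>. \<epsilon> \<in> ball 0 r \<Longrightarrow> onsite_symmetry Q U (R \<epsilon> ** A)"
      using np unfolding natural_perturbation_def by blast
    have "isCont R 0" using cont r by (simp add: continuous_on_eq_continuous_at)
    then have R0: "R 0 = mat 1" using lim unfolding isCont_def by (rule LIM_unique)
    have R: "(R \<longlongrightarrow> mat 1) (nhds 0)"
      using lim unfolding R0[symmetric] tendsto_at_iff_tendsto_nhds .
    have near: "\<forall>\<^sub>F \<epsilon> in nhds 0. \<epsilon> \<in> ball 0 r"
      by (rule eventually_nhds_in_open) (use r in auto)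
    have R_inv: "\<forall>\<^sub>F \<epsilon> in nhds 0. \<forall>q\<in>carrier Q. leaves_invariant (U q) (R \<epsilon> ** A)"
      using near by eventually_elim (use sym in \<open>auto simp: onsite_symmetry_def leaves_invariant_def\<close>)
    have inv: "\<forall>\<^sub>F \<epsilon> in nhds 0. invertible (R \<epsilon>)"
      by (rule tendsto_matrix_inv(1)[OF R matrix_inv_mat1(2)])
    have "\<forall>\<^sub>F \<epsilon> in nhds 0. G_injective G u (R \<epsilon> ** A)"
      using inv
    proof eventually_elim
      fix \<epsilon> assume i: "invertible (R \<epsilon>)"
      have "B ** matrix_inv (R \<epsilon>) ** (R \<epsilon> ** A) = B ** (matrix_inv (R \<epsilon>) ** (R \<epsilon> ** A))" by (simp only: matrix_mul_assoc)
      also have "\<dots> = group_average G u" by (simp only: matrix_inv_cancel[OF i] B)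
      finally have "\<exists>B. B ** (R \<epsilon> ** A) = group_average G u" by blast
      moreover have "R \<epsilon> ** A ** gauge (u g) (u g) = R \<epsilon> ** A" if "g \<in> carrier G" for g
        using A[OF that] by (simp flip: matrix_mul_assoc)
      ultimately show "G_injective G u (R \<epsilon> ** A)"
        unfolding G_injective_def using u irr by blast
    qed
    moreover have "\<forall>\<^sub>F \<epsilon> in nhds 0. symmetry_class G Q u U (R \<epsilon> ** A) = symmetry_class G Q u U A"
      by (rule symmetry_class_stable[OF R R_inv assms(4)])
    ultimately have "\<forall>\<^sub>F \<epsilon> in nhds 0. G_injective G u (R \<epsilon> ** A) \<and>
        symmetry_class G Q u U (R \<epsilon> ** A) = symmetry_class G Q u U A" by (rule eventually_conj)
    moreover have "\<forall>\<^sub>F \<epsilon> in nhds 0. \<epsilon> \<in> ball 0 r \<and> invertible (R \<epsilon>)" using near inv by (rule eventually_conj)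
    then obtain \<delta> where \<delta>: "\<delta> > 0" "\<And>\<epsilon>. dist \<epsilon> 0 < \<delta> \<Longrightarrow> \<epsilon> \<in> ball 0 r \<and> invertible (R \<epsilon>)"
      unfolding eventually_nhds_metric by blast
    have "continuous_on (ball 0 \<delta>) (\<lambda>\<epsilon>. parent_hamiltonian N M (R \<epsilon> ** A) s t)" for N M s t
    proof (rule continuous_parent_hamiltonian)
      show "continuous_on (ball 0 \<delta>) R" by (rule continuous_on_subset[OF cont]) (use \<delta>(2) in \<open>auto simp: dist_commute\<close>)
      show "invertible (R \<epsilon>)" if "\<epsilon> \<in> ball 0 \<delta>" for \<epsilon> using \<delta>(2)[of \<epsilon>] that by (simp add: dist_commute)
    qed
    ultimately show ?thesis using \<delta>(1) by blast
  qed
  show ?thesis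
    using virtual_symmetry_exists virtual_pair symmetry_class_quotient pert by blast
qed

end
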